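(* Let $n\ge1$, let $1<\alpha<2$ and let $\Omega\subset\mathbb{R}^n$ be a bounded domain. Then for every $u\in C_c(\Omega)$, $$ \begin{aligned} \frac12\int_{\Omega\times\Omega}\frac{(u(x)-u(y))^2}{|x-y|^{n+\alpha}}\,dx\,dy \ge{}&\kappa_{n,\alpha}\int_\Omega\frac{u^2(x)}{M_\alpha(x)^\alpha}\,dx\\ &+\frac{\pi^{(n-1)/2}\,\Gamma(\frac\alpha2)\,(4-2^{3-\alpha})}{\alpha\,\Gamma(\frac{n+\alpha-1}{2})}\cdot\frac1{\operatorname{diam}\Omega}\int_\Omega\frac{u^2(x)}{M_{\alpha-1}(x)^{\alpha-1}}\,dx. \end{aligned}\qquad(\mathrm{I}) $$ In particular, if $\Omega$ is a bounded convex domain, then for every $u\in C_c(\Omega)$, $$ \begin{aligned} \frac12\int_{\Omega\times\Omega}\frac{(u(x)-u(y))^2}{|x-y|^{n+\alpha}}\,dx\,dy \ge{}&\kappa_{n,\alpha}\int_\Omega\frac{u^2(x)}{\operatorname{dist}(x,\Omega^c)^\alpha}\,dx\\ &+\frac{\pi^{(n-1)/2}\,\Gamma(\frac\alpha2)\,(4-2^{3-\alpha})}{\alpha\,\Gamma(\frac{n+\alpha-1}{2})}\cdot\frac1{\operatorname{diam}\Omega}\int_\Omega\frac{u^2(x)}{\operatorname{dist}(x,\Omega^c)^{\alpha-1}}\,dx. \end{aligned}\qquad(\mathrm{II}) $$ The constant $\kappa_{n,\alpha}$ in (I) and in (II) may not be replaced by a bigger constant: for fixed $n$ and $\alpha$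 and every $c>\kappa_{n,\alpha}$, inequality (I) with $\kappa_{n,\alpha}$ replaced by $c$ does not hold for all bounded domains $\Omega$ and all $u\in C_c(\Omega)$, and inequality (II) with $\kappa_{n,\alpha}$ replaced by $c$ does not hold for all bounded convex domains $\Omega$ and all $u\in C_c(\Omega)$.
   Context: $C_c(\Omega)$ denotes the class of continuous functions $u\colon\Omega\to\mathbb{R}$ with compact support in $\Omega$. A domain is a nonempty connected open set; $\Omega^c=\mathbb{R}^n\setminus\Omega$, $\operatorname{dist}(x,\Omega^c)$ is the distance from $x$ to $\Omega^c$, and $\operatorname{diam}\Omega$ is the diameter of $\Omega$. The double integrals take values in $[0,\infty]$. The constant is $$\kappa_{n,\alpha}=\pi^{\frac{n-1}{2}}\frac{\Gamma(\frac{1+\alpha}{2})}{\Gamma(\frac{n+\alpha}{2})}\cdot\frac{B\left(\frac{1+\alpha}{2},\frac{2-\alpha}{2}\right)-2^{\alpha}}{\alpha2^{\alpha}},$$ where $B$ is the Euler beta function. For a direction $w\in S^{n-1}$ and $x\in\Omega$ put $$d_{w,\Omega}(x)=\min\{|t|:\ t\in\mathbb{R},\ x+tw\notin\Omega\},\qquad \delta_{w,\Omega}(x)=\sup\{|t|:\ t\in\mathbb{R},\ x+tw\in\Omega\}.$$ For $\beta>0$ the function $M_\beta$ on $\Omega$ is defined by $$\frac1{M_\beta(x)^\beta}=\frac{\displaystyle\int_{S^{n-1}}\left[\frac1{d_{w,\Omega}(x)}+\frac1{\delta_{w,\Omega}(x)}\right]^\beta dw}{\displaystyle\int_{S^{n-1}}|w_n|^\beta\,dw},$$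 where $dw$ is the surface measure on the unit sphere $S^{n-1}$ (counting measure on $\{-1,1\}$ when $n=1$) and $w_n$ is the $n$-th coordinate of $w$. *)

theory Defs
  imports "HOL-Analysis.Analysis"
begin

text \<open>The surface measure on the unit sphere, obtained from Lebesgue measure on the unit ball by
  polar coordinates: \<open>\<sigma> A\<close> is \<open>n\<close> times the volume of the cone over \<open>A\<close>
  (see \<open>emeasure_sphere_measure\<close>). In dimension 1 each of the two unit vectors has mass 1.\<close>

definition sphere_measure :: "'a::euclidean_space measure" where
  "sphere_measure = scale_measure (of_nat DIM('a))
     (distr (restrict_space lborel (ball 0 1 - {0})) (restrict_space borel (sphere 0 1)) sgn)"

lemma sgn_measurable_sphere:
  "(sgn :: 'a::euclidean_space \<Rightarrow> 'a) \<in>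
     restrict_space lborel (ball 0 1 - {0}) \<rightarrow>\<^sub>M restrict_space borel (sphere 0 1)"
proof (rule measurable_restrict_space2)
  show "(sgn :: 'a \<Rightarrow> 'a) \<in> space (restrict_space lborel (ball 0 1 - {0})) \<rightarrow> sphere 0 1"
    by (auto simp: space_restrict_space norm_sgn)
  have "(\<lambda>x::'a. x /\<^sub>R norm x) \<in> borel_measurable lborel" by measurable
  then show "(sgn :: 'a \<Rightarrow> 'a) \<in> borel_measurable (restrict_space lborel (ball 0 1 - {0}))"
    by (intro measurable_restrict_space1) (simp add: sgn_div_norm[abs_def])
qed

lemma emeasure_sphere_measure:
  fixes A :: "'a::euclidean_space set"
  assumes "A \<in> sets borel" "A \<subseteq> sphere 0 1"
  shows "emeasure sphere_measure A =
    of_nat DIM('a) * emeasure lborel {x. 0 < norm x \<and> norm x < 1 \<and> x /\<^sub>R norm x \<in> A}"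
proof -
  let ?B = "ball 0 1 - {0::'a}"
  have A: "A \<in> sets (restrict_space borel (sphere 0 1))"
    using assms by (auto simp: sets_restrict_space_iff)
  have B: "?B \<in> sets lborel" by simp
  have "sgn -` A \<inter> space (restrict_space lborel ?B)
      = {x. 0 < norm x \<and> norm x < 1 \<and> x /\<^sub>R norm x \<in> A}"
    by (auto simp: space_restrict_space sgn_div_norm)
  moreover have "\<dots> \<subseteq> ?B" by auto
  ultimately show ?thesis
    unfolding sphere_measure_def
    by (simp add: emeasure_distr[OF sgn_measurable_sphere A] emeasure_restrict_space B)
qed

text \<open>Functions on \<open>\<Omega>\<close> are total functions whose values outside \<open>\<Omega>\<close> are never used.\<close>

definition Cc :: "'a::euclidean_space set \<Rightarrow> ('a \<Rightarrow> real) set" where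
  "Cc \<Omega> = {u. continuous_on \<Omega> u \<and>
      compact (closure {x \<in> \<Omega>. u x \<noteq> 0}) \<and> closure {x \<in> \<Omega>. u x \<noteq> 0} \<subseteq> \<Omega>}"

definition bounded_domain :: "'a::euclidean_space set \<Rightarrow> bool" where
  "bounded_domain \<Omega> \<longleftrightarrow> \<Omega> \<noteq> {} \<and> open \<Omega> \<and> connected \<Omega> \<and> bounded \<Omega>"

text \<open>For bounded open \<open>\<Omega>\<close>, \<open>x \<in> \<Omega>\<close> and a unit vector \<open>w\<close>, the infimum below is a minimum and the
  supremum is finite.\<close>

definition dir_dist :: "'a::euclidean_space \<Rightarrow> 'a set \<Rightarrow> 'a \<Rightarrow> real" where
  "dir_dist w \<Omega> x = Inf {\<bar>t\<bar> | t. x + t *\<^sub>R w \<notin> \<Omega>}"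

definition dir_reach :: "'a::euclidean_space \<Rightarrow> 'a set \<Rightarrow> 'a \<Rightarrow> real" where
  "dir_reach w \<Omega> x = Sup {\<bar>t\<bar> | t. x + t *\<^sub>R w \<in> \<Omega>}"

text \<open>The function \<open>M\<^sub>\<beta>\<close>, solved for from the defining formula for \<open>1 / M\<^sub>\<beta>(x)\<^sup>\<beta>\<close>. The index \<open>k\<close> plays
  the role of the last coordinate; an abstract finite index type has no distinguished one.\<close>

definition hardy_M :: "'n \<Rightarrow> real \<Rightarrow> (real ^ 'n::finite) set \<Rightarrow> real ^ 'n \<Rightarrow> real" where
  "hardy_M k \<beta> \<Omega> x =
     ((\<integral>w. \<bar>w $ k\<bar> powr \<beta> \<partial>sphere_measure) /
      (\<integral>w. (1 / dir_dist w \<Omega> x + 1 / dir_reach w \<Omega> x) powr \<beta> \<partial>sphere_measure))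
     powr (1 / \<beta>)"

definition kappa :: "nat \<Rightarrow> real \<Rightarrow> real" where
  "kappa n \<alpha> =
     pi powr ((real n - 1) / 2) * (Gamma ((1 + \<alpha>) / 2) / Gamma ((real n + \<alpha>) / 2)) *
     ((Beta ((1 + \<alpha>) / 2) ((2 - \<alpha>) / 2) - 2 powr \<alpha>) / (\<alpha> * 2 powr \<alpha>))"

definition remainder_const :: "nat \<Rightarrow> real \<Rightarrow> real" where
  "remainder_const n \<alpha> =
     pi powr ((real n - 1) / 2) * Gamma (\<alpha> / 2) * (4 - 2 powr (3 - \<alpha>)) /
     (\<alpha> * Gamma ((real n + \<alpha> - 1) / 2))"

definition frac_energy :: "real \<Rightarrow> (real ^ 'n::finite) set \<Rightarrow> (real ^ 'n \<Rightarrow> real) \<Rightarrow> ennreal" where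
  "frac_energy \<alpha> \<Omega> u =
     (\<integral>\<^sup>+ z \<in> \<Omega> \<times> \<Omega>. ennreal ((u (fst z) - u (snd z))\<^sup>2 /
        norm (fst z - snd z) powr (real CARD('n) + \<alpha>)) \<partial>lborel)"

text \<open>The leading constant \<open>c\<close> is a parameter. Both inequalities are stated in \<open>[0,\<infinity>]\<close>; for
  \<open>1 < \<alpha> < 2\<close> both \<^term>\<open>kappa n \<alpha>\<close> and \<^term>\<open>remainder_const n \<alpha>\<close> are positive, so the coercion
  \<^const>\<open>ennreal\<close> does not truncate them.\<close>

definition hardy_ineq_M ::
  "'n \<Rightarrow> real \<Rightarrow> real \<Rightarrow> (real ^ 'n::finite) set \<Rightarrow> (real ^ 'n \<Rightarrow> real) \<Rightarrow> bool" where
  "hardy_ineq_M k \<alpha> c \<Omega> u \<longleftrightarrow>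
     ennreal (1 / 2) * frac_energy \<alpha> \<Omega> u \<ge>
       ennreal c * (\<integral>\<^sup>+ x \<in> \<Omega>. ennreal ((u x)\<^sup>2 / hardy_M k \<alpha> \<Omega> x powr \<alpha>) \<partial>lborel) +
       ennreal (remainder_const CARD('n) \<alpha> * (1 / diameter \<Omega>)) *
         (\<integral>\<^sup>+ x \<in> \<Omega>. ennreal ((u x)\<^sup>2 / hardy_M k (\<alpha> - 1) \<Omega> x powr (\<alpha> - 1)) \<partial>lborel)"

definition hardy_ineq_dist ::
  "real \<Rightarrow> real \<Rightarrow> (real ^ 'n::finite) set \<Rightarrow> (real ^ 'n \<Rightarrow> real) \<Rightarrow> bool" where
  "hardy_ineq_dist \<alpha> c \<Omega> u \<longleftrightarrow>
     ennreal (1 / 2) * frac_energy \<alpha> \<Omega> u \<ge>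
       ennreal c * (\<integral>\<^sup>+ x \<in> \<Omega>. ennreal ((u x)\<^sup>2 / infdist x (- \<Omega>) powr \<alpha>) \<partial>lborel) +
       ennreal (remainder_const CARD('n) \<alpha> * (1 / diameter \<Omega>)) *
         (\<integral>\<^sup>+ x \<in> \<Omega>. ennreal ((u x)\<^sup>2 / infdist x (- \<Omega>) powr (\<alpha> - 1)) \<partial>lborel)"

end

theory Submission
  imports Defs
begin

text \<open>
  The energy and both potentials are averages over lines, so everything rests on an inequality in
  dimension one, with the sharp constant and with a remainder.

  On the interval \<open>(-1, 1)\<close> the function \<open>w(x) = (1 - x\<^sup>2)\<^sup>p\<close> with \<open>p = (\<alpha> - 1) / 2\<close> is a positive
  generalized ground state. Expanding \<open>u = w v\<close> in the double integral gives
  \<open>(u(s) - u(t))\<^sup>2 = u(s)\<^sup>2 (1 - w(t) / w(s)) + u(t)\<^sup>2 (1 - w(s) / w(t)) + w(s) w(t) (v(s) - v(t))\<^sup>2\<close>,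
  and dropping the last term leaves the potential \<open>\<integral> (1 - w(t) / w(s)) / |s - t|\<^bsup>1 + \<alpha>\<^esup> dt\<close>. This is a
  principal value. It is avoided by cutting the kernel off along the pseudohyperbolic distance, that
  is, by keeping only the pairs with \<open>\<eta> (1 - s t) < |s - t|\<close>. The Moebius maps
  \<open>s \<mapsto> (x + s) / (1 + x s)\<close> preserve this region and transport \<open>w\<close> and the kernel up to powers of
  \<open>1 - x\<^sup>2\<close>, so both parts of the cut-off potential have closed forms
  (\<open>interval_kernel_weight_integral\<close>, \<open>interval_kernel_integral\<close>). As \<open>\<eta>\<close> tends to \<open>0\<close> the potential
  becomes at least \<open>(1 - x\<^sup>2)\<^bsup>-\<alpha>\<^esup> (B - (1 + x)\<^sup>\<alpha> - (1 - x)\<^sup>\<alpha>) / \<alpha>\<close> with the Beta value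
  \<open>B\<close> of the constant. The chord inequality \<open>(1 + x)\<^sup>\<alpha> + (1 - x)\<^sup>\<alpha> \<le> 2 + (2\<^sup>\<alpha> - 2) x\<^sup>2\<close>
  (\<open>powr_chord\<close>) splits this into the sharp term, with \<open>B - 2\<^sup>\<alpha>\<close>, and the remainder, with
  \<open>(2\<^sup>\<alpha> - 2) (1 - x\<^sup>2)\<close>. Scaling and summing over components gives the inequality on every bounded
  open subset of the line (\<open>hardy_open_set\<close>).

  In space, polar coordinates around \<open>x\<close> write the energy as an integral, over all directions and all
  parallel lines, of one-dimensional energies of the slices of \<open>\<Omega>\<close> (\<open>frac_energy_slices\<close>). On a component
  \<open>(l, r)\<close> of a slice the one-dimensional potential dominates the directional weight
  \<open>1 / d\<^sub>w + 1 / \<delta>\<^sub>w\<close>, and \<open>r - l\<close> is at most the diameter; averaging over the sphere yields the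
  inequality with \<open>M\<close>. If \<open>\<Omega>\<close> is convex, a supporting hyperplane at a nearest boundary point with normal
  \<open>e\<close> bounds the weight in direction \<open>w\<close> from below by \<open>|w \<bullet> e| / dist\<close>. Since the moments
  \<open>\<integral> |w \<bullet> e|\<^sup>\<beta> dw\<close> do not depend on \<open>e\<close>, the inequality with the distance follows from it.

  For sharpness, it is enough to refute the distance version with a bigger constant, because on a
  convex domain the version with \<open>M\<close> and any constant implies the distance version with the same
  constant. On the interval, the product of \<open>w\<close> and a logarithmic tent of length \<open>N\<close> near the end point
  \<open>-1\<close> nearly attains equality: its weighted \<open>L\<^sup>2\<close> norm grows like \<open>N\<close>, while the term dropped in the
  ground state identity stays of order \<open>1 / N\<close> (\<open>sharp_interval\<close>). In space such a function of
  \<open>x \<bullet> e\<close> is multiplied by a tent of width \<open>L\<close> in the orthogonal directions, on a slab intersected with a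
  large ball. The main terms grow like \<open>L\<^bsup>n - 1\<^esup>\<close> and the cost of the tent like
  \<open>L\<^bsup>n - 1 - \<alpha>\<^esup>\<close>, so in the limit only the one-dimensional quotient remains.
\<close>

section \<open>Elementary inequalities and integrals on the line\<close>

text \<open>Convexity of \<open>t \<mapsto> t\<^sup>a\<close> at the points \<open>1 + x\<close> and \<open>1 - x\<close>.\<close>

lemma one_plus_powr_ge_two:
  fixes a x :: real
  assumes "1 < a" "\<bar>x\<bar> \<le> 1"
  shows "2 \<le> (1 + x) powr a + (1 - x) powr a"
proof (cases "\<bar>x\<bar> = 1")
  case True
  have "2 powr 1 \<le> 2 powr a" using assms by (intro powr_mono) auto
  then show ?thesis using True by (auto simp: abs_if split: if_splits)
next
  case False
  have "convex_on {0<..} (\<lambda>t::real. t powr a)"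
    by (rule powr_convex) (use assms in auto)
  from convex_onD[OF this, of "1/2" "1 + x" "1 - x"] assms False
  show ?thesis by (auto simp: field_simps)
qed

text \<open>The numerator is convex and vanishes at \<open>0\<close>, so its slopes from \<open>0\<close> increase. This makes
  \<open>F'(y) / y\<close> decreasing for the function \<open>F\<close> in the proof of the chord inequality.\<close>

lemma powr_diff_star_shaped:
  fixes b c d :: real
  assumes b: "0 < b" "b < 1" and c: "0 < c" "c \<le> d" "d < 1"
  shows "((1 + c) powr b - (1 - c) powr b) / c \<le> ((1 + d) powr b - (1 - d) powr b) / d"
proof -
  define N where "N x = (1 + x) powr b - (1 - x) powr b" for x
  have "convex_on {0..<1} N"
  proof (rule f''_ge0_imp_convex)
    show "(N has_real_derivative b * (1 + x) powr (b - 1) + b * (1 - x) powr (b - 1)) (at x)"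
      if "x \<in> {0..<1}" for x
      unfolding N_def using that by (auto intro!: derivative_eq_intros)
    show "((\<lambda>x. b * (1 + x) powr (b - 1) + b * (1 - x) powr (b - 1)) has_real_derivative
        b * (1 - b) * ((1 - x) powr (b - 2) - (1 + x) powr (b - 2))) (at x)"
      if "x \<in> {0..<1}" for x
      using that
      by (auto intro!: derivative_eq_intros simp: algebra_simps diff_diff_eq)
    show "0 \<le> b * (1 - b) * ((1 - x) powr (b - 2) - (1 + x) powr (b - 2))"
      if "x \<in> {0..<1}" for x
      using that b by (auto intro!: mult_nonneg_nonneg powr_mono2')
  qed simp
  from convex_onD[OF this, of "c / d" 0 d] c
  have "N c \<le> c / d * N d" by (simp add: N_def)
  then show ?thesis using c by (simp add: N_def field_simps)
qed

text \<open>As a function of \<open>x\<^sup>2\<close> the left side is convex, and the right side is its chord between \<open>0\<close> and \<open>1\<close>.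
  In terms of \<open>y = |x|\<close>: the difference \<open>F\<close> vanishes at \<open>0\<close> and \<open>1\<close> and \<open>F'(y) / y\<close> decreases, so \<open>F\<close>
  cannot first fall and then rise.\<close>

lemma powr_chord:
  fixes a x :: real
  assumes a: "1 < a" "a < 2" and x: "\<bar>x\<bar> \<le> 1"
  shows "(1 + x) powr a + (1 - x) powr a \<le> 2 + (2 powr a - 2) * x\<^sup>2"
proof -
  define F where "F y = 2 + (2 powr a - 2) * y\<^sup>2 - (1 + y) powr a - (1 - y) powr a" for y
  define F' where "F' y = 2 * (2 powr a - 2) * y - a * ((1 + y) powr (a - 1) - (1 - y) powr (a - 1))"
    for y
  have D: "(F has_real_derivative F' y) (at y)" if "0 \<le> y" "y < 1" for y
    unfolding F_def F'_def using that
    by (auto intro!: derivative_eq_intros simp: algebra_simps)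
  have C: "continuous_on {0..1} F"
    unfolding F_def using a by (intro continuous_intros continuous_on_powr') auto
  have pos: "0 \<le> F y" if y: "0 < y" "y < 1" for y
  proof (rule ccontr)
    assume neg: "\<not> 0 \<le> F y"
    have F0: "F 0 = 0" "F 1 = 0" by (auto simp: F_def)
    obtain c where c: "0 < c" "c < y" "F y - F 0 = (y - 0) * F' c"
      using MVT2[of 0 y F F'] D y by auto
    obtain l d where d: "y < d" "d < 1" "(F has_real_derivative l) (at d)" "F 1 - F y = (1 - y) * l"
      using MVT[of y 1 F] y D continuous_on_subset[OF C]
      by (smt (verit, del_insts) atLeastAtMost_iff atLeastatMost_subset_iff real_differentiable_def)
    have "l = F' d" using DERIV_unique[OF d(3)] D d(1,2) y by auto
    then have "F' c < 0" "0 < F' d"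
      using c d(4) y neg F0 by (auto simp: not_le mult_less_0_iff zero_less_mult_iff)
        (smt (verit) mult_less_0_iff zero_less_mult_iff)+
    then have "F' c / c < 0" "0 < F' d / d" using c d y by (auto intro: divide_neg_pos)
    moreover have "F' d / d \<le> F' c / c"
    proof -
      have "F' e / e = 2 * (2 powr a - 2) -
          a * (((1 + e) powr (a - 1) - (1 - e) powr (a - 1)) / e)" if "0 < e" for e
        using that by (simp add: F'_def field_simps)
      moreover have "((1 + c) powr (a - 1) - (1 - c) powr (a - 1)) / c
          \<le> ((1 + d) powr (a - 1) - (1 - d) powr (a - 1)) / d"
        using a c d by (intro powr_diff_star_shaped) auto
      then have "a * (((1 + c) powr (a - 1) - (1 - c) powr (a - 1)) / c)
          \<le> a * (((1 + d) powr (a - 1) - (1 - d) powr (a - 1)) / d)"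
        using a by (intro mult_left_mono) auto
      ultimately show ?thesis using c d by simp
    qed
    ultimately show False by simp
  qed
  have "0 \<le> F \<bar>x\<bar>"
  proof (cases "\<bar>x\<bar> = 0 \<or> \<bar>x\<bar> = 1")
    case True
    then have "\<bar>x\<bar> = 0 \<or> \<bar>x\<bar> = 1" .
    moreover have "F 0 = 0" "F 1 = 0" by (auto simp: F_def)
    ultimately show ?thesis by auto
  next
    case False
    then show ?thesis using pos x by auto
  qed
  then show ?thesis by (cases "0 \<le> x") (auto simp: F_def)
qed

text \<open>This is the positivity of the constant. The product of Gamma values in the numerator is bounded
  below by the tangents of the convex function \<open>ln \<Gamma>\<close> at \<open>1\<close> and at \<open>1 / 2\<close>. The two arguments move away
  from these points by the same amount in opposite directions, so the Euler constant cancels and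
  \<open>(a - 1) ln 2\<close> is left.\<close>

lemma Beta_ge_two_powr:
  fixes a :: real
  assumes a: "1 < a" "a < 2"
  shows "2 powr a \<le> Beta ((1 + a) / 2) ((2 - a) / 2)"
proof -
  have tangent: "ln (Gamma y) - ln (Gamma c) \<ge> Digamma c * (y - c)" if "0 < c" "0 < y" for c y :: real
  proof -
    have "(ln_Gamma has_field_derivative Digamma c) (at c)"
      using that by (auto intro!: derivative_eq_intros)
    then have "((\<lambda>y. ln (Gamma y)) has_field_derivative Digamma c) (at c)"
      by (rule has_field_derivative_transform_within_open[of _ _ _ "{0<..}"])
         (use that in \<open>auto simp: ln_Gamma_real_pos\<close>)
    then show ?thesis
      using that log_convex_Gamma_real
      by (intro convex_on_imp_above_tangent[of "{0<..}" "\<lambda>y. ln (Gamma y)" c y "Digamma c"])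
         (auto simp: o_def interior_open intro: has_field_derivative_at_within)
  qed
  define G where "G = Gamma ((1 + a) / 2) * Gamma ((2 - a) / 2)"
  have Gpos: "Gamma ((1 + a) / 2) > 0" "Gamma ((2 - a) / 2) > 0" using a by auto
  have "ln G = ln (Gamma ((1 + a) / 2)) + ln (Gamma ((2 - a) / 2))"
    unfolding G_def using Gpos by (simp add: ln_mult)
  also have "\<dots> \<ge> ln (sqrt pi) + (a - 1) * ln 2"
    using tangent[of 1 "(1 + a) / 2"] tangent[of "1/2" "(2 - a) / 2"] a
    by (simp add: Digamma_one_half Gamma_one_half_real field_simps)
  finally have "ln (sqrt pi) + (a - 1) * ln 2 \<le> ln G" .
  then have "exp (ln (sqrt pi) + (a - 1) * ln 2) \<le> exp (ln G)" by simp
  then have "sqrt pi * 2 powr (a - 1) \<le> G"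
    using Gpos by (simp add: exp_add powr_def G_def)
  moreover have "Gamma (3 / 2 :: real) = sqrt pi / 2"
    using Gamma_plus1[of "1/2 :: real"] nonpos_Ints_nonpos[of "1/2 :: real"]
    by (auto simp: Gamma_one_half_real)
  moreover have "Beta ((1 + a) / 2) ((2 - a) / 2) = G / Gamma (3 / 2)"
    by (simp add: Beta_def G_def add_divide_distrib[symmetric])
  ultimately show ?thesis by (simp only:) (simp add: powr_diff field_simps)
qed

text \<open>The derivative is only assumed inside the interval, since the integrands below are singular at
  end points where the antiderivative is still continuous.\<close>

lemma nn_integral_FTC_interior:
  fixes F f :: "real \<Rightarrow> real"
  assumes "a \<le> b" "continuous_on {a..b} F"
    and "\<And>x. x \<in> {a<..<b} \<Longrightarrow> (F has_real_derivative f x) (at x)"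
    and "\<And>x. x \<in> {a<..<b} \<Longrightarrow> 0 \<le> f x"
  shows "(\<integral>\<^sup>+x\<in>{a<..<b}. ennreal (f x) \<partial>lborel) = ennreal (F b - F a)"
proof -
  have "(f has_integral (F b - F a)) {a..b}"
    using assms by (intro fundamental_theorem_of_calculus_interior)
      (auto simp: has_real_derivative_iff_has_vector_derivative)
  then have "(f has_integral (F b - F a)) {a<..<b}"
    by (simp add: has_integral_Icc_iff_Ioo)
  then show ?thesis
    using assms(4) by (intro nn_integral_has_integral_lebesgue') auto
qed

text \<open>Exhausting the open interval by compact ones reduces this to substitution on compact intervals.
  Open, possibly unbounded intervals are needed because the densities blow up at the end points.\<close>

lemma nn_integral_substitution_einterval:
  fixes f g g' :: "real \<Rightarrow> real" and a b :: ereal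
  assumes ab: "a < b"
    and f[measurable]: "f \<in> borel_measurable borel"
    and deriv: "\<And>x. x \<in> einterval a b \<Longrightarrow> (g has_real_derivative g' x) (at x)"
    and cont: "continuous_on (einterval a b) g'"
    and pos: "\<And>x. x \<in> einterval a b \<Longrightarrow> 0 < g' x"
  shows "(\<integral>\<^sup>+y\<in>g ` einterval a b. ennreal (f y) \<partial>lborel)
    = (\<integral>\<^sup>+x\<in>einterval a b. ennreal (f (g x) * g' x) \<partial>lborel)"
proof -
  obtain u l where ul: "einterval a b = (\<Union>i. {l i..u i})" "incseq u" "decseq l"
    "\<And>i. l i < u i"
    by (rule einterval_Icc_approximation[OF ab]) blast
  have sub: "{l i..u i} \<subseteq> einterval a b" for i using ul(1) by auto
  have mono: "g s \<le> g t" if "l i \<le> s" "s \<le> t" "t \<le> u i" for i s t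
  proof (rule DERIV_nonneg_imp_nondecreasing[OF that(2)])
    fix x assume "s \<le> x" "x \<le> t"
    then have "x \<in> einterval a b" using sub[of i] that by auto
    then show "\<exists>y. (g has_real_derivative y) (at x) \<and> 0 \<le> y"
      using deriv pos less_imp_le by blast
  qed
  have contg: "continuous_on {l i..u i} g" for i
    by (rule continuous_at_imp_continuous_on)
       (use deriv sub[of i] in \<open>auto intro: DERIV_isCont\<close>)
  have img: "g ` {l i..u i} = {g (l i)..g (u i)}" for i
  proof
    show "g ` {l i..u i} \<subseteq> {g (l i)..g (u i)}" using mono[of i] by auto
    show "{g (l i)..g (u i)} \<subseteq> g ` {l i..u i}"
    proof
      fix y assume "y \<in> {g (l i)..g (u i)}"
      then obtain x where "l i \<le> x" "x \<le> u i" "g x = y"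
        using IVT'[of g "l i" y "u i"] contg[of i] ul(4)[of i] by auto
      then show "y \<in> g ` {l i..u i}" by auto
    qed
  qed
  have imgU: "g ` einterval a b = (\<Union>i. {g (l i)..g (u i)})"
    by (simp add: ul(1) image_UN img)
  have inc1: "incseq (\<lambda>i. {g (l i)..g (u i)})"
    unfolding img[symmetric] using ul(2,3)
    by (intro monoI image_mono atLeastatMost_subset_iff[THEN iffD2]) (simp add: incseqD decseqD)
  have inc2: "incseq (\<lambda>i. {l i..u i})"
    using ul(2,3)
    by (intro monoI atLeastatMost_subset_iff[THEN iffD2]) (simp add: incseqD decseqD)
  have lim: "(\<integral>\<^sup>+x\<in>(\<Union>i. A i). h x \<partial>lborel) = (SUP i. \<integral>\<^sup>+x\<in>A i. h x \<partial>lborel)"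
    if "incseq A" "\<And>i. (\<lambda>x. h x * indicator (A i) x) \<in> borel_measurable borel"
    for A :: "nat \<Rightarrow> real set" and h
  proof -
    have "h x * indicator (\<Union>i. A i) x = (SUP i. h x * indicator (A i) x)" for x
    proof (cases "x \<in> (\<Union>i. A i)")
      case True
      then obtain i where i: "x \<in> A i" by auto
      have "(SUP i. h x * indicator (A i) x) = h x"
        by (rule antisym) (auto intro!: SUP_least SUP_upper2[of i] simp: i split: split_indicator)
      then show ?thesis using True by simp
    qed (auto simp: indicator_def)
    moreover have "incseq (\<lambda>i x. h x * indicator (A i) x)"
      using that(1) by (auto simp: incseq_def le_fun_def split: split_indicator)
    ultimately show ?thesis
      using that(2) by (simp add: nn_integral_monotone_convergence_SUP)
  qed
  have step: "(\<integral>\<^sup>+y\<in>{g (l i)..g (u i)}. ennreal (f y) \<partial>lborel)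
    = (\<integral>\<^sup>+x\<in>{l i..u i}. ennreal (f (g x) * g' x) \<partial>lborel)" for i
  proof -
    have "(\<integral>\<^sup>+y. ennreal (f y * indicator {g (l i)..g (u i)} y) \<partial>lborel)
      = (\<integral>\<^sup>+x. ennreal (f (g x) * g' x * indicator {l i..u i} x) \<partial>lborel)"
      using sub[of i] less_imp_le[OF pos] less_imp_le[OF ul(4)[of i]] deriv
      by (intro nn_integral_substitution continuous_on_subset[OF cont])
         (auto simp: set_borel_measurable_def)
    then show ?thesis
      by (simp add: ennreal_mult'' ennreal_indicator[symmetric])
  qed
  have m: "(\<lambda>x. ennreal (f (g x) * g' x) * indicator {l i..u i} x) \<in> borel_measurable borel" for i
  proof -
    have "(\<lambda>x. indicator {l i..u i} x *\<^sub>R g x) \<in> borel_measurable borel"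
      by (rule borel_measurable_continuous_on_indicator) (auto intro: contg)
    then have 1: "(\<lambda>x. f (indicator {l i..u i} x *\<^sub>R g x)) \<in> borel_measurable borel"
      by measurable
    have 2: "(\<lambda>x. indicator {l i..u i} x *\<^sub>R g' x) \<in> borel_measurable borel"
      by (rule borel_measurable_continuous_on_indicator)
         (auto intro: continuous_on_subset[OF cont sub])
    have "(\<lambda>x. ennreal (f (indicator {l i..u i} x *\<^sub>R g x) * (indicator {l i..u i} x *\<^sub>R g' x))
      * indicator {l i..u i} x) \<in> borel_measurable borel" using 1 2 by measurable
    also have "(\<lambda>x. ennreal (f (indicator {l i..u i} x *\<^sub>R g x) * (indicator {l i..u i} x *\<^sub>R g' x))
      * indicator {l i..u i} x) = (\<lambda>x. ennreal (f (g x) * g' x) * indicator {l i..u i} x)"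
      by (auto simp: fun_eq_iff indicator_def)
    finally show ?thesis .
  qed
  show ?thesis
    unfolding imgU unfolding ul(1)
    by (subst lim[OF inc1], measurable, subst lim[OF inc2 m]) (simp add: step)
qed

section \<open>The ground state identity and the truncation integrals\<close>

text \<open>Pointwise, \<open>(u(s) - u(t))\<^sup>2 + u(s)\<^sup>2 w(t) / w(s) + u(t)\<^sup>2 w(s) / w(t)\<close> equals
  \<open>u(s)\<^sup>2 + u(t)\<^sup>2 + w(s) w(t) (u(s) / w(s) - u(t) / w(t))\<^sup>2\<close>, and the two terms of each symmetric pair
  integrate to the same value. Negative terms are moved to the other side so that the identity holds in
  \<open>[0, \<infinity>]\<close>.\<close>

lemma ground_state_identity:
  fixes K :: "real \<Rightarrow> real \<Rightarrow> real" and u w :: "real \<Rightarrow> real"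
  assumes K[measurable]: "(\<lambda>(s, t). K s t) \<in> borel_measurable (borel \<Otimes>\<^sub>M borel)"
    and u[measurable]: "u \<in> borel_measurable borel" and w[measurable]: "w \<in> borel_measurable borel"
    and nonneg: "\<And>s t. 0 \<le> K s t" and sym: "\<And>s t. K s t = K t s"
    and pos: "\<And>s t. K s t \<noteq> 0 \<Longrightarrow> 0 < w s"
  shows "(\<integral>\<^sup>+s. \<integral>\<^sup>+t. ennreal ((u s - u t)\<^sup>2 * K s t) \<partial>lborel \<partial>lborel)
      + 2 * (\<integral>\<^sup>+s. ennreal ((u s)\<^sup>2) * (\<integral>\<^sup>+t. ennreal (w t / w s * K s t) \<partial>lborel) \<partial>lborel)
    = 2 * (\<integral>\<^sup>+s. ennreal ((u s)\<^sup>2) * (\<integral>\<^sup>+t. ennreal (K s t) \<partial>lborel) \<partial>lborel)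
      + (\<integral>\<^sup>+s. \<integral>\<^sup>+t. ennreal ((u s / w s - u t / w t)\<^sup>2 * (w s * w t * K s t)) \<partial>lborel \<partial>lborel)"
proof -
  let ?E = "\<lambda>s t. ennreal ((u s - u t)\<^sup>2 * K s t)"
  let ?A = "\<lambda>s t. ennreal ((u s)\<^sup>2 * (w t / w s * K s t))"
  let ?C = "\<lambda>s t. ennreal ((u s)\<^sup>2 * K s t)"
  let ?R = "\<lambda>s t. ennreal ((u s / w s - u t / w t)\<^sup>2 * (w s * w t * K s t))"
  let ?I = "\<lambda>f. \<integral>\<^sup>+s. \<integral>\<^sup>+t. f s t \<partial>lborel \<partial>lborel"
  have pos': "0 < w t" if "K s t \<noteq> 0" for s t using pos[of t s] sym[of s t] that by simp
  have pw: "?E s t + (?A s t + ?A t s) = (?C s t + ?C t s) + ?R s t" for s t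
  proof (cases "K s t = 0")
    case True
    then show ?thesis using sym[of s t] by simp
  next
    case False
    have w: "0 < w s" "0 < w t" using pos pos' False by auto
    have "(u s - u t)\<^sup>2 * K s t + ((u s)\<^sup>2 * (w t / w s * K s t) + (u t)\<^sup>2 * (w s / w t * K s t))
      = ((u s)\<^sup>2 * K s t + (u t)\<^sup>2 * K s t) + (u s / w s - u t / w t)\<^sup>2 * (w s * w t * K s t)"
      using w by (simp add: field_simps power2_eq_square)
    moreover have "?E s t + (?A s t + ?A t s)
        = ennreal ((u s - u t)\<^sup>2 * K s t + ((u s)\<^sup>2 * (w t / w s * K s t) + (u t)\<^sup>2 * (w s / w t * K s t)))"
      using w nonneg[of s t] sym[of s t] by (simp add: ennreal_plus)
    moreover have "?C s t + ?C t s + ?R s t = ennreal (((u s)\<^sup>2 * K s t + (u t)\<^sup>2 * K s t)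
        + (u s / w s - u t / w t)\<^sup>2 * (w s * w t * K s t))"
      using w nonneg[of s t] sym[of s t] by (simp add: ennreal_plus)
    ultimately show ?thesis by simp
  qed
  have swap: "?I (\<lambda>s t. f t s) = ?I f"
    if [measurable]: "(\<lambda>(s, t). f s t) \<in> borel_measurable (borel \<Otimes>\<^sub>M borel)"
    for f :: "real \<Rightarrow> real \<Rightarrow> ennreal"
    by (rule lborel_pair.Fubini') measurable
  have "?I ?E + (?I ?A + ?I (\<lambda>s t. ?A t s)) = ?I (\<lambda>s t. ?E s t + (?A s t + ?A t s))"
    by (simp add: nn_integral_add)
  also have "\<dots> = ?I (\<lambda>s t. (?C s t + ?C t s) + ?R s t)"
    by (simp only: pw)
  also have "\<dots> = ?I ?C + ?I (\<lambda>s t. ?C t s) + ?I ?R"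
    by (simp add: nn_integral_add)
  also have "?I (\<lambda>s t. ?A t s) = ?I ?A" by (rule swap) measurable
  also have "?I (\<lambda>s t. ?C t s) = ?I ?C" by (rule swap) measurable
  finally have "?I ?E + 2 * ?I ?A = 2 * ?I ?C + ?I ?R" by (simp add: mult_2)
  moreover have "?I ?A = (\<integral>\<^sup>+s. ennreal ((u s)\<^sup>2) * (\<integral>\<^sup>+t. ennreal (w t / w s * K s t) \<partial>lborel) \<partial>lborel)"
    by (simp only: ennreal_mult'[OF zero_le_power2])
       (simp add: nn_integral_cmult del: times_divide_eq_left times_divide_eq_right)
  moreover have "?I ?C = (\<integral>\<^sup>+s. ennreal ((u s)\<^sup>2) * (\<integral>\<^sup>+t. ennreal (K s t) \<partial>lborel) \<partial>lborel)"
    by (simp add: ennreal_mult' nn_integral_cmult)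
  ultimately show ?thesis by simp
qed

text \<open>Half of the integral of \<open>w(s) / |s|\<^bsup>1 + \<alpha>\<^esup>\<close> over \<open>\<eta> < |s| < 1\<close>: the cut-off action of the kernel on the
  ground state at the centre of the interval.\<close>

definition trunc_A :: "real \<Rightarrow> real \<Rightarrow> ennreal" where
  "trunc_A \<alpha> \<eta> = (\<integral>\<^sup>+s\<in>{\<eta><..<1}. ennreal ((1 - s\<^sup>2) powr ((\<alpha> - 1) / 2) / s powr (1 + \<alpha>)) \<partial>lborel)"

text \<open>The finite part of \<open>trunc_A\<close> up to the factor \<open>- 1 / \<alpha>\<close>; it converges as \<open>\<eta>\<close> tends to \<open>0\<close>.\<close>

definition trunc_B :: "real \<Rightarrow> real \<Rightarrow> ennreal" where
  "trunc_B \<alpha> \<eta> = (\<integral>\<^sup>+s\<in>{\<eta><..<1}. ennreal ((1 - s\<^sup>2) powr ((\<alpha> - 1) / 2) * s powr (1 - \<alpha>)) \<partial>lborel)"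

text \<open>The integrand of the left side has an explicit primitive that vanishes at \<open>1\<close>. The identity
  isolates the divergent part \<open>\<eta>\<^bsup>-\<alpha>\<^esup>\<close> of \<open>trunc_A\<close>.\<close>

lemma trunc_A_trunc_B:
  assumes a: "1 < \<alpha>" and e: "0 < \<eta>" "\<eta> < 1"
  shows "ennreal \<alpha> * trunc_A \<alpha> \<eta> + trunc_B \<alpha> \<eta>
    = ennreal (\<eta> powr (- \<alpha>) * (1 - \<eta>\<^sup>2) powr ((\<alpha> + 1) / 2))"
proof -
  define F where "F s = - (s powr (- \<alpha>) * (1 - s\<^sup>2) powr ((\<alpha> + 1) / 2))" for s
  let ?f = "\<lambda>s. \<alpha> * ((1 - s\<^sup>2) powr ((\<alpha> - 1) / 2) / s powr (1 + \<alpha>))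
      + (1 - s\<^sup>2) powr ((\<alpha> - 1) / 2) * s powr (1 - \<alpha>)"
  have sq: "s\<^sup>2 < 1" if "\<eta> < s" "s < 1" for s
    using that e by (simp add: abs_square_less_1)
  let ?A = "\<lambda>s. ennreal ((1 - s\<^sup>2) powr ((\<alpha> - 1) / 2) / s powr (1 + \<alpha>)) * indicator {\<eta><..<1} s"
  let ?B = "\<lambda>s. ennreal ((1 - s\<^sup>2) powr ((\<alpha> - 1) / 2) * s powr (1 - \<alpha>)) * indicator {\<eta><..<1} s"
  have "ennreal \<alpha> * trunc_A \<alpha> \<eta> + trunc_B \<alpha> \<eta> = (\<integral>\<^sup>+s. ennreal \<alpha> * ?A s + ?B s \<partial>lborel)"
    unfolding trunc_A_def trunc_B_def by (simp add: nn_integral_add nn_integral_cmult)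
  also have "\<dots> = (\<integral>\<^sup>+s\<in>{\<eta><..<1}. ennreal (?f s) \<partial>lborel)"
  proof (intro nn_integral_cong)
    fix s
    have "ennreal (?f s) = ennreal \<alpha> * ennreal ((1 - s\<^sup>2) powr ((\<alpha> - 1) / 2) / s powr (1 + \<alpha>))
      + ennreal ((1 - s\<^sup>2) powr ((\<alpha> - 1) / 2) * s powr (1 - \<alpha>))"
      using a by (simp only: ennreal_plus ennreal_mult' mult_nonneg_nonneg divide_nonneg_nonneg powr_ge_zero)
    then show "ennreal \<alpha> * ?A s + ?B s = ennreal (?f s) * indicator {\<eta><..<1} s"
      by (cases "s \<in> {\<eta><..<1}") (simp_all only: indicator_simps mult_1_right mult_zero_right add_0_left not_False_eq_True)
  qed
  also have "\<dots> = ennreal (F 1 - F \<eta>)"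
  proof (rule nn_integral_FTC_interior)
    show "continuous_on {\<eta>..1} F"
      unfolding F_def using a e
      by (intro continuous_intros continuous_on_powr') (auto simp: abs_square_le_1 power_le_one)
    fix s assume s: "s \<in> {\<eta><..<1}"
    have s2: "0 < 1 - s\<^sup>2" "0 < s" using s sq e by auto
    have "(F has_real_derivative (\<alpha> * s powr (- \<alpha> - 1) * (1 - s\<^sup>2) powr ((\<alpha> + 1) / 2)
       + s powr (- \<alpha>) * ((\<alpha> + 1) / 2 * (1 - s\<^sup>2) powr ((\<alpha> + 1) / 2 - 1) * (2 * s)))) (at s)"
      unfolding F_def using s2 by (auto intro!: derivative_eq_intros simp: field_simps)
    moreover have "\<alpha> * s powr (- \<alpha> - 1) * (1 - s\<^sup>2) powr ((\<alpha> + 1) / 2)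
       + s powr (- \<alpha>) * ((\<alpha> + 1) / 2 * (1 - s\<^sup>2) powr ((\<alpha> + 1) / 2 - 1) * (2 * s)) = ?f s"
    proof -
      have 1: "(1 - s\<^sup>2) powr ((\<alpha> + 1) / 2) = (1 - s\<^sup>2) powr ((\<alpha> - 1) / 2) * (1 - s\<^sup>2)"
        using powr_add[of "1 - s\<^sup>2" "(\<alpha> - 1) / 2" 1] s2 by (simp add: field_simps)
      have 2: "(\<alpha> + 1) / 2 - 1 = (\<alpha> - 1) / 2" by (simp add: field_simps)
      have 3: "s powr (- \<alpha> - 1) = s powr (1 - \<alpha>) / s\<^sup>2" "s powr (- \<alpha>) = s powr (1 - \<alpha>) / s"
        "s powr (1 + \<alpha>) = s\<^sup>2 / s powr (1 - \<alpha>)"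
        using s2 powr_add[of s "1 + \<alpha>" "1 - \<alpha>"] powr_add[of s "- \<alpha> - 1" 2] powr_add[of s "- \<alpha>" 1]
        by (auto simp: field_simps)
      show ?thesis unfolding 1 2 3 using s2 by (simp add: field_simps power2_eq_square)
    qed
    ultimately show "(F has_real_derivative ?f s) (at s)" by simp
    show "0 \<le> ?f s" using a by simp
  qed (use e in auto)
  also have "F 1 - F \<eta> = \<eta> powr (- \<alpha>) * (1 - \<eta>\<^sup>2) powr ((\<alpha> + 1) / 2)"
    using a by (simp add: F_def)
  finally show ?thesis .
qed

text \<open>Substituting \<open>y = s\<^sup>2\<close> gives the Beta integral; this is where the Beta value of the sharp constant
  comes from.\<close>

lemma trunc_B_0:
  assumes a: "1 < \<alpha>" "\<alpha> < 2"
  shows "2 * trunc_B \<alpha> 0 = ennreal (Beta ((1 + \<alpha>) / 2) ((2 - \<alpha>) / 2))"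
proof -
  let ?f = "\<lambda>y. y powr ((2 - \<alpha>) / 2 - 1) * (1 - y) powr ((1 + \<alpha>) / 2 - 1)"
  have "ennreal (Beta ((1 + \<alpha>) / 2) ((2 - \<alpha>) / 2)) = ennreal (Beta ((2 - \<alpha>) / 2) ((1 + \<alpha>) / 2))"
    by (simp add: Beta_commute)
  also have "\<dots> = (\<integral>\<^sup>+y\<in>{0<..<1}. ennreal (?f y) \<partial>lborel)"
    using a has_integral_Beta_real[of "(2 - \<alpha>) / 2" "(1 + \<alpha>) / 2"]
    by (intro nn_integral_has_integral_lebesgue'[symmetric]) (auto simp: has_integral_Icc_iff_Ioo)
  also have "{0<..<1} = (\<lambda>s::real. s\<^sup>2) ` einterval (ereal 0) (ereal 1)"
  proof (intro equalityI subsetI)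
    fix y :: real assume "y \<in> {0<..<1}"
    then have "y = (sqrt y)\<^sup>2" "sqrt y \<in> einterval (ereal 0) (ereal 1)" by (auto simp: einterval_def)
    then show "y \<in> (\<lambda>s::real. s\<^sup>2) ` einterval (ereal 0) (ereal 1)" by blast
  qed (auto simp: einterval_def power_less_one_iff abs_square_less_1)
  also have "(\<integral>\<^sup>+y\<in>\<dots>. ennreal (?f y) \<partial>lborel)
      = (\<integral>\<^sup>+s\<in>einterval (ereal 0) (ereal 1). ennreal (?f (s\<^sup>2) * (2 * s)) \<partial>lborel)"
    by (rule nn_integral_substitution_einterval)
       (auto intro!: derivative_eq_intros continuous_intros simp: einterval_def)
  also have "\<dots> = (\<integral>\<^sup>+s. 2 * (ennreal ((1 - s\<^sup>2) powr ((\<alpha> - 1) / 2) * s powr (1 - \<alpha>)) * indicator {0<..<1} s) \<partial>lborel)"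
  proof (intro nn_integral_cong)
    fix s :: real
    have "?f (s\<^sup>2) * (2 * s) = 2 * ((1 - s\<^sup>2) powr ((\<alpha> - 1) / 2) * s powr (1 - \<alpha>))" if "0 < s"
    proof -
      have "(s\<^sup>2) powr ((2 - \<alpha>) / 2 - 1) = s powr (- \<alpha>)"
        using that by (simp add: powr_powr diff_divide_distrib flip: powr_numeral)
      moreover have "s powr (1 - \<alpha>) = s powr (- \<alpha>) * s"
        using that powr_add[of s "- \<alpha>" 1] by simp
      moreover have "(1 + \<alpha>) / 2 - 1 = (\<alpha> - 1) / 2" by (simp add: field_simps)
      ultimately show ?thesis by simp
    qed
    then show "ennreal (?f (s\<^sup>2) * (2 * s)) * indicator (einterval (ereal 0) (ereal 1)) s
      = 2 * (ennreal ((1 - s\<^sup>2) powr ((\<alpha> - 1) / 2) * s powr (1 - \<alpha>)) * indicator {0<..<1} s)"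
      by (cases "s \<in> {0<..<1}") (auto simp: einterval_def simp flip: ennreal_mult'' ennreal_numeral)
  qed
  also have "\<dots> = 2 * trunc_B \<alpha> 0"
    unfolding trunc_B_def by (rule nn_integral_cmult) measurable
  finally show ?thesis by simp
qed

lemma trunc_B_antimono: "\<eta> \<le> \<eta>' \<Longrightarrow> trunc_B \<alpha> \<eta>' \<le> trunc_B \<alpha> \<eta>"
  unfolding trunc_B_def by (intro nn_integral_mono) (auto simp: indicator_def)

lemma trunc_B_approx:
  assumes a: "1 < \<alpha>" "\<alpha> < 2" and e: "0 < \<epsilon>"
  obtains \<eta>\<^sub>0 where "0 < \<eta>\<^sub>0" "\<eta>\<^sub>0 < 1"
    "\<And>\<eta>. \<eta> \<le> \<eta>\<^sub>0 \<Longrightarrow> ennreal (Beta ((1 + \<alpha>) / 2) ((2 - \<alpha>) / 2) - \<epsilon>) \<le> 2 * trunc_B \<alpha> \<eta>"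
proof -
  let ?B = "Beta ((1 + \<alpha>) / 2) ((2 - \<alpha>) / 2)"
  let ?h = "\<lambda>s. ennreal ((1 - s\<^sup>2) powr ((\<alpha> - 1) / 2) * s powr (1 - \<alpha>))"
  let ?e = "\<lambda>n. 1 / (real n + 2)"
  have "trunc_B \<alpha> 0 = (\<integral>\<^sup>+s. (SUP n. ?h s * indicator {?e n<..<1} s) \<partial>lborel)"
    unfolding trunc_B_def
  proof (intro nn_integral_cong)
    fix s :: real
    show "?h s * indicator {0<..<1} s = (SUP n. ?h s * indicator {?e n<..<1} s)"
    proof (cases "s \<in> {0<..<1}")
      case True
      then obtain n where "1 / real (Suc n) < s" using nat_approx_posE by (metis greaterThanLessThan_iff)
      moreover have "?e n \<le> 1 / real (Suc n)" by (simp add: field_simps)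
      ultimately have i: "s \<in> {?e n<..<1}" using True by auto
      have "(SUP n. ?h s * indicator {?e n<..<1} s) = ?h s"
        by (rule antisym) (use i in \<open>auto intro!: SUP_least SUP_upper2[of n] split: split_indicator\<close>)
      then show ?thesis using True by simp
    next
      case False
      have "s \<notin> {?e n<..<1}" for n
        using False order_less_trans[of 0 "?e n" s] by auto
      then show ?thesis using False by simp
    qed
  qed
  also have "\<dots> = (SUP n. trunc_B \<alpha> (?e n))"
    unfolding trunc_B_def
    by (rule nn_integral_monotone_convergence_SUP)
       (auto simp: incseq_def le_fun_def frac_le split: split_indicator intro: le_less_trans[rotated])
  finally have "ennreal ?B = 2 * (SUP n. trunc_B \<alpha> (?e n))" using trunc_B_0[OF a] by simp
  also have "\<dots> = (SUP n. 2 * trunc_B \<alpha> (?e n))" by (simp add: SUP_mult_left_ennreal)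
  finally have S: "ennreal ?B = (SUP n. 2 * trunc_B \<alpha> (?e n))" .
  have "0 < ?B" using Beta_ge_two_powr[OF a] by (smt (verit) powr_gt_zero)
  then have "ennreal (?B - \<epsilon>) < ennreal ?B" using e by (auto simp: ennreal_less_iff ennreal_lessI)
  then obtain n where n: "ennreal (?B - \<epsilon>) < 2 * trunc_B \<alpha> (?e n)"
    unfolding S less_SUP_iff by auto
  show ?thesis
  proof (rule that[of "?e n"])
    fix \<eta> assume "\<eta> \<le> ?e n"
    then have "2 * trunc_B \<alpha> (?e n) \<le> 2 * trunc_B \<alpha> \<eta>"
      by (intro mult_left_mono trunc_B_antimono) auto
    then show "ennreal (?B - \<epsilon>) \<le> 2 * trunc_B \<alpha> \<eta>" using n by simp
  qed auto
qed

section \<open>The kernel cut off along the pseudohyperbolic distance\<close>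

lemma abs_mult_less_one: "\<bar>x\<bar> < 1 \<Longrightarrow> \<bar>s\<bar> < 1 \<Longrightarrow> \<bar>x * s\<bar> < (1::real)"
  using mult_strict_mono'[of "\<bar>x\<bar>" 1 "\<bar>s\<bar>" 1] by (simp add: abs_mult)

lemma powr_neg_minus_one: "y powr (- \<alpha> - 1) = 1 / y powr (1 + \<alpha>)" for y \<alpha> :: real
proof -
  have "- \<alpha> - 1 = - (1 + \<alpha>)" by simp
  then show ?thesis by (simp only: powr_minus_divide)
qed

lemma powr_neg_divide: "0 < a \<Longrightarrow> 0 < A \<Longrightarrow> (a / A) powr (- \<alpha>) = a powr (- \<alpha>) * A powr \<alpha>"
  for a A \<alpha> :: real
  by (simp add: powr_divide powr_minus field_simps)

text \<open>The map is an increasing bijection of \<open>(-1, 1)\<close> with inverse \<open>t \<mapsto> (t - x) / (1 - x t)\<close>.\<close>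

lemma moebius_image:
  fixes x c d :: real
  assumes x: "\<bar>x\<bar> < 1" and cd: "-1 \<le> c" "d \<le> 1"
  shows "(\<lambda>s. (x + s) / (1 + x * s)) ` {c<..<d}
    = {t. \<bar>t\<bar> < 1 \<and> c < (t - x) / (1 - x * t) \<and> (t - x) / (1 - x * t) < d}"
proof -
  have den: "0 < 1 + x * s" "0 < 1 - x * s" if "\<bar>s\<bar> < 1" for s
  proof -
    have "\<bar>x * s\<bar> < 1" using x that by (rule abs_mult_less_one)
    then show "0 < 1 + x * s" "0 < 1 - x * s" by auto
  qed
  have x2: "0 < 1 - x\<^sup>2" using x by (simp add: abs_square_less_1)
  have bound: "\<bar>(x + s) / (1 + x * s)\<bar> < 1" if "\<bar>s\<bar> < 1" for s
  proof -
    have "0 < (1 + x) * (1 + s)" "0 < (1 - x) * (1 - s)" using x that by auto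
    then have "x + s < 1 + x * s" "- (x + s) < 1 + x * s" by (auto simp: algebra_simps)
    then show ?thesis using den(1)[OF that] by (auto simp: abs_less_iff field_simps)
  qed
  have inv1: "((x + s) / (1 + x * s) - x) / (1 - x * ((x + s) / (1 + x * s))) = s" if "\<bar>s\<bar> < 1" for s
  proof -
    have "(x + s) / (1 + x * s) - x = s * (1 - x\<^sup>2) / (1 + x * s)"
      using den(1)[OF that] by (simp add: field_simps power2_eq_square)
    moreover have "1 - x * ((x + s) / (1 + x * s)) = (1 - x\<^sup>2) / (1 + x * s)"
      using den(1)[OF that] by (simp add: field_simps power2_eq_square)
    ultimately show ?thesis using den(1)[OF that] x2 by simp
  qed
  have inv2: "(x + (t - x) / (1 - x * t)) / (1 + x * ((t - x) / (1 - x * t))) = t" if "\<bar>t\<bar> < 1" for t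
  proof -
    have "x + (t - x) / (1 - x * t) = t * (1 - x\<^sup>2) / (1 - x * t)"
      using den(2)[OF that] by (simp add: field_simps power2_eq_square)
    moreover have "1 + x * ((t - x) / (1 - x * t)) = (1 - x\<^sup>2) / (1 - x * t)"
      using den(2)[OF that] by (simp add: field_simps power2_eq_square)
    ultimately show ?thesis using den(2)[OF that] x2 by simp
  qed
  show ?thesis
  proof (intro equalityI subsetI)
    fix t assume "t \<in> (\<lambda>s. (x + s) / (1 + x * s)) ` {c<..<d}"
    then obtain s where s: "c < s" "s < d" "t = (x + s) / (1 + x * s)" by auto
    then have "\<bar>s\<bar> < 1" using cd by auto
    then show "t \<in> {t. \<bar>t\<bar> < 1 \<and> c < (t - x) / (1 - x * t) \<and> (t - x) / (1 - x * t) < d}"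
      using s bound[of s] inv1[of s] by simp
  next
    fix t assume t: "t \<in> {t. \<bar>t\<bar> < 1 \<and> c < (t - x) / (1 - x * t) \<and> (t - x) / (1 - x * t) < d}"
    then have "t = (x + (t - x) / (1 - x * t)) / (1 + x * ((t - x) / (1 - x * t)))"
      using inv2[of t] by simp
    then show "t \<in> (\<lambda>s. (x + s) / (1 + x * s)) ` {c<..<d}"
      using t by (intro image_eqI[where x = "(t - x) / (1 - x * t)"]) auto
  qed
qed

text \<open>Under \<open>t = (x + s) / (1 + x s)\<close> one has \<open>1 - t\<^sup>2 = (1 - x\<^sup>2) (1 - s\<^sup>2) / (1 + x s)\<^sup>2\<close> and
  \<open>t - x = s (1 - x\<^sup>2) / (1 + x s)\<close>, while \<open>dt / ds = (1 - x\<^sup>2) / (1 + x s)\<^sup>2\<close>. For the exponent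
  \<open>(\<alpha> - 1) / 2\<close> the powers of \<open>1 + x s\<close> cancel, so that moving the singularity from \<open>0\<close> to \<open>x\<close> only costs a
  power of \<open>1 - x\<^sup>2\<close>.\<close>

lemma moebius_weight_integral:
  fixes x c d :: real
  assumes x: "\<bar>x\<bar> < 1" and cd: "-1 \<le> c" "c < d" "d \<le> 1" and a: "1 < \<alpha>" and nz: "0 \<le> c \<or> d \<le> 0"
  shows "(\<integral>\<^sup>+t\<in>{t. \<bar>t\<bar> < 1 \<and> c < (t - x) / (1 - x * t) \<and> (t - x) / (1 - x * t) < d}.
      ennreal ((1 - t\<^sup>2) powr ((\<alpha> - 1) / 2) / \<bar>x - t\<bar> powr (1 + \<alpha>)) \<partial>lborel)
    = ennreal ((1 - x\<^sup>2) powr ((\<alpha> - 1) / 2 - \<alpha>)) *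
      (\<integral>\<^sup>+s\<in>{c<..<d}. ennreal ((1 - s\<^sup>2) powr ((\<alpha> - 1) / 2) / \<bar>s\<bar> powr (1 + \<alpha>)) \<partial>lborel)"
proof -
  define p where "p = (\<alpha> - 1) / 2"
  let ?g = "\<lambda>s. (x + s) / (1 + x * s)"
  let ?g' = "\<lambda>s. (1 - x\<^sup>2) / (1 + x * s)\<^sup>2"
  let ?f = "\<lambda>t. (1 - t\<^sup>2) powr p / \<bar>x - t\<bar> powr (1 + \<alpha>)"
  have den: "0 < 1 + x * s" if "\<bar>s\<bar> < 1" for s
  proof -
    have "\<bar>x * s\<bar> < 1" using x that by (rule abs_mult_less_one)
    then show ?thesis by auto
  qed
  have x2: "0 < 1 - x\<^sup>2" using x by (simp add: abs_square_less_1)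
  have ab: "\<bar>s\<bar> < 1" if "s \<in> {c<..<d}" for s using that cd by auto
  have ein: "einterval (ereal c) (ereal d) = {c<..<d}" by (auto simp: einterval_def)
  have deriv: "(?g has_real_derivative ?g' s) (at s)" if "s \<in> {c<..<d}" for s
    using den[OF ab[OF that]]
    by (auto intro!: derivative_eq_intros simp: field_simps power2_eq_square)
  have "(\<integral>\<^sup>+t\<in>?g ` {c<..<d}. ennreal (?f t) \<partial>lborel)
     = (\<integral>\<^sup>+s\<in>{c<..<d}. ennreal (?f (?g s) * ?g' s) \<partial>lborel)"
  proof (rule nn_integral_substitution_einterval[of "ereal c" "ereal d", unfolded ein])
    show "continuous_on {c<..<d} ?g'"
      using den[OF ab] by (intro continuous_intros) (fastforce dest: less_imp_neq)
    show "0 < ?g' s" if "s \<in> {c<..<d}" for s using den[OF ab[OF that]] x2 by simp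
  qed (use cd deriv in auto)
  also have "\<dots> = (\<integral>\<^sup>+s. ennreal ((1 - x\<^sup>2) powr (p - \<alpha>)) *
      (ennreal ((1 - s\<^sup>2) powr p / \<bar>s\<bar> powr (1 + \<alpha>)) * indicator {c<..<d} s) \<partial>lborel)"
  proof (intro nn_integral_cong)
    fix s :: real
    have "?f (?g s) * ?g' s = (1 - x\<^sup>2) powr (p - \<alpha>) * ((1 - s\<^sup>2) powr p / \<bar>s\<bar> powr (1 + \<alpha>))"
      if s: "s \<in> {c<..<d}"
    proof -
      define D where "D = 1 + x * s"
      have D: "0 < D" unfolding D_def by (rule den[OF ab[OF s]])
      have s2: "0 < 1 - s\<^sup>2" "s \<noteq> 0" using ab[OF s] s nz by (auto simp: abs_square_less_1)
      have 1: "1 - (?g s)\<^sup>2 = (1 - x\<^sup>2) * (1 - s\<^sup>2) / D\<^sup>2"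
      proof -
        have "1 - (?g s)\<^sup>2 = (D\<^sup>2 - (x + s)\<^sup>2) / D\<^sup>2"
          using D by (simp add: D_def[symmetric] power_divide diff_divide_distrib)
        also have "D\<^sup>2 - (x + s)\<^sup>2 = (1 - x\<^sup>2) * (1 - s\<^sup>2)"
          by (simp add: D_def power2_eq_square algebra_simps)
        finally show ?thesis .
      qed
      have "x - ?g s = - (s * (1 - x\<^sup>2) / D)"
        using D by (simp add: D_def field_simps power2_eq_square)
      then have 2: "\<bar>x - ?g s\<bar> = \<bar>s\<bar> * (1 - x\<^sup>2) / D"
        using D x2 by (simp add: abs_mult)
      have D2: "D\<^sup>2 = D powr 2" using D by simp
      have "?f (?g s) * ?g' s = ((1 - x\<^sup>2) powr p * (1 - s\<^sup>2) powr p / (D\<^sup>2) powr p)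
          / (\<bar>s\<bar> powr (1 + \<alpha>) * (1 - x\<^sup>2) powr (1 + \<alpha>) / D powr (1 + \<alpha>)) * ((1 - x\<^sup>2) / D\<^sup>2)"
        unfolding 1 2 using x2 s2 D by (simp add: powr_divide powr_mult D_def)
      also have "\<dots> = ((1 - x\<^sup>2) powr p * (1 - x\<^sup>2) powr 1 / (1 - x\<^sup>2) powr (1 + \<alpha>))
          * (D powr (1 + \<alpha>) / (D powr (2 * p) * D powr 2)) * ((1 - s\<^sup>2) powr p / \<bar>s\<bar> powr (1 + \<alpha>))"
        unfolding D2 powr_powr using x2 by (simp add: field_simps)
      also have "(1 - x\<^sup>2) powr p * (1 - x\<^sup>2) powr 1 / (1 - x\<^sup>2) powr (1 + \<alpha>) = (1 - x\<^sup>2) powr (p - \<alpha>)"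
        by (simp only: powr_add[symmetric] powr_diff[symmetric]) simp
      also have "D powr (1 + \<alpha>) / (D powr (2 * p) * D powr 2) = 1"
      proof -
        have "1 + \<alpha> = 2 * p + 2" by (simp add: p_def field_simps)
        then have "D powr (1 + \<alpha>) = D powr (2 * p) * D powr 2" by (simp only: powr_add)
        then show ?thesis using D by simp
      qed
      finally show ?thesis by simp
    qed
    then show "ennreal (?f (?g s) * ?g' s) * indicator {c<..<d} s
      = ennreal ((1 - x\<^sup>2) powr (p - \<alpha>)) * (ennreal ((1 - s\<^sup>2) powr p / \<bar>s\<bar> powr (1 + \<alpha>)) * indicator {c<..<d} s)"
      by (cases "s \<in> {c<..<d}") (simp_all add: ennreal_mult'[symmetric])
  qed
  also have "\<dots> = ennreal ((1 - x\<^sup>2) powr (p - \<alpha>)) *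
      (\<integral>\<^sup>+s\<in>{c<..<d}. ennreal ((1 - s\<^sup>2) powr p / \<bar>s\<bar> powr (1 + \<alpha>)) \<partial>lborel)"
    by (rule nn_integral_cmult) measurable
  finally show ?thesis
    unfolding moebius_image[OF x cd(1,3)] p_def .
qed

lemma trunc_A_reflect:
  "(\<integral>\<^sup>+s\<in>{-1<..<- \<eta>}. ennreal ((1 - s\<^sup>2) powr ((\<alpha> - 1) / 2) / \<bar>s\<bar> powr (1 + \<alpha>)) \<partial>lborel)
    = (\<integral>\<^sup>+s\<in>{\<eta><..<1}. ennreal ((1 - s\<^sup>2) powr ((\<alpha> - 1) / 2) / \<bar>s\<bar> powr (1 + \<alpha>)) \<partial>lborel)"
proof -
  let ?h = "\<lambda>s. ennreal ((1 - s\<^sup>2) powr ((\<alpha> - 1) / 2) / \<bar>s\<bar> powr (1 + \<alpha>))"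
  have "(\<integral>\<^sup>+s. ?h s * indicator {-1<..<- \<eta>} s \<partial>lborel)
    = ennreal \<bar>-1\<bar> * (\<integral>\<^sup>+s. ?h (0 + - 1 * s) * indicator {-1<..<- \<eta>} (0 + - 1 * s) \<partial>lborel)"
  proof (rule nn_integral_real_affine)
    have [measurable]: "{-1<..<- \<eta>} \<in> sets borel" by (rule borel_open) (rule open_greaterThanLessThan)
    show "(\<lambda>s. ?h s * indicator {-1<..<- \<eta>} s) \<in> borel_measurable borel" by measurable
  qed simp
  also have "(\<lambda>s. ?h (0 + - 1 * s) * indicator {-1<..<- \<eta>} (0 + - 1 * s)) = (\<lambda>s. ?h s * indicator {\<eta><..<1} s)"
  proof
    fix s :: real
    have "indicator {-1<..<- \<eta>} (0 + - 1 * s) = (indicator {\<eta><..<1} s :: ennreal)"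
      by (simp add: indicator_def conj_commute)
    then show "?h (0 + - 1 * s) * indicator {-1<..<- \<eta>} (0 + - 1 * s) = ?h s * indicator {\<eta><..<1} s"
      by simp
  qed
  finally show ?thesis by simp
qed
lemma trunc_A_abs:
  assumes "0 < \<eta>"
  shows "(\<integral>\<^sup>+s\<in>{\<eta><..<1}. ennreal ((1 - s\<^sup>2) powr ((\<alpha> - 1) / 2) / \<bar>s\<bar> powr (1 + \<alpha>)) \<partial>lborel)
    = trunc_A \<alpha> \<eta>"
  unfolding trunc_A_def
proof (intro nn_integral_cong)
  fix s :: real
  show "ennreal ((1 - s\<^sup>2) powr ((\<alpha> - 1) / 2) / \<bar>s\<bar> powr (1 + \<alpha>)) * indicator {\<eta><..<1} s
    = ennreal ((1 - s\<^sup>2) powr ((\<alpha> - 1) / 2) / s powr (1 + \<alpha>)) * indicator {\<eta><..<1} s"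
  proof (cases "s \<in> {\<eta><..<1}")
    case True
    then have "\<bar>s\<bar> = s" using assms by (simp only: greaterThanLessThan_iff) linarith
    then show ?thesis by (simp only:)
  qed (simp only: indicator_simps mult_zero_right not_False_eq_True)
qed

text \<open>The kernel of the energy on \<open>(-1, 1)\<close>, restricted to pairs of pseudohyperbolic distance
  \<open>|s - t| / (1 - s t)\<close> greater than \<open>\<eta>\<close>.\<close>

definition interval_kernel :: "real \<Rightarrow> real \<Rightarrow> real \<Rightarrow> real \<Rightarrow> real" where
  "interval_kernel \<alpha> \<eta> s t =
    (if \<bar>s\<bar> < 1 \<and> \<bar>t\<bar> < 1 \<and> \<eta> * (1 - s * t) < \<bar>s - t\<bar> then 1 / \<bar>s - t\<bar> powr (1 + \<alpha>) else 0)"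

lemma interval_kernel_measurable[measurable]:
  "(\<lambda>(s, t). interval_kernel \<alpha> \<eta> s t) \<in> borel_measurable (borel \<Otimes>\<^sub>M borel)"
  unfolding interval_kernel_def by measurable

lemma interval_kernel_support:
  fixes x \<eta> :: real
  assumes x: "\<bar>x\<bar> < 1" and e: "0 < \<eta>" "\<eta> < 1"
  shows "{t. \<bar>t\<bar> < 1 \<and> \<eta> * (1 - x * t) < \<bar>x - t\<bar>}
    = {t. \<bar>t\<bar> < 1 \<and> -1 < (t - x) / (1 - x * t) \<and> (t - x) / (1 - x * t) < - \<eta>}
      \<union> {t. \<bar>t\<bar> < 1 \<and> \<eta> < (t - x) / (1 - x * t) \<and> (t - x) / (1 - x * t) < 1}"
proof -
  have "\<eta> * (1 - x * t) < \<bar>x - t\<bar> \<longleftrightarrow>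
     -1 < (t - x) / (1 - x * t) \<and> (t - x) / (1 - x * t) < - \<eta> \<or>
     \<eta> < (t - x) / (1 - x * t) \<and> (t - x) / (1 - x * t) < 1" if t: "\<bar>t\<bar> < 1" for t
  proof -
    have "0 < (1 + x) * (1 - t)" "0 < (1 - x) * (1 + t)" using x t by auto
    then have 1: "t - x < 1 - x * t" "- (1 - x * t) < t - x" by (auto simp: algebra_simps)
    then have D: "0 < 1 - x * t" by simp
    have 2: "-1 < (t - x) / (1 - x * t)" "(t - x) / (1 - x * t) < 1"
      using D 1 by (auto simp: less_divide_eq divide_less_eq)
    have 3: "\<eta> < (t - x) / (1 - x * t) \<longleftrightarrow> \<eta> * (1 - x * t) < t - x"
      "(t - x) / (1 - x * t) < - \<eta> \<longleftrightarrow> t - x < - (\<eta> * (1 - x * t))"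
      using D by (auto simp: less_divide_eq divide_less_eq)
    have 4: "0 < \<eta> * (1 - x * t)" using D e by simp
    show ?thesis using 2 4 unfolding 3 by (auto simp: abs_if)
  qed
  then show ?thesis by blast
qed

text \<open>Both Moebius images of \<open>(-1, -\<eta>)\<close> and \<open>(\<eta>, 1)\<close> contribute the same amount. With a Euclidean cut-off
  the two sides of the singularity would not balance for \<open>x \<noteq> 0\<close>.\<close>

lemma interval_kernel_weight_integral:
  assumes x: "\<bar>x\<bar> < 1" and e: "0 < \<eta>" "\<eta> < 1" and a: "1 < \<alpha>"
  shows "(\<integral>\<^sup>+t. ennreal ((1 - t\<^sup>2) powr ((\<alpha> - 1) / 2) / (1 - x\<^sup>2) powr ((\<alpha> - 1) / 2)
      * interval_kernel \<alpha> \<eta> x t) \<partial>lborel) = 2 * ennreal ((1 - x\<^sup>2) powr (- \<alpha>)) * trunc_A \<alpha> \<eta>"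
proof -
  let ?p = "(\<alpha> - 1) / 2"
  have x2: "0 < 1 - x\<^sup>2" using x by (simp add: abs_square_less_1)
  let ?f = "\<lambda>t. ennreal ((1 - t\<^sup>2) powr ?p / \<bar>x - t\<bar> powr (1 + \<alpha>))"
  let ?S = "{t. \<bar>t\<bar> < 1 \<and> -1 < (t - x) / (1 - x * t) \<and> (t - x) / (1 - x * t) < - \<eta>}"
  let ?T = "{t. \<bar>t\<bar> < 1 \<and> \<eta> < (t - x) / (1 - x * t) \<and> (t - x) / (1 - x * t) < 1}"
  have "(\<integral>\<^sup>+t. ennreal ((1 - t\<^sup>2) powr ?p / (1 - x\<^sup>2) powr ?p * interval_kernel \<alpha> \<eta> x t) \<partial>lborel)
    = (\<integral>\<^sup>+t. ennreal ((1 - x\<^sup>2) powr (- ?p)) * (?f t * indicator ?S t + ?f t * indicator ?T t) \<partial>lborel)"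
  proof (intro nn_integral_cong)
    fix t :: real
    have "ennreal ((1 - t\<^sup>2) powr ?p / (1 - x\<^sup>2) powr ?p * interval_kernel \<alpha> \<eta> x t)
      = ennreal ((1 - x\<^sup>2) powr (- ?p)) * (?f t * indicator {t. \<bar>t\<bar> < 1 \<and> \<eta> * (1 - x * t) < \<bar>x - t\<bar>} t)"
      using x by (auto simp: interval_kernel_def powr_minus field_simps simp flip: ennreal_mult')
    also have "?f t * indicator {t. \<bar>t\<bar> < 1 \<and> \<eta> * (1 - x * t) < \<bar>x - t\<bar>} t
       = ?f t * indicator ?S t + ?f t * indicator ?T t"
      unfolding interval_kernel_support[OF x e] using e by (auto split: split_indicator)
    finally show "ennreal ((1 - t\<^sup>2) powr ?p / (1 - x\<^sup>2) powr ?p * interval_kernel \<alpha> \<eta> x t)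
      = ennreal ((1 - x\<^sup>2) powr (- ?p)) * (?f t * indicator ?S t + ?f t * indicator ?T t)" .
  qed
  also have "\<dots> = ennreal ((1 - x\<^sup>2) powr (- ?p)) *
      ((\<integral>\<^sup>+t. ?f t * indicator ?S t \<partial>lborel) + (\<integral>\<^sup>+t. ?f t * indicator ?T t \<partial>lborel))"
    by (simp add: nn_integral_cmult nn_integral_add)
  also have "(\<integral>\<^sup>+t. ?f t * indicator ?S t \<partial>lborel) = ennreal ((1 - x\<^sup>2) powr (?p - \<alpha>)) * trunc_A \<alpha> \<eta>"
    using x e a by (subst moebius_weight_integral) (auto simp: trunc_A_reflect trunc_A_abs)
  also have "(\<integral>\<^sup>+t. ?f t * indicator ?T t \<partial>lborel) = ennreal ((1 - x\<^sup>2) powr (?p - \<alpha>)) * trunc_A \<alpha> \<eta>"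
    using x e a by (subst moebius_weight_integral) (auto simp: trunc_A_abs)
  also have "ennreal ((1 - x\<^sup>2) powr (- ?p)) * (ennreal ((1 - x\<^sup>2) powr (?p - \<alpha>)) * trunc_A \<alpha> \<eta>
      + ennreal ((1 - x\<^sup>2) powr (?p - \<alpha>)) * trunc_A \<alpha> \<eta>)
     = 2 * (ennreal ((1 - x\<^sup>2) powr (- ?p)) * ennreal ((1 - x\<^sup>2) powr (?p - \<alpha>))) * trunc_A \<alpha> \<eta>"
    by (simp add: mult_2 distrib_left mult.assoc distrib_right)
  also have "ennreal ((1 - x\<^sup>2) powr (- ?p)) * ennreal ((1 - x\<^sup>2) powr (?p - \<alpha>)) = ennreal ((1 - x\<^sup>2) powr (- \<alpha>))"
    by (simp only: ennreal_mult'[symmetric] powr_ge_zero powr_add[symmetric]) simp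
  finally show ?thesis .
qed

text \<open>The region is the complement in \<open>(-1, 1)\<close> of an interval around \<open>x\<close> whose end points are Moebius images
  of \<open>-\<eta>\<close> and \<open>\<eta>\<close>; integrating the power explicitly leaves these four terms.\<close>

lemma interval_kernel_integral:
  assumes x: "\<bar>x\<bar> < 1" and e: "0 < \<eta>" "\<eta> < 1" and a: "1 < \<alpha>"
  shows "(\<integral>\<^sup>+t. ennreal (interval_kernel \<alpha> \<eta> x t) \<partial>lborel)
    = ennreal ((1 - x\<^sup>2) powr (- \<alpha>) / \<alpha> *
       ((1 / \<eta> + x) powr \<alpha> + (1 / \<eta> - x) powr \<alpha> - (1 + x) powr \<alpha> - (1 - x) powr \<alpha>))"
proof -
  have x2: "0 < 1 - x\<^sup>2" using x by (simp add: abs_square_less_1)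
  have ex: "\<bar>\<eta> * x\<bar> < 1" using x e by (intro abs_mult_less_one) auto
  define t1 where "t1 = (x - \<eta>) / (1 - \<eta> * x)"
  define t2 where "t2 = (x + \<eta>) / (1 + \<eta> * x)"
  have d: "0 < 1 - \<eta> * x" "0 < 1 + \<eta> * x" using ex by auto
  have t1x: "x - t1 = \<eta> * (1 - x\<^sup>2) / (1 - \<eta> * x)" and t2x: "t2 - x = \<eta> * (1 - x\<^sup>2) / (1 + \<eta> * x)"
    using d by (auto simp: t1_def t2_def field_simps power2_eq_square)
  have t1: "-1 < t1" "t1 < x"
  proof -
    have "0 < (1 - \<eta>) * (1 + x)" using x e by simp
    then show "-1 < t1" using d by (simp add: t1_def less_divide_eq algebra_simps)
    have "0 < x - t1" unfolding t1x using e x2 d by simp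
    then show "t1 < x" by simp
  qed
  have t2: "x < t2" "t2 < 1"
  proof -
    have "0 < (1 - \<eta>) * (1 - x)" using x e by simp
    then show "t2 < 1" using d by (simp add: t2_def divide_less_eq algebra_simps)
    have "0 < t2 - x" unfolding t2x using e x2 d by simp
    then show "x < t2" by simp
  qed
  have K: "ennreal (interval_kernel \<alpha> \<eta> x t) = ennreal (1 / (x - t) powr (1 + \<alpha>)) * indicator {-1<..<t1} t
      + ennreal (1 / (t - x) powr (1 + \<alpha>)) * indicator {t2<..<1} t" for t
  proof -
    have c1: "t < t1 \<longleftrightarrow> \<eta> * (1 - x * t) < x - t" "t2 < t \<longleftrightarrow> \<eta> * (1 - x * t) < t - x"
      using d by (auto simp: t1_def t2_def less_divide_eq divide_less_eq algebra_simps)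
    show ?thesis
    proof (cases "\<bar>t\<bar> < 1")
      case True
      have "0 < (1 + x) * (1 - t)" "0 < (1 - x) * (1 + t)" using x True by auto
      then have "0 < 1 - x * t" by (simp add: algebra_simps)
      then have "0 < \<eta> * (1 - x * t)" using e by simp
      then show ?thesis using True x c1
        by (auto simp: interval_kernel_def indicator_def abs_if)
    next
      case False
      then show ?thesis using t1 t2 x by (auto simp: interval_kernel_def indicator_def)
    qed
  qed
  have I1: "(\<integral>\<^sup>+t\<in>{-1<..<t1}. ennreal (1 / (x - t) powr (1 + \<alpha>)) \<partial>lborel)
      = ennreal ((x - t1) powr (- \<alpha>) / \<alpha> - (x - (-1)) powr (- \<alpha>) / \<alpha>)"
  proof (rule nn_integral_FTC_interior)
    show "continuous_on {-1..t1} (\<lambda>t. (x - t) powr (- \<alpha>) / \<alpha>)"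
      using t1 a by (intro continuous_intros) auto
    show "((\<lambda>t. (x - t) powr (- \<alpha>) / \<alpha>) has_real_derivative 1 / (x - t) powr (1 + \<alpha>)) (at t)"
      if "t \<in> {-1<..<t1}" for t
      using that t1 a by (auto intro!: derivative_eq_intros simp: powr_neg_minus_one)
  qed (use t1 in auto)
  have I2: "(\<integral>\<^sup>+t\<in>{t2<..<1}. ennreal (1 / (t - x) powr (1 + \<alpha>)) \<partial>lborel)
      = ennreal (- ((1 - x) powr (- \<alpha>) / \<alpha>) - (- ((t2 - x) powr (- \<alpha>) / \<alpha>)))"
  proof (rule nn_integral_FTC_interior)
    show "continuous_on {t2..1} (\<lambda>t. - ((t - x) powr (- \<alpha>) / \<alpha>))"
      using t2 a by (intro continuous_intros) auto
    show "((\<lambda>t. - ((t - x) powr (- \<alpha>) / \<alpha>)) has_real_derivative 1 / (t - x) powr (1 + \<alpha>)) (at t)"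
      if "t \<in> {t2<..<1}" for t
      using that t2 a by (auto intro!: derivative_eq_intros simp: powr_neg_minus_one)
  qed (use t2 in auto)
  have n1: "(x + 1) powr (- \<alpha>) \<le> (x - t1) powr (- \<alpha>)" "(1 - x) powr (- \<alpha>) \<le> (t2 - x) powr (- \<alpha>)"
    using t1 t2 x a by (auto intro!: powr_mono2')
  have "(\<integral>\<^sup>+t. ennreal (interval_kernel \<alpha> \<eta> x t) \<partial>lborel)
    = ennreal ((x - t1) powr (- \<alpha>) / \<alpha> - (x - (-1)) powr (- \<alpha>) / \<alpha>)
      + ennreal (- ((1 - x) powr (- \<alpha>) / \<alpha>) - (- ((t2 - x) powr (- \<alpha>) / \<alpha>)))"
    unfolding K I1[symmetric] I2[symmetric] by (rule nn_integral_add) measurable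
  also have "\<dots> = ennreal (((x - t1) powr (- \<alpha>) - (1 + x) powr (- \<alpha>) + (t2 - x) powr (- \<alpha>) - (1 - x) powr (- \<alpha>)) / \<alpha>)"
  proof (subst ennreal_plus[symmetric])
    show "0 \<le> (x - t1) powr (- \<alpha>) / \<alpha> - (x - (-1)) powr (- \<alpha>) / \<alpha>"
      "0 \<le> - ((1 - x) powr (- \<alpha>) / \<alpha>) - (- ((t2 - x) powr (- \<alpha>) / \<alpha>))"
      using n1 a by (auto intro!: divide_right_mono)
  qed (rule arg_cong[where f = ennreal], simp add: diff_divide_distrib add_divide_distrib add.commute)
  also have "(x - t1) powr (- \<alpha>) = (1 - x\<^sup>2) powr (- \<alpha>) * (1 / \<eta> - x) powr \<alpha>"
  proof -
    have 1: "1 - \<eta> * x = \<eta> * (1 / \<eta> - x)" using e by (simp add: right_diff_distrib)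
    then have 2: "0 < 1 / \<eta> - x" using d e by (metis zero_less_mult_pos)
    have "x - t1 = (1 - x\<^sup>2) / (1 / \<eta> - x)" using t1x e unfolding 1 by simp
    then show ?thesis using x2 2 by (simp add: powr_neg_divide)
  qed
  also have "(t2 - x) powr (- \<alpha>) = (1 - x\<^sup>2) powr (- \<alpha>) * (1 / \<eta> + x) powr \<alpha>"
  proof -
    have 1: "1 + \<eta> * x = \<eta> * (1 / \<eta> + x)" using e by (simp add: distrib_left)
    then have 2: "0 < 1 / \<eta> + x" using d e by (metis zero_less_mult_pos)
    have "t2 - x = (1 - x\<^sup>2) / (1 / \<eta> + x)" using t2x e unfolding 1 by simp
    then show ?thesis using x2 2 by (simp add: powr_neg_divide)
  qed
  also have "(1 + x) powr (- \<alpha>) = (1 - x\<^sup>2) powr (- \<alpha>) * (1 - x) powr \<alpha>"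
  proof -
    have "1 - x\<^sup>2 = (1 + x) * (1 - x)" by (simp add: power2_eq_square algebra_simps)
    then have "(1 - x\<^sup>2) powr (- \<alpha>) = (1 + x) powr (- \<alpha>) * (1 - x) powr (- \<alpha>)"
      using x by (simp add: powr_mult)
    then show ?thesis using x by (simp add: powr_minus)
  qed
  also have "(1 - x) powr (- \<alpha>) = (1 - x\<^sup>2) powr (- \<alpha>) * (1 + x) powr \<alpha>"
  proof -
    have "1 - x\<^sup>2 = (1 + x) * (1 - x)" by (simp add: power2_eq_square algebra_simps)
    then have "(1 - x\<^sup>2) powr (- \<alpha>) = (1 + x) powr (- \<alpha>) * (1 - x) powr (- \<alpha>)"
      using x by (simp add: powr_mult)
    then show ?thesis using x by (simp add: powr_minus)
  qed
  finally have "(\<integral>\<^sup>+t. ennreal (interval_kernel \<alpha> \<eta> x t) \<partial>lborel) =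
    ennreal (((1 - x\<^sup>2) powr (- \<alpha>) * (1 / \<eta> - x) powr \<alpha> - (1 - x\<^sup>2) powr (- \<alpha>) * (1 - x) powr \<alpha>
      + (1 - x\<^sup>2) powr (- \<alpha>) * (1 / \<eta> + x) powr \<alpha> - (1 - x\<^sup>2) powr (- \<alpha>) * (1 + x) powr \<alpha>) / \<alpha>)" .
  also have "\<dots> = ennreal ((1 - x\<^sup>2) powr (- \<alpha>) / \<alpha> *
       ((1 / \<eta> + x) powr \<alpha> + (1 / \<eta> - x) powr \<alpha> - (1 + x) powr \<alpha> - (1 - x) powr \<alpha>))"
    by (rule arg_cong[where f = ennreal]) (simp add: algebra_simps add_divide_distrib diff_divide_distrib)
  finally show ?thesis .
qed

section \<open>The Hardy inequality on the unit interval\<close>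

lemma kappa_1:
  assumes "1 < \<alpha>"
  shows "kappa 1 \<alpha> = (Beta ((1 + \<alpha>) / 2) ((2 - \<alpha>) / 2) - 2 powr \<alpha>) / (\<alpha> * 2 powr \<alpha>)"
proof -
  have "Gamma ((1 + \<alpha>) / 2) \<noteq> 0" using assms by (intro less_imp_neq[symmetric] Gamma_real_pos) auto
  then show ?thesis by (simp add: kappa_def)
qed

lemma kappa_1_nonneg: "1 < \<alpha> \<Longrightarrow> \<alpha> < 2 \<Longrightarrow> 0 \<le> kappa 1 \<alpha>"
  unfolding kappa_1 using Beta_ge_two_powr[of \<alpha>] by simp

lemma remainder_const_1:
  assumes "1 < \<alpha>"
  shows "remainder_const 1 \<alpha> = (4 - 2 powr (3 - \<alpha>)) / \<alpha>"
proof -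
  have "Gamma (\<alpha> / 2) \<noteq> 0" using assms by (intro less_imp_neq[symmetric] Gamma_real_pos) auto
  then show ?thesis by (simp add: remainder_const_def)
qed

lemma two_powr_ge_two: "1 < \<alpha> \<Longrightarrow> 2 \<le> 2 powr (\<alpha>::real)"
  using powr_mono[of 1 \<alpha> 2] by simp

lemma remainder_const_1_nonneg:
  assumes "1 < \<alpha>"
  shows "0 \<le> remainder_const 1 \<alpha>"
proof -
  have "2 powr (3 - \<alpha>) \<le> 2 powr 2" using assms by (intro powr_mono) auto
  then show ?thesis using assms unfolding remainder_const_1[OF assms] by simp
qed

text \<open>The cut-off potential dominates the two target terms up to the error \<open>e\<close>. The divergent parts satisfy
  \<open>2 \<eta>\<^bsup>-\<alpha>\<^esup> \<le> (1 / \<eta> + x)\<^sup>\<alpha> + (1 / \<eta> - x)\<^sup>\<alpha>\<close> by convexity and cancel against \<open>2 \<alpha> A\<close>; what is left is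
  \<open>2 b - (1 + x)\<^sup>\<alpha> - (1 - x)\<^sup>\<alpha>\<close>, to which the chord inequality applies.\<close>

lemma interval_potential_bound:
  fixes x A b e \<eta> \<alpha> :: real
  assumes a: "1 < \<alpha>" "\<alpha> < 2" and x: "\<bar>x\<bar> < 1" and eta: "0 < \<eta>" "\<eta> < 1"
    and A: "\<alpha> * A + b = \<eta> powr (- \<alpha>) * (1 - \<eta>\<^sup>2) powr ((\<alpha> + 1) / 2)"
    and b: "Beta ((1 + \<alpha>) / 2) ((2 - \<alpha>) / 2) - e \<le> 2 * b"
  shows "2 * (1 - x\<^sup>2) powr (- \<alpha>) * A
      + (kappa 1 \<alpha> * (2 / (1 - x\<^sup>2)) powr \<alpha> + (2 powr \<alpha> - 2) / \<alpha> * (1 - x\<^sup>2) powr (1 - \<alpha>))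
    \<le> (1 - x\<^sup>2) powr (- \<alpha>) / \<alpha> *
       ((1 / \<eta> + x) powr \<alpha> + (1 / \<eta> - x) powr \<alpha> - (1 + x) powr \<alpha> - (1 - x) powr \<alpha>)
      + e / \<alpha> * (1 - x\<^sup>2) powr (- \<alpha>)"
proof -
  define B where "B = Beta ((1 + \<alpha>) / 2) ((2 - \<alpha>) / 2)"
  define q where "q = (1 - x\<^sup>2) powr (- \<alpha>)"
  have x2: "0 < 1 - x\<^sup>2" using x by (simp add: abs_square_less_1)
  have q: "0 < q" using x2 by (simp add: q_def)
  have 1: "kappa 1 \<alpha> * (2 / (1 - x\<^sup>2)) powr \<alpha> = q / \<alpha> * (B - 2 powr \<alpha>)"
    using a x2 unfolding kappa_1[OF a(1)] by (simp add: B_def q_def powr_divide powr_minus field_simps)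
  have 2: "(1 - x\<^sup>2) powr (1 - \<alpha>) = q * (1 - x\<^sup>2)"
    using x2 powr_add[of "1 - x\<^sup>2" "- \<alpha>" 1] by (simp add: q_def)
  have ex: "\<bar>\<eta> * x\<bar> \<le> 1" using abs_mult_less_one[of \<eta> x] x eta by auto
  have 3: "2 * \<eta> powr (- \<alpha>) \<le> (1 / \<eta> + x) powr \<alpha> + (1 / \<eta> - x) powr \<alpha>"
  proof -
    have "1 / \<eta> + x = (1 + \<eta> * x) / \<eta>" "1 / \<eta> - x = (1 - \<eta> * x) / \<eta>" using eta by (auto simp: field_simps)
    then have "(1 / \<eta> + x) powr \<alpha> + (1 / \<eta> - x) powr \<alpha>
        = \<eta> powr (- \<alpha>) * ((1 + \<eta> * x) powr \<alpha> + (1 - \<eta> * x) powr \<alpha>)"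
      using eta ex by (simp add: powr_divide powr_minus field_simps)
    moreover have "2 \<le> (1 + \<eta> * x) powr \<alpha> + (1 - \<eta> * x) powr \<alpha>"
      using a ex by (intro one_plus_powr_ge_two) auto
    ultimately show ?thesis 
      by (simp only: mult.commute[of 2] mult_left_mono powr_ge_zero)
  qed
  have 4: "(1 + x) powr \<alpha> + (1 - x) powr \<alpha> \<le> 2 + (2 powr \<alpha> - 2) * x\<^sup>2"
    using a x by (intro powr_chord) auto
  have 5: "2 * (\<alpha> * A) \<le> 2 * \<eta> powr (- \<alpha>) - 2 * b"
  proof -
    have "(1 - \<eta>\<^sup>2) powr ((\<alpha> + 1) / 2) \<le> 1"
      using eta a by (intro powr_le1) (auto simp: abs_square_le_1 power_le_one)
    then have "\<eta> powr (- \<alpha>) * (1 - \<eta>\<^sup>2) powr ((\<alpha> + 1) / 2) \<le> \<eta> powr (- \<alpha>) * 1"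
      by (intro mult_left_mono) auto
    then show ?thesis using A by simp
  qed
  have "2 * (\<alpha> * A) + (B - 2 powr \<alpha>) + (2 powr \<alpha> - 2) * (1 - x\<^sup>2)
      \<le> ((1 / \<eta> + x) powr \<alpha> + (1 / \<eta> - x) powr \<alpha> - (1 + x) powr \<alpha> - (1 - x) powr \<alpha>) + e"
    using 3 4 5 b unfolding B_def[symmetric] by (simp add: algebra_simps)
  then have "q / \<alpha> * (2 * (\<alpha> * A) + (B - 2 powr \<alpha>) + (2 powr \<alpha> - 2) * (1 - x\<^sup>2))
      \<le> q / \<alpha> * (((1 / \<eta> + x) powr \<alpha> + (1 / \<eta> - x) powr \<alpha> - (1 + x) powr \<alpha> - (1 - x) powr \<alpha>) + e)"
    using q a by (intro mult_left_mono) auto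
  moreover have "q / \<alpha> * (2 * (\<alpha> * A) + (B - 2 powr \<alpha>) + (2 powr \<alpha> - 2) * (1 - x\<^sup>2))
     = 2 * q * A + (q / \<alpha> * (B - 2 powr \<alpha>) + (2 powr \<alpha> - 2) / \<alpha> * (q * (1 - x\<^sup>2)))"
    using a by (simp add: distrib_left)
  ultimately show ?thesis unfolding 1 2 unfolding q_def[symmetric]
    by (simp only: distrib_left times_divide_eq_left mult.commute[of e q])
qed

lemma ennreal_subadditive: "0 \<le> b \<Longrightarrow> ennreal (a + b) \<le> ennreal a + ennreal b"
proof (cases "0 \<le> a")
  case False
  assume "0 \<le> b"
  have "ennreal (a + b) \<le> ennreal b" using False by (intro ennreal_leI) auto
  then show ?thesis by (simp add: add_increasing)
qed (simp add: ennreal_plus)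

text \<open>For each \<open>e\<close>, a small \<open>\<eta>\<close> makes the potential error at most \<open>e / \<alpha>\<close> times the weighted norm \<open>X\<close>. The
  hypothesis that \<open>X\<close> is finite has two uses: the large terms \<open>2 A X\<close> on both sides of the ground state
  identity can be cancelled, and the error vanishes with \<open>e\<close>.\<close>

lemma hardy_unit_interval:
  fixes u :: "real \<Rightarrow> real"
  assumes a: "1 < \<alpha>" "\<alpha> < 2" and u[measurable]: "u \<in> borel_measurable borel"
    and fin: "(\<integral>\<^sup>+s\<in>{-1<..<1}. ennreal ((u s)\<^sup>2 * (1 - s\<^sup>2) powr (- \<alpha>)) \<partial>lborel) < \<infinity>"
  shows "2 * (\<integral>\<^sup>+s\<in>{-1<..<1}. ennreal ((u s)\<^sup>2 * (kappa 1 \<alpha> * (2 / (1 - s\<^sup>2)) powr \<alpha>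
        + (2 powr \<alpha> - 2) / \<alpha> * (1 - s\<^sup>2) powr (1 - \<alpha>))) \<partial>lborel)
    \<le> (\<integral>\<^sup>+s\<in>{-1<..<1}. (\<integral>\<^sup>+t\<in>{-1<..<1}. ennreal ((u s - u t)\<^sup>2 / \<bar>s - t\<bar> powr (1 + \<alpha>)) \<partial>lborel) \<partial>lborel)"
    (is "2 * ?V \<le> ?E")
proof -
  let ?I = "{-1<..<1::real}"
  let ?w = "\<lambda>x. (1 - x\<^sup>2) powr ((\<alpha> - 1) / 2)"
  let ?V' = "\<lambda>s. kappa 1 \<alpha> * (2 / (1 - s\<^sup>2)) powr \<alpha> + (2 powr \<alpha> - 2) / \<alpha> * (1 - s\<^sup>2) powr (1 - \<alpha>)"
  let ?q = "\<lambda>s. (1 - s\<^sup>2) powr (- \<alpha>)"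
  define X where "X = (\<integral>\<^sup>+s\<in>?I. ennreal ((u s)\<^sup>2 * ?q s) \<partial>lborel)"
  have key: "2 * ?V \<le> ?E + ennreal (2 * (e / \<alpha>)) * X" if e: "0 < e" for e
  proof -
    obtain \<eta> where eta: "0 < \<eta>" "\<eta> < 1"
      and B: "ennreal (Beta ((1 + \<alpha>) / 2) ((2 - \<alpha>) / 2) - e) \<le> 2 * trunc_B \<alpha> \<eta>"
      using trunc_B_approx[OF a e] by (metis order_refl)
    let ?K = "interval_kernel \<alpha> \<eta>"
    let ?a = "\<lambda>s. \<integral>\<^sup>+t. ennreal (?w t / ?w s * ?K s t) \<partial>lborel"
    let ?c = "\<lambda>s. \<integral>\<^sup>+t. ennreal (?K s t) \<partial>lborel"
    note AB = trunc_A_trunc_B[OF a(1) eta]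
    have "trunc_B \<alpha> \<eta> < top" using AB by (metis ennreal_less_top ennreal_add_less_top)
    then obtain b where b: "trunc_B \<alpha> \<eta> = ennreal b" "0 \<le> b" by (cases "trunc_B \<alpha> \<eta>") auto
    have "ennreal \<alpha> * trunc_A \<alpha> \<eta> < top" using AB by (metis ennreal_less_top ennreal_add_less_top)
    then have "trunc_A \<alpha> \<eta> < top" using a by (auto simp: ennreal_mult_less_top)
    then obtain A where A: "trunc_A \<alpha> \<eta> = ennreal A" "0 \<le> A" by (cases "trunc_A \<alpha> \<eta>") auto
    have AB': "\<alpha> * A + b = \<eta> powr (- \<alpha>) * (1 - \<eta>\<^sup>2) powr ((\<alpha> + 1) / 2)"
      using AB A b a by (simp flip: ennreal_mult ennreal_plus)
    have b': "Beta ((1 + \<alpha>) / 2) ((2 - \<alpha>) / 2) - e \<le> 2 * b"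
      using B b by (simp flip: ennreal_numeral ennreal_mult)
    have outside: "?K s t = 0" if "s \<notin> ?I" for s t
      using that by (auto simp: interval_kernel_def)
    have av: "?a s = ennreal (2 * ?q s * A) * indicator ?I s" for s
    proof (cases "s \<in> ?I")
      case True
      then have "\<bar>s\<bar> < 1" by auto
      from interval_kernel_weight_integral[OF this eta a(1)] True A(2) show ?thesis
        unfolding A(1) by (simp add: ennreal_mult')
    next
      case False
      then show ?thesis using outside[OF False] by simp
    qed
    have pw: "ennreal ((u s)\<^sup>2) * ?a s + ennreal ((u s)\<^sup>2 * ?V' s) * indicator ?I s
        \<le> ennreal ((u s)\<^sup>2) * ?c s + ennreal (e / \<alpha>) * (ennreal ((u s)\<^sup>2 * ?q s) * indicator ?I s)" for s
    proof (cases "s \<in> ?I")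
      case True
      then have s: "\<bar>s\<bar> < 1" by auto
      have V': "0 \<le> ?V' s" using kappa_1_nonneg[OF a] two_powr_ge_two[OF a(1)] a by auto
      have cv: "?c s = ennreal ((1 - s\<^sup>2) powr (- \<alpha>) / \<alpha> *
         ((1 / \<eta> + s) powr \<alpha> + (1 / \<eta> - s) powr \<alpha> - (1 + s) powr \<alpha> - (1 - s) powr \<alpha>))" (is "_ = ennreal ?cr")
        by (rule interval_kernel_integral[OF s eta a(1)])
      have "ennreal (2 * ?q s * A) + ennreal (?V' s) = ennreal (2 * ?q s * A + ?V' s)"
        using A(2) V' by (simp add: ennreal_plus)
      also have "\<dots> \<le> ennreal (?cr + e / \<alpha> * ?q s)"
        by (rule ennreal_leI, rule interval_potential_bound[OF a s eta AB' b'])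
      also have "\<dots> \<le> ennreal ?cr + ennreal (e / \<alpha> * ?q s)" using e a by (intro ennreal_subadditive) auto
      finally have "ennreal ((u s)\<^sup>2) * (ennreal (2 * ?q s * A) + ennreal (?V' s))
        \<le> ennreal ((u s)\<^sup>2) * (ennreal ?cr + ennreal (e / \<alpha> * ?q s))" by (rule mult_left_mono) simp
      moreover have "ennreal ((u s)\<^sup>2 * ?V' s) = ennreal ((u s)\<^sup>2) * ennreal (?V' s)"
        by (rule ennreal_mult') simp
      moreover have "ennreal (e / \<alpha>) * ennreal ((u s)\<^sup>2 * ?q s) = ennreal ((u s)\<^sup>2) * ennreal (e / \<alpha> * ?q s)"
        using e a by (simp add: ennreal_mult' mult.left_commute flip: times_divide_eq_left)
      ultimately show ?thesis
        unfolding av cv indicator_simps(1)[OF True] mult_1_right by (simp only: distrib_left)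
    next
      case False
      then show ?thesis unfolding av by simp
    qed
    have m: "?a \<in> borel_measurable borel" "?c \<in> borel_measurable borel"
      by measurable
    have Xa: "(\<integral>\<^sup>+s. ennreal ((u s)\<^sup>2) * ?a s \<partial>lborel) = ennreal (2 * A) * X"
    proof -
      have "ennreal ((u s)\<^sup>2) * ?a s = ennreal (2 * A) * (ennreal ((u s)\<^sup>2 * ?q s) * indicator ?I s)" for s
      proof -
        have "ennreal ((u s)\<^sup>2) * ennreal (2 * ?q s * A) = ennreal (2 * A) * ennreal ((u s)\<^sup>2 * ?q s)"
          using A(2) by (simp only: ennreal_mult'[symmetric] zero_le_power2 mult_nonneg_nonneg zero_le_numeral)
            (simp add: ac_simps)
        then show ?thesis unfolding av by (simp only: mult.assoc[symmetric])
      qed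
      then show ?thesis unfolding X_def by (simp add: nn_integral_cmult)
    qed
    have "ennreal (2 * A) * X + ?V = (\<integral>\<^sup>+s. ennreal ((u s)\<^sup>2) * ?a s + ennreal ((u s)\<^sup>2 * ?V' s) * indicator ?I s \<partial>lborel)"
      unfolding Xa[symmetric] using m by (intro nn_integral_add[symmetric]) measurable
    also have "\<dots> \<le> (\<integral>\<^sup>+s. ennreal ((u s)\<^sup>2) * ?c s + ennreal (e / \<alpha>) * (ennreal ((u s)\<^sup>2 * ?q s) * indicator ?I s) \<partial>lborel)"
      by (intro nn_integral_mono pw)
    also have "\<dots> = (\<integral>\<^sup>+s. ennreal ((u s)\<^sup>2) * ?c s \<partial>lborel) + ennreal (e / \<alpha>) * X"
      using m unfolding X_def by (subst nn_integral_add) (auto simp: nn_integral_cmult)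
    finally have 1: "ennreal (2 * A) * X + ?V \<le> (\<integral>\<^sup>+s. ennreal ((u s)\<^sup>2) * ?c s \<partial>lborel) + ennreal (e / \<alpha>) * X" .
    have "2 * (\<integral>\<^sup>+s. ennreal ((u s)\<^sup>2) * ?c s \<partial>lborel)
       \<le> (\<integral>\<^sup>+s. \<integral>\<^sup>+t. ennreal ((u s - u t)\<^sup>2 * ?K s t) \<partial>lborel \<partial>lborel)
        + 2 * (\<integral>\<^sup>+s. ennreal ((u s)\<^sup>2) * ?a s \<partial>lborel)"
    proof (subst ground_state_identity)
      show "0 \<le> ?K s t" "?K s t = ?K t s" for s t
        by (auto simp: interval_kernel_def abs_minus_commute mult.commute)
      show "0 < ?w s" if "?K s t \<noteq> 0" for s t
        using that by (auto simp: interval_kernel_def abs_square_less_1 abs_square_eq_1 split: if_splits)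
    qed auto
    also have "(\<integral>\<^sup>+s. \<integral>\<^sup>+t. ennreal ((u s - u t)\<^sup>2 * ?K s t) \<partial>lborel \<partial>lborel) \<le> ?E"
    proof -
      have "(\<integral>\<^sup>+t. ennreal ((u s - u t)\<^sup>2 * ?K s t) \<partial>lborel)
        \<le> (\<integral>\<^sup>+t\<in>?I. ennreal ((u s - u t)\<^sup>2 / \<bar>s - t\<bar> powr (1 + \<alpha>)) \<partial>lborel) * indicator ?I s" for s
      proof (cases "s \<in> ?I")
        case True
        then show ?thesis
          by (auto intro!: nn_integral_mono simp: interval_kernel_def split: split_indicator)
      next
        case False
        then show ?thesis using outside[OF False] by simp
      qed
      then show ?thesis by (intro nn_integral_mono)
    qed
    also note Xa
    finally have 2: "2 * (\<integral>\<^sup>+s. ennreal ((u s)\<^sup>2) * ?c s \<partial>lborel) \<le> ?E + 2 * (ennreal (2 * A) * X)"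
      by (simp add: add_right_mono)
    have "2 * (ennreal (2 * A) * X) + 2 * ?V \<le> 2 * ((\<integral>\<^sup>+s. ennreal ((u s)\<^sup>2) * ?c s \<partial>lborel) + ennreal (e / \<alpha>) * X)"
      using mult_left_mono[OF 1, of 2] by (simp add: distrib_left)
    also have "\<dots> = 2 * (\<integral>\<^sup>+s. ennreal ((u s)\<^sup>2) * ?c s \<partial>lborel) + ennreal (2 * (e / \<alpha>)) * X"
    proof -
      have "ennreal (2 * (e / \<alpha>)) = 2 * ennreal (e / \<alpha>)"
        by (simp only: ennreal_mult'[OF zero_le_numeral] ennreal_numeral)
      then show ?thesis by (simp only: distrib_left mult.assoc)
    qed
    also have "\<dots> \<le> ?E + 2 * (ennreal (2 * A) * X) + ennreal (2 * (e / \<alpha>)) * X"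
      by (intro add_right_mono 2)
    finally have "2 * (ennreal (2 * A) * X) + 2 * ?V \<le> 2 * (ennreal (2 * A) * X) + (?E + ennreal (2 * (e / \<alpha>)) * X)"
      by (simp add: ac_simps)
    moreover have "2 * (ennreal (2 * A) * X) < top"
      using fin by (simp add: X_def ennreal_mult_less_top)
    ultimately show ?thesis
      by (auto simp only: ennreal_add_left_cancel_le infinity_ennreal_def)
  qed
  obtain x where x: "X = ennreal x" "0 \<le> x" using fin unfolding X_def[symmetric] by (cases X) auto
  show ?thesis
  proof (rule ennreal_le_epsilon)
    fix d :: real assume d: "0 < d"
    define e where "e = d / (x + 1) * (\<alpha> / 2)"
    have e: "0 < e" using d a x by (simp add: e_def)
    have "2 * (y * (\<alpha> / 2) / \<alpha>) = y" for y using a by simp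
    from this[of "d / (x + 1)"] have "2 * (e / \<alpha>) = d / (x + 1)" unfolding e_def .
    then have "2 * (e / \<alpha>) * x = d * (x / (x + 1))" by (simp only:) simp
    also have "\<dots> \<le> d * 1" using d x by (intro mult_left_mono) auto
    finally have "ennreal (2 * (e / \<alpha>)) * X \<le> ennreal d"
      using x e a by (simp add: ennreal_leI flip: ennreal_mult)
    then show "2 * ?V \<le> ?E + ennreal d"
      using key[OF e] by (meson add_left_mono order_trans)
  qed
qed

section \<open>Intervals and bounded open sets of the line\<close>

lemma powr_pos_divide: "0 < a \<Longrightarrow> 0 < A \<Longrightarrow> (a / A) powr b = A powr (- b) * a powr b"
  for a A b :: real
  by (simp add: powr_divide powr_minus field_simps)

text \<open>An affine change of variables from the unit interval. A distance \<open>\<delta>\<close> between the support of the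
  bounded function \<open>u\<close> and the end points makes the weighted norm finite.\<close>

lemma hardy_interval:
  fixes u :: "real \<Rightarrow> real"
  assumes a: "1 < \<alpha>" "\<alpha> < 2" and lr: "l < r" and u[measurable]: "u \<in> borel_measurable borel"
    and M: "\<And>s. \<bar>u s\<bar> \<le> M" and d: "0 < \<delta>"
    and supp: "\<And>s. s \<in> {l<..<r} \<Longrightarrow> u s \<noteq> 0 \<Longrightarrow> l + \<delta> \<le> s \<and> s \<le> r - \<delta>"
  shows "2 * (\<integral>\<^sup>+s\<in>{l<..<r}. ennreal ((u s)\<^sup>2 * (kappa 1 \<alpha> * (1 / (s - l) + 1 / (r - s)) powr \<alpha>
        + remainder_const 1 \<alpha> / (r - l) * (1 / (s - l) + 1 / (r - s)) powr (\<alpha> - 1))) \<partial>lborel)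
    \<le> (\<integral>\<^sup>+s\<in>{l<..<r}. (\<integral>\<^sup>+t\<in>{l<..<r}. ennreal ((u s - u t)\<^sup>2 / \<bar>s - t\<bar> powr (1 + \<alpha>)) \<partial>lborel) \<partial>lborel)"
proof -
  define h where "h = (r - l) / 2"
  define m where "m = (l + r) / 2"
  define v where "v y = u (m + h * y)" for y
  have h: "0 < h" using lr by (simp add: h_def)
  have [measurable]: "v \<in> borel_measurable borel" unfolding v_def by measurable
  let ?I = "{-1<..<1::real}"
  have ends: "m + h * y - l = h * (1 + y)" "r - (m + h * y) = h * (1 - y)" for y
    by (auto simp: m_def h_def field_simps)
  have iff: "m + h * y \<in> {l<..<r} \<longleftrightarrow> y \<in> ?I" for y
  proof -
    have "m + h * y \<in> {l<..<r} \<longleftrightarrow> 0 < m + h * y - l \<and> 0 < r - (m + h * y)" by auto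
    also have "\<dots> \<longleftrightarrow> y \<in> ?I" unfolding ends using h by (auto simp: zero_less_mult_iff)
    finally show ?thesis .
  qed
  let ?P = "\<lambda>s. kappa 1 \<alpha> * (1 / (s - l) + 1 / (r - s)) powr \<alpha>
        + remainder_const 1 \<alpha> / (r - l) * (1 / (s - l) + 1 / (r - s)) powr (\<alpha> - 1)"
  let ?Q = "\<lambda>s. kappa 1 \<alpha> * (2 / (1 - s\<^sup>2)) powr \<alpha> + (2 powr \<alpha> - 2) / \<alpha> * (1 - s\<^sup>2) powr (1 - \<alpha>)"
  have PQ: "?P (m + h * y) = h powr (- \<alpha>) * ?Q y" if y: "y \<in> ?I" for y
  proof -
    have y2: "0 < 1 - y\<^sup>2" using y by (simp add: abs_square_less_1 abs_less_iff)
    have e: "1 - y\<^sup>2 = (1 + y) * (1 - y)" by (simp add: power2_eq_square algebra_simps)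
    have s: "1 / (h * (1 + y)) + 1 / (h * (1 - y)) = (2 / (1 - y\<^sup>2)) / h"
    proof -
      have "1 / (h * p) + 1 / (h * q) = (p + q) / (p * q) / h" if "0 < p" "0 < q" for p q
        using that h by (simp add: field_simps)
      from this[of "1 + y" "1 - y"] show ?thesis unfolding e using y by simp
    qed
    have 1: "((2 / (1 - y\<^sup>2)) / h) powr \<alpha> = h powr (- \<alpha>) * (2 / (1 - y\<^sup>2)) powr \<alpha>"
      by (rule powr_pos_divide) (use h y2 in auto)
    have "((2 / (1 - y\<^sup>2)) / h) powr (\<alpha> - 1) = 2 powr (\<alpha> - 1) * (1 - y\<^sup>2) powr (1 - \<alpha>) * h powr (1 - \<alpha>)"
    proof -
      have "((2 / (1 - y\<^sup>2)) / h) powr (\<alpha> - 1) = h powr (- (\<alpha> - 1)) * (2 / (1 - y\<^sup>2)) powr (\<alpha> - 1)"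
        by (rule powr_pos_divide) (use h y2 in auto)
      also have "(2 / (1 - y\<^sup>2)) powr (\<alpha> - 1) = (1 - y\<^sup>2) powr (- (\<alpha> - 1)) * 2 powr (\<alpha> - 1)"
        by (rule powr_pos_divide) (use y2 in auto)
      finally show ?thesis by (simp add: mult_ac)
    qed
    also have "h powr (1 - \<alpha>) = h * h powr (- \<alpha>)" using h powr_add[of h 1 "- \<alpha>"] by simp
    finally have 2: "remainder_const 1 \<alpha> / (r - l) * ((2 / (1 - y\<^sup>2)) / h) powr (\<alpha> - 1)
      = remainder_const 1 \<alpha> / (r - l) * h * 2 powr (\<alpha> - 1) * (h powr (- \<alpha>) * (1 - y\<^sup>2) powr (1 - \<alpha>))"
      by simp
    have "r - l = 2 * h" by (simp add: h_def)
    then have "remainder_const 1 \<alpha> / (r - l) * h * 2 powr (\<alpha> - 1) = (4 - 2 powr (3 - \<alpha>)) / \<alpha> * (2 powr (\<alpha> - 1) / 2)"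
      unfolding remainder_const_1[OF a(1)] using h by simp
    also have "\<dots> = (2 powr \<alpha> - 2) / \<alpha>"
    proof -
      have "2 powr (3 - \<alpha>) * 2 powr (\<alpha> - 1) = (2 powr 2 :: real)" by (simp only: powr_add[symmetric]) simp
      then have X: "(4 - 2 powr (3 - \<alpha>)) * (2 powr (\<alpha> - 1)) = 2 * (2 powr \<alpha> - 2)"
        by (simp add: left_diff_distrib) (simp add: powr_diff)
      have "(4 - 2 powr (3 - \<alpha>)) / \<alpha> * (2 powr (\<alpha> - 1) / 2) = 2 * (2 powr \<alpha> - 2) / (\<alpha> * 2)"
        unfolding times_divide_times_eq X ..
      also have "\<dots> = (2 powr \<alpha> - 2) / \<alpha>"
        unfolding mult.commute[of \<alpha> 2] by (rule mult_divide_mult_cancel_left) simp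
      finally show ?thesis .
    qed
    finally have 3: "remainder_const 1 \<alpha> / (r - l) * h * 2 powr (\<alpha> - 1) = (2 powr \<alpha> - 2) / \<alpha>" .
    show ?thesis unfolding ends s 2 unfolding 1 3 by (simp only: distrib_left mult_ac)
  qed
  have fin: "(\<integral>\<^sup>+s\<in>?I. ennreal ((v s)\<^sup>2 * (1 - s\<^sup>2) powr (- \<alpha>)) \<partial>lborel) < \<infinity>"
  proof -
    have "(v s)\<^sup>2 * (1 - s\<^sup>2) powr (- \<alpha>) \<le> M\<^sup>2 * (\<delta> / h) powr (- \<alpha>)" if s: "s \<in> ?I" for s
    proof (cases "v s = 0")
      case False
      have "l + \<delta> \<le> m + h * s \<and> m + h * s \<le> r - \<delta>"
        using supp[of "m + h * s"] False s iff by (auto simp: v_def)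
      then have "\<delta> \<le> h * (1 + s)" "\<delta> \<le> h * (1 - s)" unfolding ends[symmetric] by auto
      then have 1: "\<delta> / h \<le> 1 + s" "\<delta> / h \<le> 1 - s" using h by (auto simp: field_simps)
      have "s\<^sup>2 \<le> \<bar>s\<bar>" using s power_le_one_iff[of "\<bar>s\<bar>" 1] mult_left_le[of "\<bar>s\<bar>" "\<bar>s\<bar>"]
        by (auto simp: power2_eq_square)
      then have "\<delta> / h \<le> 1 - s\<^sup>2" using 1 by (auto simp: abs_if split: if_splits)
      then have "(1 - s\<^sup>2) powr (- \<alpha>) \<le> (\<delta> / h) powr (- \<alpha>)"
        using d h a by (intro powr_mono2') auto
      moreover have "(v s)\<^sup>2 \<le> M\<^sup>2" using power_mono[OF M[of "m + h * s"] abs_ge_zero, of 2] by (simp add: v_def)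
      ultimately show ?thesis by (intro mult_mono) auto
    qed simp
    then have "(\<integral>\<^sup>+s\<in>?I. ennreal ((v s)\<^sup>2 * (1 - s\<^sup>2) powr (- \<alpha>)) \<partial>lborel)
      \<le> (\<integral>\<^sup>+s. ennreal (M\<^sup>2 * (\<delta> / h) powr (- \<alpha>)) * indicator ?I s \<partial>lborel)"
      by (intro nn_integral_mono) (auto split: split_indicator intro: ennreal_leI)
    also have "\<dots> < \<infinity>" by (simp add: nn_integral_cmult_indicator ennreal_mult_less_top)
    finally show ?thesis .
  qed
  let ?V = "\<integral>\<^sup>+s\<in>?I. ennreal ((v s)\<^sup>2 * ?Q s) \<partial>lborel"
  let ?E = "\<integral>\<^sup>+s\<in>?I. (\<integral>\<^sup>+t\<in>?I. ennreal ((v s - v t)\<^sup>2 / \<bar>s - t\<bar> powr (1 + \<alpha>)) \<partial>lborel) \<partial>lborel"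
  have ind: "indicator {l<..<r} (m + h * y) = (indicator ?I y :: ennreal)" for y
    using iff[of y] by (simp add: indicator_def)
  have L: "(\<integral>\<^sup>+s\<in>{l<..<r}. ennreal ((u s)\<^sup>2 * ?P s) \<partial>lborel) = ennreal (h * h powr (- \<alpha>)) * ?V"
  proof -
    have "(\<integral>\<^sup>+s\<in>{l<..<r}. ennreal ((u s)\<^sup>2 * ?P s) \<partial>lborel)
      = ennreal \<bar>h\<bar> * (\<integral>\<^sup>+y. ennreal ((u (m + h * y))\<^sup>2 * ?P (m + h * y)) * indicator {l<..<r} (m + h * y) \<partial>lborel)"
      by (rule nn_integral_real_affine) (use h in auto)
    also have "(\<lambda>y. ennreal ((u (m + h * y))\<^sup>2 * ?P (m + h * y)) * indicator {l<..<r} (m + h * y))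
      = (\<lambda>y. ennreal (h powr (- \<alpha>)) * (ennreal ((v y)\<^sup>2 * ?Q y) * indicator ?I y))"
    proof
      fix y
      show "ennreal ((u (m + h * y))\<^sup>2 * ?P (m + h * y)) * indicator {l<..<r} (m + h * y)
        = ennreal (h powr (- \<alpha>)) * (ennreal ((v y)\<^sup>2 * ?Q y) * indicator ?I y)"
      proof (cases "y \<in> ?I")
        case True
        have "(u (m + h * y))\<^sup>2 * ?P (m + h * y) = h powr (- \<alpha>) * ((v y)\<^sup>2 * ?Q y)"
          unfolding PQ[OF True] v_def by (simp only: mult_ac)
        then show ?thesis unfolding ind indicator_simps(1)[OF True]
          by (simp only: mult_1_right ennreal_mult'[OF powr_ge_zero])
      next
        case False
        then show ?thesis unfolding ind by simp
      qed
    qed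
    also have "(\<integral>\<^sup>+y. ennreal (h powr (- \<alpha>)) * (ennreal ((v y)\<^sup>2 * ?Q y) * indicator ?I y) \<partial>lborel)
      = ennreal (h powr (- \<alpha>)) * ?V"
      by (rule nn_integral_cmult) measurable
    finally show ?thesis using h by (simp add: ennreal_mult' mult.assoc)
  qed
  have R: "(\<integral>\<^sup>+s\<in>{l<..<r}. (\<integral>\<^sup>+t\<in>{l<..<r}. ennreal ((u s - u t)\<^sup>2 / \<bar>s - t\<bar> powr (1 + \<alpha>)) \<partial>lborel) \<partial>lborel)
    = ennreal (h * h powr (- \<alpha>)) * ?E"
  proof -
    let ?G = "\<lambda>s t. ennreal ((u s - u t)\<^sup>2 / \<bar>s - t\<bar> powr (1 + \<alpha>))"
    let ?H = "\<lambda>s t. ennreal ((v s - v t)\<^sup>2 / \<bar>s - t\<bar> powr (1 + \<alpha>))"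
    have inner: "(\<integral>\<^sup>+t\<in>{l<..<r}. ?G (m + h * y) t \<partial>lborel) = ennreal (h powr (- \<alpha>)) * (\<integral>\<^sup>+t\<in>?I. ?H y t \<partial>lborel)" for y
    proof -
      have "(\<integral>\<^sup>+t\<in>{l<..<r}. ?G (m + h * y) t \<partial>lborel)
        = ennreal \<bar>h\<bar> * (\<integral>\<^sup>+z. ?G (m + h * y) (m + h * z) * indicator {l<..<r} (m + h * z) \<partial>lborel)"
        by (rule nn_integral_real_affine) (use h in auto)
      also have "(\<lambda>z. ?G (m + h * y) (m + h * z) * indicator {l<..<r} (m + h * z))
        = (\<lambda>z. ennreal (h powr (- \<alpha> - 1)) * (?H y z * indicator ?I z))"
      proof
        fix z
        have "m + h * y - (m + h * z) = h * (y - z)" by (simp add: right_diff_distrib)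
        then have "\<bar>m + h * y - (m + h * z)\<bar> = h * \<bar>y - z\<bar>" using h by (simp add: abs_mult)
        then have "(u (m + h * y) - u (m + h * z))\<^sup>2 / \<bar>m + h * y - (m + h * z)\<bar> powr (1 + \<alpha>)
          = h powr (- \<alpha> - 1) * ((v y - v z)\<^sup>2 / \<bar>y - z\<bar> powr (1 + \<alpha>))"
          using h by (simp add: v_def powr_mult powr_neg_minus_one)
        then have "?G (m + h * y) (m + h * z) = ennreal (h powr (- \<alpha> - 1)) * ?H y z"
          by (simp only: ennreal_mult'[OF powr_ge_zero])
        then show "?G (m + h * y) (m + h * z) * indicator {l<..<r} (m + h * z)
          = ennreal (h powr (- \<alpha> - 1)) * (?H y z * indicator ?I z)"
          unfolding ind by (simp only: mult.assoc)
      qed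
      also have "(\<integral>\<^sup>+z. ennreal (h powr (- \<alpha> - 1)) * (?H y z * indicator ?I z) \<partial>lborel)
        = ennreal (h powr (- \<alpha> - 1)) * (\<integral>\<^sup>+z\<in>?I. ?H y z \<partial>lborel)"
        by (rule nn_integral_cmult) measurable
      also have "ennreal \<bar>h\<bar> * (ennreal (h powr (- \<alpha> - 1)) * (\<integral>\<^sup>+z\<in>?I. ?H y z \<partial>lborel))
        = ennreal (h powr (- \<alpha>)) * (\<integral>\<^sup>+z\<in>?I. ?H y z \<partial>lborel)"
      proof -
        have "\<bar>h\<bar> * h powr (- \<alpha> - 1) = h powr (- \<alpha>)" using h powr_add[of h 1 "- \<alpha> - 1"] by simp
        then have "ennreal \<bar>h\<bar> * ennreal (h powr (- \<alpha> - 1)) = ennreal (h powr (- \<alpha>))"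
          by (simp only: ennreal_mult'[OF abs_ge_zero, symmetric])
        then show ?thesis by (simp only: mult.assoc[symmetric])
      qed
      finally show ?thesis .
    qed
    have "(\<integral>\<^sup>+s\<in>{l<..<r}. (\<integral>\<^sup>+t\<in>{l<..<r}. ?G s t \<partial>lborel) \<partial>lborel)
      = ennreal \<bar>h\<bar> * (\<integral>\<^sup>+y. (\<integral>\<^sup>+t\<in>{l<..<r}. ?G (m + h * y) t \<partial>lborel) * indicator {l<..<r} (m + h * y) \<partial>lborel)"
      by (rule nn_integral_real_affine) (use h in auto)
    also have "\<dots> = ennreal h * (\<integral>\<^sup>+y. ennreal (h powr (- \<alpha>)) * ((\<integral>\<^sup>+t\<in>?I. ?H y t \<partial>lborel) * indicator ?I y) \<partial>lborel)"
      unfolding inner ind using h by (simp only: mult.assoc abs_of_pos)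
    also have "(\<integral>\<^sup>+y. ennreal (h powr (- \<alpha>)) * ((\<integral>\<^sup>+t\<in>?I. ?H y t \<partial>lborel) * indicator ?I y) \<partial>lborel) = ennreal (h powr (- \<alpha>)) * ?E"
      by (rule nn_integral_cmult) measurable
    finally show ?thesis using h by (simp only: ennreal_mult'[OF less_imp_le[OF h]] mult.assoc)
  qed
  have "2 * (ennreal (h * h powr (- \<alpha>)) * ?V) = ennreal (h * h powr (- \<alpha>)) * (2 * ?V)" by (simp only: mult_ac)
  also have "\<dots> \<le> ennreal (h * h powr (- \<alpha>)) * ?E"
    by (intro mult_left_mono hardy_unit_interval[OF a _ fin]) auto
  finally show ?thesis unfolding L R .
qed

lemma open_component_interval:
  fixes J :: "real set"
  assumes J: "open J" "bounded J" and C: "C \<in> components J"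
  obtains l r where "l < r" "C = {l<..<r}" "l \<notin> J" "r \<notin> J"
proof -
  have ne: "C \<noteq> {}" and sub: "C \<subseteq> J" and con: "connected C" and op: "open C"
    using in_components_nonempty[OF C] in_components_subset[OF C] in_components_connected[OF C]
      open_components[OF J(1) C] by simp_all
  have bd: "bdd_above C" "bdd_below C"
    using bounded_subset[OF J(2) sub] by (auto dest: bounded_imp_bdd_above bounded_imp_bdd_below)
  define l where "l = Inf C"
  define r where "r = Sup C"
  have lr: "l \<le> s" "s \<le> r" if "s \<in> C" for s
    using that bd by (auto simp: l_def r_def cInf_lower cSup_upper)
  have lC: "l \<notin> C"
  proof
    assume "l \<in> C"
    then obtain e where "0 < e" "ball l e \<subseteq> C" using op open_contains_ball by blast
    then have "l - e / 2 \<in> C" by (auto simp: dist_real_def subset_iff)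
    then show False using lr(1)[of "l - e / 2"] \<open>0 < e\<close> by simp
  qed
  have rC: "r \<notin> C"
  proof
    assume "r \<in> C"
    then obtain e where "0 < e" "ball r e \<subseteq> C" using op open_contains_ball by blast
    then have "r + e / 2 \<in> C" by (auto simp: dist_real_def subset_iff)
    then show False using lr(2)[of "r + e / 2"] \<open>0 < e\<close> by simp
  qed
  have eq: "C = {l<..<r}"
  proof (intro equalityI subsetI)
    fix s assume "s \<in> C"
    then show "s \<in> {l<..<r}" using lr[of s] lC rC by (auto simp: less_le)
  next
    fix s assume s: "s \<in> {l<..<r}"
    obtain c where c: "c \<in> C" "c < s" using s cInf_lessD[OF ne, of s] by (auto simp: l_def)
    obtain d where d: "d \<in> C" "s < d" using s less_cSupD[OF ne, of s] by (auto simp: r_def)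
    show "s \<in> C" using connected_contains_Icc[OF con c(1) d(1)] c d by auto
  qed
  have lt: "l < r" using ne unfolding eq by auto
  have "l \<notin> J"
  proof
    assume "l \<in> J"
    then have "{l..<r} \<subseteq> J" using sub unfolding eq by (force simp: less_le)
    moreover have "connected {l..<r}" by (simp add: convex_connected)
    moreover have "C \<inter> {l..<r} \<noteq> {}" using dense[OF lt] unfolding eq by force
    ultimately have "{l..<r} \<subseteq> C" using components_maximal[OF C] by blast
    then show False using lC lt by auto
  qed
  moreover have "r \<notin> J"
  proof
    assume "r \<in> J"
    then have "{l<..r} \<subseteq> J" using sub unfolding eq by (force simp: less_le)
    moreover have "connected {l<..r}" by (simp add: convex_connected)
    moreover have "C \<inter> {l<..r} \<noteq> {}" using dense[OF lt] unfolding eq by force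
    ultimately have "{l<..r} \<subseteq> C" using components_maximal[OF C] by blast
    then show False using rC lt by auto
  qed
  ultimately show ?thesis using that lt eq by blast
qed

lemma countable_open_components:
  fixes J :: "real set"
  assumes "open J"
  shows "countable (components J)"
  by (intro countable_disjoint_open_subsets)
     (auto simp: pairwise_def disjnt_def disjoint_def components_nonoverlap intro: open_components assms)

text \<open>Summation over components is written as integration over counting measure, so that it can be
  exchanged with the Lebesgue integral.\<close>

lemma sum_indicator_components:
  fixes f :: ennreal and s :: "'a::topological_space"
  shows "(\<integral>\<^sup>+C. f * indicator C s \<partial>count_space (components J)) = f * indicator J s"
proof (cases "s \<in> J")
  case True
  then obtain C where C: "C \<in> components J" "s \<in> C" using Union_components[of J] by blast
  have "(\<integral>\<^sup>+D. f * indicator D s \<partial>count_space (components J))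
    = (\<integral>\<^sup>+D. f * indicator {C} D \<partial>count_space (components J))"
  proof (intro nn_integral_cong)
    fix D assume "D \<in> space (count_space (components J))"
    then have "s \<in> D \<longleftrightarrow> D = C" using components_nonoverlap[of D J C] C by auto
    then show "f * indicator D s = f * indicator {C} D" by (simp add: indicator_def)
  qed
  also have "\<dots> = f" using C by (simp add: nn_integral_cmult_indicator)
  finally show ?thesis using True by simp
next
  case False
  then have "s \<notin> C" if "C \<in> components J" for C using in_components_subset[OF that] by auto
  then have "(\<integral>\<^sup>+C. f * indicator C s \<partial>count_space (components J)) = (\<integral>\<^sup>+C. 0 \<partial>count_space (components J))"
    by (intro nn_integral_cong) simp
  then show ?thesis using False by simp
qed

text \<open>On each component the weight \<open>m\<close> may be replaced by its upper bound and \<open>D\<close> by the length of the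
  component. The interactions between different components only increase the right side.\<close>

lemma hardy_open_set:
  fixes u m :: "real \<Rightarrow> real"
  assumes a: "1 < \<alpha>" "\<alpha> < 2" and J: "open J" "bounded J"
    and u[measurable]: "u \<in> borel_measurable borel" and m[measurable]: "m \<in> borel_measurable borel"
    and M: "\<And>s. \<bar>u s\<bar> \<le> M" and d: "0 < \<delta>"
    and supp: "\<And>s t. s \<in> J \<Longrightarrow> u s \<noteq> 0 \<Longrightarrow> t \<notin> J \<Longrightarrow> \<delta> \<le> \<bar>s - t\<bar>"
    and D: "0 < D" "\<And>s t. s \<in> J \<Longrightarrow> t \<in> J \<Longrightarrow> \<bar>s - t\<bar> \<le> D"
    and m_le: "\<And>l s r. l < s \<Longrightarrow> s < r \<Longrightarrow> {l<..<r} \<subseteq> J \<Longrightarrow> l \<notin> J \<Longrightarrow> r \<notin> J \<Longrightarrow>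
        0 \<le> m s \<and> m s \<le> 1 / (s - l) + 1 / (r - s)"
  shows "2 * (\<integral>\<^sup>+s\<in>J. ennreal ((u s)\<^sup>2 * (kappa 1 \<alpha> * m s powr \<alpha>
        + remainder_const 1 \<alpha> / D * m s powr (\<alpha> - 1))) \<partial>lborel)
    \<le> (\<integral>\<^sup>+s\<in>J. (\<integral>\<^sup>+t\<in>J. ennreal ((u s - u t)\<^sup>2 / \<bar>s - t\<bar> powr (1 + \<alpha>)) \<partial>lborel) \<partial>lborel)"
proof -
  let ?f = "\<lambda>s. ennreal ((u s)\<^sup>2 * (kappa 1 \<alpha> * m s powr \<alpha> + remainder_const 1 \<alpha> / D * m s powr (\<alpha> - 1)))"
  let ?G = "\<lambda>s t. ennreal ((u s - u t)\<^sup>2 / \<bar>s - t\<bar> powr (1 + \<alpha>))"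
  let ?S = "count_space (components J)"
  have [measurable]: "J \<in> sets borel" using J by simp
  have Cb: "C \<in> sets borel" if "C \<in> components J" for C
    using open_components[OF J(1) that] by simp
  have comp: "2 * (\<integral>\<^sup>+s. ?f s * indicator C s \<partial>lborel)
      \<le> (\<integral>\<^sup>+s. (\<integral>\<^sup>+t. ?G s t * indicator J t \<partial>lborel) * indicator C s \<partial>lborel)"
    if C: "C \<in> components J" for C
  proof -
    obtain l r where lr: "l < r" "C = {l<..<r}" "l \<notin> J" "r \<notin> J"
      using open_component_interval[OF J C] .
    have CJ: "{l<..<r} \<subseteq> J" using in_components_subset[OF C] lr by simp
    have rlD: "r - l \<le> D"
    proof (rule field_le_epsilon)
      fix e :: real assume e: "0 < e"
      define e' where "e' = min (e / 2) ((r - l) / 4)"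
      have m: "e' \<le> e / 2" "e' \<le> (r - l) / 4"
        unfolding e'_def by (rule min.cobounded1, rule min.cobounded2)
      have p: "0 < e'" using e lr(1) by (simp add: e'_def)
      have "2 * e' < 4 * e'" using p by simp
      also have "4 * e' \<le> r - l" using m(2) by (simp add: le_divide_eq mult.commute)
      finally have q: "2 * e' < r - l" .
      have e': "0 < e'" "2 * e' \<le> e" "2 * e' < r - l" using p q m(1) by auto
      then have "l + e' \<in> J" "r - e' \<in> J" using CJ lr by (auto simp: subset_iff)
      from D(2)[OF this] e' show "r - l \<le> D + e" by (auto simp: abs_if split: if_splits)
    qed
    have "(\<integral>\<^sup>+s\<in>{l<..<r}. ?f s \<partial>lborel) \<le> (\<integral>\<^sup>+s\<in>{l<..<r}. ennreal ((u s)\<^sup>2 * (kappa 1 \<alpha> * (1 / (s - l) + 1 / (r - s)) powr \<alpha>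
        + remainder_const 1 \<alpha> / (r - l) * (1 / (s - l) + 1 / (r - s)) powr (\<alpha> - 1))) \<partial>lborel)"
    proof (intro nn_integral_mono)
      fix s :: real
      show "?f s * indicator {l<..<r} s \<le> ennreal ((u s)\<^sup>2 * (kappa 1 \<alpha> * (1 / (s - l) + 1 / (r - s)) powr \<alpha>
        + remainder_const 1 \<alpha> / (r - l) * (1 / (s - l) + 1 / (r - s)) powr (\<alpha> - 1))) * indicator {l<..<r} s"
      proof (cases "s \<in> {l<..<r}")
        case True
        have m: "0 \<le> m s" "m s \<le> 1 / (s - l) + 1 / (r - s)"
          using m_le[of l s r] True CJ lr by auto
        have A1: "kappa 1 \<alpha> * m s powr \<alpha> \<le> kappa 1 \<alpha> * (1 / (s - l) + 1 / (r - s)) powr \<alpha>"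
          using m a by (intro mult_left_mono powr_mono2 kappa_1_nonneg) auto
        have A2: "remainder_const 1 \<alpha> / D * m s powr (\<alpha> - 1)
            \<le> remainder_const 1 \<alpha> / (r - l) * (1 / (s - l) + 1 / (r - s)) powr (\<alpha> - 1)"
          using m a rlD lr remainder_const_1_nonneg[OF a(1)]
          by (intro mult_mono powr_mono2 divide_left_mono divide_nonneg_nonneg) auto
        show ?thesis
          by (rule mult_right_mono[OF ennreal_leI[OF mult_left_mono[OF add_mono[OF A1 A2] zero_le_power2]]]) simp
      qed simp
    qed
    then have "2 * (\<integral>\<^sup>+s\<in>{l<..<r}. ?f s \<partial>lborel) \<le> 2 * (\<integral>\<^sup>+s\<in>{l<..<r}. ennreal ((u s)\<^sup>2 * (kappa 1 \<alpha> * (1 / (s - l) + 1 / (r - s)) powr \<alpha>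
        + remainder_const 1 \<alpha> / (r - l) * (1 / (s - l) + 1 / (r - s)) powr (\<alpha> - 1))) \<partial>lborel)"
      by (rule mult_left_mono) simp
    also have "\<dots> \<le> (\<integral>\<^sup>+s\<in>{l<..<r}. (\<integral>\<^sup>+t\<in>{l<..<r}. ?G s t \<partial>lborel) \<partial>lborel)"
    proof (rule hardy_interval[OF a lr(1) u M d])
      fix s assume "s \<in> {l<..<r}" "u s \<noteq> 0"
      then show "l + \<delta> \<le> s \<and> s \<le> r - \<delta>"
        using supp[of s l] supp[of s r] CJ lr by (auto simp: subset_iff abs_if split: if_splits)
    qed
    also have "\<dots> \<le> (\<integral>\<^sup>+s. (\<integral>\<^sup>+t. ?G s t * indicator J t \<partial>lborel) * indicator {l<..<r} s \<partial>lborel)"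
      using CJ by (intro nn_integral_mono mult_right_mono) (auto split: split_indicator)
    finally show ?thesis unfolding lr(2) .
  qed
  have mC: "(\<lambda>s. h s * indicator C s) \<in> borel_measurable lborel"
    if "C \<in> components J" "h \<in> borel_measurable borel" for C and h :: "real \<Rightarrow> ennreal"
  proof -
    note [measurable] = Cb[OF that(1)] that(2)
    show ?thesis by measurable
  qed
  have "2 * (\<integral>\<^sup>+s\<in>J. ?f s \<partial>lborel) = 2 * (\<integral>\<^sup>+s. \<integral>\<^sup>+C. ?f s * indicator C s \<partial>?S \<partial>lborel)"
    by (simp only: sum_indicator_components)
  also have "(\<integral>\<^sup>+s. \<integral>\<^sup>+C. ?f s * indicator C s \<partial>?S \<partial>lborel) = (\<integral>\<^sup>+C. \<integral>\<^sup>+s. ?f s * indicator C s \<partial>lborel \<partial>?S)"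
    by (intro nn_integral_count_space_nn_integral countable_open_components J mC) measurable
  also have "2 * \<dots> = (\<integral>\<^sup>+C. 2 * (\<integral>\<^sup>+s. ?f s * indicator C s \<partial>lborel) \<partial>?S)"
    by (rule nn_integral_cmult[symmetric]) simp
  also have "\<dots> \<le> (\<integral>\<^sup>+C. (\<integral>\<^sup>+s. (\<integral>\<^sup>+t. ?G s t * indicator J t \<partial>lborel) * indicator C s \<partial>lborel) \<partial>?S)"
    using comp by (intro nn_integral_mono) simp
  also have "\<dots> = (\<integral>\<^sup>+s. \<integral>\<^sup>+C. (\<integral>\<^sup>+t. ?G s t * indicator J t \<partial>lborel) * indicator C s \<partial>?S \<partial>lborel)"
    by (intro nn_integral_count_space_nn_integral[symmetric] countable_open_components J mC) measurable
  also have "\<dots> = (\<integral>\<^sup>+s\<in>J. (\<integral>\<^sup>+t\<in>J. ?G s t \<partial>lborel) \<partial>lborel)"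
    by (simp only: sum_indicator_components)
  finally show ?thesis .
qed

section \<open>Polar coordinates and integration along lines\<close>

lemma sets_sphere_measure: "sets (sphere_measure :: 'a::euclidean_space measure) = sets (restrict_space borel (sphere 0 1))"
  by (simp add: sphere_measure_def)

lemma space_sphere_measure: "space (sphere_measure :: 'a::euclidean_space measure) = sphere 0 1"
  by (simp add: sphere_measure_def space_restrict_space space_scale_measure)

lemma sphere_measure_id_measurable:
  "(\<lambda>w. w) \<in> (sphere_measure :: 'a::euclidean_space measure) \<rightarrow>\<^sub>M borel"
  unfolding measurable_cong_sets[OF sets_sphere_measure refl]
  by (rule measurable_restrict_space1) simp

text \<open>Integration against the surface measure means integrating a function of degree \<open>0\<close> over the unit ball.\<close>

lemma nn_integral_sphere_measure:
  fixes g :: "'a::euclidean_space \<Rightarrow> ennreal"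
  assumes [measurable]: "g \<in> borel_measurable borel"
  shows "(\<integral>\<^sup>+w. g w \<partial>sphere_measure)
    = of_nat DIM('a) * (\<integral>\<^sup>+z\<in>ball 0 1 - {0}. g (sgn z) \<partial>lborel)"
proof -
  have g: "g \<in> borel_measurable (restrict_space borel (sphere 0 1))"
    by (rule measurable_restrict_space1) simp
  show ?thesis
    unfolding sphere_measure_def using g
    by (simp add: nn_integral_scale_measure nn_integral_distr[OF sgn_measurable_sphere]
        nn_integral_restrict_space)
qed

lemma emeasure_sphere_measure_space:
  "emeasure sphere_measure (space (sphere_measure :: 'a::euclidean_space measure))
    = of_nat DIM('a) * ennreal (unit_ball_vol (real DIM('a)))"
proof -
  have "emeasure sphere_measure (space (sphere_measure :: 'a measure)) = (\<integral>\<^sup>+w. 1 \<partial>(sphere_measure :: 'a measure))"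
    by simp
  also have "\<dots> = of_nat DIM('a) * (\<integral>\<^sup>+z\<in>ball 0 1 - {0::'a}. 1 \<partial>lborel)"
    by (rule nn_integral_sphere_measure) simp
  also have "(\<integral>\<^sup>+z\<in>ball 0 1 - {0::'a}. 1 \<partial>lborel) = emeasure lborel (ball 0 1 - {0::'a})"
    by simp
  also have "\<dots> = emeasure lborel (ball 0 (1::real) :: 'a set)"
    by (rule emeasure_Diff_null_set) (auto simp: null_sets_def)
  also have "\<dots> = ennreal (unit_ball_vol (real DIM('a)))"
    by (simp add: emeasure_ball)
  finally show ?thesis .
qed

interpretation sphere_measure: finite_measure "sphere_measure :: 'a::euclidean_space measure"
  by (rule finite_measureI) (simp add: emeasure_sphere_measure_space ennreal_mult_eq_top_iff)

lemma nn_integral_even: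
  fixes f :: "real \<Rightarrow> ennreal"
  assumes [measurable]: "f \<in> borel_measurable borel" and even: "\<And>s. f (- s) = f s"
  shows "(\<integral>\<^sup>+s. f s \<partial>lborel) = 2 * (\<integral>\<^sup>+s\<in>{0<..}. f s \<partial>lborel)"
proof -
  have "(\<integral>\<^sup>+s. f s \<partial>lborel) = (\<integral>\<^sup>+s. f s * indicator {0<..} s + f s * indicator {..<0} s \<partial>lborel)"
  proof (rule nn_integral_cong_AE)
    have "AE s in lborel. s \<noteq> (0::real)" by (rule AE_lborel_singleton)
    then show "AE s in lborel. f s = f s * indicator {0<..} s + f s * indicator {..<0} s"
      by eventually_elim (auto simp: indicator_def)
  qed
  also have "\<dots> = (\<integral>\<^sup>+s\<in>{0<..}. f s \<partial>lborel) + (\<integral>\<^sup>+s\<in>{..<0}. f s \<partial>lborel)"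
    by (rule nn_integral_add) measurable
  also have "(\<integral>\<^sup>+s\<in>{..<0}. f s \<partial>lborel) = ennreal \<bar>-1\<bar> * (\<integral>\<^sup>+s. f (0 + - 1 * s) * indicator {..<0} (0 + - 1 * s) \<partial>lborel)"
    by (rule nn_integral_real_affine) simp_all
  also have "(\<lambda>s. f (0 + - 1 * s) * indicator {..<0} (0 + - 1 * s)) = (\<lambda>s. f s * indicator {0<..} s)"
    by (auto simp: even indicator_def)
  finally show ?thesis by (simp add: mult_2)
qed

lemma nn_integral_lborel_translate:
  fixes f :: "'a::euclidean_space \<Rightarrow> ennreal"
  assumes [measurable]: "f \<in> borel_measurable borel"
  shows "(\<integral>\<^sup>+x. f (a + x) \<partial>lborel) = (\<integral>\<^sup>+x. f x \<partial>lborel)"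
proof -
  have "(\<integral>\<^sup>+x. f x \<partial>lborel) = (\<integral>\<^sup>+x. f x \<partial>distr lborel borel ((+) a))"
    by (simp only: lborel_distr_plus)
  also have "\<dots> = (\<integral>\<^sup>+x. f (a + x) \<partial>lborel)" by (simp add: nn_integral_distr)
  finally show ?thesis by simp
qed

lemma nn_integral_lborel_scale:
  fixes f :: "'a::euclidean_space \<Rightarrow> ennreal"
  assumes [measurable]: "f \<in> borel_measurable borel" and c: "c \<noteq> 0"
  shows "(\<integral>\<^sup>+x. f x \<partial>lborel) = ennreal (\<bar>c\<bar> ^ DIM('a)) * (\<integral>\<^sup>+x. f (c *\<^sub>R x) \<partial>lborel)"
  by (subst lborel_affine[OF c, of 0])
     (simp add: nn_integral_density nn_integral_distr nn_integral_cmult)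

text \<open>With \<open>c = norm y\<close> this is the radial integral that remains at the end of the proof of the polar
  coordinate formula.\<close>

lemma nn_integral_inverse_power_tail:
  assumes c: "0 < c" and n: "0 < (n::nat)"
  shows "(\<integral>\<^sup>+s. ennreal (1 / \<bar>s\<bar> ^ (n + 1)) * indicator {s. c < \<bar>s\<bar>} s \<partial>lborel) = ennreal (2 / (real n * c ^ n))"
proof -
  have "(\<integral>\<^sup>+s. ennreal (1 / \<bar>s\<bar> ^ (n + 1)) * indicator {s. c < \<bar>s\<bar>} s \<partial>lborel)
     = 2 * (\<integral>\<^sup>+s\<in>{0<..}. ennreal (1 / \<bar>s\<bar> ^ (n + 1)) * indicator {s. c < \<bar>s\<bar>} s \<partial>lborel)"
    by (rule nn_integral_even) (auto simp: indicator_def)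
  also have "(\<integral>\<^sup>+s\<in>{0<..}. ennreal (1 / \<bar>s\<bar> ^ (n + 1)) * indicator {s. c < \<bar>s\<bar>} s \<partial>lborel)
     = (\<integral>\<^sup>+s. ennreal (1 / s ^ (n + 1)) * indicator {c..} s \<partial>lborel)"
  proof (rule nn_integral_cong_AE)
    have "AE s in lborel. s \<noteq> c" by (rule AE_lborel_singleton)
    then show "AE s in lborel. ennreal (1 / \<bar>s\<bar> ^ (n + 1)) * indicator {s. c < \<bar>s\<bar>} s * indicator {0<..} s
      = ennreal (1 / s ^ (n + 1)) * indicator {c..} s"
      by eventually_elim (use c in \<open>auto simp: indicator_def\<close>)
  qed
  also have "\<dots> = ennreal (0 - (- (1 / real n) * inverse c ^ n))"
  proof (rule nn_integral_FTC_atLeast)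
    show "((\<lambda>s. - (1 / real n) * inverse s ^ n) has_real_derivative 1 / s ^ (n + 1)) (at s)" if "c \<le> s" for s
    proof -
      have s: "s \<noteq> 0" using that c by auto
      have "((\<lambda>s. - (1 / real n) * inverse s ^ n) has_real_derivative
          - (1 / real n) * (real n * (- (inverse s ^ Suc (Suc 0)) * inverse s ^ (n - 1)))) (at s)"
        using s by (auto intro!: derivative_eq_intros)
      moreover have "- (1 / real n) * (real n * (- (inverse s ^ Suc (Suc 0)) * inverse s ^ (n - 1))) = 1 / s ^ (n + 1)"
        using n s by (cases n) (simp_all add: power_inverse divide_inverse)
      ultimately show ?thesis by simp
    qed
    have "((\<lambda>s::real. - (1 / real n) * (inverse s ^ n)) \<longlongrightarrow> - (1 / real n) * 0 ^ n) at_top"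
      by (intro tendsto_intros tendsto_inverse_0_at_top filterlim_ident)
    then show "((\<lambda>s::real. - (1 / real n) * inverse s ^ n) \<longlongrightarrow> 0) at_top"
      using n by (simp add: zero_power)
  qed (use c in auto)
  also have "0 - (- (1 / real n) * inverse c ^ n) = 1 / (real n * c ^ n)"
    by (simp add: divide_inverse power_inverse)
  also have "2 * ennreal (1 / (real n * c ^ n)) = ennreal (2 * (1 / (real n * c ^ n)))"
    by (simp only: ennreal_mult'[OF zero_le_numeral] ennreal_numeral)
  finally show ?thesis by simp
qed

text \<open>The radius runs over the whole line, so every point is reached twice and no case distinction on the
  sign is needed when a line is cut by a domain. The surface measure is an integral over the unit ball;
  rescaling the radius by \<open>norm z\<close>, exchanging the integrals and dilating by \<open>s\<close> leaves a radial integral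
  that is computed explicitly.\<close>

lemma nn_integral_polar:
  fixes f :: "'a::euclidean_space \<Rightarrow> ennreal"
  assumes [measurable]: "f \<in> borel_measurable borel"
  shows "2 * (\<integral>\<^sup>+x. f x \<partial>lborel)
    = (\<integral>\<^sup>+w. (\<integral>\<^sup>+r. f (r *\<^sub>R w) * ennreal (\<bar>r\<bar> ^ (DIM('a) - 1)) \<partial>lborel) \<partial>sphere_measure)"
proof -
  let ?n = "DIM('a)"
  let ?B = "ball 0 1 - {0::'a}"
  let ?F = "\<lambda>s y. f y * ennreal (norm y ^ ?n) * indicator {s. norm y < \<bar>s\<bar>} s * indicator (-{0}) y * ennreal (1 / \<bar>s\<bar> ^ (?n + 1))"
  have [measurable]: "?B \<in> sets borel" by simp
  have radial: "(\<integral>\<^sup>+r. f (r *\<^sub>R sgn z) * ennreal (\<bar>r\<bar> ^ (?n - 1)) \<partial>lborel)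
     = (\<integral>\<^sup>+s. f (s *\<^sub>R z) * ennreal (\<bar>s\<bar> ^ (?n - 1) * norm z ^ ?n) \<partial>lborel)" if z: "z \<noteq> 0" for z :: 'a
  proof -
    have "(\<integral>\<^sup>+r. f (r *\<^sub>R sgn z) * ennreal (\<bar>r\<bar> ^ (?n - 1)) \<partial>lborel)
      = ennreal \<bar>norm z\<bar> * (\<integral>\<^sup>+s. f ((0 + norm z * s) *\<^sub>R sgn z) * ennreal (\<bar>0 + norm z * s\<bar> ^ (?n - 1)) \<partial>lborel)"
      by (rule nn_integral_real_affine) (use z in auto)
    also have "\<dots> = (\<integral>\<^sup>+s. ennreal (norm z) * (f ((0 + norm z * s) *\<^sub>R sgn z) * ennreal (\<bar>0 + norm z * s\<bar> ^ (?n - 1))) \<partial>lborel)"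
      by (simp add: nn_integral_cmult)
    also have "\<dots> = (\<integral>\<^sup>+s. f (s *\<^sub>R z) * ennreal (\<bar>s\<bar> ^ (?n - 1) * norm z ^ ?n) \<partial>lborel)"
    proof (intro nn_integral_cong)
      fix s :: real
      have 1: "(0 + norm z * s) *\<^sub>R sgn z = s *\<^sub>R z" using z by (simp add: sgn_div_norm)
      have "norm z * \<bar>0 + norm z * s\<bar> ^ (?n - 1) = \<bar>s\<bar> ^ (?n - 1) * norm z ^ ?n"
        using power_eq_if[of "norm z" ?n] by (simp add: abs_mult power_mult_distrib)
      then have 2: "ennreal (norm z) * ennreal (\<bar>0 + norm z * s\<bar> ^ (?n - 1)) = ennreal (\<bar>s\<bar> ^ (?n - 1) * norm z ^ ?n)"
        by (simp only: ennreal_mult'[OF norm_ge_zero, symmetric])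
      show "ennreal (norm z) * (f ((0 + norm z * s) *\<^sub>R sgn z) * ennreal (\<bar>0 + norm z * s\<bar> ^ (?n - 1)))
         = f (s *\<^sub>R z) * ennreal (\<bar>s\<bar> ^ (?n - 1) * norm z ^ ?n)"
        unfolding 1 2[symmetric] by (simp only: mult_ac)
    qed
    finally show ?thesis .
  qed
  have dil: "(\<integral>\<^sup>+z. f (s *\<^sub>R z) * ennreal (\<bar>s\<bar> ^ (?n - 1) * norm z ^ ?n) * indicator ?B z \<partial>lborel)
     = (\<integral>\<^sup>+y. ?F s y \<partial>lborel)" if s: "s \<noteq> 0" for s
  proof -
    have "(\<integral>\<^sup>+y. ?F s y \<partial>lborel) = ennreal (\<bar>s\<bar> ^ ?n) * (\<integral>\<^sup>+z. ?F s (s *\<^sub>R z) \<partial>lborel)"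
      by (rule nn_integral_lborel_scale) (use s in auto)
    also have "\<dots> = (\<integral>\<^sup>+z. ennreal (\<bar>s\<bar> ^ ?n) * ?F s (s *\<^sub>R z) \<partial>lborel)"
      by (rule nn_integral_cmult[symmetric]) measurable
    also have "\<dots> = (\<integral>\<^sup>+z. f (s *\<^sub>R z) * ennreal (\<bar>s\<bar> ^ (?n - 1) * norm z ^ ?n) * indicator ?B z \<partial>lborel)"
    proof (intro nn_integral_cong)
      fix z :: 'a
      have ind: "indicator {t. norm (s *\<^sub>R z) < \<bar>t\<bar>} s * indicator (-{0}) (s *\<^sub>R z) = (indicator ?B z :: ennreal)"
        using s by (auto simp: indicator_def mult_less_cancel_left2)
      have "\<bar>s\<bar> ^ ?n * norm (s *\<^sub>R z) ^ ?n * (1 / \<bar>s\<bar> ^ (?n + 1)) = \<bar>s\<bar> ^ (?n - 1) * norm z ^ ?n"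
        using s power_eq_if[of "\<bar>s\<bar>" ?n] by (simp add: power_mult_distrib)
      then have c: "ennreal (\<bar>s\<bar> ^ ?n) * ennreal (norm (s *\<^sub>R z) ^ ?n) * ennreal (1 / \<bar>s\<bar> ^ (?n + 1))
        = ennreal (\<bar>s\<bar> ^ (?n - 1) * norm z ^ ?n)"
        by (simp only: ennreal_mult'[symmetric] zero_le_power abs_ge_zero norm_ge_zero mult_nonneg_nonneg)
      show "ennreal (\<bar>s\<bar> ^ ?n) * ?F s (s *\<^sub>R z)
        = f (s *\<^sub>R z) * ennreal (\<bar>s\<bar> ^ (?n - 1) * norm z ^ ?n) * indicator ?B z"
        unfolding c[symmetric] ind[symmetric] by (simp only: mult_ac)
    qed
    finally show ?thesis by simp
  qed
  have "(\<integral>\<^sup>+w. (\<integral>\<^sup>+r. f (r *\<^sub>R w) * ennreal (\<bar>r\<bar> ^ (?n - 1)) \<partial>lborel) \<partial>sphere_measure)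
     = of_nat ?n * (\<integral>\<^sup>+z\<in>?B. (\<integral>\<^sup>+r. f (r *\<^sub>R sgn z) * ennreal (\<bar>r\<bar> ^ (?n - 1)) \<partial>lborel) \<partial>lborel)"
    by (rule nn_integral_sphere_measure) measurable
  also have "(\<integral>\<^sup>+z\<in>?B. (\<integral>\<^sup>+r. f (r *\<^sub>R sgn z) * ennreal (\<bar>r\<bar> ^ (?n - 1)) \<partial>lborel) \<partial>lborel)
     = (\<integral>\<^sup>+z. (\<integral>\<^sup>+s. f (s *\<^sub>R z) * ennreal (\<bar>s\<bar> ^ (?n - 1) * norm z ^ ?n) * indicator ?B z \<partial>lborel) \<partial>lborel)"
  proof (rule nn_integral_cong)
    fix z :: 'a
    show "(\<integral>\<^sup>+r. f (r *\<^sub>R sgn z) * ennreal (\<bar>r\<bar> ^ (?n - 1)) \<partial>lborel) * indicator ?B z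
      = (\<integral>\<^sup>+s. f (s *\<^sub>R z) * ennreal (\<bar>s\<bar> ^ (?n - 1) * norm z ^ ?n) * indicator ?B z \<partial>lborel)"
    proof (cases "z \<in> ?B")
      case True
      then have "z \<noteq> 0" by simp
      from radial[OF this] show ?thesis by (simp only: indicator_simps(1)[OF True] mult_1_right)
    qed simp
  qed
  also have "\<dots> = (\<integral>\<^sup>+s. (\<integral>\<^sup>+z. f (s *\<^sub>R z) * ennreal (\<bar>s\<bar> ^ (?n - 1) * norm z ^ ?n) * indicator ?B z \<partial>lborel) \<partial>lborel)"
    by (rule lborel_pair.Fubini') measurable
  also have "\<dots> = (\<integral>\<^sup>+s. (\<integral>\<^sup>+y. ?F s y \<partial>lborel) \<partial>lborel)"
  proof (rule nn_integral_cong_AE)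
    have "AE s in lborel. s \<noteq> (0::real)" by (rule AE_lborel_singleton)
    then show "AE s in lborel. (\<integral>\<^sup>+z. f (s *\<^sub>R z) * ennreal (\<bar>s\<bar> ^ (?n - 1) * norm z ^ ?n) * indicator ?B z \<partial>lborel)
       = (\<integral>\<^sup>+y. ?F s y \<partial>lborel)"
      by eventually_elim (rule dil)
  qed
  also have "\<dots> = (\<integral>\<^sup>+y. (\<integral>\<^sup>+s. ?F s y \<partial>lborel) \<partial>lborel)"
    by (rule lborel_pair.Fubini') measurable
  also have "\<dots> = (\<integral>\<^sup>+y. ennreal (2 / real ?n) * f y \<partial>lborel)"
  proof (rule nn_integral_cong_AE)
    have "AE y in lborel. y \<noteq> (0::'a)" by (rule AE_lborel_singleton)
    then show "AE y in lborel. (\<integral>\<^sup>+s. ?F s y \<partial>lborel) = ennreal (2 / real ?n) * f y"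
    proof eventually_elim
      fix y :: 'a assume y: "y \<noteq> 0"
      have "(\<integral>\<^sup>+s. ?F s y \<partial>lborel) = (\<integral>\<^sup>+s. f y * ennreal (norm y ^ ?n) *
          (ennreal (1 / \<bar>s\<bar> ^ (?n + 1)) * indicator {s. norm y < \<bar>s\<bar>} s) \<partial>lborel)"
        using y by (intro nn_integral_cong) (simp add: mult_ac)
      also have "\<dots> = f y * ennreal (norm y ^ ?n) * ennreal (2 / (real ?n * norm y ^ ?n))"
      proof (subst nn_integral_cmult)
        have "0 < norm y" "0 < ?n" using y by simp_all
        then show "f y * ennreal (norm y ^ ?n) * (\<integral>\<^sup>+s. ennreal (1 / \<bar>s\<bar> ^ (?n + 1)) * indicator {s. norm y < \<bar>s\<bar>} s \<partial>lborel)
          = f y * ennreal (norm y ^ ?n) * ennreal (2 / (real ?n * norm y ^ ?n))"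
          by (simp only: nn_integral_inverse_power_tail)
      qed measurable
      also have "\<dots> = f y * ennreal (norm y ^ ?n * (2 / (real ?n * norm y ^ ?n)))"
        by (simp only: mult.assoc ennreal_mult'[OF zero_le_power[OF norm_ge_zero]])
      also have "norm y ^ ?n * (2 / (real ?n * norm y ^ ?n)) = 2 / real ?n"
        using y by simp
      finally show "(\<integral>\<^sup>+s. ?F s y \<partial>lborel) = ennreal (2 / real ?n) * f y" by (simp only: mult.commute)
    qed
  qed
  also have "\<dots> = ennreal (2 / real ?n) * (\<integral>\<^sup>+y. f y \<partial>lborel)"
    by (rule nn_integral_cmult) measurable
  also have "of_nat ?n * (ennreal (2 / real ?n) * (\<integral>\<^sup>+y. f y \<partial>lborel)) = 2 * (\<integral>\<^sup>+y. f y \<partial>lborel)"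
  proof -
    have "of_nat ?n * ennreal (2 / real ?n) = 2"
      unfolding ennreal_of_nat_eq_real_of_nat by (simp flip: ennreal_mult)
    then show ?thesis by (simp only: mult.assoc[symmetric])
  qed
  finally show ?thesis by simp
qed

text \<open>Every point is reached from the points of a unit segment of its line, the part of the line inside the
  strip \<open>0 \<le> x \<bullet> w < 1\<close>. Averaging over lines that start in the strip replaces an orthogonal
  decomposition of the space, which would depend on a choice of coordinates.\<close>

lemma nn_integral_lines:
  fixes g :: "'a::euclidean_space \<Rightarrow> ennreal"
  assumes [measurable]: "g \<in> borel_measurable borel" and w: "norm w = 1"
  shows "(\<integral>\<^sup>+x. g x \<partial>lborel)
    = (\<integral>\<^sup>+x. (\<integral>\<^sup>+s. g (x + s *\<^sub>R w) \<partial>lborel) * indicator {x. 0 \<le> x \<bullet> w \<and> x \<bullet> w < 1} x \<partial>lborel)"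
proof -
  let ?q = "\<lambda>x. indicator {x. 0 \<le> x \<bullet> w \<and> x \<bullet> w < 1} x :: ennreal"
  have ww: "w \<bullet> w = 1" using w by (simp add: dot_square_norm)
  have "(\<integral>\<^sup>+x. (\<integral>\<^sup>+s. g (x + s *\<^sub>R w) \<partial>lborel) * ?q x \<partial>lborel)
     = (\<integral>\<^sup>+x. (\<integral>\<^sup>+s. g (x + s *\<^sub>R w) * ?q x \<partial>lborel) \<partial>lborel)"
    by (simp add: nn_integral_multc)
  also have "\<dots> = (\<integral>\<^sup>+s. (\<integral>\<^sup>+x. g (x + s *\<^sub>R w) * ?q x \<partial>lborel) \<partial>lborel)"
    by (rule lborel_pair.Fubini') measurable
  also have "\<dots> = (\<integral>\<^sup>+s. (\<integral>\<^sup>+x. g x * ?q (x - s *\<^sub>R w) \<partial>lborel) \<partial>lborel)"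
  proof (rule nn_integral_cong)
    fix s :: real
    have "(\<integral>\<^sup>+x. g ((s *\<^sub>R w) + x) * ?q (((s *\<^sub>R w) + x) - s *\<^sub>R w) \<partial>lborel)
      = (\<integral>\<^sup>+x. g x * ?q (x - s *\<^sub>R w) \<partial>lborel)"
      by (rule nn_integral_lborel_translate) measurable
    then show "(\<integral>\<^sup>+x. g (x + s *\<^sub>R w) * ?q x \<partial>lborel) = (\<integral>\<^sup>+x. g x * ?q (x - s *\<^sub>R w) \<partial>lborel)"
      by (simp add: add.commute)
  qed
  also have "\<dots> = (\<integral>\<^sup>+x. (\<integral>\<^sup>+s. g x * ?q (x - s *\<^sub>R w) \<partial>lborel) \<partial>lborel)"
    by (rule lborel_pair.Fubini') measurable
  also have "\<dots> = (\<integral>\<^sup>+x. g x \<partial>lborel)"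
  proof (intro nn_integral_cong)
    fix x :: 'a
    have "?q (x - s *\<^sub>R w) = indicator {x \<bullet> w - 1<..x \<bullet> w} s" for s
      by (auto simp: indicator_def inner_diff_left ww)
    then have "(\<integral>\<^sup>+s. g x * ?q (x - s *\<^sub>R w) \<partial>lborel)
      = (\<integral>\<^sup>+s. g x * indicator {x \<bullet> w - 1<..x \<bullet> w} s \<partial>lborel)" by (simp only:)
    also have "\<dots> = g x" by (subst nn_integral_cmult_indicator) simp_all
    finally show "(\<integral>\<^sup>+s. g x * ?q (x - s *\<^sub>R w) \<partial>lborel) = g x" .
  qed
  finally show ?thesis by simp
qed

section \<open>Moments of the surface measure\<close>

lemma gaussian_moment:
  assumes q: "- 1 < q"
  shows "(\<integral>\<^sup>+r. ennreal (\<bar>r\<bar> powr q * exp (- r\<^sup>2)) \<partial>lborel) = ennreal (Gamma ((q + 1) / 2))"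
proof -
  let ?f = "\<lambda>t. t powr ((q + 1) / 2 - 1) / exp t"
  have ein: "einterval 0 \<infinity> = {0<..}" by (auto simp: einterval_def)
  have img: "(\<lambda>r::real. r\<^sup>2) ` {0<..} = {0<..}"
  proof (intro equalityI subsetI)
    fix y :: real assume "y \<in> {0<..}"
    then have "y = (sqrt y)\<^sup>2" "sqrt y \<in> {0<..}" by auto
    then show "y \<in> (\<lambda>r::real. r\<^sup>2) ` {0<..}" by blast
  qed auto
  have "ennreal (Gamma ((q + 1) / 2)) = (\<integral>\<^sup>+t. ennreal (indicator {0..} t * t powr ((q + 1) / 2 - 1) / exp t) \<partial>lborel)"
    by (rule Gamma_conv_nn_integral_real) (use q in auto)
  also have "\<dots> = (\<integral>\<^sup>+t\<in>{0<..}. ennreal (?f t) \<partial>lborel)"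
  proof (rule nn_integral_cong_AE)
    have "AE t in lborel. t \<noteq> (0::real)" by (rule AE_lborel_singleton)
    then show "AE t in lborel. ennreal (indicator {0..} t * t powr ((q + 1) / 2 - 1) / exp t) = ennreal (?f t) * indicator {0<..} t"
      by eventually_elim (auto simp: indicator_def)
  qed
  also have "\<dots> = (\<integral>\<^sup>+r\<in>{0<..}. ennreal (?f (r\<^sup>2) * (2 * r)) \<partial>lborel)"
  proof -
    have D: "((\<lambda>r. r\<^sup>2) has_real_derivative 2 * r) (at r)" for r :: real
      by (auto intro!: derivative_eq_intros)
    have "(\<integral>\<^sup>+t\<in>(\<lambda>r::real. r\<^sup>2) ` einterval 0 \<infinity>. ennreal (?f t) \<partial>lborel)
      = (\<integral>\<^sup>+r\<in>einterval 0 \<infinity>. ennreal (?f (r\<^sup>2) * (2 * r)) \<partial>lborel)"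
      by (rule nn_integral_substitution_einterval) (use D in \<open>auto simp: einterval_def intro!: continuous_intros\<close>)
    then show ?thesis unfolding ein img .
  qed
  also have "\<dots> = (\<integral>\<^sup>+r. 2 * (ennreal (\<bar>r\<bar> powr q * exp (- r\<^sup>2)) * indicator {0<..} r) \<partial>lborel)"
  proof (rule nn_integral_cong)
    fix r :: real
    show "ennreal (?f (r\<^sup>2) * (2 * r)) * indicator {0<..} r = 2 * (ennreal (\<bar>r\<bar> powr q * exp (- r\<^sup>2)) * indicator {0<..} r)"
    proof (cases "r \<in> {0<..}")
      case True
      then have r: "0 < r" by simp
      have p1: "(r\<^sup>2) powr ((q + 1) / 2 - 1) = r powr (q - 1)"
      proof -
        have "r\<^sup>2 = r powr 2" using r by simp
        moreover have "2 * ((q + 1) / 2 - 1) = q - 1" by simp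
        ultimately show ?thesis by (simp only: powr_powr)
      qed
      have p2: "\<bar>r\<bar> powr q = r powr (q - 1) * r" using r powr_add[of r "q - 1" 1] by simp
      have "?f (r\<^sup>2) * (2 * r) = 2 * (\<bar>r\<bar> powr q * exp (- r\<^sup>2))"
        by (simp only: p1 p2 exp_minus) (simp add: divide_inverse)
      then have "ennreal (?f (r\<^sup>2) * (2 * r)) = 2 * ennreal (\<bar>r\<bar> powr q * exp (- r\<^sup>2))"
        by (simp only: ennreal_mult'[OF zero_le_numeral] ennreal_numeral)
      then show ?thesis using True by simp
    qed simp
  qed
  also have "\<dots> = 2 * (\<integral>\<^sup>+r\<in>{0<..}. ennreal (\<bar>r\<bar> powr q * exp (- r\<^sup>2)) \<partial>lborel)"
    by (rule nn_integral_cmult) measurable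
  also have "\<dots> = (\<integral>\<^sup>+r. ennreal (\<bar>r\<bar> powr q * exp (- r\<^sup>2)) \<partial>lborel)"
    by (rule nn_integral_even[symmetric]) simp_all
  finally show ?thesis by simp
qed

lemma gaussian_moment_0: "(\<integral>\<^sup>+r. ennreal (exp (- r\<^sup>2)) \<partial>lborel) = ennreal (sqrt pi)"
proof -
  have "(\<integral>\<^sup>+r. ennreal (exp (- r\<^sup>2)) \<partial>lborel) = (\<integral>\<^sup>+r. ennreal (\<bar>r\<bar> powr 0 * exp (- r\<^sup>2)) \<partial>lborel)"
  proof (rule nn_integral_cong_AE)
    have "AE r in lborel. r \<noteq> (0::real)" by (rule AE_lborel_singleton)
    then show "AE r in lborel. ennreal (exp (- r\<^sup>2)) = ennreal (\<bar>r\<bar> powr 0 * exp (- r\<^sup>2))"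
      by eventually_elim simp
  qed
  also have "\<dots> = ennreal (Gamma ((0 + 1) / 2))" by (rule gaussian_moment) simp
  finally show ?thesis by (simp add: Gamma_one_half_real)
qed

text \<open>The integral of \<open>|w \<bullet> e|\<^sup>\<beta>\<close> over the unit sphere in dimension \<open>n\<close>, for any unit vector \<open>e\<close>
  (\<open>sphere_moment_integral\<close>).\<close>

definition sphere_moment :: "nat \<Rightarrow> real \<Rightarrow> real" where
  "sphere_moment n \<beta> = 2 * pi powr ((real n - 1) / 2) * (Gamma ((1 + \<beta>) / 2) / Gamma ((real n + \<beta>) / 2))"

lemma sphere_moment_pos: "0 < n \<Longrightarrow> 0 \<le> \<beta> \<Longrightarrow> 0 < sphere_moment n \<beta>"
  unfolding sphere_moment_def by (intro mult_pos_pos divide_pos_pos Gamma_real_pos) auto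

text \<open>In polar coordinates, with the total mass of the sphere computed from the volume of the unit ball.\<close>

lemma nn_integral_gaussian:
  "(\<integral>\<^sup>+x. ennreal (exp (- (norm (x::'a::euclidean_space))\<^sup>2)) \<partial>lborel) = ennreal (pi powr (real DIM('a) / 2))"
proof -
  let ?n = "DIM('a)"
  let ?I = "\<integral>\<^sup>+x. ennreal (exp (- (norm (x::'a))\<^sup>2)) \<partial>lborel"
  have g: "0 < Gamma (real ?n / 2)" by (intro Gamma_real_pos) simp
  have "2 * ?I = (\<integral>\<^sup>+w. (\<integral>\<^sup>+r. ennreal (exp (- (norm (r *\<^sub>R w))\<^sup>2)) * ennreal (\<bar>r\<bar> ^ (?n - 1)) \<partial>lborel) \<partial>(sphere_measure :: 'a measure))"
    by (rule nn_integral_polar) measurable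
  also have "\<dots> = (\<integral>\<^sup>+w. ennreal (Gamma (real ?n / 2)) \<partial>(sphere_measure :: 'a measure))"
  proof (rule nn_integral_cong)
    fix w :: 'a assume "w \<in> space sphere_measure"
    then have w: "norm w = 1" by (simp add: space_sphere_measure)
    have "(\<integral>\<^sup>+r. ennreal (exp (- (norm (r *\<^sub>R w))\<^sup>2)) * ennreal (\<bar>r\<bar> ^ (?n - 1)) \<partial>lborel)
       = (\<integral>\<^sup>+r. ennreal (\<bar>r\<bar> powr (real ?n - 1) * exp (- r\<^sup>2)) \<partial>lborel)"
    proof (rule nn_integral_cong_AE)
      have "AE r in lborel. r \<noteq> (0::real)" by (rule AE_lborel_singleton)
      then show "AE r in lborel. ennreal (exp (- (norm (r *\<^sub>R w))\<^sup>2)) * ennreal (\<bar>r\<bar> ^ (?n - 1))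
          = ennreal (\<bar>r\<bar> powr (real ?n - 1) * exp (- r\<^sup>2))"
      proof eventually_elim
        fix r :: real assume "r \<noteq> 0"
        moreover have "real (?n - 1) = real ?n - 1" by (simp add: of_nat_diff Suc_leI)
        ultimately have "\<bar>r\<bar> powr (real ?n - 1) = \<bar>r\<bar> ^ (?n - 1)"
          using powr_realpow[of "\<bar>r\<bar>" "?n - 1"] by simp
        then show "ennreal (exp (- (norm (r *\<^sub>R w))\<^sup>2)) * ennreal (\<bar>r\<bar> ^ (?n - 1))
          = ennreal (\<bar>r\<bar> powr (real ?n - 1) * exp (- r\<^sup>2))"
          using w by (simp add: mult.commute flip: ennreal_mult)
      qed
    qed
    also have "\<dots> = ennreal (Gamma ((real ?n - 1 + 1) / 2))"
      by (rule gaussian_moment) simp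
    finally show "(\<integral>\<^sup>+r. ennreal (exp (- (norm (r *\<^sub>R w))\<^sup>2)) * ennreal (\<bar>r\<bar> ^ (?n - 1)) \<partial>lborel)
       = ennreal (Gamma (real ?n / 2))" by simp
  qed
  also have "\<dots> = ennreal (Gamma (real ?n / 2)) * (of_nat ?n * ennreal (unit_ball_vol (real ?n)))"
    by (simp add: emeasure_sphere_measure_space)
  also have "\<dots> = ennreal (Gamma (real ?n / 2) * (real ?n * unit_ball_vol (real ?n)))"
    using g by (simp add: ennreal_of_nat_eq_real_of_nat ennreal_mult)
  also have "Gamma (real ?n / 2) * (real ?n * unit_ball_vol (real ?n)) = 2 * pi powr (real ?n / 2)"
  proof -
    have "Gamma (real ?n / 2 + 1) = real ?n / 2 * Gamma (real ?n / 2)"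
      by (rule Gamma_plus1) (auto dest: nonpos_Ints_nonpos)
    moreover have "Gamma (real ?n / 2) \<noteq> 0" using less_imp_neq[OF g] by simp
    ultimately show ?thesis unfolding unit_ball_vol_def by (simp only:) simp
  qed
  also have "ennreal (2 * pi powr (real ?n / 2)) = 2 * ennreal (pi powr (real ?n / 2))"
    by (simp only: ennreal_mult'[OF zero_le_numeral] ennreal_numeral)
  finally show ?thesis
    by (simp add: ennreal_mult_cancel_left)
qed

text \<open>The integral of \<open>|x \<bullet> e|\<^sup>\<beta> exp (- norm x ^ 2)\<close> is computed twice. Along lines parallel to \<open>e\<close> it is a
  one-dimensional moment times a factor independent of \<open>\<beta>\<close>, which \<open>\<beta> = 0\<close> determines; in polar coordinates
  it is the moment of the sphere times a radial Gaussian moment.\<close>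

lemma sphere_moment_integral:
  fixes e :: "'a::euclidean_space"
  assumes e: "norm e = 1" and b: "0 \<le> \<beta>"
  shows "(\<integral>\<^sup>+w. ennreal (\<bar>w \<bullet> e\<bar> powr \<beta>) \<partial>sphere_measure) = ennreal (sphere_moment DIM('a) \<beta>)"
proof -
  let ?n = "DIM('a)"
  let ?P = "\<integral>\<^sup>+w. ennreal (\<bar>w \<bullet> e\<bar> powr \<beta>) \<partial>sphere_measure"
  let ?q = "\<lambda>x::'a. indicator {x. 0 \<le> x \<bullet> e \<and> x \<bullet> e < 1} x :: ennreal"
  \<comment> \<open>The Gaussian integral over a hyperplane orthogonal to \<open>e\<close>.\<close>
  define Y where "Y = (\<integral>\<^sup>+x. ennreal (exp (- ((norm x)\<^sup>2 - (x \<bullet> e)\<^sup>2))) * ?q x \<partial>lborel)"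
  have ee: "e \<bullet> e = 1" using e by (simp add: dot_square_norm)
  have nsq: "(norm (x + s *\<^sub>R e))\<^sup>2 = ((norm x)\<^sup>2 - (x \<bullet> e)\<^sup>2) + (x \<bullet> e + s)\<^sup>2" for x s
    unfolding power2_norm_eq_inner
    by (simp add: inner_add_left inner_add_right inner_commute ee power2_eq_square algebra_simps)
  have lines: "(\<integral>\<^sup>+x. ennreal (h (x \<bullet> e) * exp (- (norm x)\<^sup>2)) \<partial>lborel)
      = (\<integral>\<^sup>+s. ennreal (h s * exp (- s\<^sup>2)) \<partial>lborel) * Y"
    if [measurable]: "h \<in> borel_measurable borel" and h: "\<And>s. 0 \<le> h s" for h :: "real \<Rightarrow> real"
  proof -
    let ?H = "\<integral>\<^sup>+s. ennreal (h s * exp (- s\<^sup>2)) \<partial>lborel"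
    have "(\<integral>\<^sup>+x. ennreal (h (x \<bullet> e) * exp (- (norm x)\<^sup>2)) \<partial>lborel)
      = (\<integral>\<^sup>+x. (\<integral>\<^sup>+s. ennreal (h ((x + s *\<^sub>R e) \<bullet> e) * exp (- (norm (x + s *\<^sub>R e))\<^sup>2)) \<partial>lborel) * ?q x \<partial>lborel)"
      by (rule nn_integral_lines) (use e in simp_all)
    also have "\<dots> = (\<integral>\<^sup>+x. ?H * (ennreal (exp (- ((norm x)\<^sup>2 - (x \<bullet> e)\<^sup>2))) * ?q x) \<partial>lborel)"
    proof (rule nn_integral_cong)
      fix x :: 'a
      have "(\<integral>\<^sup>+s. ennreal (h ((x + s *\<^sub>R e) \<bullet> e) * exp (- (norm (x + s *\<^sub>R e))\<^sup>2)) \<partial>lborel)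
        = (\<integral>\<^sup>+s. ennreal (exp (- ((norm x)\<^sup>2 - (x \<bullet> e)\<^sup>2))) * ennreal (h (x \<bullet> e + s) * exp (- (x \<bullet> e + s)\<^sup>2)) \<partial>lborel)"
      proof (rule nn_integral_cong)
        fix s :: real
        have "exp (- (norm (x + s *\<^sub>R e))\<^sup>2) = exp (- ((norm x)\<^sup>2 - (x \<bullet> e)\<^sup>2)) * exp (- (x \<bullet> e + s)\<^sup>2)"
          unfolding nsq exp_add[symmetric] by simp
        then have "h ((x + s *\<^sub>R e) \<bullet> e) * exp (- (norm (x + s *\<^sub>R e))\<^sup>2)
          = exp (- ((norm x)\<^sup>2 - (x \<bullet> e)\<^sup>2)) * (h (x \<bullet> e + s) * exp (- (x \<bullet> e + s)\<^sup>2))"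
          by (simp add: inner_add_left ee)
        then show "ennreal (h ((x + s *\<^sub>R e) \<bullet> e) * exp (- (norm (x + s *\<^sub>R e))\<^sup>2))
          = ennreal (exp (- ((norm x)\<^sup>2 - (x \<bullet> e)\<^sup>2))) * ennreal (h (x \<bullet> e + s) * exp (- (x \<bullet> e + s)\<^sup>2))"
          by (simp only: ennreal_mult'[OF exp_ge_zero])
      qed
      also have "\<dots> = ennreal (exp (- ((norm x)\<^sup>2 - (x \<bullet> e)\<^sup>2))) * (\<integral>\<^sup>+s. ennreal (h (x \<bullet> e + s) * exp (- (x \<bullet> e + s)\<^sup>2)) \<partial>lborel)"
        by (rule nn_integral_cmult) measurable
      also have "(\<integral>\<^sup>+s. ennreal (h (x \<bullet> e + s) * exp (- (x \<bullet> e + s)\<^sup>2)) \<partial>lborel) = ?H"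
        by (rule nn_integral_lborel_translate) measurable
      finally show "(\<integral>\<^sup>+s. ennreal (h ((x + s *\<^sub>R e) \<bullet> e) * exp (- (norm (x + s *\<^sub>R e))\<^sup>2)) \<partial>lborel) * ?q x
        = ?H * (ennreal (exp (- ((norm x)\<^sup>2 - (x \<bullet> e)\<^sup>2))) * ?q x)" by (simp only: mult_ac)
    qed
    also have "\<dots> = ?H * Y" unfolding Y_def by (rule nn_integral_cmult) measurable
    finally show ?thesis .
  qed
  have Y: "ennreal (sqrt pi) * Y = ennreal (pi powr (real ?n / 2))"
    using lines[of "\<lambda>_. 1"] nn_integral_gaussian[where 'a = 'a] gaussian_moment_0 by simp
  have g: "0 < Gamma ((real ?n + \<beta>) / 2)" using b by (intro Gamma_real_pos) (simp add: add_pos_nonneg)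
  have g1: "0 < Gamma ((\<beta> + 1) / 2)" using b by (intro Gamma_real_pos) simp
  have "2 * (ennreal (Gamma ((\<beta> + 1) / 2)) * Y) = 2 * (\<integral>\<^sup>+x. ennreal (\<bar>x \<bullet> e\<bar> powr \<beta> * exp (- (norm x)\<^sup>2)) \<partial>lborel)"
    using lines[of "\<lambda>s. \<bar>s\<bar> powr \<beta>"] gaussian_moment[of \<beta>] b by simp
  also have "\<dots> = (\<integral>\<^sup>+w. (\<integral>\<^sup>+r. ennreal (\<bar>(r *\<^sub>R w) \<bullet> e\<bar> powr \<beta> * exp (- (norm (r *\<^sub>R w))\<^sup>2)) * ennreal (\<bar>r\<bar> ^ (?n - 1)) \<partial>lborel) \<partial>(sphere_measure :: 'a measure))"
    by (rule nn_integral_polar) measurable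
  also have "\<dots> = (\<integral>\<^sup>+w. ennreal (Gamma ((real ?n + \<beta>) / 2)) * ennreal (\<bar>w \<bullet> e\<bar> powr \<beta>) \<partial>(sphere_measure :: 'a measure))"
  proof (rule nn_integral_cong)
    fix w :: 'a assume "w \<in> space sphere_measure"
    then have w: "norm w = 1" by (simp add: space_sphere_measure)
    have "(\<integral>\<^sup>+r. ennreal (\<bar>(r *\<^sub>R w) \<bullet> e\<bar> powr \<beta> * exp (- (norm (r *\<^sub>R w))\<^sup>2)) * ennreal (\<bar>r\<bar> ^ (?n - 1)) \<partial>lborel)
       = (\<integral>\<^sup>+r. ennreal (\<bar>w \<bullet> e\<bar> powr \<beta>) * ennreal (\<bar>r\<bar> powr (\<beta> + real ?n - 1) * exp (- r\<^sup>2)) \<partial>lborel)"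
    proof (rule nn_integral_cong_AE)
      have "AE r in lborel. r \<noteq> (0::real)" by (rule AE_lborel_singleton)
      then show "AE r in lborel. ennreal (\<bar>(r *\<^sub>R w) \<bullet> e\<bar> powr \<beta> * exp (- (norm (r *\<^sub>R w))\<^sup>2)) * ennreal (\<bar>r\<bar> ^ (?n - 1))
          = ennreal (\<bar>w \<bullet> e\<bar> powr \<beta>) * ennreal (\<bar>r\<bar> powr (\<beta> + real ?n - 1) * exp (- r\<^sup>2))"
      proof eventually_elim
        fix r :: real assume r: "r \<noteq> 0"
        moreover have "real (?n - 1) = real ?n - 1" by (simp add: of_nat_diff Suc_leI)
        ultimately have "\<bar>r\<bar> powr (real ?n - 1) = \<bar>r\<bar> ^ (?n - 1)"
          using powr_realpow[of "\<bar>r\<bar>" "?n - 1"] by simp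
        moreover have "\<bar>r\<bar> powr (\<beta> + real ?n - 1) = \<bar>r\<bar> powr \<beta> * \<bar>r\<bar> powr (real ?n - 1)"
          by (simp add: add_diff_eq flip: powr_add)
        moreover have "\<bar>(r *\<^sub>R w) \<bullet> e\<bar> powr \<beta> = \<bar>r\<bar> powr \<beta> * \<bar>w \<bullet> e\<bar> powr \<beta>"
          by (simp add: abs_mult powr_mult)
        moreover have "(norm (r *\<^sub>R w))\<^sup>2 = r\<^sup>2" using w by simp
        ultimately show "ennreal (\<bar>(r *\<^sub>R w) \<bullet> e\<bar> powr \<beta> * exp (- (norm (r *\<^sub>R w))\<^sup>2)) * ennreal (\<bar>r\<bar> ^ (?n - 1))
          = ennreal (\<bar>w \<bullet> e\<bar> powr \<beta>) * ennreal (\<bar>r\<bar> powr (\<beta> + real ?n - 1) * exp (- r\<^sup>2))"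
          by (simp add: mult_ac flip: ennreal_mult')
      qed
    qed
    also have "\<dots> = ennreal (\<bar>w \<bullet> e\<bar> powr \<beta>) * (\<integral>\<^sup>+r. ennreal (\<bar>r\<bar> powr (\<beta> + real ?n - 1) * exp (- r\<^sup>2)) \<partial>lborel)"
      by (rule nn_integral_cmult) measurable
    also have "(\<integral>\<^sup>+r. ennreal (\<bar>r\<bar> powr (\<beta> + real ?n - 1) * exp (- r\<^sup>2)) \<partial>lborel) = ennreal (Gamma ((\<beta> + real ?n - 1 + 1) / 2))"
      by (rule gaussian_moment) (use b in \<open>simp add: add_pos_nonneg add_nonneg_pos\<close>)
    also have "\<beta> + real ?n - 1 + 1 = real ?n + \<beta>" by simp
    finally show "(\<integral>\<^sup>+r. ennreal (\<bar>(r *\<^sub>R w) \<bullet> e\<bar> powr \<beta> * exp (- (norm (r *\<^sub>R w))\<^sup>2)) * ennreal (\<bar>r\<bar> ^ (?n - 1)) \<partial>lborel)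
       = ennreal (Gamma ((real ?n + \<beta>) / 2)) * ennreal (\<bar>w \<bullet> e\<bar> powr \<beta>)" by (simp only: mult.commute)
  qed
  also have "\<dots> = ennreal (Gamma ((real ?n + \<beta>) / 2)) * ?P"
  proof (rule nn_integral_cmult)
    show "(\<lambda>w. ennreal (\<bar>w \<bullet> e\<bar> powr \<beta>)) \<in> borel_measurable sphere_measure"
      by (rule measurable_compose[OF sphere_measure_id_measurable]) measurable
  qed
  finally have main: "2 * (ennreal (Gamma ((\<beta> + 1) / 2)) * Y) = ennreal (Gamma ((real ?n + \<beta>) / 2)) * ?P" .
  have "Y < top" using Y by (cases "Y = top") (auto simp: ennreal_mult_eq_top_iff less_top)
  then obtain y where y: "Y = ennreal y" "0 \<le> y" by (cases Y) auto
  have y': "y = pi powr ((real ?n - 1) / 2)"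
  proof -
    have "sqrt pi * y = pi powr (real ?n / 2)" using Y y by (simp flip: ennreal_mult)
    moreover have "pi powr (real ?n / 2) = sqrt pi * pi powr ((real ?n - 1) / 2)"
      by (simp add: powr_half_sqrt[symmetric] diff_divide_distrib flip: powr_add)
    ultimately show ?thesis by simp
  qed
  have "2 * (ennreal (Gamma ((\<beta> + 1) / 2)) * Y) = ennreal (2 * (Gamma ((\<beta> + 1) / 2) * y))"
    using y g1 by (simp add: ennreal_mult)
  also have "2 * (Gamma ((\<beta> + 1) / 2) * y) = Gamma ((real ?n + \<beta>) / 2) * sphere_moment ?n \<beta>"
    using g by (simp add: sphere_moment_def y' add.commute)
  also have "ennreal \<dots> = ennreal (Gamma ((real ?n + \<beta>) / 2)) * ennreal (sphere_moment ?n \<beta>)"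
    using g by (simp add: ennreal_mult')
  finally have "ennreal (Gamma ((real ?n + \<beta>) / 2)) * ?P = ennreal (Gamma ((real ?n + \<beta>) / 2)) * ennreal (sphere_moment ?n \<beta>)"
    using main by simp
  then show ?thesis using g by (simp add: ennreal_mult_cancel_left)
qed

text \<open>The constant in dimension \<open>n\<close> is the one-dimensional constant averaged over the directions; the factor
  \<open>2\<close> is that of polar coordinates over whole lines.\<close>

lemma kappa_sphere_moment: "sphere_moment n \<alpha> * kappa 1 \<alpha> = 2 * kappa n \<alpha>" if "1 < \<alpha>"
  unfolding kappa_1[OF that] by (simp add: sphere_moment_def kappa_def)

lemma remainder_sphere_moment: "sphere_moment n (\<alpha> - 1) * remainder_const 1 \<alpha> = 2 * remainder_const n \<alpha>" if "1 < \<alpha>"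
  unfolding remainder_const_1[OF that] by (simp add: sphere_moment_def remainder_const_def add_diff_eq mult_ac)

section \<open>Distances along a direction\<close>

text \<open>Outside \<open>\<Omega>\<close> nothing is known about \<open>u\<close>, not even measurability, so \<open>u\<close> is replaced by its extension
  by zero.\<close>

lemma Cc_zero_extension:
  fixes u :: "'a::euclidean_space \<Rightarrow> real"
  assumes "open \<Omega>" and u: "u \<in> Cc \<Omega>"
  defines "v \<equiv> \<lambda>x. indicator \<Omega> x * u x"
  obtains M \<delta> where "v \<in> borel_measurable borel" "\<And>x. \<bar>v x\<bar> \<le> M" "0 < \<delta>"
    "\<And>x y. v x \<noteq> 0 \<Longrightarrow> y \<notin> \<Omega> \<Longrightarrow> \<delta> \<le> dist x y"
proof -
  let ?K = "closure {x \<in> \<Omega>. u x \<noteq> 0}"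
  have K: "compact ?K" "?K \<subseteq> \<Omega>" and cont: "continuous_on \<Omega> u" using u by (auto simp: Cc_def)
  have vK: "x \<in> ?K" if "v x \<noteq> 0" for x
    using that closure_subset[of "{x \<in> \<Omega>. u x \<noteq> 0}"] by (auto simp: v_def indicator_def split: if_splits)
  have "v \<in> borel_measurable borel"
    using borel_measurable_continuous_on_indicator[of \<Omega> u] assms(1) cont by (simp add: v_def)
  moreover have "bounded (u ` ?K)"
    using compact_continuous_image[OF continuous_on_subset[OF cont K(2)] K(1)] compact_imp_bounded by blast
  then obtain M where M: "\<And>x. x \<in> ?K \<Longrightarrow> \<bar>u x\<bar> \<le> M" by (auto simp: bounded_real)
  have "\<bar>v x\<bar> \<le> \<bar>M\<bar>" for x
  proof (cases "v x = 0")
    case False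
    then show ?thesis using M[OF vK[OF False]] by (auto simp: v_def indicator_def split: if_splits)
  qed simp
  moreover obtain \<delta> where "0 < \<delta>" "\<And>x y. x \<in> ?K \<Longrightarrow> y \<in> - \<Omega> \<Longrightarrow> \<delta> \<le> dist x y"
  proof -
    have "\<exists>\<delta>>0. \<forall>x\<in>?K. \<forall>y\<in>- \<Omega>. \<delta> \<le> dist x y"
      by (rule separate_compact_closed) (use assms(1) K in \<open>auto simp: closed_def\<close>)
    then show ?thesis using that by blast
  qed
  ultimately show ?thesis using that vK by (metis ComplI)
qed

lemma line_exit:
  fixes x w :: "'a::euclidean_space"
  assumes "bounded \<Omega>" "w \<noteq> 0"
  obtains B where "\<And>t. x + t *\<^sub>R w \<in> \<Omega> \<Longrightarrow> \<bar>t\<bar> \<le> B"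
proof -
  obtain r where r: "\<And>y. y \<in> \<Omega> \<Longrightarrow> norm y \<le> r" using assms(1) by (auto simp: bounded_iff)
  have "\<bar>t\<bar> \<le> (r + norm x) / norm w" if "x + t *\<^sub>R w \<in> \<Omega>" for t
  proof -
    have "norm (t *\<^sub>R w) \<le> norm (x + t *\<^sub>R w) + norm x" by (metis add.commute norm_add_leD norm_minus_cancel add_diff_cancel_left' norm_triangle_le_diff order_refl)
    also have "\<dots> \<le> r + norm x" using r[OF that] by simp
    finally show ?thesis using assms(2) by (simp add: le_divide_eq)
  qed
  then show ?thesis using that by blast
qed

lemma dir_dist_le: "x + t *\<^sub>R w \<notin> \<Omega> \<Longrightarrow> dir_dist w \<Omega> x \<le> \<bar>t\<bar>"
  unfolding dir_dist_def by (intro cInf_lower bdd_belowI[of _ 0]) auto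

lemma dir_dist_ge:
  assumes "bounded \<Omega>" "w \<noteq> 0" and "\<And>t. x + t *\<^sub>R w \<notin> \<Omega> \<Longrightarrow> c \<le> \<bar>t\<bar>"
  shows "c \<le> dir_dist w \<Omega> x"
proof -
  obtain B where B: "\<And>t. x + t *\<^sub>R w \<in> \<Omega> \<Longrightarrow> \<bar>t\<bar> \<le> B" using line_exit[OF assms(1,2)] by metis
  have "x + (\<bar>B\<bar> + 1) *\<^sub>R w \<notin> \<Omega>" using B[of "\<bar>B\<bar> + 1"] by auto
  then show ?thesis unfolding dir_dist_def using assms(3) by (intro cInf_greatest) auto
qed

lemma dir_reach_ge:
  assumes "bounded \<Omega>" "w \<noteq> 0" and "x + t *\<^sub>R w \<in> \<Omega>"
  shows "\<bar>t\<bar> \<le> dir_reach w \<Omega> x"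
proof -
  obtain B where B: "\<And>t. x + t *\<^sub>R w \<in> \<Omega> \<Longrightarrow> \<bar>t\<bar> \<le> B" using line_exit[OF assms(1,2)] by metis
  then show ?thesis unfolding dir_reach_def using assms(3)
    by (intro cSup_upper bdd_aboveI[of _ B]) auto
qed

text \<open>A compact segment that lies in the open set \<open>\<Omega>\<close> can be enlarged, which makes the inequality strict.\<close>

lemma less_dir_dist_iff:
  assumes "open \<Omega>" "bounded \<Omega>" "w \<noteq> 0" and that: "0 \<le> c"
  shows "c < dir_dist w \<Omega> x \<longleftrightarrow> (\<forall>t\<in>{-c..c}. x + t *\<^sub>R w \<in> \<Omega>)"
proof
  assume "c < dir_dist w \<Omega> x"
  then show "\<forall>t\<in>{-c..c}. x + t *\<^sub>R w \<in> \<Omega>"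
    using dir_dist_le[of x _ w \<Omega>] by (force simp: abs_le_iff)
next
  assume all: "\<forall>t\<in>{-c..c}. x + t *\<^sub>R w \<in> \<Omega>"
  have "compact ((\<lambda>t. x + t *\<^sub>R w) ` {-c..c})" by (intro compact_continuous_image continuous_intros) auto
  then obtain d where d: "0 < d" "\<And>y z. y \<in> (\<lambda>t. x + t *\<^sub>R w) ` {-c..c} \<Longrightarrow> z \<in> - \<Omega> \<Longrightarrow> d \<le> dist y z"
    using separate_compact_closed[of "(\<lambda>t. x + t *\<^sub>R w) ` {-c..c}" "- \<Omega>"] all assms(1) by blast
  have "c + d / norm w \<le> dir_dist w \<Omega> x"
  proof (rule dir_dist_ge[OF assms(2,3)])
    fix t assume t: "x + t *\<^sub>R w \<notin> \<Omega>"
    define s where "s = max (-c) (min c t)"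
    have s: "s \<in> {-c..c}" using that by (auto simp: s_def)
    have tc: "c < \<bar>t\<bar>" using t all by (metis abs_le_iff atLeastAtMost_iff leI minus_le_iff)
    have "d \<le> dist (x + s *\<^sub>R w) (x + t *\<^sub>R w)" using d(2) s t by blast
    also have "\<dots> = \<bar>s - t\<bar> * norm w"
      by (simp add: dist_norm flip: scaleR_diff_left)
    also have "\<bar>s - t\<bar> = \<bar>t\<bar> - c" using tc that by (auto simp: s_def max_def min_def)
    finally show "c + d / norm w \<le> \<bar>t\<bar>" using assms(3) by (simp add: field_simps)
  qed
  moreover have "0 < d / norm w" using d assms(3) by simp
  ultimately show "c < dir_dist w \<Omega> x" by simp
qed

lemma dir_dist_pos:
  assumes "open \<Omega>" "bounded \<Omega>" "w \<noteq> 0" "x \<in> \<Omega>"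
  shows "0 < dir_dist w \<Omega> x"
  using less_dir_dist_iff[OF assms(1-3), of 0 x] assms(4) by simp

lemma dir_dist_le_reach:
  assumes "open \<Omega>" "bounded \<Omega>" "w \<noteq> 0" "x \<in> \<Omega>"
  shows "dir_dist w \<Omega> x \<le> dir_reach w \<Omega> x"
proof (rule dense_le_bounded[OF dir_dist_pos[OF assms]])
  fix c assume c: "0 < c" "c < dir_dist w \<Omega> x"
  then have "x + c *\<^sub>R w \<in> \<Omega>" using dir_dist_le[of x c w \<Omega>] by force
  from dir_reach_ge[OF assms(2,3) this] show "c \<le> dir_reach w \<Omega> x" using c by simp
qed

text \<open>The integrand in the definition of \<open>M\<close>, with value \<open>0\<close> at the zero vector and outside the domain so that
  it is Borel measurable on the whole product space.\<close>

definition dir_weight :: "'a::euclidean_space set \<Rightarrow> 'a \<Rightarrow> 'a \<Rightarrow> real" where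
  "dir_weight \<Omega> w x = (if w \<noteq> 0 \<and> x \<in> \<Omega> then 1 / dir_dist w \<Omega> x + 1 / dir_reach w \<Omega> x else 0)"

text \<open>The distance is lower semicontinuous, because its complementary level sets are projections of closed
  sets along compact segments. So is the reach, whose level sets are unions of open sets.\<close>

lemma dir_weight_measurable:
  assumes "open \<Omega>" "bounded \<Omega>"
  shows "(\<lambda>(w, x). dir_weight \<Omega> w x) \<in> borel_measurable (borel \<Otimes>\<^sub>M borel)"
proof -
  let ?U = "{z. fst z \<noteq> 0 \<and> snd z \<in> \<Omega>} :: ('a \<times> 'a) set"
  have U: "?U = (- {0}) \<times> \<Omega>" by auto
  have oU: "open ?U" unfolding U using assms by (intro open_Times) auto
  have line: "continuous_on UNIV (\<lambda>(t::real, z::'a \<times> 'a). snd z + t *\<^sub>R fst z)"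
    unfolding case_prod_beta by (intro continuous_intros)
  have d: "(\<lambda>z. if z \<in> ?U then dir_dist (fst z) \<Omega> (snd z) else 0) \<in> borel_measurable borel"
  proof (rule borel_measurableI_greater)
    fix c :: real
    show "{z \<in> space borel. c < (if z \<in> ?U then dir_dist (fst z) \<Omega> (snd z) else 0)} \<in> sets borel"
    proof (cases "0 \<le> c")
      case True
      have cl: "closed {z. \<exists>t. t \<in> {-c..c} \<and> (t, z) \<in> {(t, z). snd z + t *\<^sub>R fst z \<in> - \<Omega>}}"
      proof (rule closed_compact_projection)
        have "{(t, z). snd z + t *\<^sub>R fst z \<in> - \<Omega>} = (\<lambda>(t::real, z::'a \<times> 'a). snd z + t *\<^sub>R fst z) -` (- \<Omega>)" by auto
        then show "closed {(t, z). snd z + t *\<^sub>R fst z \<in> - \<Omega>}"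
          using closed_vimage[OF _ line, of "- \<Omega>"] assms(1) by (simp add: closed_def)
      qed simp
      have "{z \<in> space borel. c < (if z \<in> ?U then dir_dist (fst z) \<Omega> (snd z) else 0)}
        = ?U \<inter> - {z. \<exists>t. t \<in> {-c..c} \<and> (t, z) \<in> {(t, z). snd z + t *\<^sub>R fst z \<in> - \<Omega>}}"
        using True less_dir_dist_iff[OF assms _ True] by auto
      then show ?thesis using oU cl by simp
    next
      case False
      have "c < dir_dist (fst z) \<Omega> (snd z)" if "z \<in> ?U" for z
        using dir_dist_pos[OF assms, of "fst z" "snd z"] that False by auto
      then have "{z \<in> space borel. c < (if z \<in> ?U then dir_dist (fst z) \<Omega> (snd z) else 0)} = UNIV"
        using False by auto
      then show ?thesis by simp
    qed
  qed
  have r: "(\<lambda>z. if z \<in> ?U then dir_reach (fst z) \<Omega> (snd z) else 0) \<in> borel_measurable borel"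
  proof (rule borel_measurableI_greater)
    fix c :: real
    show "{z \<in> space borel. c < (if z \<in> ?U then dir_reach (fst z) \<Omega> (snd z) else 0)} \<in> sets borel"
    proof (cases "0 \<le> c")
      case True
      have op: "open {z::'a \<times> 'a. snd z + t *\<^sub>R fst z \<in> \<Omega>}" for t
      proof -
        have "continuous_on UNIV (\<lambda>z::'a \<times> 'a. snd z + t *\<^sub>R fst z)" by (intro continuous_intros)
        from open_vimage[OF assms(1) this] show ?thesis by (simp add: vimage_def)
      qed
      have "c < dir_reach (fst z) \<Omega> (snd z) \<longleftrightarrow> (\<exists>t. c < \<bar>t\<bar> \<and> snd z + t *\<^sub>R fst z \<in> \<Omega>)" if z: "z \<in> ?U" for z
      proof
        assume c: "c < dir_reach (fst z) \<Omega> (snd z)"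
        have "snd z + 0 *\<^sub>R fst z \<in> \<Omega>" using z by simp
        then have "{\<bar>t\<bar> |t. snd z + t *\<^sub>R fst z \<in> \<Omega>} \<noteq> {}" by blast
        from less_cSupD[OF this c[unfolded dir_reach_def]]
        obtain y where "y \<in> {\<bar>t\<bar> |t. snd z + t *\<^sub>R fst z \<in> \<Omega>}" "c < y" by blast
        then show "\<exists>t. c < \<bar>t\<bar> \<and> snd z + t *\<^sub>R fst z \<in> \<Omega>" by blast
      next
        assume "\<exists>t. c < \<bar>t\<bar> \<and> snd z + t *\<^sub>R fst z \<in> \<Omega>"
        then obtain t where t: "c < \<bar>t\<bar>" "snd z + t *\<^sub>R fst z \<in> \<Omega>" by blast
        have "fst z \<noteq> 0" using z by simp
        from dir_reach_ge[OF assms(2) this t(2)] show "c < dir_reach (fst z) \<Omega> (snd z)" using t(1) by linarith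
      qed
      then have "{z \<in> space borel. c < (if z \<in> ?U then dir_reach (fst z) \<Omega> (snd z) else 0)}
        = ?U \<inter> (\<Union>t\<in>{t. c < \<bar>t\<bar>}. {z. snd z + t *\<^sub>R fst z \<in> \<Omega>})"
        using True by auto
      moreover have "open \<dots>" using oU op by (intro open_Int open_UN) auto
      ultimately show ?thesis by simp
    next
      case False
      have "c < dir_reach (fst z) \<Omega> (snd z)" if "z \<in> ?U" for z
        using dir_dist_pos[OF assms, of "fst z" "snd z"] dir_dist_le_reach[OF assms, of "fst z" "snd z"] that False by auto
      then have "{z \<in> space borel. c < (if z \<in> ?U then dir_reach (fst z) \<Omega> (snd z) else 0)} = UNIV"
        using False by auto
      then show ?thesis by simp
    qed
  qed
  have "(\<lambda>z. 1 / (if z \<in> ?U then dir_dist (fst z) \<Omega> (snd z) else 0)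
      + 1 / (if z \<in> ?U then dir_reach (fst z) \<Omega> (snd z) else 0)) \<in> borel_measurable borel"
    using d r by measurable
  also have "(\<lambda>z. 1 / (if z \<in> ?U then dir_dist (fst z) \<Omega> (snd z) else 0)
      + 1 / (if z \<in> ?U then dir_reach (fst z) \<Omega> (snd z) else 0)) = (\<lambda>(w, x). dir_weight \<Omega> w x)"
    by (auto simp: dir_weight_def fun_eq_iff)
  finally show ?thesis by (simp add: borel_prod)
qed

lemma dir_weight_nonneg: "open \<Omega> \<Longrightarrow> bounded \<Omega> \<Longrightarrow> 0 \<le> dir_weight \<Omega> w x"
  using dir_dist_pos[of \<Omega> w x] dir_dist_le_reach[of \<Omega> w x]
  by (auto simp: dir_weight_def intro!: add_nonneg_nonneg divide_nonneg_nonneg)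

text \<open>The distance to the complement along the line is at least the smaller of \<open>s - l\<close> and \<open>r - s\<close>, and the
  reach is at least the larger one.\<close>

lemma dir_weight_slice_le:
  fixes \<Omega> :: "'a::euclidean_space set"
  assumes O: "open \<Omega>" "bounded \<Omega>" and w: "w \<noteq> 0"
    and lr: "l < s" "s < r" and sub: "{l<..<r} \<subseteq> {t. x + t *\<^sub>R w \<in> \<Omega>}"
    and out: "x + l *\<^sub>R w \<notin> \<Omega>" "x + r *\<^sub>R w \<notin> \<Omega>"
  shows "dir_weight \<Omega> w (x + s *\<^sub>R w) \<le> 1 / (s - l) + 1 / (r - s)"
proof -
  let ?y = "x + s *\<^sub>R w"
  have shift: "?y + t *\<^sub>R w = x + (s + t) *\<^sub>R w" for t by (simp add: scaleR_add_left)
  have y: "?y \<in> \<Omega>" using lr sub by auto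
  have d: "min (s - l) (r - s) \<le> dir_dist w \<Omega> ?y"
  proof (rule dir_dist_ge[OF O(2) w])
    fix t assume "?y + t *\<^sub>R w \<notin> \<Omega>"
    then have "s + t \<notin> {l<..<r}" using sub unfolding shift by blast
    then show "min (s - l) (r - s) \<le> \<bar>t\<bar>" by (auto simp: min_def abs_if)
  qed
  have R: "s - l \<le> dir_reach w \<Omega> ?y"
  proof (rule dense_le_bounded[of 0])
    fix t assume "0 < t" "t < s - l"
    then have "s + (- t) \<in> {l<..<r}" using lr by auto
    then have "?y + (- t) *\<^sub>R w \<in> \<Omega>" using sub unfolding shift by blast
    from dir_reach_ge[OF O(2) w this] show "t \<le> dir_reach w \<Omega> ?y" by simp
  qed (use lr in auto)
  have L: "r - s \<le> dir_reach w \<Omega> ?y"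
  proof (rule dense_le_bounded[of 0])
    fix t assume "0 < t" "t < r - s"
    then have "s + t \<in> {l<..<r}" using lr by auto
    then have "?y + t *\<^sub>R w \<in> \<Omega>" using sub unfolding shift by blast
    from dir_reach_ge[OF O(2) w this] show "t \<le> dir_reach w \<Omega> ?y" by simp
  qed (use lr in auto)
  have "1 / dir_dist w \<Omega> ?y \<le> 1 / min (s - l) (r - s)"
    using d lr by (intro divide_left_mono mult_pos_pos) auto
  moreover have "1 / dir_reach w \<Omega> ?y \<le> 1 / max (s - l) (r - s)"
    using R L lr by (intro divide_left_mono mult_pos_pos) (auto simp: max_def)
  ultimately show ?thesis using w y by (auto simp: dir_weight_def min_def max_def split: if_splits)
qed

text \<open>Let \<open>e\<close> be normal to a hyperplane that separates \<open>\<Omega>\<close> from a nearest point \<open>z\<close> of its complement. The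
  line through \<open>x\<close> in direction \<open>w\<close> meets the hyperplane, and hence leaves \<open>\<Omega>\<close>, after a length of at most
  \<open>dist x z / |w \<bullet> e|\<close>.\<close>

lemma dir_weight_convex_ge:
  fixes \<Omega> :: "'a::euclidean_space set"
  assumes O: "open \<Omega>" "bounded \<Omega>" "convex \<Omega>" and x: "x \<in> \<Omega>"
  obtains e where "norm e = 1" "\<And>w. w \<noteq> 0 \<Longrightarrow> \<bar>w \<bullet> e\<bar> / infdist x (- \<Omega>) \<le> dir_weight \<Omega> w x"
    "0 < infdist x (- \<Omega>)"
proof -
  have ne: "- \<Omega> \<noteq> {}" using O(2) not_bounded_UNIV by (metis Compl_empty_eq double_compl)
  have cl: "closed (- \<Omega>)" using O(1) by (simp add: closed_def)
  obtain z where z: "z \<notin> \<Omega>" "infdist x (- \<Omega>) = dist x z"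
    using infdist_attains_inf[OF cl ne] by auto
  have D: "0 < infdist x (- \<Omega>)" unfolding z(2) using z(1) x by auto
  obtain a b where ab: "a \<noteq> 0" "\<And>y. y \<in> \<Omega> \<Longrightarrow> a \<bullet> y \<le> b" "b \<le> a \<bullet> z"
    using separating_hyperplane_sets[of \<Omega> "{z}"] O(3) x z(1) by auto
  have strict: "a \<bullet> y < a \<bullet> z" if y: "y \<in> \<Omega>" for y
  proof -
    obtain d where d: "0 < d" "ball y d \<subseteq> \<Omega>" using O(1) y open_contains_ball by blast
    define h where "h = (d / (2 * norm a)) *\<^sub>R a"
    have "norm h < d" using ab(1) d by (simp add: h_def)
    then have "y + h \<in> \<Omega>" using d(2) by (auto simp: dist_norm subset_iff)
    then have "a \<bullet> (y + h) \<le> a \<bullet> z" using ab by (meson order_trans)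
    moreover have "0 < a \<bullet> h" using ab(1) d by (simp add: h_def)
    ultimately show ?thesis by (simp add: inner_add_right)
  qed
  define e where "e = a /\<^sub>R norm a"
  have e: "norm e = 1" using ab(1) by (simp add: e_def)
  have strict': "e \<bullet> y < e \<bullet> z" if "y \<in> \<Omega>" for y
    using strict[OF that] ab(1) by (simp add: e_def divide_strict_right_mono)
  have "\<bar>w \<bullet> e\<bar> / infdist x (- \<Omega>) \<le> dir_weight \<Omega> w x" if w: "w \<noteq> 0" for w
  proof (cases "w \<bullet> e = 0")
    case True
    then show ?thesis using dir_weight_nonneg[OF O(1,2)] by simp
  next
    case False
    define t where "t = (e \<bullet> (z - x)) / (w \<bullet> e)"
    have "e \<bullet> (x + t *\<^sub>R w) = e \<bullet> z"
      using False by (simp add: t_def inner_add_right inner_diff_right inner_commute)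
    then have "x + t *\<^sub>R w \<notin> \<Omega>" using strict' by force
    then have "dir_dist w \<Omega> x \<le> \<bar>t\<bar>" by (rule dir_dist_le)
    also have "\<bar>t\<bar> = \<bar>e \<bullet> (z - x)\<bar> / \<bar>w \<bullet> e\<bar>" by (simp add: t_def)
    also have "\<dots> \<le> infdist x (- \<Omega>) / \<bar>w \<bullet> e\<bar>"
      using Cauchy_Schwarz_ineq2[of e "z - x"] e z(2)
      by (intro divide_right_mono) (auto simp: dist_norm norm_minus_commute)
    finally have dd: "dir_dist w \<Omega> x \<le> infdist x (- \<Omega>) / \<bar>w \<bullet> e\<bar>" .
    have dp: "0 < dir_dist w \<Omega> x" by (rule dir_dist_pos[OF O(1,2) w x])
    have "\<bar>w \<bullet> e\<bar> / infdist x (- \<Omega>) = 1 / (infdist x (- \<Omega>) / \<bar>w \<bullet> e\<bar>)" by simp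
    also have "\<dots> \<le> 1 / dir_dist w \<Omega> x"
      using dd dp D False by (intro divide_left_mono mult_pos_pos divide_pos_pos) auto
    also have "\<dots> \<le> dir_weight \<Omega> w x"
      using w x dp dir_dist_le_reach[OF O(1,2) w x] by (simp add: dir_weight_def)
    finally show ?thesis .
  qed
  then show ?thesis using that e D by blast
qed

section \<open>The energy as an average over lines\<close>

lemma measurable_lborel_sphere:
  assumes "(\<lambda>(x, w). f x w) \<in> borel_measurable (borel \<Otimes>\<^sub>M borel)"
  shows "(\<lambda>(x, w). f x w) \<in> borel_measurable (lborel \<Otimes>\<^sub>M (sphere_measure :: 'b::euclidean_space measure))"
proof -
  have "(\<lambda>z. (fst z, snd z)) \<in> lborel \<Otimes>\<^sub>M (sphere_measure :: 'b measure) \<rightarrow>\<^sub>M borel \<Otimes>\<^sub>M borel"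
    by (intro measurable_Pair measurable_compose[OF measurable_snd sphere_measure_id_measurable]) simp_all
  from measurable_compose[OF this assms] show ?thesis by (simp add: case_prod_beta)
qed

lemma Fubini_sphere:
  fixes f :: "'a::euclidean_space \<Rightarrow> 'b::euclidean_space \<Rightarrow> ennreal"
  assumes "(\<lambda>(x, w). f x w) \<in> borel_measurable (borel \<Otimes>\<^sub>M borel)"
  shows "(\<integral>\<^sup>+x. \<integral>\<^sup>+w. f x w \<partial>sphere_measure \<partial>lborel) = (\<integral>\<^sup>+w. \<integral>\<^sup>+x. f x w \<partial>lborel \<partial>sphere_measure)"
proof -
  interpret pair_sigma_finite lborel "sphere_measure :: 'b measure"
    by (intro pair_sigma_finite.intro sphere_measure.sigma_finite_measure_axioms lborel.sigma_finite_measure_axioms)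
  show ?thesis by (rule Fubini'[symmetric]) (rule measurable_lborel_sphere[OF assms])
qed

lemma nn_integral_polar_around:
  fixes f :: "'a::euclidean_space \<Rightarrow> ennreal"
  assumes [measurable]: "f \<in> borel_measurable borel"
  shows "2 * (\<integral>\<^sup>+y. f y \<partial>lborel)
    = (\<integral>\<^sup>+w. (\<integral>\<^sup>+r. f (x + r *\<^sub>R w) * ennreal (\<bar>r\<bar> ^ (DIM('a) - 1)) \<partial>lborel) \<partial>sphere_measure)"
proof -
  have "(\<integral>\<^sup>+y. f y \<partial>lborel) = (\<integral>\<^sup>+h. f (x + h) \<partial>lborel)"
    by (rule nn_integral_lborel_translate[symmetric]) simp
  then show ?thesis using nn_integral_polar[of "\<lambda>h. f (x + h)"] by simp
qed

text \<open>The Jacobian of polar coordinates reduces the kernel to the one-dimensional one.\<close>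

lemma polar_kernel:
  fixes w :: "'a::euclidean_space"
  assumes w: "norm w = 1"
  shows "c / norm (x - (x + r *\<^sub>R w)) powr (real DIM('a) + \<alpha>) * \<bar>r\<bar> ^ (DIM('a) - 1) = c / \<bar>r\<bar> powr (1 + \<alpha>)"
proof (cases "r = 0")
  case False
  have n: "norm (x - (x + r *\<^sub>R w)) = \<bar>r\<bar>" using w by simp
  have "\<bar>r\<bar> ^ (DIM('a) - 1) = \<bar>r\<bar> powr real (DIM('a) - 1)" by (subst powr_realpow) (use False in simp_all)
  also have "real (DIM('a) - 1) = real DIM('a) - 1" by (simp add: of_nat_diff Suc_leI)
  finally have "\<bar>r\<bar> powr (1 + \<alpha>) * \<bar>r\<bar> ^ (DIM('a) - 1) = \<bar>r\<bar> powr (real DIM('a) + \<alpha>)"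
    by (simp add: add.commute flip: powr_add)
  then show ?thesis unfolding n using False by (simp add: field_simps)
qed simp

text \<open>In polar coordinates around \<open>x\<close> the Jacobian turns the kernel into \<open>1 / |r|\<^bsup>1 + \<alpha>\<^esup>\<close>; the integral over
  \<open>x\<close> is then split into lines parallel to \<open>w\<close>, and \<open>r = t - s\<close> on each line.\<close>

lemma frac_energy_slices:
  fixes \<Omega> :: "(real ^ 'n::finite) set"
  assumes O: "open \<Omega>" and v[measurable]: "v \<in> borel_measurable borel" and uv: "\<And>x. x \<in> \<Omega> \<Longrightarrow> v x = u x"
  shows "2 * frac_energy \<alpha> \<Omega> u
    = (\<integral>\<^sup>+w. (\<integral>\<^sup>+x. (\<integral>\<^sup>+s\<in>{s. x + s *\<^sub>R w \<in> \<Omega>}. (\<integral>\<^sup>+t\<in>{t. x + t *\<^sub>R w \<in> \<Omega>}.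
        ennreal ((v (x + s *\<^sub>R w) - v (x + t *\<^sub>R w))\<^sup>2 / \<bar>s - t\<bar> powr (1 + \<alpha>)) \<partial>lborel) \<partial>lborel)
        * indicator {x. 0 \<le> x \<bullet> w \<and> x \<bullet> w < 1} x \<partial>lborel) \<partial>sphere_measure)"
proof -
  let ?n = "real CARD('n)"
  let ?q = "\<lambda>w x. indicator {x. 0 \<le> x \<bullet> w \<and> x \<bullet> w < 1} x :: ennreal"
  have [measurable]: "\<Omega> \<in> sets borel" using O by simp
  let ?F = "\<lambda>x y. ennreal ((v x - v y)\<^sup>2 / norm (x - y) powr (?n + \<alpha>)) * (indicator \<Omega> x * indicator \<Omega> y)"
  let ?G = "\<lambda>x w r. ennreal ((v x - v (x + r *\<^sub>R w))\<^sup>2 / \<bar>r\<bar> powr (1 + \<alpha>)) * (indicator \<Omega> x * indicator \<Omega> (x + r *\<^sub>R w))"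
  have "frac_energy \<alpha> \<Omega> u = (\<integral>\<^sup>+z. ?F (fst z) (snd z) \<partial>lborel)"
    unfolding frac_energy_def
    by (intro nn_integral_cong) (auto simp: uv indicator_def)
  also have "\<dots> = (\<integral>\<^sup>+z. (\<lambda>(x, y). ?F x y) z \<partial>(lborel \<Otimes>\<^sub>M lborel))"
    by (simp add: lborel_prod case_prod_beta)
  also have "\<dots> = (\<integral>\<^sup>+x. \<integral>\<^sup>+y. ?F x y \<partial>lborel \<partial>lborel)"
  proof -
    have "(\<lambda>(x, y). ?F x y) \<in> borel_measurable (lborel \<Otimes>\<^sub>M lborel)" by measurable
    from lborel.nn_integral_fst[OF this] show ?thesis by simp
  qed
  finally have "2 * frac_energy \<alpha> \<Omega> u = (\<integral>\<^sup>+x. 2 * (\<integral>\<^sup>+y. ?F x y \<partial>lborel) \<partial>lborel)"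
    by (simp add: nn_integral_cmult)
  also have "\<dots> = (\<integral>\<^sup>+x. (\<integral>\<^sup>+w. (\<integral>\<^sup>+r. ?G x w r \<partial>lborel) \<partial>sphere_measure) \<partial>lborel)"
  proof (rule nn_integral_cong)
    fix x :: "real ^ 'n"
    have "2 * (\<integral>\<^sup>+y. ?F x y \<partial>lborel)
      = (\<integral>\<^sup>+w. (\<integral>\<^sup>+r. ?F x (x + r *\<^sub>R w) * ennreal (\<bar>r\<bar> ^ (DIM(real ^ 'n) - 1)) \<partial>lborel) \<partial>sphere_measure)"
      by (rule nn_integral_polar_around) measurable
    also have "\<dots> = (\<integral>\<^sup>+w. (\<integral>\<^sup>+r. ?G x w r \<partial>lborel) \<partial>sphere_measure)"
    proof (rule nn_integral_cong, rule nn_integral_cong)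
      fix w :: "real ^ 'n" and r :: real assume "w \<in> space sphere_measure"
      then have w: "norm w = 1" by (simp add: space_sphere_measure)
      let ?c = "(v x - v (x + r *\<^sub>R w))\<^sup>2"
      have "ennreal (?c / norm (x - (x + r *\<^sub>R w)) powr (?n + \<alpha>)) * ennreal (\<bar>r\<bar> ^ (DIM(real ^ 'n) - 1))
        = ennreal (?c / norm (x - (x + r *\<^sub>R w)) powr (?n + \<alpha>) * \<bar>r\<bar> ^ (DIM(real ^ 'n) - 1))"
        by (rule ennreal_mult'[symmetric]) simp
      also have "\<dots> = ennreal (?c / \<bar>r\<bar> powr (1 + \<alpha>))"
        using polar_kernel[OF w, of ?c x r \<alpha>] by simp
      finally show "?F x (x + r *\<^sub>R w) * ennreal (\<bar>r\<bar> ^ (DIM(real ^ 'n) - 1)) = ?G x w r"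
        by (simp only: mult_ac)
    qed
    finally show "2 * (\<integral>\<^sup>+y. ?F x y \<partial>lborel) = (\<integral>\<^sup>+w. (\<integral>\<^sup>+r. ?G x w r \<partial>lborel) \<partial>sphere_measure)" .
  qed
  also have "\<dots> = (\<integral>\<^sup>+w. (\<integral>\<^sup>+x. (\<integral>\<^sup>+r. ?G x w r \<partial>lborel) \<partial>lborel) \<partial>sphere_measure)"
    by (rule Fubini_sphere) measurable
  also have "\<dots> = (\<integral>\<^sup>+w. (\<integral>\<^sup>+x. (\<integral>\<^sup>+s\<in>{s. x + s *\<^sub>R w \<in> \<Omega>}. (\<integral>\<^sup>+t\<in>{t. x + t *\<^sub>R w \<in> \<Omega>}.
        ennreal ((v (x + s *\<^sub>R w) - v (x + t *\<^sub>R w))\<^sup>2 / \<bar>s - t\<bar> powr (1 + \<alpha>)) \<partial>lborel) \<partial>lborel) * ?q w x \<partial>lborel) \<partial>sphere_measure)"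
  proof (rule nn_integral_cong)
    fix w :: "real ^ 'n" assume "w \<in> space sphere_measure"
    then have w: "norm w = 1" by (simp add: space_sphere_measure)
    have "(\<integral>\<^sup>+x. (\<integral>\<^sup>+r. ?G x w r \<partial>lborel) \<partial>lborel)
      = (\<integral>\<^sup>+x. (\<integral>\<^sup>+s. (\<integral>\<^sup>+r. ?G (x + s *\<^sub>R w) w r \<partial>lborel) \<partial>lborel) * ?q w x \<partial>lborel)"
      by (rule nn_integral_lines[OF _ w]) measurable
    also have "\<dots> = (\<integral>\<^sup>+x. (\<integral>\<^sup>+s\<in>{s. x + s *\<^sub>R w \<in> \<Omega>}. (\<integral>\<^sup>+t\<in>{t. x + t *\<^sub>R w \<in> \<Omega>}.
        ennreal ((v (x + s *\<^sub>R w) - v (x + t *\<^sub>R w))\<^sup>2 / \<bar>s - t\<bar> powr (1 + \<alpha>)) \<partial>lborel) \<partial>lborel) * ?q w x \<partial>lborel)"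
    proof (rule nn_integral_cong, rule arg_cong2[where f = "(*)", OF _ refl], rule nn_integral_cong)
      fix x :: "real ^ 'n" and s :: real
      let ?H = "\<lambda>t. ennreal ((v (x + s *\<^sub>R w) - v (x + t *\<^sub>R w))\<^sup>2 / \<bar>s - t\<bar> powr (1 + \<alpha>))
        * indicator {t. x + t *\<^sub>R w \<in> \<Omega>} t * indicator {s. x + s *\<^sub>R w \<in> \<Omega>} s"
      have "(\<integral>\<^sup>+r. ?G (x + s *\<^sub>R w) w r \<partial>lborel) = (\<integral>\<^sup>+r. ?H (s + r) \<partial>lborel)"
      proof (rule nn_integral_cong)
        fix r :: real
        have "x + s *\<^sub>R w + r *\<^sub>R w = x + (s + r) *\<^sub>R w" by (simp add: scaleR_add_left)
        then show "?G (x + s *\<^sub>R w) w r = ?H (s + r)" by (simp only:) (simp add: indicator_def)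
      qed
      also have "\<dots> = (\<integral>\<^sup>+t. ?H t \<partial>lborel)"
        by (rule nn_integral_lborel_translate) measurable
      also have "\<dots> = (\<integral>\<^sup>+t\<in>{t. x + t *\<^sub>R w \<in> \<Omega>}. ennreal ((v (x + s *\<^sub>R w) - v (x + t *\<^sub>R w))\<^sup>2 / \<bar>s - t\<bar> powr (1 + \<alpha>)) \<partial>lborel)
          * indicator {s. x + s *\<^sub>R w \<in> \<Omega>} s"
        by (rule nn_integral_multc) measurable
      finally show "(\<integral>\<^sup>+r. ?G (x + s *\<^sub>R w) w r \<partial>lborel) = \<dots>" .
    qed
    finally show "(\<integral>\<^sup>+x. (\<integral>\<^sup>+r. ?G x w r \<partial>lborel) \<partial>lborel) = \<dots>" .
  qed
  finally show ?thesis .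
qed

text \<open>The one-dimensional inequality is applied to every slice of \<open>\<Omega>\<close> and integrated over lines and
  directions. The directional weight enters as the function \<open>m\<close> of \<open>hardy_open_set\<close>.\<close>

lemma hardy_sphere_average:
  fixes \<Omega> :: "(real ^ 'n::finite) set"
  assumes a: "1 < \<alpha>" "\<alpha> < 2" and O: "bounded_domain \<Omega>" and u: "u \<in> Cc \<Omega>"
  shows "(\<integral>\<^sup>+x\<in>\<Omega>. ennreal ((u x)\<^sup>2) * (ennreal (kappa 1 \<alpha>) * (\<integral>\<^sup>+w. ennreal (dir_weight \<Omega> w x powr \<alpha>) \<partial>sphere_measure)) \<partial>lborel)
     + (\<integral>\<^sup>+x\<in>\<Omega>. ennreal ((u x)\<^sup>2) * (ennreal (remainder_const 1 \<alpha> / diameter \<Omega>) *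
        (\<integral>\<^sup>+w. ennreal (dir_weight \<Omega> w x powr (\<alpha> - 1)) \<partial>sphere_measure)) \<partial>lborel)
    \<le> frac_energy \<alpha> \<Omega> u"
proof -
  have op: "open \<Omega>" and bd: "bounded \<Omega>" and ne: "\<Omega> \<noteq> {}" using O by (auto simp: bounded_domain_def)
  have [measurable]: "\<Omega> \<in> sets borel" using op by simp
  define v where "v x = indicator \<Omega> x * u x" for x
  obtain M \<delta> where v[measurable]: "v \<in> borel_measurable borel" and M: "\<And>x. \<bar>v x\<bar> \<le> M" and d: "0 < \<delta>"
    and supp: "\<And>x y. v x \<noteq> 0 \<Longrightarrow> y \<notin> \<Omega> \<Longrightarrow> \<delta> \<le> dist x y"
    using Cc_zero_extension[OF op u] unfolding v_def by metis
  have vu: "v x = u x" if "x \<in> \<Omega>" for x using that by (simp add: v_def)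
  let ?m = "dir_weight \<Omega>"
  have [measurable]: "(\<lambda>(w, x). ?m w x) \<in> borel_measurable (borel \<Otimes>\<^sub>M borel)"
    by (rule dir_weight_measurable[OF op bd])
  define D where "D = diameter \<Omega>"
  have D: "0 < D"
  proof -
    obtain x where x: "x \<in> \<Omega>" using ne by auto
    obtain e where e: "0 < e" "ball x e \<subseteq> \<Omega>" using op x open_contains_ball by blast
    obtain b :: "real ^ 'n" where b: "norm b = 1" using vector_choose_size[of 1] by auto
    have "dist x (x + (e / 2) *\<^sub>R b) = e / 2" using e b by (simp add: dist_norm)
    moreover have "x + (e / 2) *\<^sub>R b \<in> \<Omega>" using e calculation by (auto simp: subset_iff)
    ultimately show ?thesis using diameter_bounded_bound[OF bd x] e unfolding D_def by fastforce
  qed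
  let ?p = "\<lambda>w x. kappa 1 \<alpha> * ?m w x powr \<alpha> + remainder_const 1 \<alpha> / D * ?m w x powr (\<alpha> - 1)"
  let ?g = "\<lambda>x w. ennreal ((v x)\<^sup>2 * ?p w x) * indicator \<Omega> x"
  let ?q = "\<lambda>w x. indicator {x. 0 \<le> x \<bullet> w \<and> x \<bullet> w < 1} x :: ennreal"
  have line: "2 * (\<integral>\<^sup>+s. ?g (x + s *\<^sub>R w) w \<partial>lborel)
      \<le> (\<integral>\<^sup>+s\<in>{s. x + s *\<^sub>R w \<in> \<Omega>}. (\<integral>\<^sup>+t\<in>{t. x + t *\<^sub>R w \<in> \<Omega>}.
        ennreal ((v (x + s *\<^sub>R w) - v (x + t *\<^sub>R w))\<^sup>2 / \<bar>s - t\<bar> powr (1 + \<alpha>)) \<partial>lborel) \<partial>lborel)"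
    if w: "norm w = 1" for x w
  proof -
    let ?J = "{s. x + s *\<^sub>R w \<in> \<Omega>}"
    have w0: "w \<noteq> 0" using w by auto
    have dst: "dist (x + s *\<^sub>R w) (x + t *\<^sub>R w) = \<bar>s - t\<bar>" for s t
      using w by (simp add: dist_norm flip: scaleR_diff_left)
    have "(\<integral>\<^sup>+s. ?g (x + s *\<^sub>R w) w \<partial>lborel)
      = (\<integral>\<^sup>+s\<in>?J. ennreal ((v (x + s *\<^sub>R w))\<^sup>2 * ?p w (x + s *\<^sub>R w)) \<partial>lborel)"
      by (intro nn_integral_cong) (simp add: indicator_def)
    moreover have "2 * \<dots> \<le> (\<integral>\<^sup>+s\<in>?J. (\<integral>\<^sup>+t\<in>?J.
        ennreal ((v (x + s *\<^sub>R w) - v (x + t *\<^sub>R w))\<^sup>2 / \<bar>s - t\<bar> powr (1 + \<alpha>)) \<partial>lborel) \<partial>lborel)"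
    proof (rule hardy_open_set[OF a])
      have "continuous_on UNIV (\<lambda>s. x + s *\<^sub>R w)" by (intro continuous_intros)
      from open_vimage[OF op this] show "open ?J" by (simp add: vimage_def)
      obtain B where "\<And>t. x + t *\<^sub>R w \<in> \<Omega> \<Longrightarrow> \<bar>t\<bar> \<le> B" using line_exit[OF bd w0] by metis
      then show "bounded ?J" by (auto simp: bounded_real)
      show "\<bar>v (x + s *\<^sub>R w)\<bar> \<le> M" for s by (rule M)
      show "\<delta> \<le> \<bar>s - t\<bar>" if "v (x + s *\<^sub>R w) \<noteq> 0" "t \<notin> ?J" for s t
        using supp[OF that(1), of "x + t *\<^sub>R w", unfolded dst] that(2) by simp
      show "\<bar>s - t\<bar> \<le> D" if "s \<in> ?J" "t \<in> ?J" for s t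
        using diameter_bounded_bound[OF bd, of "x + s *\<^sub>R w" "x + t *\<^sub>R w", unfolded dst] that by (simp add: D_def)
      show "0 \<le> ?m w (x + s *\<^sub>R w) \<and> ?m w (x + s *\<^sub>R w) \<le> 1 / (s - l) + 1 / (r - s)"
        if "l < s" "s < r" "{l<..<r} \<subseteq> ?J" "l \<notin> ?J" "r \<notin> ?J" for l s r
        using dir_weight_slice_le[OF op bd w0 that(1-3)] that(4,5) dir_weight_nonneg[OF op bd] by simp
      show "0 < \<delta>" "0 < D" by (rule d, rule D)
      show "(\<lambda>s. v (x + s *\<^sub>R w)) \<in> borel_measurable borel" by measurable
      show "(\<lambda>s. ?m w (x + s *\<^sub>R w)) \<in> borel_measurable borel" by measurable
    qed
    ultimately show ?thesis by (simp only:)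
  qed
  have energy: "2 * frac_energy \<alpha> \<Omega> u = (\<integral>\<^sup>+w. (\<integral>\<^sup>+x. (\<integral>\<^sup>+s\<in>{s. x + s *\<^sub>R w \<in> \<Omega>}. (\<integral>\<^sup>+t\<in>{t. x + t *\<^sub>R w \<in> \<Omega>}.
        ennreal ((v (x + s *\<^sub>R w) - v (x + t *\<^sub>R w))\<^sup>2 / \<bar>s - t\<bar> powr (1 + \<alpha>)) \<partial>lborel) \<partial>lborel) * ?q w x \<partial>lborel) \<partial>sphere_measure)"
    by (rule frac_energy_slices[OF op v vu])
  have "2 * (\<integral>\<^sup>+w. \<integral>\<^sup>+x. ?g x w \<partial>lborel \<partial>sphere_measure)
      = (\<integral>\<^sup>+w. 2 * (\<integral>\<^sup>+x. ?g x w \<partial>lborel) \<partial>sphere_measure)"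
  proof (rule nn_integral_cmult[symmetric])
    show "(\<lambda>w. \<integral>\<^sup>+x. ?g x w \<partial>lborel) \<in> borel_measurable sphere_measure"
      by (rule measurable_compose[OF sphere_measure_id_measurable]) measurable
  qed
  also have "\<dots> \<le> 2 * frac_energy \<alpha> \<Omega> u"
  proof (simp only: energy, rule nn_integral_mono)
    fix w :: "real ^ 'n" assume "w \<in> space sphere_measure"
    then have w: "norm w = 1" by (simp add: space_sphere_measure)
    have "(\<integral>\<^sup>+x. ?g x w \<partial>lborel) = (\<integral>\<^sup>+x. (\<integral>\<^sup>+s. ?g (x + s *\<^sub>R w) w \<partial>lborel) * ?q w x \<partial>lborel)"
      by (rule nn_integral_lines[OF _ w]) measurable
    then have "2 * (\<integral>\<^sup>+x. ?g x w \<partial>lborel) = 2 * (\<integral>\<^sup>+x. (\<integral>\<^sup>+s. ?g (x + s *\<^sub>R w) w \<partial>lborel) * ?q w x \<partial>lborel)"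
      by (rule arg_cong)
    also have "\<dots> = (\<integral>\<^sup>+x. 2 * ((\<integral>\<^sup>+s. ?g (x + s *\<^sub>R w) w \<partial>lborel) * ?q w x) \<partial>lborel)"
      by (rule nn_integral_cmult[symmetric]) measurable
    also have "\<dots> \<le> (\<integral>\<^sup>+x. (\<integral>\<^sup>+s\<in>{s. x + s *\<^sub>R w \<in> \<Omega>}. (\<integral>\<^sup>+t\<in>{t. x + t *\<^sub>R w \<in> \<Omega>}.
        ennreal ((v (x + s *\<^sub>R w) - v (x + t *\<^sub>R w))\<^sup>2 / \<bar>s - t\<bar> powr (1 + \<alpha>)) \<partial>lborel) \<partial>lborel) * ?q w x \<partial>lborel)"
      unfolding mult.assoc[symmetric] by (intro nn_integral_mono mult_right_mono line[OF w]) simp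
    finally show "2 * (\<integral>\<^sup>+x. ?g x w \<partial>lborel) \<le> \<dots>" .
  qed
  finally have "(\<integral>\<^sup>+w. \<integral>\<^sup>+x. ?g x w \<partial>lborel \<partial>sphere_measure) \<le> frac_energy \<alpha> \<Omega> u"
    by (simp add: ennreal_mult_le_mult_iff)
  also have "(\<integral>\<^sup>+w. \<integral>\<^sup>+x. ?g x w \<partial>lborel \<partial>sphere_measure) = (\<integral>\<^sup>+x. \<integral>\<^sup>+w. ?g x w \<partial>sphere_measure \<partial>lborel)"
    by (rule Fubini_sphere[symmetric]) measurable
  also have "\<dots> = (\<integral>\<^sup>+x. ennreal ((u x)\<^sup>2) * (ennreal (kappa 1 \<alpha>) * (\<integral>\<^sup>+w. ennreal (?m w x powr \<alpha>) \<partial>sphere_measure)) * indicator \<Omega> x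
     + ennreal ((u x)\<^sup>2) * (ennreal (remainder_const 1 \<alpha> / D) * (\<integral>\<^sup>+w. ennreal (?m w x powr (\<alpha> - 1)) \<partial>sphere_measure)) * indicator \<Omega> x \<partial>lborel)"
  proof (rule nn_integral_cong)
    fix x :: "real ^ 'n"
    have k: "0 \<le> kappa 1 \<alpha>" "0 \<le> remainder_const 1 \<alpha> / D"
      using kappa_1_nonneg[OF a] remainder_const_1_nonneg[OF a(1)] D by (auto intro: divide_nonneg_pos)
    have mm: "(\<lambda>w. ennreal (?m w x powr b)) \<in> borel_measurable sphere_measure" for b
      by (rule measurable_compose[OF sphere_measure_id_measurable]) measurable
    have "?g x w = (ennreal ((u x)\<^sup>2) * indicator \<Omega> x) *
        (ennreal (kappa 1 \<alpha>) * ennreal (?m w x powr \<alpha>) + ennreal (remainder_const 1 \<alpha> / D) * ennreal (?m w x powr (\<alpha> - 1)))" for w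
    proof (cases "x \<in> \<Omega>")
      case True
      have "ennreal (?p w x) = ennreal (kappa 1 \<alpha>) * ennreal (?m w x powr \<alpha>) + ennreal (remainder_const 1 \<alpha> / D) * ennreal (?m w x powr (\<alpha> - 1))"
        using k by (simp only: ennreal_mult'[symmetric] ennreal_plus mult_nonneg_nonneg powr_ge_zero)
      then show ?thesis using True
        by (simp only: vu[OF True] ennreal_mult'[OF zero_le_power2] indicator_simps mult_1_right)
    qed simp
    then have "(\<integral>\<^sup>+w. ?g x w \<partial>sphere_measure) = (ennreal ((u x)\<^sup>2) * indicator \<Omega> x) *
        (ennreal (kappa 1 \<alpha>) * (\<integral>\<^sup>+w. ennreal (?m w x powr \<alpha>) \<partial>sphere_measure)
        + ennreal (remainder_const 1 \<alpha> / D) * (\<integral>\<^sup>+w. ennreal (?m w x powr (\<alpha> - 1)) \<partial>sphere_measure))"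
      using mm by (simp add: nn_integral_cmult nn_integral_add)
    then show "(\<integral>\<^sup>+w. ?g x w \<partial>sphere_measure) =
        ennreal ((u x)\<^sup>2) * (ennreal (kappa 1 \<alpha>) * (\<integral>\<^sup>+w. ennreal (?m w x powr \<alpha>) \<partial>sphere_measure)) * indicator \<Omega> x
     + ennreal ((u x)\<^sup>2) * (ennreal (remainder_const 1 \<alpha> / D) * (\<integral>\<^sup>+w. ennreal (?m w x powr (\<alpha> - 1)) \<partial>sphere_measure)) * indicator \<Omega> x"
      by (simp only: distrib_left mult_ac)
  qed
  also have "\<dots> = (\<integral>\<^sup>+x\<in>\<Omega>. ennreal ((u x)\<^sup>2) * (ennreal (kappa 1 \<alpha>) * (\<integral>\<^sup>+w. ennreal (?m w x powr \<alpha>) \<partial>sphere_measure)) \<partial>lborel)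
     + (\<integral>\<^sup>+x\<in>\<Omega>. ennreal ((u x)\<^sup>2) * (ennreal (remainder_const 1 \<alpha> / D) * (\<integral>\<^sup>+w. ennreal (?m w x powr (\<alpha> - 1)) \<partial>sphere_measure)) \<partial>lborel)"
  proof (rule nn_integral_add)
    have W: "(\<lambda>x. \<integral>\<^sup>+w. ennreal (?m w x powr b) \<partial>sphere_measure) \<in> borel_measurable borel" for b
    proof -
      have "(\<lambda>(x, w). ennreal (?m w x powr b)) \<in> borel_measurable (lborel \<Otimes>\<^sub>M sphere_measure)"
        by (rule measurable_lborel_sphere) measurable
      from sphere_measure.borel_measurable_nn_integral_fst[OF this] show ?thesis by simp
    qed
    have U: "(\<lambda>x. ennreal ((u x)\<^sup>2) * (k * c x) * indicator \<Omega> x) \<in> borel_measurable lborel"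
      if [measurable]: "c \<in> borel_measurable borel" for c :: "real ^ 'n \<Rightarrow> ennreal" and k
    proof -
      have "(\<lambda>x. ennreal ((v x)\<^sup>2) * (k * c x) * indicator \<Omega> x) \<in> borel_measurable lborel" by measurable
      also have "(\<lambda>x. ennreal ((v x)\<^sup>2) * (k * c x) * indicator \<Omega> x) = (\<lambda>x. ennreal ((u x)\<^sup>2) * (k * c x) * indicator \<Omega> x)"
        by (auto simp: fun_eq_iff vu split: split_indicator)
      finally show ?thesis .
    qed
    show "(\<lambda>x. ennreal ((u x)\<^sup>2) * (ennreal (kappa 1 \<alpha>) * (\<integral>\<^sup>+w. ennreal (?m w x powr \<alpha>) \<partial>sphere_measure)) * indicator \<Omega> x) \<in> borel_measurable lborel"
      by (rule U[OF W])
    show "(\<lambda>x. ennreal ((u x)\<^sup>2) * (ennreal (remainder_const 1 \<alpha> / D) * (\<integral>\<^sup>+w. ennreal (?m w x powr (\<alpha> - 1)) \<partial>sphere_measure)) * indicator \<Omega> x) \<in> borel_measurable lborel"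
      by (rule U[OF W])
  qed
  finally show ?thesis unfolding D_def .
qed

section \<open>The Hardy inequalities in space\<close>

text \<open>The Bochner integral of a function that is not integrable is \<open>0\<close>.\<close>

lemma ennreal_integral_le_nn_integral:
  assumes "\<And>x. 0 \<le> f x"
  shows "ennreal (\<integral>x. f x \<partial>M) \<le> (\<integral>\<^sup>+x. ennreal (f x) \<partial>M)"
proof (cases "integrable M f")
  case True
  then show ?thesis using assms by (simp add: nn_integral_eq_integral)
qed (simp add: not_integrable_integral_eq)

lemma inner_axis_1: "w \<bullet> axis k (1::real) = w $ k"
  by (simp add: inner_axis)

lemma sphere_moment_Bochner:
  assumes b: "0 \<le> \<beta>"
  shows "(\<integral>w. \<bar>w $ k\<bar> powr \<beta> \<partial>(sphere_measure :: (real ^ 'n::finite) measure)) = sphere_moment CARD('n) \<beta>"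
proof -
  have "(\<integral>\<^sup>+w. ennreal (\<bar>w $ k\<bar> powr \<beta>) \<partial>(sphere_measure :: (real ^ 'n) measure)) = ennreal (sphere_moment CARD('n) \<beta>)"
    using sphere_moment_integral[of "axis k 1 :: real ^ 'n" \<beta>] b by (simp add: inner_axis_1 norm_axis_1)
  moreover have "0 \<le> sphere_moment CARD('n) \<beta>" using sphere_moment_pos[of "CARD('n)" \<beta>] b by simp
  moreover have "(\<lambda>w. \<bar>w $ k\<bar> powr \<beta>) \<in> borel_measurable (sphere_measure :: (real ^ 'n) measure)"
    by (rule measurable_compose[OF sphere_measure_id_measurable]) measurable
  ultimately show ?thesis by (subst integral_eq_nn_integral) simp_all
qed

text \<open>The surrounding power in the definition of \<open>M\<close> cancels. If the mean of the weight vanishes, both sides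
  are \<open>0\<close> by the conventions for division.\<close>

lemma hardy_M_weight:
  fixes \<Omega> :: "(real ^ 'n::finite) set"
  assumes b: "0 < \<beta>" and x: "x \<in> \<Omega>"
  shows "c / hardy_M k \<beta> \<Omega> x powr \<beta>
    = c * ((\<integral>w. dir_weight \<Omega> w x powr \<beta> \<partial>sphere_measure) / sphere_moment CARD('n) \<beta>)"
proof -
  define Q where "Q = (\<integral>w. dir_weight \<Omega> w x powr \<beta> \<partial>sphere_measure)"
  have P: "0 < sphere_moment CARD('n) \<beta>" using b by (intro sphere_moment_pos) auto
  have Q0: "0 \<le> Q" unfolding Q_def by simp
  have "(\<integral>w. (1 / dir_dist w \<Omega> x + 1 / dir_reach w \<Omega> x) powr \<beta> \<partial>sphere_measure) = Q"
    unfolding Q_def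
  proof (rule Bochner_Integration.integral_cong[OF refl])
    fix w :: "real ^ 'n" assume "w \<in> space sphere_measure"
    then have "w \<noteq> 0" by (auto simp: space_sphere_measure)
    then show "(1 / dir_dist w \<Omega> x + 1 / dir_reach w \<Omega> x) powr \<beta> = dir_weight \<Omega> w x powr \<beta>"
      using x by (simp add: dir_weight_def)
  qed
  then have h: "hardy_M k \<beta> \<Omega> x powr \<beta> = sphere_moment CARD('n) \<beta> / Q"
    using b P Q0 by (simp add: hardy_M_def sphere_moment_Bochner powr_powr)
  show ?thesis unfolding Q_def[symmetric] h by simp
qed

text \<open>For arbitrary functions, so that lower bounds of the weights can be used below without a proof that they
  are measurable.\<close>

lemma nn_integral_cmult_ge: "c * (\<integral>\<^sup>+x. f x \<partial>M) \<le> (\<integral>\<^sup>+x. c * f x \<partial>M)" for c :: ennreal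
proof -
  have "c * integral\<^sup>S M g \<le> (\<integral>\<^sup>+x. c * f x \<partial>M)" if g: "simple_function M g" "g \<le> f" for g
  proof -
    have "c * integral\<^sup>S M g = integral\<^sup>S M (\<lambda>x. c * g x)" by (rule simple_integral_mult[OF g(1), symmetric])
    also have "\<dots> = (\<integral>\<^sup>+x. c * g x \<partial>M)"
      by (rule nn_integral_eq_simple_integral[symmetric]) (use g(1) in \<open>intro simple_function_mult simple_function_const\<close>)
    also have "\<dots> \<le> (\<integral>\<^sup>+x. c * f x \<partial>M)"
      using g(2) by (intro nn_integral_mono mult_left_mono) (auto simp: le_fun_def)
    finally show ?thesis .
  qed
  then show ?thesis
    unfolding nn_integral_def[of M f] by (subst SUP_mult_left_ennreal) (auto intro!: SUP_least)
qed

lemma nn_integral_cmult_pos: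
  assumes "0 < c"
  shows "(\<integral>\<^sup>+x. ennreal c * f x \<partial>M) = ennreal c * (\<integral>\<^sup>+x. f x \<partial>M)"
proof (rule antisym)
  have c: "ennreal c * (ennreal (1 / c) * y) = y" "ennreal (1 / c) * (ennreal c * y) = y" for y
    using assms by (simp_all add: mult.assoc[symmetric] flip: ennreal_mult)
  have "ennreal (1 / c) * (\<integral>\<^sup>+x. ennreal c * f x \<partial>M) \<le> (\<integral>\<^sup>+x. f x \<partial>M)"
    using nn_integral_cmult_ge[of "ennreal (1 / c)" M "\<lambda>x. ennreal c * f x"] by (simp only: c)
  then have "ennreal c * (ennreal (1 / c) * (\<integral>\<^sup>+x. ennreal c * f x \<partial>M)) \<le> ennreal c * (\<integral>\<^sup>+x. f x \<partial>M)"
    by (rule mult_left_mono) simp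
  then show "(\<integral>\<^sup>+x. ennreal c * f x \<partial>M) \<le> ennreal c * (\<integral>\<^sup>+x. f x \<partial>M)" by (simp only: c)
qed (rule nn_integral_cmult_ge)

text \<open>The sphere averages of the directional weight may be replaced by any lower bounds; the constants in
  dimension \<open>n\<close> arise from those in dimension one by \<open>kappa_sphere_moment\<close> and \<open>remainder_sphere_moment\<close>.
  The two inequalities in space differ only in the choice of these bounds.\<close>

lemma hardy_of_weights:
  fixes \<Omega> :: "(real ^ 'n::finite) set"
  assumes a: "1 < \<alpha>" "\<alpha> < 2" and O: "bounded_domain \<Omega>" and u: "u \<in> Cc \<Omega>"
    and W1: "\<And>x. x \<in> \<Omega> \<Longrightarrow> ennreal (sphere_moment CARD('n) \<alpha> * W1 x)
        \<le> (\<integral>\<^sup>+w. ennreal (dir_weight \<Omega> w x powr \<alpha>) \<partial>sphere_measure)"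
    and W2: "\<And>x. x \<in> \<Omega> \<Longrightarrow> ennreal (sphere_moment CARD('n) (\<alpha> - 1) * W2 x)
        \<le> (\<integral>\<^sup>+w. ennreal (dir_weight \<Omega> w x powr (\<alpha> - 1)) \<partial>sphere_measure)"
  shows "ennreal (kappa CARD('n) \<alpha>) * (\<integral>\<^sup>+x\<in>\<Omega>. ennreal ((u x)\<^sup>2 * W1 x) \<partial>lborel)
     + ennreal (remainder_const CARD('n) \<alpha> * (1 / diameter \<Omega>)) * (\<integral>\<^sup>+x\<in>\<Omega>. ennreal ((u x)\<^sup>2 * W2 x) \<partial>lborel)
    \<le> ennreal (1 / 2) * frac_energy \<alpha> \<Omega> u"
proof -
  let ?n = "CARD('n)"
  let ?A = "\<lambda>x. \<integral>\<^sup>+w. ennreal (dir_weight \<Omega> w x powr \<alpha>) \<partial>sphere_measure"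
  let ?B = "\<lambda>x. \<integral>\<^sup>+w. ennreal (dir_weight \<Omega> w x powr (\<alpha> - 1)) \<partial>sphere_measure"
  let ?r = "remainder_const 1 \<alpha> / diameter \<Omega>"
  have D: "0 \<le> diameter \<Omega>"
    using O by (auto simp: bounded_domain_def intro: diameter_ge_0)
  have k0: "0 \<le> kappa 1 \<alpha>" and r0: "0 \<le> ?r"
    using kappa_1_nonneg[OF a] remainder_const_1_nonneg[OF a(1)] D by auto
  have weight: "ennreal K * (\<integral>\<^sup>+x\<in>\<Omega>. ennreal ((u x)\<^sup>2 * W x) \<partial>lborel)
      \<le> ennreal (1 / 2) * (\<integral>\<^sup>+x\<in>\<Omega>. ennreal ((u x)\<^sup>2) * (ennreal L * A x) \<partial>lborel)"
    if KL: "2 * K = P * L" and P: "0 < P" and L: "0 \<le> L"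
      and W: "\<And>x. x \<in> \<Omega> \<Longrightarrow> ennreal (P * W x) \<le> A x" for K L P W A
  proof -
    have K: "K = 1 / 2 * (L * P)" using KL by (simp add: mult.commute)
    have "ennreal K * (\<integral>\<^sup>+x\<in>\<Omega>. ennreal ((u x)\<^sup>2 * W x) \<partial>lborel)
      \<le> (\<integral>\<^sup>+x. ennreal K * (ennreal ((u x)\<^sup>2 * W x) * indicator \<Omega> x) \<partial>lborel)"
      by (rule nn_integral_cmult_ge)
    also have "\<dots> \<le> (\<integral>\<^sup>+x. ennreal (1 / 2) * (ennreal ((u x)\<^sup>2) * (ennreal L * A x) * indicator \<Omega> x) \<partial>lborel)"
    proof (rule nn_integral_mono)
      fix x
      show "ennreal K * (ennreal ((u x)\<^sup>2 * W x) * indicator \<Omega> x)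
        \<le> ennreal (1 / 2) * (ennreal ((u x)\<^sup>2) * (ennreal L * A x) * indicator \<Omega> x)"
      proof (cases "x \<in> \<Omega>")
        case True
        have "K * ((u x)\<^sup>2 * W x) = 1 / 2 * ((u x)\<^sup>2 * (L * (P * W x)))" unfolding K by (simp only: mult_ac)
        moreover have "0 \<le> K" unfolding K using P L by simp
        ultimately have "ennreal K * ennreal ((u x)\<^sup>2 * W x) = ennreal (1 / 2 * ((u x)\<^sup>2 * (L * (P * W x))))"
          by (simp only: ennreal_mult'[symmetric])
        also have "\<dots> = ennreal (1 / 2) * (ennreal ((u x)\<^sup>2) * (ennreal L * ennreal (P * W x)))"
          using L by (simp only: ennreal_mult' zero_le_power2 zero_le_divide_1_iff zero_le_numeral)
        also have "\<dots> \<le> ennreal (1 / 2) * (ennreal ((u x)\<^sup>2) * (ennreal L * A x))"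
          by (intro mult_left_mono W True) simp_all
        finally show ?thesis using True by simp
      qed simp
    qed
    also have "\<dots> = ennreal (1 / 2) * (\<integral>\<^sup>+x\<in>\<Omega>. ennreal ((u x)\<^sup>2) * (ennreal L * A x) \<partial>lborel)"
      by (rule nn_integral_cmult_pos) simp
    finally show ?thesis .
  qed
  have 1: "ennreal (kappa ?n \<alpha>) * (\<integral>\<^sup>+x\<in>\<Omega>. ennreal ((u x)\<^sup>2 * W1 x) \<partial>lborel)
      \<le> ennreal (1 / 2) * (\<integral>\<^sup>+x\<in>\<Omega>. ennreal ((u x)\<^sup>2) * (ennreal (kappa 1 \<alpha>) * ?A x) \<partial>lborel)"
    by (rule weight[OF _ _ k0 W1])
       (use a in \<open>simp_all add: kappa_sphere_moment[OF a(1), symmetric] sphere_moment_pos del: One_nat_def\<close>)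
  have 2: "ennreal (remainder_const ?n \<alpha> * (1 / diameter \<Omega>)) * (\<integral>\<^sup>+x\<in>\<Omega>. ennreal ((u x)\<^sup>2 * W2 x) \<partial>lborel)
      \<le> ennreal (1 / 2) * (\<integral>\<^sup>+x\<in>\<Omega>. ennreal ((u x)\<^sup>2) * (ennreal ?r * ?B x) \<partial>lborel)"
  proof (rule weight[OF _ _ r0 W2])
    show "2 * (remainder_const ?n \<alpha> * (1 / diameter \<Omega>)) = sphere_moment ?n (\<alpha> - 1) * ?r"
      using remainder_sphere_moment[OF a(1), of ?n] by simp
    show "0 < sphere_moment ?n (\<alpha> - 1)" using a by (intro sphere_moment_pos) auto
  qed
  have "ennreal (1 / 2) * (\<integral>\<^sup>+x\<in>\<Omega>. ennreal ((u x)\<^sup>2) * (ennreal (kappa 1 \<alpha>) * ?A x) \<partial>lborel)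
     + ennreal (1 / 2) * (\<integral>\<^sup>+x\<in>\<Omega>. ennreal ((u x)\<^sup>2) * (ennreal ?r * ?B x) \<partial>lborel)
    \<le> ennreal (1 / 2) * frac_energy \<alpha> \<Omega> u"
    unfolding distrib_left[symmetric] by (rule mult_left_mono[OF hardy_sphere_average[OF a O u]]) simp
  then show ?thesis using add_mono[OF 1 2] by (rule order_trans[rotated])
qed

theorem hardy_M_inequality:
  fixes \<Omega> :: "(real ^ 'n::finite) set"
  assumes a: "1 < \<alpha>" "\<alpha> < 2" and O: "bounded_domain \<Omega>" and u: "u \<in> Cc \<Omega>"
  shows "hardy_ineq_M k \<alpha> (kappa CARD('n) \<alpha>) \<Omega> u"
proof -
  have op: "open \<Omega>" "bounded \<Omega>" using O by (auto simp: bounded_domain_def)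
  have w: "ennreal (sphere_moment CARD('n) \<beta> * ((\<integral>w. dir_weight \<Omega> w x powr \<beta> \<partial>sphere_measure) / sphere_moment CARD('n) \<beta>))
      \<le> (\<integral>\<^sup>+w. ennreal (dir_weight \<Omega> w x powr \<beta>) \<partial>sphere_measure)" if "0 < \<beta>" for \<beta> x
  proof -
    have "0 < sphere_moment CARD('n) \<beta>" using that by (intro sphere_moment_pos) auto
    then show ?thesis using ennreal_integral_le_nn_integral[of "\<lambda>w. dir_weight \<Omega> w x powr \<beta>" sphere_measure] by simp
  qed
  have eq: "(\<integral>\<^sup>+x\<in>\<Omega>. ennreal ((u x)\<^sup>2 / hardy_M k \<beta> \<Omega> x powr \<beta>) \<partial>lborel)
     = (\<integral>\<^sup>+x\<in>\<Omega>. ennreal ((u x)\<^sup>2 * ((\<integral>w. dir_weight \<Omega> w x powr \<beta> \<partial>sphere_measure) / sphere_moment CARD('n) \<beta>)) \<partial>lborel)"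
    if "0 < \<beta>" for \<beta>
  proof (rule nn_integral_cong)
    fix x :: "real ^ 'n"
    show "ennreal ((u x)\<^sup>2 / hardy_M k \<beta> \<Omega> x powr \<beta>) * indicator \<Omega> x
     = ennreal ((u x)\<^sup>2 * ((\<integral>w. dir_weight \<Omega> w x powr \<beta> \<partial>sphere_measure) / sphere_moment CARD('n) \<beta>)) * indicator \<Omega> x"
    proof (cases "x \<in> \<Omega>")
      case True
      show ?thesis by (simp only: hardy_M_weight[OF that True])
    qed simp
  qed
  have b: "0 < \<alpha>" "0 < \<alpha> - 1" using a by auto
  show ?thesis
    unfolding hardy_ineq_M_def eq[OF b(1)] eq[OF b(2)] using b
    by (intro hardy_of_weights[OF a O u] w)
qed

lemma dist_weight_le:
  fixes \<Omega> :: "'a::euclidean_space set"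
  assumes O: "open \<Omega>" "bounded \<Omega>" "convex \<Omega>" and x: "x \<in> \<Omega>" and b: "0 \<le> \<beta>"
  shows "ennreal (sphere_moment DIM('a) \<beta> * (1 / infdist x (- \<Omega>) powr \<beta>))
    \<le> (\<integral>\<^sup>+w. ennreal (dir_weight \<Omega> w x powr \<beta>) \<partial>sphere_measure)"
proof -
  obtain e where e: "norm e = 1" and le: "\<And>w. w \<noteq> 0 \<Longrightarrow> \<bar>w \<bullet> e\<bar> / infdist x (- \<Omega>) \<le> dir_weight \<Omega> w x"
    and D: "0 < infdist x (- \<Omega>)" using dir_weight_convex_ge[OF O x] by blast
  let ?D = "infdist x (- \<Omega>) powr \<beta>"
  have "ennreal (sphere_moment DIM('a) \<beta> * (1 / ?D)) = ennreal (1 / ?D) * ennreal (sphere_moment DIM('a) \<beta>)"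
    by (subst ennreal_mult'[symmetric]) simp_all
  also have "\<dots> = ennreal (1 / ?D) * (\<integral>\<^sup>+w. ennreal (\<bar>w \<bullet> e\<bar> powr \<beta>) \<partial>sphere_measure)"
    by (simp only: sphere_moment_integral[OF e b])
  also have "\<dots> \<le> (\<integral>\<^sup>+w. ennreal (1 / ?D) * ennreal (\<bar>w \<bullet> e\<bar> powr \<beta>) \<partial>sphere_measure)"
    by (rule nn_integral_cmult_ge)
  also have "\<dots> \<le> (\<integral>\<^sup>+w. ennreal (dir_weight \<Omega> w x powr \<beta>) \<partial>sphere_measure)"
  proof (rule nn_integral_mono)
    fix w :: 'a assume "w \<in> space sphere_measure"
    then have "w \<noteq> 0" by (auto simp: space_sphere_measure)
    then have "(\<bar>w \<bullet> e\<bar> / infdist x (- \<Omega>)) powr \<beta> \<le> dir_weight \<Omega> w x powr \<beta>"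
      using le D b by (intro powr_mono2) auto
    moreover have "ennreal (1 / ?D) * ennreal (\<bar>w \<bullet> e\<bar> powr \<beta>) = ennreal ((\<bar>w \<bullet> e\<bar> / infdist x (- \<Omega>)) powr \<beta>)"
      using D by (simp add: powr_divide flip: ennreal_mult)
    ultimately show "ennreal (1 / ?D) * ennreal (\<bar>w \<bullet> e\<bar> powr \<beta>) \<le> ennreal (dir_weight \<Omega> w x powr \<beta>)"
      by (simp add: ennreal_leI)
  qed
  finally show ?thesis .
qed

theorem hardy_dist_inequality:
  fixes \<Omega> :: "(real ^ 'n::finite) set"
  assumes a: "1 < \<alpha>" "\<alpha> < 2" and O: "bounded_domain \<Omega>" "convex \<Omega>" and u: "u \<in> Cc \<Omega>"
  shows "hardy_ineq_dist \<alpha> (kappa CARD('n) \<alpha>) \<Omega> u"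
proof -
  have op: "open \<Omega>" "bounded \<Omega>" using O by (auto simp: bounded_domain_def)
  have w: "ennreal (sphere_moment CARD('n) \<beta> * (1 / infdist x (- \<Omega>) powr \<beta>))
    \<le> (\<integral>\<^sup>+w. ennreal (dir_weight \<Omega> w x powr \<beta>) \<partial>sphere_measure)" if "0 \<le> \<beta>" "x \<in> \<Omega>" for \<beta> x
    using dist_weight_le[OF op O(2) that(2,1)] by simp
  have b: "0 \<le> \<alpha>" "0 \<le> \<alpha> - 1" using a by auto
  show ?thesis
    using hardy_of_weights[OF a O(1) u w[OF b(1)] w[OF b(2)]]
    unfolding hardy_ineq_dist_def by (simp only: times_divide_eq_right mult_1_right)
qed

text \<open>On a convex domain \<open>M\<close> is at most the distance, whatever the constant is. This carries the sharpness
  from the distance version over to the version with \<open>M\<close>.\<close>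

lemma hardy_dist_of_hardy_M:
  fixes \<Omega> :: "(real ^ 'n::finite) set"
  assumes a: "1 < \<alpha>" "\<alpha> < 2" and O: "bounded_domain \<Omega>" "convex \<Omega>" and M: "hardy_ineq_M k \<alpha> c \<Omega> u"
  shows "hardy_ineq_dist \<alpha> c \<Omega> u"
proof -
  have op: "open \<Omega>" "bounded \<Omega>" using O by (auto simp: bounded_domain_def)
  have le: "(\<integral>\<^sup>+x\<in>\<Omega>. ennreal ((u x)\<^sup>2 / infdist x (- \<Omega>) powr \<beta>) \<partial>lborel)
     \<le> (\<integral>\<^sup>+x\<in>\<Omega>. ennreal ((u x)\<^sup>2 / hardy_M k \<beta> \<Omega> x powr \<beta>) \<partial>lborel)" if b: "0 < \<beta>" for \<beta>
  proof (rule nn_integral_mono)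
    fix x :: "real ^ 'n"
    show "ennreal ((u x)\<^sup>2 / infdist x (- \<Omega>) powr \<beta>) * indicator \<Omega> x
      \<le> ennreal ((u x)\<^sup>2 / hardy_M k \<beta> \<Omega> x powr \<beta>) * indicator \<Omega> x"
    proof (cases "x \<in> \<Omega>")
      case True
      let ?P = "sphere_moment CARD('n) \<beta>"
      let ?Q = "\<integral>w. dir_weight \<Omega> w x powr \<beta> \<partial>sphere_measure"
      have P: "0 < ?P" using b by (intro sphere_moment_pos) auto
      have m: "(\<lambda>w. dir_weight \<Omega> w x powr \<beta>) \<in> borel_measurable (sphere_measure :: (real ^ 'n) measure)"
      proof -
        note [measurable] = dir_weight_measurable[OF op]
        show ?thesis by (rule measurable_compose[OF sphere_measure_id_measurable]) measurable
      qed
      obtain d where d: "0 < d" "ball x d \<subseteq> \<Omega>" using op(1) True open_contains_ball by blast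
      have "dir_weight \<Omega> w x \<le> 2 / d" if "w \<in> space sphere_measure" for w
      proof -
        have w: "norm w = 1" "w \<noteq> 0" using that by (auto simp: space_sphere_measure)
        have "d \<le> dir_dist w \<Omega> x"
        proof (rule dir_dist_ge[OF op(2) w(2)])
          fix t assume "x + t *\<^sub>R w \<notin> \<Omega>"
          then have "x + t *\<^sub>R w \<notin> ball x d" using d(2) by blast
          then show "d \<le> \<bar>t\<bar>" using w by (simp add: dist_norm not_less)
        qed
        moreover have "dir_dist w \<Omega> x \<le> dir_reach w \<Omega> x" by (rule dir_dist_le_reach[OF op w(2) True])
        ultimately have "1 / dir_dist w \<Omega> x \<le> 1 / d" "1 / dir_reach w \<Omega> x \<le> 1 / d"
          using d(1) by (auto intro!: divide_left_mono)
        then show ?thesis using w True by (simp add: dir_weight_def)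
      qed
      then have bdd: "norm (dir_weight \<Omega> w x powr \<beta>) \<le> (2 / d) powr \<beta>" if "w \<in> space sphere_measure" for w
        using that dir_weight_nonneg[OF op, of w x] b by (auto intro!: powr_mono2)
      have "integrable (sphere_measure :: (real ^ 'n) measure) (\<lambda>w. dir_weight \<Omega> w x powr \<beta>)"
        by (rule sphere_measure.integrable_const_bound[OF _ m]) (use bdd in auto)
      then have "ennreal (?P * (1 / infdist x (- \<Omega>) powr \<beta>)) \<le> ennreal ?Q"
        using dist_weight_le[OF op O(2) True, of \<beta>] b by (simp add: nn_integral_eq_integral)
      then have "?P * (1 / infdist x (- \<Omega>) powr \<beta>) \<le> ?Q"
        by (subst (asm) ennreal_le_iff) simp_all
      then have "1 / infdist x (- \<Omega>) powr \<beta> \<le> ?Q / ?P" using P by (simp add: le_divide_eq mult.commute)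
      then have "(u x)\<^sup>2 * (1 / infdist x (- \<Omega>) powr \<beta>) \<le> (u x)\<^sup>2 * (?Q / ?P)" by (rule mult_left_mono) simp
      then show ?thesis using True unfolding hardy_M_weight[OF b True] by (simp add: ennreal_leI)
    qed simp
  qed
  have b: "0 < \<alpha>" "0 < \<alpha> - 1" using a by auto
  show ?thesis
    using M unfolding hardy_ineq_dist_def hardy_ineq_M_def
    by (elim order_trans[rotated]) (intro add_mono mult_left_mono le b, simp_all)
qed

section \<open>Potential bounds near an end point\<close>

text \<open>The difference of the two sides vanishes at \<open>q = 1\<close> and is monotone.\<close>

lemma two_ln_le: "1 \<le> q \<Longrightarrow> 2 * ln q \<le> q - 1 / q" for q :: real
proof -
  assume q: "1 \<le> q"
  have "1 - 1 / 1 - 2 * ln 1 \<le> q - 1 / q - 2 * ln q"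
  proof (rule DERIV_nonneg_imp_nondecreasing[OF q, of "\<lambda>q. q - 1 / q - 2 * ln q"])
    fix x :: real assume x: "1 \<le> x"
    have "((\<lambda>q. q - 1 / q - 2 * ln q) has_real_derivative (1 + 1 / x\<^sup>2 - 2 / x)) (at x)"
      using x by (auto intro!: derivative_eq_intros simp: field_simps power2_eq_square)
    moreover have "1 + 1 / x\<^sup>2 - 2 / x = (1 - 1 / x)\<^sup>2"
      by (simp add: power2_eq_square algebra_simps)
    ultimately show "\<exists>y. ((\<lambda>q. q - 1 / q - 2 * ln q) has_real_derivative y) (at x) \<and> 0 \<le> y"
      by (metis zero_le_power2)
  qed
  then show ?thesis by simp
qed

text \<open>The previous inequality with \<open>q\<close> the square root of the quotient of the larger and the smaller number.\<close>

lemma ln_diff_square_le: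
  fixes s t :: real
  assumes "0 < s" "0 < t"
  shows "(ln s - ln t)\<^sup>2 \<le> (s - t)\<^sup>2 / (s * t)"
proof -
  have *: "(ln s - ln t)\<^sup>2 \<le> (s - t)\<^sup>2 / (s * t)" if st: "0 < t" "t \<le> s" for s t :: real
  proof -
    define q where "q = sqrt (s / t)"
    have q: "1 \<le> q" using st by (simp add: q_def)
    have q2: "q\<^sup>2 = s / t" using st by (simp add: q_def)
    have "ln s - ln t = ln (q\<^sup>2)" unfolding q2 using st by (simp add: ln_div)
    also have "\<dots> = 2 * ln q" using q by (simp add: ln_realpow)
    finally have e: "ln s - ln t = 2 * ln q" .
    have "(2 * ln q)\<^sup>2 \<le> (q - 1 / q)\<^sup>2" using two_ln_le[OF q] q by (intro power_mono) auto
    also have "(q - 1 / q)\<^sup>2 = q\<^sup>2 + 1 / q\<^sup>2 - 2" using q by (simp add: power2_eq_square field_simps)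
    also have "\<dots> = (s - t)\<^sup>2 / (s * t)" unfolding q2 using st by (simp add: power2_eq_square field_simps)
    finally show ?thesis unfolding e .
  qed
  show ?thesis
  proof (cases "t \<le> s")
    case True
    then show ?thesis using *[of t s] assms by simp
  next
    case False
    then show ?thesis using *[of s t] assms by (simp add: power2_commute mult.commute)
  qed
qed

text \<open>A converse to \<open>interval_potential_bound\<close> on the left half of the interval. The divergent parts agree up
  to a multiple of \<open>\<eta>\<^bsup>2 - \<alpha>\<^esup>\<close>, and near \<open>-1\<close> the remaining factor tends to the sharp constant.\<close>

lemma interval_potential_upper:
  fixes x A b d \<eta> \<alpha> :: real
  assumes a: "1 < \<alpha>" "\<alpha> < 2" and x: "-1 < x" "x \<le> 0" and eta: "0 < \<eta>" "\<eta> < 1"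
    and A: "\<alpha> * A + b = \<eta> powr (- \<alpha>) * (1 - \<eta>\<^sup>2) powr ((\<alpha> + 1) / 2)"
    and b: "2 * b \<le> Beta ((1 + \<alpha>) / 2) ((2 - \<alpha>) / 2)"
    and small: "6 * \<eta> powr (2 - \<alpha>) \<le> d"
    and near: "(Beta ((1 + \<alpha>) / 2) ((2 - \<alpha>) / 2) * (1 - x) powr (- \<alpha>) - 1) / \<alpha> \<le> kappa 1 \<alpha> + d"
  shows "(1 - x\<^sup>2) powr (- \<alpha>) / \<alpha> *
       ((1 / \<eta> + x) powr \<alpha> + (1 / \<eta> - x) powr \<alpha> - (1 + x) powr \<alpha> - (1 - x) powr \<alpha>)
    \<le> 2 * (1 - x\<^sup>2) powr (- \<alpha>) * A + (kappa 1 \<alpha> + 2 * d) * (1 + x) powr (- \<alpha>)"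
proof -
  define B where "B = Beta ((1 + \<alpha>) / 2) ((2 - \<alpha>) / 2)"
  define q where "q = (1 - x\<^sup>2) powr (- \<alpha>)"
  define Z where "Z = \<eta> powr (2 - \<alpha>)"
  have q: "q = (1 + x) powr (- \<alpha>) * (1 - x) powr (- \<alpha>)"
  proof -
    have "1 - x\<^sup>2 = (1 + x) * (1 - x)" by (simp add: power2_eq_square algebra_simps)
    then show ?thesis using x by (simp add: q_def powr_mult)
  qed
  have q0: "0 \<le> q" by (simp add: q_def)
  have Z: "0 \<le> Z" "\<eta> powr (- \<alpha>) * \<eta>\<^sup>2 = Z"
    using eta powr_add[of \<eta> "- \<alpha>" 2] by (auto simp: Z_def)
  have ex: "\<bar>\<eta> * x\<bar> \<le> 1" using abs_mult_less_one[of \<eta> x] x eta by auto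
  have t2: "0 \<le> 2 powr \<alpha> - 2" "2 powr \<alpha> - 2 \<le> 2"
  proof -
    show "0 \<le> 2 powr \<alpha> - 2" using two_powr_ge_two[OF a(1)] by simp
    have "2 powr \<alpha> \<le> 2 powr 2" using a by (intro powr_mono) auto
    then show "2 powr \<alpha> - 2 \<le> 2" by simp
  qed
  have x1: "x\<^sup>2 \<le> 1" using x by (simp add: abs_square_le_1 abs_le_iff)
  have 3: "(1 / \<eta> + x) powr \<alpha> + (1 / \<eta> - x) powr \<alpha> \<le> 2 * \<eta> powr (- \<alpha>) + 2 * Z"
  proof -
    have e: "1 / \<eta> + x = (1 + \<eta> * x) / \<eta>" "1 / \<eta> - x = (1 - \<eta> * x) / \<eta>" using eta by (auto simp: field_simps)
    have "(1 + \<eta> * x) powr \<alpha> + (1 - \<eta> * x) powr \<alpha> \<le> 2 + (2 powr \<alpha> - 2) * (\<eta> * x)\<^sup>2"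
      using a ex by (intro powr_chord) auto
    also have "(2 powr \<alpha> - 2) * (\<eta> * x)\<^sup>2 \<le> 2 * (\<eta>\<^sup>2 * 1)"
      unfolding power_mult_distrib using t2 x1 by (intro mult_mono mult_left_mono) auto
    finally have "\<eta> powr (- \<alpha>) * ((1 + \<eta> * x) powr \<alpha> + (1 - \<eta> * x) powr \<alpha>) \<le> \<eta> powr (- \<alpha>) * (2 + 2 * \<eta>\<^sup>2)"
      by (intro mult_left_mono) auto
    moreover have "(1 / \<eta> + x) powr \<alpha> + (1 / \<eta> - x) powr \<alpha>
        = \<eta> powr (- \<alpha>) * ((1 + \<eta> * x) powr \<alpha> + (1 - \<eta> * x) powr \<alpha>)"
      unfolding e using eta ex by (simp add: powr_divide powr_minus field_simps)
    moreover have "\<eta> powr (- \<alpha>) * (2 + 2 * \<eta>\<^sup>2) = 2 * \<eta> powr (- \<alpha>) + 2 * Z"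
      using Z by (simp add: distrib_left)
    ultimately show ?thesis by simp
  qed
  have 5: "2 * \<eta> powr (- \<alpha>) - 4 * Z - B \<le> 2 * (\<alpha> * A)"
  proof -
    have e2: "0 < 1 - \<eta>\<^sup>2" using eta by (simp add: abs_square_less_1)
    have "1 - 2 * \<eta>\<^sup>2 \<le> (1 - \<eta>\<^sup>2) powr 2" using e2 zero_le_power2[of "\<eta>\<^sup>2"] by (simp add: power2_diff)
    also have "\<dots> \<le> (1 - \<eta>\<^sup>2) powr ((\<alpha> + 1) / 2)"
      using e2 a by (intro powr_mono') auto
    finally have "\<eta> powr (- \<alpha>) * (1 - 2 * \<eta>\<^sup>2) \<le> \<eta> powr (- \<alpha>) * (1 - \<eta>\<^sup>2) powr ((\<alpha> + 1) / 2)"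
      by (intro mult_left_mono) auto
    then have "\<eta> powr (- \<alpha>) - 2 * Z \<le> \<alpha> * A + b" using Z unfolding A by (simp add: right_diff_distrib)
    then show ?thesis using b unfolding B_def by simp
  qed
  have "(1 / \<eta> + x) powr \<alpha> + (1 / \<eta> - x) powr \<alpha> - (1 + x) powr \<alpha> - (1 - x) powr \<alpha>
     \<le> 2 * (\<alpha> * A) + 6 * Z + (B - (1 - x) powr \<alpha>)"
    using 3 5 powr_ge_zero[of "1 + x" \<alpha>] by linarith
  then have "q / \<alpha> * ((1 / \<eta> + x) powr \<alpha> + (1 / \<eta> - x) powr \<alpha> - (1 + x) powr \<alpha> - (1 - x) powr \<alpha>)
     \<le> q / \<alpha> * (2 * (\<alpha> * A) + 6 * Z + (B - (1 - x) powr \<alpha>))"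
    using q0 a by (intro mult_left_mono) auto
  also have "\<dots> = 2 * q * A + q / \<alpha> * (6 * Z) + q / \<alpha> * (B - (1 - x) powr \<alpha>)"
    using a by (simp add: distrib_left)
  also have "q / \<alpha> * (6 * Z) \<le> (1 + x) powr (- \<alpha>) * d"
  proof -
    have "(1 - x) powr (- \<alpha>) \<le> 1" using x a powr_mono[of "- \<alpha>" 0 "1 - x"] by simp
    then have "(1 - x) powr (- \<alpha>) / \<alpha> \<le> 1" using a by (simp add: divide_le_eq)
    then have "(1 - x) powr (- \<alpha>) / \<alpha> * (6 * Z) \<le> 1 * d"
      using small Z a by (intro mult_mono) (auto simp: Z_def)
    then have "(1 + x) powr (- \<alpha>) * ((1 - x) powr (- \<alpha>) / \<alpha> * (6 * Z)) \<le> (1 + x) powr (- \<alpha>) * d"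
      by (intro mult_left_mono) auto
    then show ?thesis unfolding q by (simp only: mult.assoc times_divide_eq_right times_divide_eq_left)
  qed
  also have "q / \<alpha> * (B - (1 - x) powr \<alpha>) \<le> (1 + x) powr (- \<alpha>) * (kappa 1 \<alpha> + d)"
  proof -
    have "(1 - x) powr (- \<alpha>) * (1 - x) powr \<alpha> = 1" using x by (simp add: powr_minus)
    then have "(1 - x) powr (- \<alpha>) * (B - (1 - x) powr \<alpha>) = B * (1 - x) powr (- \<alpha>) - 1"
      by (simp add: right_diff_distrib mult.commute)
    then have "q / \<alpha> * (B - (1 - x) powr \<alpha>) = (1 + x) powr (- \<alpha>) * ((B * (1 - x) powr (- \<alpha>) - 1) / \<alpha>)"
      unfolding q by (simp only: mult.assoc times_divide_eq_right times_divide_eq_left)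
    also have "\<dots> \<le> (1 + x) powr (- \<alpha>) * (kappa 1 \<alpha> + d)"
      using near unfolding B_def by (intro mult_left_mono) auto
    finally show ?thesis .
  qed
  finally show ?thesis unfolding q_def[symmetric] by (simp add: algebra_simps)
qed

text \<open>At \<open>x = -1\<close> the left side equals \<open>kappa 1 \<alpha>\<close>, and it is continuous there.\<close>

lemma near_boundary_constant:
  assumes a: "1 < \<alpha>" "\<alpha> < 2" and d: "0 < d"
  obtains r where "0 < r" "r \<le> 1"
    "\<And>x. -1 < x \<Longrightarrow> x \<le> -1 + r \<Longrightarrow> (Beta ((1 + \<alpha>) / 2) ((2 - \<alpha>) / 2) * (1 - x) powr (- \<alpha>) - 1) / \<alpha> \<le> kappa 1 \<alpha> + d"
proof -
  let ?B = "Beta ((1 + \<alpha>) / 2) ((2 - \<alpha>) / 2)"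
  let ?f = "\<lambda>x. (?B * (1 - x) powr (- \<alpha>) - 1) / \<alpha>"
  have "?f (-1) = kappa 1 \<alpha>" using a unfolding kappa_1[OF a(1)] by (simp add: powr_minus field_simps)
  moreover have "isCont ?f (-1)" using a by (intro continuous_intros) auto
  ultimately obtain r where r: "0 < r" "\<And>x. dist x (-1) < r \<Longrightarrow> dist (?f x) (kappa 1 \<alpha>) < d"
    using d unfolding continuous_at_eps_delta by metis
  show ?thesis
  proof (rule that[of "min (r / 2) 1"])
    fix x :: real assume x: "-1 < x" "x \<le> -1 + min (r / 2) 1"
    then have "dist x (-1) < r" using r(1) by (auto simp: dist_real_def)
    from r(2)[OF this] show "?f x \<le> kappa 1 \<alpha> + d" by (simp add: dist_real_def abs_less_iff)
  qed (use r in auto)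
qed

text \<open>The integrand decays like \<open>t\<^bsup>-(\<alpha> + 1) / 2\<^esup>\<close> at infinity and its singularities at \<open>0\<close> and \<open>1\<close> are
  integrable, since \<open>1 < \<alpha> < 2\<close>.\<close>

lemma tau_integral_finite:
  assumes a: "1 < \<alpha>" "\<alpha> < 2"
  shows "(\<integral>\<^sup>+t\<in>{0<..}. ennreal (t powr ((\<alpha> - 1) / 2 - 1) * \<bar>1 - t\<bar> powr (1 - \<alpha>)) \<partial>lborel) < \<infinity>"
proof -
  let ?p = "(\<alpha> - 1) / 2"
  let ?f = "\<lambda>t. t powr (?p - 1) * \<bar>1 - t\<bar> powr (1 - \<alpha>)"
  have 1: "(\<integral>\<^sup>+t\<in>{0<..<1}. ennreal (?f t) \<partial>lborel) < \<infinity>"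
  proof -
    have "((\<lambda>t. t powr (?p - 1) * (1 - t) powr (2 - \<alpha> - 1)) has_integral Beta ?p (2 - \<alpha>)) {0<..<1}"
      using has_integral_Beta_real[of ?p "2 - \<alpha>"] a by (simp add: has_integral_Icc_iff_Ioo)
    then have "(\<integral>\<^sup>+t\<in>{0<..<1}. ennreal (t powr (?p - 1) * (1 - t) powr (2 - \<alpha> - 1)) \<partial>lborel) = ennreal (Beta ?p (2 - \<alpha>))"
      by (intro nn_integral_has_integral_lebesgue') auto
    moreover have "(\<integral>\<^sup>+t\<in>{0<..<1}. ennreal (?f t) \<partial>lborel)
      = (\<integral>\<^sup>+t\<in>{0<..<1}. ennreal (t powr (?p - 1) * (1 - t) powr (2 - \<alpha> - 1)) \<partial>lborel)"
    proof (rule nn_integral_cong)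
      fix t :: real
      have e: "2 - \<alpha> - 1 = 1 - \<alpha>" by simp
      show "ennreal (?f t) * indicator {0<..<1} t = ennreal (t powr (?p - 1) * (1 - t) powr (2 - \<alpha> - 1)) * indicator {0<..<1} t"
        unfolding e by (cases "t \<in> {0<..<1}") simp_all
    qed
    ultimately show ?thesis by simp
  qed
  have 2: "(\<integral>\<^sup>+t\<in>{1<..<2}. ennreal (?f t) \<partial>lborel) < \<infinity>"
  proof -
    have "(\<integral>\<^sup>+t\<in>{1<..<2}. ennreal (?f t) \<partial>lborel) \<le> (\<integral>\<^sup>+t\<in>{1<..<2}. ennreal ((t - 1) powr (1 - \<alpha>)) \<partial>lborel)"
    proof (rule nn_integral_mono)
      fix t :: real
      show "ennreal (?f t) * indicator {1<..<2} t \<le> ennreal ((t - 1) powr (1 - \<alpha>)) * indicator {1<..<2} t"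
      proof (cases "t \<in> {1<..<2}")
        case True
        have "t powr (?p - 1) \<le> 1" using True a powr_mono[of "?p - 1" 0 t] by simp
        then have "?f t \<le> 1 * (t - 1) powr (1 - \<alpha>)" using True by (intro mult_mono) auto
        then show ?thesis using True by (simp add: ennreal_leI)
      qed simp
    qed
    also have "\<dots> = ennreal ((2 - 1) powr (2 - \<alpha>) / (2 - \<alpha>) - (1 - 1) powr (2 - \<alpha>) / (2 - \<alpha>))"
    proof (rule nn_integral_FTC_interior)
      show "continuous_on {1..2} (\<lambda>t::real. (t - 1) powr (2 - \<alpha>) / (2 - \<alpha>))"
        using a by (intro continuous_intros continuous_on_powr') auto
      show "((\<lambda>t. (t - 1) powr (2 - \<alpha>) / (2 - \<alpha>)) has_real_derivative (t - 1) powr (1 - \<alpha>)) (at t)"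
        if "t \<in> {1<..<2}" for t
        using that a by (auto intro!: derivative_eq_intros)
    qed auto
    also have "\<dots> < \<infinity>" by simp
    finally show ?thesis .
  qed
  have 3: "(\<integral>\<^sup>+t\<in>{2..}. ennreal (?f t) \<partial>lborel) < \<infinity>"
  proof -
    let ?e = "?p - \<alpha>"
    have e: "?e < -1" using a by (simp add: field_simps)
    have "(\<integral>\<^sup>+t\<in>{2..}. ennreal (?f t) \<partial>lborel) \<le> (\<integral>\<^sup>+t\<in>{2..}. ennreal (2 powr (\<alpha> - 1) * t powr ?e) \<partial>lborel)"
    proof (rule nn_integral_mono)
      fix t :: real
      show "ennreal (?f t) * indicator {2..} t \<le> ennreal (2 powr (\<alpha> - 1) * t powr ?e) * indicator {2..} t"
      proof (cases "t \<in> {2..}")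
        case True
        then have t: "2 \<le> t" by simp
        have "\<bar>1 - t\<bar> powr (1 - \<alpha>) \<le> (t / 2) powr (1 - \<alpha>)" using t a by (intro powr_mono2') auto
        also have "\<dots> = 2 powr (- (1 - \<alpha>)) * t powr (1 - \<alpha>)" by (rule powr_pos_divide) (use t in auto)
        finally have "?f t \<le> t powr (?p - 1) * (2 powr (- (1 - \<alpha>)) * t powr (1 - \<alpha>))" by (intro mult_left_mono) auto
        also have "\<dots> = 2 powr (\<alpha> - 1) * (t powr (?p - 1) * t powr (1 - \<alpha>))" by simp
        also have "t powr (?p - 1) * t powr (1 - \<alpha>) = t powr (?p - 1 + (1 - \<alpha>))" by (simp only: powr_add)
        also have "?p - 1 + (1 - \<alpha>) = ?e" by simp
        finally show ?thesis using True by (simp add: ennreal_leI)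
      qed simp
    qed
    also have "\<dots> = ennreal (0 - 2 powr (\<alpha> - 1) * (2 powr (?e + 1) / (?e + 1)))"
    proof (rule nn_integral_FTC_atLeast[where F = "\<lambda>t. 2 powr (\<alpha> - 1) * (t powr (?e + 1) / (?e + 1))" and T = 0])
      show "((\<lambda>t. 2 powr (\<alpha> - 1) * (t powr (?e + 1) / (?e + 1))) has_real_derivative 2 powr (\<alpha> - 1) * t powr ?e) (at t)" if "2 \<le> t" for t
      proof -
        have "((\<lambda>t. t powr (?e + 1)) has_real_derivative (?e + 1) * t powr (?e + 1 - 1)) (at t)"
          using that by (intro has_real_derivative_powr) simp
        from DERIV_cmult[OF DERIV_cdivide[OF this, of "?e + 1"], of "2 powr (\<alpha> - 1)"] e
        show ?thesis by simp
      qed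
      have "((\<lambda>t. t powr (?e + 1)) \<longlongrightarrow> 0) at_top" using e by (intro tendsto_neg_powr filterlim_ident) auto
      then have "((\<lambda>t. 2 powr (\<alpha> - 1) * (t powr (?e + 1) / (?e + 1))) \<longlongrightarrow> 2 powr (\<alpha> - 1) * (0 / (?e + 1))) at_top"
        using e by (intro tendsto_intros) auto
      then show "((\<lambda>t. 2 powr (\<alpha> - 1) * (t powr (?e + 1) / (?e + 1))) \<longlongrightarrow> 0) at_top" by simp
    qed auto
    also have "\<dots> < \<infinity>" by simp
    finally show ?thesis .
  qed
  have "(\<integral>\<^sup>+t\<in>{0<..}. ennreal (?f t) \<partial>lborel)
     = (\<integral>\<^sup>+t. ennreal (?f t) * indicator {0<..<1} t + ennreal (?f t) * indicator {1<..<2} t + ennreal (?f t) * indicator {2..} t \<partial>lborel)"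
  proof (rule nn_integral_cong_AE)
    have "AE t in lborel. t \<noteq> (1::real)" by (rule AE_lborel_singleton)
    then show "AE t in lborel. ennreal (?f t) * indicator {0<..} t
      = ennreal (?f t) * indicator {0<..<1} t + ennreal (?f t) * indicator {1<..<2} t + ennreal (?f t) * indicator {2..} t"
      by eventually_elim (auto split: split_indicator)
  qed
  also have "\<dots> = (\<integral>\<^sup>+t\<in>{0<..<1}. ennreal (?f t) \<partial>lborel) + (\<integral>\<^sup>+t\<in>{1<..<2}. ennreal (?f t) \<partial>lborel) + (\<integral>\<^sup>+t\<in>{2..}. ennreal (?f t) \<partial>lborel)"
    by (simp add: nn_integral_add)
  also have "\<dots> < \<infinity>" using 1 2 3 by simp
  finally show ?thesis .
qed

section \<open>Logarithmic tents\<close>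

text \<open>A tent function of height \<open>1 / 2\<close> in the variable \<open>- ln s / N\<close>, supported between \<open>1\<close> and \<open>2\<close>. On the
  logarithmic scale it has slope \<open>1 / N\<close> and length \<open>N\<close>.\<close>

definition log_tent :: "real \<Rightarrow> real \<Rightarrow> real" where
  "log_tent N s = max 0 (1 / 2 - \<bar>- ln s / N - 3 / 2\<bar>)"

lemma log_tent_measurable[measurable]: "log_tent N \<in> borel_measurable borel"
  unfolding log_tent_def by measurable

lemma log_tent_bounds: "0 \<le> log_tent N s" "log_tent N s \<le> 1"
  by (auto simp: log_tent_def)

lemma log_tent_support:
  assumes "0 < N" "0 < s" "log_tent N s \<noteq> 0"
  shows "exp (- 2 * N) < s" "s < exp (- N)"
proof -
  have "\<bar>- ln s / N - 3 / 2\<bar> < 1 / 2" using assms(3) by (auto simp: log_tent_def max_def split: if_splits)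
  then have "1 < - ln s / N" "- ln s / N < 2" by linarith+
  then have l: "N < - ln s" "- ln s < 2 * N"
    using assms(1) by (simp_all only: pos_less_divide_eq pos_divide_less_eq mult_1_left)
  have "exp (- 2 * N) < exp (ln s)" using l by simp
  then show "exp (- 2 * N) < s" using assms(2) by simp
  have "exp (ln s) < exp (- N)" using l by simp
  then show "s < exp (- N)" using assms(2) by simp
qed

lemma log_tent_middle:
  assumes "0 < N" "0 < s" "exp (- 7 / 4 * N) < s" "s < exp (- 5 / 4 * N)"
  shows "1 / 4 \<le> log_tent N s"
proof -
  have "- 7 / 4 * N < ln s" "ln s < - 5 / 4 * N"
    using assms by (metis exp_gt_zero exp_less_cancel_iff exp_ln)+
  then have l: "5 / 4 * N < - ln s" "- ln s < 7 / 4 * N" by linarith+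
  have "5 / 4 < - ln s / N" by (rule pos_less_divide_eq[OF assms(1), THEN iffD2, OF l(1)])
  moreover have "- ln s / N < 7 / 4" by (rule pos_divide_less_eq[OF assms(1), THEN iffD2, OF l(2)])
  ultimately have "1 / 4 \<le> 1 / 2 - \<bar>- ln s / N - 3 / 2\<bar>" by linarith
  then show ?thesis unfolding log_tent_def by (rule max.coboundedI2)
qed

text \<open>The tent is Lipschitz with constant \<open>1 / N\<close> in \<open>ln s\<close>, and \<open>ln_diff_square_le\<close> returns to the
  variables \<open>s\<close> and \<open>t\<close> with the factor \<open>1 / (s t)\<close> that matches the homogeneity of the ground state.\<close>

lemma log_tent_lipschitz:
  assumes "0 < N" "0 < s" "0 < t"
  shows "(log_tent N s - log_tent N t)\<^sup>2 \<le> (s - t)\<^sup>2 / (s * t) / N\<^sup>2"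
proof -
  have tent: "\<bar>max 0 (1 / 2 - \<bar>a - 3 / 2\<bar>) - max 0 (1 / 2 - \<bar>b - 3 / 2\<bar>)\<bar> \<le> \<bar>a - b\<bar>" for a b :: real
    by (smt (verit))
  have "\<bar>log_tent N s - log_tent N t\<bar> \<le> \<bar>- ln s / N - (- ln t / N)\<bar>"
    unfolding log_tent_def by (rule tent)
  also have "- ln s / N - (- ln t / N) = (ln t - ln s) / N" by (simp add: diff_divide_distrib)
  finally have "\<bar>log_tent N s - log_tent N t\<bar>\<^sup>2 \<le> \<bar>(ln t - ln s) / N\<bar>\<^sup>2" by (intro power_mono) auto
  then have "(log_tent N s - log_tent N t)\<^sup>2 \<le> (ln s - ln t)\<^sup>2 / N\<^sup>2"
    by (simp add: power_divide power2_commute)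
  also have "\<dots> \<le> (s - t)\<^sup>2 / (s * t) / N\<^sup>2"
    by (intro divide_right_mono ln_diff_square_le assms) auto
  finally show ?thesis .
qed

lemma nn_integral_inverse:
  assumes "0 < l" "l < r"
  shows "(\<integral>\<^sup>+s\<in>{l<..<r}. ennreal (1 / s) \<partial>lborel) = ennreal (ln r - ln l)"
proof (rule nn_integral_FTC_interior)
  show "continuous_on {l..r} ln" using assms by (intro continuous_intros) auto
  show "(ln has_real_derivative 1 / s) (at s)" if "s \<in> {l<..<r}" for s
    using that assms by (auto intro!: derivative_eq_intros)
qed (use assms in auto)

lemma tau_integral_scaled:
  assumes s: "0 < s"
  shows "(\<integral>\<^sup>+t\<in>{0<..}. ennreal ((s * t) powr ((\<alpha> - 1) / 2 - 1) * \<bar>s - t\<bar> powr (1 - \<alpha>)) \<partial>lborel)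
    = ennreal (1 / s) * (\<integral>\<^sup>+t\<in>{0<..}. ennreal (t powr ((\<alpha> - 1) / 2 - 1) * \<bar>1 - t\<bar> powr (1 - \<alpha>)) \<partial>lborel)"
proof -
  let ?p = "(\<alpha> - 1) / 2"
  let ?g = "\<lambda>t. ennreal ((s * t) powr (?p - 1) * \<bar>s - t\<bar> powr (1 - \<alpha>)) * indicator {0<..} t"
  let ?h = "\<lambda>t. ennreal (t powr (?p - 1) * \<bar>1 - t\<bar> powr (1 - \<alpha>)) * indicator {0<..} t"
  have "(\<integral>\<^sup>+t. ?g t \<partial>lborel) = ennreal \<bar>s\<bar> * (\<integral>\<^sup>+t. ?g (0 + s * t) \<partial>lborel)"
    by (rule nn_integral_real_affine) (use s in auto)
  also have "(\<lambda>t. ?g (0 + s * t)) = (\<lambda>t. ennreal (1 / s\<^sup>2) * ?h t)"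
  proof
    fix t :: real
    show "?g (0 + s * t) = ennreal (1 / s\<^sup>2) * ?h t"
    proof (cases "0 < t")
      case True
      have "s - s * t = s * (1 - t)" by (simp add: right_diff_distrib)
      then have e1: "\<bar>s - s * t\<bar> powr (1 - \<alpha>) = s powr (1 - \<alpha>) * \<bar>1 - t\<bar> powr (1 - \<alpha>)"
        using s by (simp add: abs_mult powr_mult)
      have e2: "(s * (s * t)) powr (?p - 1) = s powr (2 * (?p - 1)) * t powr (?p - 1)"
      proof -
        have "2 * (?p - 1) = (?p - 1) + (?p - 1)" by (rule mult_2)
        then have "s powr (2 * (?p - 1)) = s powr (?p - 1) * s powr (?p - 1)" by (simp only: powr_add)
        then show ?thesis using s True by (simp add: powr_mult)
      qed
      have e3: "s powr (2 * (?p - 1)) * s powr (1 - \<alpha>) = 1 / s\<^sup>2"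
      proof -
        have h: "2 * ?p = \<alpha> - 1" by simp
        have "2 * (?p - 1) + (1 - \<alpha>) = 2 * ?p - 2 + (1 - \<alpha>)"
          by (simp only: right_diff_distrib mult_1_right)
        also have "\<dots> = - 2" unfolding h by simp
        finally have "2 * (?p - 1) + (1 - \<alpha>) = - 2" .
        then have "s powr (2 * (?p - 1)) * s powr (1 - \<alpha>) = s powr (- 2)" by (simp only: powr_add[symmetric])
        also have "\<dots> = 1 / s\<^sup>2" using s by (simp add: powr_minus_divide)
        finally show ?thesis .
      qed
      have "(s * (s * t)) powr (?p - 1) * \<bar>s - s * t\<bar> powr (1 - \<alpha>)
         = 1 / s\<^sup>2 * (t powr (?p - 1) * \<bar>1 - t\<bar> powr (1 - \<alpha>))"
        unfolding e1 e2 e3[symmetric] by (simp only: mult_ac)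
      then have "ennreal ((s * (s * t)) powr (?p - 1) * \<bar>s - s * t\<bar> powr (1 - \<alpha>))
         = ennreal (1 / s\<^sup>2) * ennreal (t powr (?p - 1) * \<bar>1 - t\<bar> powr (1 - \<alpha>))"
        by (simp only: ennreal_mult' zero_le_divide_1_iff zero_le_power2)
      then show ?thesis using s True by simp
    next
      case False
      then show ?thesis using s by (simp add: zero_less_mult_iff)
    qed
  qed
  also have "(\<integral>\<^sup>+t. ennreal (1 / s\<^sup>2) * ?h t \<partial>lborel) = ennreal (1 / s\<^sup>2) * (\<integral>\<^sup>+t. ?h t \<partial>lborel)"
    by (rule nn_integral_cmult) measurable
  also have "ennreal \<bar>s\<bar> * (ennreal (1 / s\<^sup>2) * (\<integral>\<^sup>+t. ?h t \<partial>lborel)) = ennreal (1 / s) * (\<integral>\<^sup>+t. ?h t \<partial>lborel)"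
  proof -
    have "\<bar>s\<bar> * (1 / s\<^sup>2) = 1 / s" using s by (simp add: power2_eq_square)
    then show ?thesis by (simp only: mult.assoc[symmetric] ennreal_mult'[OF abs_ge_zero, symmetric])
  qed
  finally show ?thesis .
qed

text \<open>The cut-off kernels increase to the full kernel as \<open>\<eta>\<close> decreases to \<open>0\<close>, so monotone convergence applies.\<close>

lemma interval_energy_le:
  fixes \<psi> :: "real \<Rightarrow> real"
  assumes [measurable]: "\<psi> \<in> borel_measurable borel" and e0: "0 < \<eta>\<^sub>0" "\<eta>\<^sub>0 < 1"
    and le: "\<And>\<eta>. 0 < \<eta> \<Longrightarrow> \<eta> \<le> \<eta>\<^sub>0 \<Longrightarrow>
      (\<integral>\<^sup>+s. \<integral>\<^sup>+t. ennreal ((\<psi> s - \<psi> t)\<^sup>2 * interval_kernel \<alpha> \<eta> s t) \<partial>lborel \<partial>lborel) \<le> Z"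
  shows "(\<integral>\<^sup>+s\<in>{-1<..<1}. (\<integral>\<^sup>+t\<in>{-1<..<1}. ennreal ((\<psi> s - \<psi> t)\<^sup>2 / \<bar>s - t\<bar> powr (1 + \<alpha>)) \<partial>lborel) \<partial>lborel) \<le> Z"
proof -
  define \<eta> where "\<eta> n = \<eta>\<^sub>0 / (real n + 1)" for n :: nat
  have eta: "0 < \<eta> n" "\<eta> n \<le> \<eta>\<^sub>0" for n using e0 by (auto simp: \<eta>_def divide_le_eq)
  have dec: "\<eta> n \<le> \<eta> m" if "m \<le> n" for m n using that e0 by (auto simp: \<eta>_def intro!: divide_left_mono)
  let ?f = "\<lambda>n s t. ennreal ((\<psi> s - \<psi> t)\<^sup>2 * interval_kernel \<alpha> (\<eta> n) s t)"
  let ?F = "\<lambda>s t. ennreal ((\<psi> s - \<psi> t)\<^sup>2 / \<bar>s - t\<bar> powr (1 + \<alpha>)) * indicator {-1<..<1} t * indicator {-1<..<1} s"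
  have pos: "0 < 1 - s * t" if "\<bar>s\<bar> < 1" "\<bar>t\<bar> < 1" for s t :: real
    using abs_mult_less_one[OF that] by (auto simp: abs_less_iff)
  have K: "interval_kernel \<alpha> (\<eta> m) s t \<le> interval_kernel \<alpha> (\<eta> n) s t" if "m \<le> n" for m n s t
  proof -
    have "\<eta> n * (1 - s * t) < \<bar>s - t\<bar>" if "\<eta> m * (1 - s * t) < \<bar>s - t\<bar>" "\<bar>s\<bar> < 1" "\<bar>t\<bar> < 1"
      using that mult_right_mono[OF dec[OF \<open>m \<le> n\<close>], of "1 - s * t"] pos[of s t] by linarith
    then show ?thesis by (simp add: interval_kernel_def)
  qed
  have mono: "?f m s t \<le> ?f n s t" if "m \<le> n" for m n s t
    using K[OF that] by (intro ennreal_leI mult_left_mono) auto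
  have sup: "?F s t = (SUP n. ?f n s t)" for s t
  proof (cases "\<bar>s\<bar> < 1 \<and> \<bar>t\<bar> < 1 \<and> s \<noteq> t")
    case True
    have "0 < \<bar>s - t\<bar> / (\<eta>\<^sub>0 * (1 - s * t))" using True e0 pos[of s t] by simp
    then obtain n where n: "\<eta>\<^sub>0 * (1 - s * t) / \<bar>s - t\<bar> < real n"
      using reals_Archimedean2 by blast
    then have "\<eta>\<^sub>0 * (1 - s * t) < \<bar>s - t\<bar> * (real n + 1)"
      using True by (simp add: divide_less_eq distrib_left mult.commute)
    then have "\<eta> n * (1 - s * t) < \<bar>s - t\<bar>"
      unfolding \<eta>_def by (simp add: divide_less_eq)
    then have fn: "?f n s t = ?F s t" using True by (simp add: interval_kernel_def abs_less_iff)
    have up: "?f m s t \<le> ?F s t" for m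
      using True by (auto simp: interval_kernel_def abs_less_iff intro!: ennreal_leI)
    show ?thesis
      by (rule antisym) (use fn up in \<open>auto intro!: SUP_least SUP_upper2[of n]\<close>)
  next
    case False
    have "?F s t = 0" using False by (auto simp: abs_less_iff split: split_indicator)
    moreover have "?f n s t = 0" for n using False by (auto simp: interval_kernel_def)
    ultimately show ?thesis by (simp only: SUP_const[OF UNIV_not_empty])
  qed
  have "(\<integral>\<^sup>+s\<in>{-1<..<1}. (\<integral>\<^sup>+t\<in>{-1<..<1}. ennreal ((\<psi> s - \<psi> t)\<^sup>2 / \<bar>s - t\<bar> powr (1 + \<alpha>)) \<partial>lborel) \<partial>lborel)
    = (\<integral>\<^sup>+s. \<integral>\<^sup>+t. ?F s t \<partial>lborel \<partial>lborel)"
    by (rule nn_integral_cong, rule nn_integral_multc[symmetric]) measurable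
  also have "\<dots> = (\<integral>\<^sup>+s. (SUP n. \<integral>\<^sup>+t. ?f n s t \<partial>lborel) \<partial>lborel)"
    unfolding sup
    by (rule nn_integral_cong, rule nn_integral_monotone_convergence_SUP)
       (auto simp: incseq_def le_fun_def mono)
  also have "\<dots> = (SUP n. \<integral>\<^sup>+s. \<integral>\<^sup>+t. ?f n s t \<partial>lborel \<partial>lborel)"
    by (rule nn_integral_monotone_convergence_SUP)
       (auto simp: incseq_def le_fun_def intro!: nn_integral_mono mono)
  also have "\<dots> \<le> Z" using le eta by (intro SUP_least) auto
  finally show ?thesis .
qed

text \<open>Here the ground state identity is used in full: the energy is the integral of the potential, which is
  close to the sharp one where \<open>\<psi>\<close> lives, plus the term \<open>R\<close> that the lower bound dropped.\<close>

lemma interval_truncated_energy_le: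
  fixes \<psi> :: "real \<Rightarrow> real"
  assumes a: "1 < \<alpha>" "\<alpha> < 2" and psi[measurable]: "\<psi> \<in> borel_measurable borel"
    and supp: "\<And>s. \<psi> s \<noteq> 0 \<Longrightarrow> -1 < s \<and> s \<le> 0 \<and>
      (Beta ((1 + \<alpha>) / 2) ((2 - \<alpha>) / 2) * (1 - s) powr (- \<alpha>) - 1) / \<alpha> \<le> kappa 1 \<alpha> + d"
    and d: "0 \<le> d" and eta: "0 < \<eta>" "\<eta> < 1" and small: "6 * \<eta> powr (2 - \<alpha>) \<le> d"
    and X: "X = (\<integral>\<^sup>+s\<in>{-1<..<1}. ennreal ((\<psi> s)\<^sup>2 * (1 + s) powr (- \<alpha>)) \<partial>lborel)" "X < \<infinity>"
  shows "(\<integral>\<^sup>+s. \<integral>\<^sup>+t. ennreal ((\<psi> s - \<psi> t)\<^sup>2 * interval_kernel \<alpha> \<eta> s t) \<partial>lborel \<partial>lborel)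
    \<le> 2 * (ennreal (kappa 1 \<alpha> + 2 * d) * X)
      + (\<integral>\<^sup>+s. \<integral>\<^sup>+t. ennreal ((\<psi> s / (1 - s\<^sup>2) powr ((\<alpha> - 1) / 2) - \<psi> t / (1 - t\<^sup>2) powr ((\<alpha> - 1) / 2))\<^sup>2
        * ((1 - s\<^sup>2) powr ((\<alpha> - 1) / 2) * (1 - t\<^sup>2) powr ((\<alpha> - 1) / 2) * interval_kernel \<alpha> \<eta> s t)) \<partial>lborel \<partial>lborel)"
    (is "?E \<le> _ + ?R")
proof -
  let ?I = "{-1<..<1::real}"
  let ?w = "\<lambda>x. (1 - x\<^sup>2) powr ((\<alpha> - 1) / 2)"
  let ?K = "interval_kernel \<alpha> \<eta>"
  let ?a = "\<lambda>s. \<integral>\<^sup>+t. ennreal (?w t / ?w s * ?K s t) \<partial>lborel"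
  let ?c = "\<lambda>s. \<integral>\<^sup>+t. ennreal (?K s t) \<partial>lborel"
  let ?x = "\<lambda>s. ennreal ((\<psi> s)\<^sup>2 * (1 + s) powr (- \<alpha>)) * indicator ?I s"
  note AB = trunc_A_trunc_B[OF a(1) eta]
  have "trunc_B \<alpha> \<eta> < top" using AB by (metis ennreal_less_top ennreal_add_less_top)
  then obtain b where b: "trunc_B \<alpha> \<eta> = ennreal b" "0 \<le> b" by (cases "trunc_B \<alpha> \<eta>") auto
  have "ennreal \<alpha> * trunc_A \<alpha> \<eta> < top" using AB by (metis ennreal_less_top ennreal_add_less_top)
  then have "trunc_A \<alpha> \<eta> < top" using a by (auto simp: ennreal_mult_less_top)
  then obtain A where A: "trunc_A \<alpha> \<eta> = ennreal A" "0 \<le> A" by (cases "trunc_A \<alpha> \<eta>") auto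
  have AB': "\<alpha> * A + b = \<eta> powr (- \<alpha>) * (1 - \<eta>\<^sup>2) powr ((\<alpha> + 1) / 2)"
    using AB A b a by (simp flip: ennreal_mult ennreal_plus)
  have b': "2 * b \<le> Beta ((1 + \<alpha>) / 2) ((2 - \<alpha>) / 2)"
  proof -
    have "2 * trunc_B \<alpha> \<eta> \<le> 2 * trunc_B \<alpha> 0" using eta by (intro mult_left_mono trunc_B_antimono) auto
    then have "ennreal (2 * b) \<le> ennreal (Beta ((1 + \<alpha>) / 2) ((2 - \<alpha>) / 2))"
      unfolding trunc_B_0[OF a] b(1) by (simp only: ennreal_mult'[OF zero_le_numeral] ennreal_numeral)
    moreover have "0 \<le> Beta ((1 + \<alpha>) / 2) ((2 - \<alpha>) / 2)"
      using Beta_ge_two_powr[OF a] two_powr_ge_two[OF a(1)] by linarith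
    ultimately show ?thesis by (subst (asm) ennreal_le_iff)
  qed
  have k: "0 \<le> kappa 1 \<alpha> + 2 * d" using kappa_1_nonneg[OF a] d by simp
  have av: "?a s = ennreal (2 * (1 - s\<^sup>2) powr (- \<alpha>) * A)" if s: "\<bar>s\<bar> < 1" for s
    using interval_kernel_weight_integral[OF s eta a(1)] A(2)
    unfolding A(1) by (simp add: ennreal_mult')
  have pw: "ennreal ((\<psi> s)\<^sup>2) * ?c s \<le> ennreal ((\<psi> s)\<^sup>2) * ?a s + ennreal (kappa 1 \<alpha> + 2 * d) * ?x s" for s
  proof (cases "\<psi> s = 0")
    case False
    note sp = supp[OF False]
    have s: "\<bar>s\<bar> < 1" using sp by auto
    have "?c s \<le> ennreal (2 * (1 - s\<^sup>2) powr (- \<alpha>) * A + (kappa 1 \<alpha> + 2 * d) * (1 + s) powr (- \<alpha>))"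
      unfolding interval_kernel_integral[OF s eta a(1)]
      using sp by (intro ennreal_leI interval_potential_upper[OF a _ _ eta AB' b' small]) auto
    also have "\<dots> = ?a s + ennreal (kappa 1 \<alpha> + 2 * d) * ennreal ((1 + s) powr (- \<alpha>))"
      unfolding av[OF s] using A(2) k by (simp add: ennreal_mult')
    finally have "ennreal ((\<psi> s)\<^sup>2) * ?c s \<le> ennreal ((\<psi> s)\<^sup>2) * (?a s + ennreal (kappa 1 \<alpha> + 2 * d) * ennreal ((1 + s) powr (- \<alpha>)))"
      by (rule mult_left_mono) simp
    also have "\<dots> = ennreal ((\<psi> s)\<^sup>2) * ?a s + ennreal (kappa 1 \<alpha> + 2 * d) * (ennreal ((\<psi> s)\<^sup>2) * ennreal ((1 + s) powr (- \<alpha>)))"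
      by (simp only: distrib_left mult.left_commute)
    also have "ennreal ((\<psi> s)\<^sup>2) * ennreal ((1 + s) powr (- \<alpha>)) = ?x s"
      using s by (simp add: ennreal_mult' abs_less_iff)
    finally show ?thesis .
  qed simp
  have m: "?a \<in> borel_measurable borel" "?c \<in> borel_measurable borel" by measurable
  have "(\<integral>\<^sup>+s. ennreal ((\<psi> s)\<^sup>2) * ?c s \<partial>lborel)
     \<le> (\<integral>\<^sup>+s. ennreal ((\<psi> s)\<^sup>2) * ?a s + ennreal (kappa 1 \<alpha> + 2 * d) * ?x s \<partial>lborel)"
    by (intro nn_integral_mono pw)
  also have "\<dots> = (\<integral>\<^sup>+s. ennreal ((\<psi> s)\<^sup>2) * ?a s \<partial>lborel) + ennreal (kappa 1 \<alpha> + 2 * d) * X"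
    unfolding X(1) using m by (subst nn_integral_add) (auto simp: nn_integral_cmult)
  finally have C: "(\<integral>\<^sup>+s. ennreal ((\<psi> s)\<^sup>2) * ?c s \<partial>lborel)
     \<le> (\<integral>\<^sup>+s. ennreal ((\<psi> s)\<^sup>2) * ?a s \<partial>lborel) + ennreal (kappa 1 \<alpha> + 2 * d) * X" (is "?C \<le> ?Aa + _") .
  have fin: "?Aa < top"
  proof -
    have "?Aa \<le> (\<integral>\<^sup>+s. ennreal (2 * A) * ?x s \<partial>lborel)"
    proof (rule nn_integral_mono)
      fix s :: real
      show "ennreal ((\<psi> s)\<^sup>2) * ?a s \<le> ennreal (2 * A) * ?x s"
      proof (cases "\<psi> s = 0")
        case False
        note sp = supp[OF False]
        have s: "\<bar>s\<bar> < 1" using sp by auto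
        have "(1 - s\<^sup>2) powr (- \<alpha>) \<le> (1 + s) powr (- \<alpha>)"
        proof (rule powr_mono2')
          have "0 \<le> (- s) * (1 + s)" using sp by (intro mult_nonneg_nonneg) auto
          then show "1 + s \<le> 1 - s\<^sup>2" by (simp add: power2_eq_square algebra_simps)
        qed (use a sp in auto)
        then have "(\<psi> s)\<^sup>2 * (2 * (1 - s\<^sup>2) powr (- \<alpha>) * A) \<le> (\<psi> s)\<^sup>2 * (2 * (1 + s) powr (- \<alpha>) * A)"
          using A(2) by (intro mult_left_mono mult_right_mono) auto
        also have "\<dots> = 2 * A * ((\<psi> s)\<^sup>2 * (1 + s) powr (- \<alpha>))" by (simp only: mult_ac)
        finally have "ennreal ((\<psi> s)\<^sup>2 * (2 * (1 - s\<^sup>2) powr (- \<alpha>) * A)) \<le> ennreal (2 * A * ((\<psi> s)\<^sup>2 * (1 + s) powr (- \<alpha>)))"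
          by (rule ennreal_leI)
        moreover have "ennreal ((\<psi> s)\<^sup>2) * ?a s = ennreal ((\<psi> s)\<^sup>2 * (2 * (1 - s\<^sup>2) powr (- \<alpha>) * A))"
          unfolding av[OF s] by (rule ennreal_mult'[symmetric]) simp
        moreover have "ennreal (2 * A) * ?x s = ennreal (2 * A * ((\<psi> s)\<^sup>2 * (1 + s) powr (- \<alpha>)))"
          using s A(2) by (subst ennreal_mult'[of "2 * A"]) (auto simp: abs_less_iff)
        ultimately show ?thesis by (simp only:)
      qed simp
    qed
    also have "\<dots> = ennreal (2 * A) * X" unfolding X(1) by (rule nn_integral_cmult) measurable
    also have "\<dots> < top" using X(2) by (simp add: ennreal_mult_less_top)
    finally show ?thesis .
  qed
  have G: "?E + 2 * ?Aa = 2 * ?C + ?R"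
  proof (rule ground_state_identity)
    show "0 \<le> ?K s t" "?K s t = ?K t s" for s t
      by (auto simp: interval_kernel_def abs_minus_commute mult.commute)
    show "0 < ?w s" if "?K s t \<noteq> 0" for s t
      using that by (auto simp: interval_kernel_def abs_square_less_1 abs_square_eq_1 split: if_splits)
  qed auto
  have "2 * ?Aa + ?E \<le> 2 * (?Aa + ennreal (kappa 1 \<alpha> + 2 * d) * X) + ?R"
    using G add_right_mono[OF mult_left_mono[OF C, of 2], of ?R] by (simp add: add.commute)
  also have "\<dots> = 2 * ?Aa + (2 * (ennreal (kappa 1 \<alpha> + 2 * d) * X) + ?R)"
    by (simp only: distrib_left add.assoc)
  finally have "2 * ?Aa = top \<or> ?E \<le> 2 * (ennreal (kappa 1 \<alpha> + 2 * d) * X) + ?R"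
    by (simp only: ennreal_add_left_cancel_le infinity_ennreal_def)
  moreover have "2 * ?Aa \<noteq> top" using fin by (simp add: ennreal_mult_eq_top_iff less_top)
  ultimately show ?thesis by (simp only: simp_thms)
qed

section \<open>Sharpness on the interval\<close>

text \<open>The Lipschitz bound gives a kernel that is homogeneous of degree \<open>-2\<close>. By scaling, its integral in \<open>t\<close> is
  \<open>Q / s\<close>, and the integral of \<open>1 / s\<close> over the support of the tent is \<open>N\<close>; the factor \<open>1 / N\<^sup>2\<close> then
  leaves \<open>1 / N\<close>. The two cases that \<open>s\<close> or \<open>t\<close> lies in the support account for the factor \<open>2\<close>.\<close>

lemma log_tent_remainder_le:
  assumes a: "1 < \<alpha>" "\<alpha> < 2" and N: "0 < N" and Q: "0 \<le> Q"
    and tau: "(\<integral>\<^sup>+t\<in>{0<..}. ennreal (t powr ((\<alpha> - 1) / 2 - 1) * \<bar>1 - t\<bar> powr (1 - \<alpha>)) \<partial>lborel) = ennreal Q"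
  shows "(\<integral>\<^sup>+s\<in>{0<..}. (\<integral>\<^sup>+t\<in>{0<..}. ennreal ((log_tent N s - log_tent N t)\<^sup>2 *
      ((s * t) powr ((\<alpha> - 1) / 2) / \<bar>s - t\<bar> powr (1 + \<alpha>))) \<partial>lborel) \<partial>lborel) \<le> ennreal (2 * Q / N)"
proof -
  let ?p = "(\<alpha> - 1) / 2"
  let ?S = "{exp (- 2 * N)<..<exp (- N)}"
  let ?P = "{0<..} :: real set"
  let ?g = "\<lambda>s t. ennreal ((s * t) powr (?p - 1) * \<bar>s - t\<bar> powr (1 - \<alpha>))"
  let ?h = "\<lambda>s t. ?g s t * indicator ?P s * indicator ?P t * indicator ?S s"
  have S: "?S \<subseteq> ?P" by (auto intro: less_trans[OF exp_gt_zero])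
  have pw: "ennreal ((log_tent N s - log_tent N t)\<^sup>2 * ((s * t) powr ?p / \<bar>s - t\<bar> powr (1 + \<alpha>))) * indicator ?P t * indicator ?P s
     \<le> ennreal (1 / N\<^sup>2) * (?h s t + ?h t s)" for s t
  proof (cases "0 < s \<and> 0 < t \<and> log_tent N s \<noteq> log_tent N t")
    case True
    then have st: "0 < s" "0 < t" and ne: "s \<noteq> t" by auto
    have "s \<in> ?S \<or> t \<in> ?S"
    proof (cases "log_tent N s = 0")
      case True
      then have "log_tent N t \<noteq> 0" using \<open>0 < s \<and> 0 < t \<and> log_tent N s \<noteq> log_tent N t\<close> by simp
      from log_tent_support[OF N st(2) this] show ?thesis by simp
    next
      case False
      from log_tent_support[OF N st(1) this] show ?thesis by simp
    qed
    then have ind: "?g s t \<le> ?h s t + ?h t s"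
      using st by (auto simp: abs_minus_commute mult.commute[of t s] add_increasing add_increasing2 split: split_indicator)
    have "(log_tent N s - log_tent N t)\<^sup>2 * ((s * t) powr ?p / \<bar>s - t\<bar> powr (1 + \<alpha>))
       \<le> (s - t)\<^sup>2 / (s * t) / N\<^sup>2 * ((s * t) powr ?p / \<bar>s - t\<bar> powr (1 + \<alpha>))"
      by (intro mult_right_mono log_tent_lipschitz N st) simp
    also have "\<dots> = 1 / N\<^sup>2 * ((s * t) powr (?p - 1) * \<bar>s - t\<bar> powr (1 - \<alpha>))"
    proof -
      have 1: "(s * t) powr (?p - 1) = (s * t) powr ?p / (s * t)" using st by (simp add: powr_diff)
      have "\<bar>s - t\<bar> powr (1 - \<alpha>) * \<bar>s - t\<bar> powr (1 + \<alpha>) = \<bar>s - t\<bar> powr 2" by (simp add: powr_add[symmetric] del: powr_numeral)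
      also have "\<dots> = (s - t)\<^sup>2" using ne by simp
      finally have 2: "\<bar>s - t\<bar> powr (1 - \<alpha>) = (s - t)\<^sup>2 / \<bar>s - t\<bar> powr (1 + \<alpha>)" using ne by (simp add: eq_divide_eq)
      show ?thesis unfolding 1 2 by (simp add: mult_ac)
    qed
    finally have "ennreal ((log_tent N s - log_tent N t)\<^sup>2 * ((s * t) powr ?p / \<bar>s - t\<bar> powr (1 + \<alpha>)))
       \<le> ennreal (1 / N\<^sup>2 * ((s * t) powr (?p - 1) * \<bar>s - t\<bar> powr (1 - \<alpha>)))" by (rule ennreal_leI)
    also have "\<dots> = ennreal (1 / N\<^sup>2) * ?g s t" by (rule ennreal_mult') simp
    also have "\<dots> \<le> ennreal (1 / N\<^sup>2) * (?h s t + ?h t s)" by (rule mult_left_mono[OF ind]) simp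
    finally show ?thesis using st by simp
  next
    case False
    then show ?thesis by (auto split: split_indicator)
  qed
  have I: "(\<integral>\<^sup>+s. \<integral>\<^sup>+t. ?h s t \<partial>lborel \<partial>lborel) = ennreal (N * Q)"
  proof -
    have "(\<integral>\<^sup>+s. \<integral>\<^sup>+t. ?h s t \<partial>lborel \<partial>lborel) = (\<integral>\<^sup>+s. ennreal Q * (ennreal (1 / s) * indicator ?S s) \<partial>lborel)"
    proof (rule nn_integral_cong)
      fix s :: real
      show "(\<integral>\<^sup>+t. ?h s t \<partial>lborel) = ennreal Q * (ennreal (1 / s) * indicator ?S s)"
      proof (cases "s \<in> ?S")
        case True
        then have s: "0 < s" using S by auto
        have "(\<integral>\<^sup>+t. ?h s t \<partial>lborel) = (\<integral>\<^sup>+t\<in>?P. ?g s t \<partial>lborel)" using True s by simp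
        also have "\<dots> = ennreal (1 / s) * ennreal Q" unfolding tau_integral_scaled[OF s] tau ..
        finally show ?thesis using True by (simp add: mult.commute)
      qed simp
    qed
    also have "\<dots> = ennreal Q * (\<integral>\<^sup>+s\<in>?S. ennreal (1 / s) \<partial>lborel)" by (rule nn_integral_cmult) measurable
    also have "(\<integral>\<^sup>+s\<in>?S. ennreal (1 / s) \<partial>lborel) = ennreal (ln (exp (- N)) - ln (exp (- 2 * N)))"
      by (rule nn_integral_inverse) (use N in auto)
    also have "ln (exp (- N)) - ln (exp (- 2 * N)) = N" by simp
    also have "ennreal Q * ennreal N = ennreal (N * Q)" using Q N by (simp add: mult.commute flip: ennreal_mult)
    finally show ?thesis .
  qed
  have I': "(\<integral>\<^sup>+s. \<integral>\<^sup>+t. ?h t s \<partial>lborel \<partial>lborel) = ennreal (N * Q)"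
    unfolding I[symmetric] by (rule lborel_pair.Fubini') measurable
  have "(\<integral>\<^sup>+s\<in>?P. (\<integral>\<^sup>+t\<in>?P. ennreal ((log_tent N s - log_tent N t)\<^sup>2 * ((s * t) powr ?p / \<bar>s - t\<bar> powr (1 + \<alpha>))) \<partial>lborel) \<partial>lborel)
    = (\<integral>\<^sup>+s. \<integral>\<^sup>+t. ennreal ((log_tent N s - log_tent N t)\<^sup>2 * ((s * t) powr ?p / \<bar>s - t\<bar> powr (1 + \<alpha>))) * indicator ?P t * indicator ?P s \<partial>lborel \<partial>lborel)"
    by (rule nn_integral_cong, rule nn_integral_multc[symmetric]) measurable
  also have "\<dots> \<le> (\<integral>\<^sup>+s. \<integral>\<^sup>+t. ennreal (1 / N\<^sup>2) * (?h s t + ?h t s) \<partial>lborel \<partial>lborel)"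
    by (intro nn_integral_mono pw)
  also have "\<dots> = ennreal (1 / N\<^sup>2) * ((\<integral>\<^sup>+s. \<integral>\<^sup>+t. ?h s t \<partial>lborel \<partial>lborel) + (\<integral>\<^sup>+s. \<integral>\<^sup>+t. ?h t s \<partial>lborel \<partial>lborel))"
    by (simp add: nn_integral_cmult nn_integral_add)
  also have "\<dots> = ennreal (1 / N\<^sup>2 * (N * Q + N * Q))"
  proof -
    have nn: "0 \<le> N * Q" using Q N by simp
    show ?thesis unfolding I I' ennreal_plus[OF nn nn, symmetric] by (rule ennreal_mult'[symmetric]) simp
  qed
  also have "1 / N\<^sup>2 * (N * Q + N * Q) = 2 * Q / N" using N by (simp add: field_simps power2_eq_square)
  finally show ?thesis .
qed

text \<open>The test function is the ground state times a logarithmic tent at the end point \<open>-1\<close>. Its weighted norm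
  is at least \<open>N / 32\<close> and the remainder is at most a multiple of \<open>1 / N\<close>, so that the remainder is
  absorbed into the constant for large \<open>N\<close>.\<close>

lemma sharp_interval:
  assumes a: "1 < \<alpha>" "\<alpha> < 2" and d: "0 < d"
  obtains \<psi> :: "real \<Rightarrow> real" and r
  where "0 < r" "r < 1" "\<psi> \<in> borel_measurable borel" "continuous_on {-1<..<1} \<psi>" "\<And>s. \<bar>\<psi> s\<bar> \<le> 1"
    "\<And>s. \<psi> s \<noteq> 0 \<Longrightarrow> -1 + r \<le> s \<and> s \<le> 0"
    "(\<integral>\<^sup>+s\<in>{-1<..<1}. (\<integral>\<^sup>+t\<in>{-1<..<1}. ennreal ((\<psi> s - \<psi> t)\<^sup>2 / \<bar>s - t\<bar> powr (1 + \<alpha>)) \<partial>lborel) \<partial>lborel)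
      \<le> 2 * (ennreal (kappa 1 \<alpha> + d) * (\<integral>\<^sup>+s\<in>{-1<..<1}. ennreal ((\<psi> s)\<^sup>2 * (1 + s) powr (- \<alpha>)) \<partial>lborel))"
    "0 < (\<integral>\<^sup>+s\<in>{-1<..<1}. ennreal ((\<psi> s)\<^sup>2 * (1 + s) powr (- \<alpha>)) \<partial>lborel)"
    "(\<integral>\<^sup>+s\<in>{-1<..<1}. ennreal ((\<psi> s)\<^sup>2 * (1 + s) powr (- \<alpha>)) \<partial>lborel) < \<infinity>"
proof -
  let ?p = "(\<alpha> - 1) / 2"
  define \<delta> where "\<delta> = d / 3"
  have \<delta>: "0 < \<delta>" using d by (simp add: \<delta>_def)
  obtain Q where Q: "0 \<le> Q" and tau: "(\<integral>\<^sup>+t\<in>{0<..}. ennreal (t powr (?p - 1) * \<bar>1 - t\<bar> powr (1 - \<alpha>)) \<partial>lborel) = ennreal Q"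
    using tau_integral_finite[OF a]
    by (cases "\<integral>\<^sup>+t\<in>{0<..}. ennreal (t powr (?p - 1) * \<bar>1 - t\<bar> powr (1 - \<alpha>)) \<partial>lborel") auto
  obtain r0 where r0: "0 < r0" "r0 \<le> 1"
    and near: "\<And>x. -1 < x \<Longrightarrow> x \<le> -1 + r0 \<Longrightarrow>
      (Beta ((1 + \<alpha>) / 2) ((2 - \<alpha>) / 2) * (1 - x) powr (- \<alpha>) - 1) / \<alpha> \<le> kappa 1 \<alpha> + \<delta>"
    using near_boundary_constant[OF a \<delta>] by metis
  \<comment> \<open>The first bound places the support within \<open>r0\<close> of the end point, the second makes the remainder
    at most \<open>2 \<delta>\<close> times the weighted norm, which is at least \<open>N / 32\<close>.\<close>
  define N where "N = max (max 1 (- ln r0)) (32 * 4 powr ?p * Q / \<delta>)"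
  have N1: "1 \<le> N" and Nr: "- ln r0 \<le> N" and NQ: "32 * 4 powr ?p * Q / \<delta> \<le> N" by (auto simp: N_def)
  have N: "0 < N" using N1 by simp
  define \<psi> where "\<psi> x = (if \<bar>x\<bar> < 1 then (1 - x\<^sup>2) powr ?p * log_tent N (1 + x) else 0)" for x
  define X where "X = (\<integral>\<^sup>+s\<in>{-1<..<1}. ennreal ((\<psi> s)\<^sup>2 * (1 + s) powr (- \<alpha>)) \<partial>lborel)"
  have meas[measurable]: "\<psi> \<in> borel_measurable borel" unfolding \<psi>_def by measurable
  have supp0: "exp (- 2 * N) < 1 + s \<and> 1 + s < exp (- N)" if "\<psi> s \<noteq> 0" for s
    using that log_tent_support[OF N, of "1 + s"] by (auto simp: \<psi>_def abs_less_iff split: if_splits)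
  have eN: "exp (- N) \<le> r0"
  proof -
    have "exp (- N) \<le> exp (ln r0)" using Nr by simp
    then show ?thesis using r0 by simp
  qed
  have supp: "-1 + exp (- 2 * N) \<le> s \<and> s \<le> 0" if "\<psi> s \<noteq> 0" for s
    using supp0[OF that] eN r0 by auto
  have cont: "continuous_on {-1<..<1} \<psi>"
  proof (rule continuous_on_eq)
    show "continuous_on {-1<..<1} (\<lambda>x. (1 - x\<^sup>2) powr ?p * log_tent N (1 + x))"
      unfolding log_tent_def using N
      by (intro continuous_intros) (auto simp: power2_eq_1_iff)
  qed (auto simp: \<psi>_def abs_less_iff)
  have bd: "\<bar>\<psi> s\<bar> \<le> 1" for s
  proof -
    have "(1 - s\<^sup>2) powr ?p * log_tent N (1 + s) \<le> 1 * 1" if "\<bar>s\<bar> < 1"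
      using that a log_tent_bounds[of N "1 + s"] by (intro mult_mono powr_le1) (auto simp: abs_square_le_1)
    then show ?thesis using log_tent_bounds[of N "1 + s"] by (auto simp: \<psi>_def abs_mult)
  qed
  have Xfin: "X < \<infinity>"
  proof -
    have "X \<le> (\<integral>\<^sup>+s. ennreal (exp (- 2 * N) powr (- \<alpha>)) * indicator {-1<..<1::real} s \<partial>lborel)"
      unfolding X_def
    proof (rule nn_integral_mono)
      fix s :: real
      have "(\<psi> s)\<^sup>2 * (1 + s) powr (- \<alpha>) \<le> exp (- 2 * N) powr (- \<alpha>)"
      proof (cases "\<psi> s = 0")
        case False
        have "(\<psi> s)\<^sup>2 \<le> 1" using bd[of s] by (simp add: abs_square_le_1)
        moreover have "(1 + s) powr (- \<alpha>) \<le> exp (- 2 * N) powr (- \<alpha>)"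
          using supp0[OF False] a by (intro powr_mono2') auto
        ultimately have "(\<psi> s)\<^sup>2 * (1 + s) powr (- \<alpha>) \<le> 1 * exp (- 2 * N) powr (- \<alpha>)" by (intro mult_mono) auto
        then show ?thesis by simp
      qed simp
      then show "ennreal ((\<psi> s)\<^sup>2 * (1 + s) powr (- \<alpha>)) * indicator {-1<..<1} s
        \<le> ennreal (exp (- 2 * N) powr (- \<alpha>)) * indicator {-1<..<1} s"
        by (intro mult_right_mono ennreal_leI) auto
    qed
    also have "\<dots> < \<infinity>" by (simp add: nn_integral_cmult_indicator ennreal_mult_less_top)
    finally show ?thesis .
  qed
  have Xlow: "ennreal (N / 32) \<le> X"
  proof -
    let ?M = "{exp (- 7 / 4 * N)<..<exp (- 5 / 4 * N)}"
    have "ennreal (N / 32) = ennreal (1 / 16) * ennreal (ln (exp (- 5 / 4 * N)) - ln (exp (- 7 / 4 * N)))"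
      using N by (simp flip: ennreal_mult)
    also have "\<dots> = ennreal (1 / 16) * (\<integral>\<^sup>+s\<in>?M. ennreal (1 / s) \<partial>lborel)"
      using N by (subst nn_integral_inverse) auto
    also have "\<dots> = (\<integral>\<^sup>+s. ennreal (1 / 16) * (ennreal (1 / s) * indicator ?M s) \<partial>lborel)"
      by (rule nn_integral_cmult[symmetric]) measurable
    also have "\<dots> = (\<integral>\<^sup>+s. ennreal (1 / 16) * (ennreal (1 / (1 + s)) * indicator ?M (1 + s)) \<partial>lborel)"
      by (rule nn_integral_lborel_translate[symmetric]) measurable
    also have "\<dots> \<le> X" unfolding X_def
    proof (rule nn_integral_mono)
      fix s :: real
      show "ennreal (1 / 16) * (ennreal (1 / (1 + s)) * indicator ?M (1 + s))
        \<le> ennreal ((\<psi> s)\<^sup>2 * (1 + s) powr (- \<alpha>)) * indicator {-1<..<1} s"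
      proof (cases "1 + s \<in> ?M")
        case True
        have t: "exp (- 7 / 4 * N) < 1 + s" "1 + s < exp (- 5 / 4 * N)"
          using True by (simp_all only: greaterThanLessThan_iff)
        have s1: "0 < 1 + s" by (rule less_trans[OF exp_gt_zero t(1)])
        have "exp (- 5 / 4 * N) \<le> 1" using N by simp
        from less_le_trans[OF t(2) this] have s0: "s < 0" by simp
        have s: "\<bar>s\<bar> < 1" using s1 s0 by auto
        have f: "1 / 4 \<le> log_tent N (1 + s)" by (rule log_tent_middle[OF N s1 t])
        have "(1 + s) powr (?p + ?p) \<le> (1 - s\<^sup>2) powr (?p + ?p)"
        proof (rule powr_mono2)
          have "0 \<le> (- s) * (1 + s)" using s0 s1 by (intro mult_nonneg_nonneg) auto
          then show "1 + s \<le> 1 - s\<^sup>2" by (simp add: power2_eq_square algebra_simps)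
        qed (use a s1 in auto)
        also have "\<dots> = ((1 - s\<^sup>2) powr ?p)\<^sup>2" by (simp only: powr_add power2_eq_square)
        finally have w: "(1 + s) powr (\<alpha> - 1) \<le> ((1 - s\<^sup>2) powr ?p)\<^sup>2" by simp
        have "(1 / 4)\<^sup>2 \<le> (log_tent N (1 + s))\<^sup>2" using f by (intro power_mono) auto
        then have "1 / 16 * (1 + s) powr (\<alpha> - 1) \<le> (log_tent N (1 + s))\<^sup>2 * ((1 - s\<^sup>2) powr ?p)\<^sup>2"
          using w by (intro mult_mono) (auto simp: power2_eq_square)
        also have "\<dots> = (\<psi> s)\<^sup>2" using s by (simp add: \<psi>_def power_mult_distrib)
        finally have "1 / 16 * (1 + s) powr (\<alpha> - 1) * (1 + s) powr (- \<alpha>) \<le> (\<psi> s)\<^sup>2 * (1 + s) powr (- \<alpha>)"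
          by (intro mult_right_mono) auto
        also have "1 / 16 * (1 + s) powr (\<alpha> - 1) * (1 + s) powr (- \<alpha>) = 1 / 16 * (1 / (1 + s))"
        proof -
          have "(1 + s) powr (\<alpha> - 1) * (1 + s) powr (- \<alpha>) = (1 + s) powr (- 1)"
            by (simp add: powr_add[symmetric] del: powr_neg_one)
          also have "\<dots> = 1 / (1 + s)" using s1 by (simp add: powr_minus_divide)
          finally show ?thesis by (simp only: mult.assoc)
        qed
        finally have "ennreal (1 / 16 * (1 / (1 + s))) \<le> ennreal ((\<psi> s)\<^sup>2 * (1 + s) powr (- \<alpha>))" by (rule ennreal_leI)
        moreover have "ennreal (1 / 16 * (1 / (1 + s))) = ennreal (1 / 16) * ennreal (1 / (1 + s))"
          by (rule ennreal_mult') simp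
        moreover have "s \<in> {-1<..<1}" using s by auto
        ultimately show ?thesis using True by (simp only: indicator_simps mult_1_right)
      qed simp
    qed
    finally show ?thesis .
  qed
  let ?W = "\<lambda>s. (1 - s\<^sup>2) powr ?p"
  let ?R = "\<lambda>\<eta>. \<integral>\<^sup>+s. \<integral>\<^sup>+t. ennreal ((\<psi> s / ?W s - \<psi> t / ?W t)\<^sup>2 * (?W s * ?W t * interval_kernel \<alpha> \<eta> s t)) \<partial>lborel \<partial>lborel"
  have R: "?R \<eta> \<le> ennreal (4 powr ?p) * ennreal (2 * Q / N)" for \<eta>
  proof -
    let ?L = "\<lambda>s t. ennreal ((log_tent N s - log_tent N t)\<^sup>2 * ((s * t) powr ?p / \<bar>s - t\<bar> powr (1 + \<alpha>))) * indicator {0<..} t * indicator {0<..} s"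
    have pw: "ennreal ((\<psi> s / ?W s - \<psi> t / ?W t)\<^sup>2 * (?W s * ?W t * interval_kernel \<alpha> \<eta> s t))
       \<le> ennreal (4 powr ?p) * ?L (1 + s) (1 + t)" for s t
    proof (cases "interval_kernel \<alpha> \<eta> s t = 0")
      case False
      then have st: "\<bar>s\<bar> < 1" "\<bar>t\<bar> < 1" and K: "interval_kernel \<alpha> \<eta> s t = 1 / \<bar>s - t\<bar> powr (1 + \<alpha>)"
        by (auto simp: interval_kernel_def split: if_splits)
      have w: "?W y \<le> 2 powr ?p * (1 + y) powr ?p" "?W y \<noteq> 0" if "\<bar>y\<bar> < 1" for y
      proof -
        have "?W y \<le> (2 * (1 + y)) powr ?p"
        proof (rule powr_mono2)
          have "(1 - y) * (1 + y) \<le> 2 * (1 + y)" using that by (intro mult_right_mono) auto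
          then show "1 - y\<^sup>2 \<le> 2 * (1 + y)" by (simp add: power2_eq_square algebra_simps)
        qed (use a that in \<open>auto simp: abs_square_le_1\<close>)
        also have "(2 * (1 + y)) powr ?p = 2 powr ?p * (1 + y) powr ?p" by (rule powr_mult)
        finally show "?W y \<le> 2 powr ?p * (1 + y) powr ?p" .
        show "?W y \<noteq> 0" using that by (simp add: abs_square_eq_1)
      qed
      have "?W s * ?W t \<le> (2 powr ?p * (1 + s) powr ?p) * (2 powr ?p * (1 + t) powr ?p)"
        by (intro mult_mono w st) auto
      also have "\<dots> = (2 powr ?p * 2 powr ?p) * ((1 + s) powr ?p * (1 + t) powr ?p)" by (simp only: mult_ac)
      also have "\<dots> = 4 powr ?p * ((1 + s) * (1 + t)) powr ?p"
        using st by (simp add: powr_mult[symmetric])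
      finally have ww: "?W s * ?W t \<le> 4 powr ?p * ((1 + s) * (1 + t)) powr ?p" .
      have q: "\<psi> y / ?W y = log_tent N (1 + y)" if "\<bar>y\<bar> < 1" for y using w(2)[OF that] that by (simp add: \<psi>_def)
      let ?D = "(log_tent N (1 + s) - log_tent N (1 + t))\<^sup>2"
      have "(\<psi> s / ?W s - \<psi> t / ?W t)\<^sup>2 * (?W s * ?W t * interval_kernel \<alpha> \<eta> s t)
        \<le> ?D * (4 powr ?p * ((1 + s) * (1 + t)) powr ?p * (1 / \<bar>s - t\<bar> powr (1 + \<alpha>)))"
        unfolding q[OF st(1)] q[OF st(2)] K by (intro mult_left_mono mult_right_mono ww) auto
      also have "\<dots> = 4 powr ?p * (?D * (((1 + s) * (1 + t)) powr ?p / \<bar>(1 + s) - (1 + t)\<bar> powr (1 + \<alpha>)))"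
        by simp
      finally have "ennreal ((\<psi> s / ?W s - \<psi> t / ?W t)\<^sup>2 * (?W s * ?W t * interval_kernel \<alpha> \<eta> s t))
         \<le> ennreal (4 powr ?p * (?D * (((1 + s) * (1 + t)) powr ?p / \<bar>(1 + s) - (1 + t)\<bar> powr (1 + \<alpha>))))"
        by (rule ennreal_leI)
      also have "\<dots> = ennreal (4 powr ?p) * ennreal (?D * (((1 + s) * (1 + t)) powr ?p / \<bar>(1 + s) - (1 + t)\<bar> powr (1 + \<alpha>)))"
        by (rule ennreal_mult') simp
      also have "\<dots> = ennreal (4 powr ?p) * ?L (1 + s) (1 + t)"
      proof -
        have "1 + s \<in> {0<..}" "1 + t \<in> {0<..}" using st by (auto simp: abs_less_iff)
        then show ?thesis by (simp only: indicator_simps mult_1_right)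
      qed
      finally show ?thesis .
    qed simp
    have "?R \<eta> \<le> (\<integral>\<^sup>+s. \<integral>\<^sup>+t. ennreal (4 powr ?p) * ?L (1 + s) (1 + t) \<partial>lborel \<partial>lborel)"
      by (intro nn_integral_mono pw)
    also have "\<dots> = (\<integral>\<^sup>+s. ennreal (4 powr ?p) * (\<integral>\<^sup>+t. ?L (1 + s) t \<partial>lborel) \<partial>lborel)"
    proof (rule nn_integral_cong)
      fix s :: real
      have "(\<integral>\<^sup>+t. ennreal (4 powr ?p) * ?L (1 + s) (1 + t) \<partial>lborel) = (\<integral>\<^sup>+t. ennreal (4 powr ?p) * ?L (1 + s) t \<partial>lborel)"
        by (rule nn_integral_lborel_translate) measurable
      also have "\<dots> = ennreal (4 powr ?p) * (\<integral>\<^sup>+t. ?L (1 + s) t \<partial>lborel)"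
        by (rule nn_integral_cmult) measurable
      finally show "(\<integral>\<^sup>+t. ennreal (4 powr ?p) * ?L (1 + s) (1 + t) \<partial>lborel) = ennreal (4 powr ?p) * (\<integral>\<^sup>+t. ?L (1 + s) t \<partial>lborel)" .
    qed
    also have "\<dots> = (\<integral>\<^sup>+s. ennreal (4 powr ?p) * (\<integral>\<^sup>+t. ?L s t \<partial>lborel) \<partial>lborel)"
      by (rule nn_integral_lborel_translate) measurable
    also have "\<dots> = ennreal (4 powr ?p) * (\<integral>\<^sup>+s. \<integral>\<^sup>+t. ?L s t \<partial>lborel \<partial>lborel)"
      by (rule nn_integral_cmult) measurable
    also have "(\<integral>\<^sup>+s. \<integral>\<^sup>+t. ?L s t \<partial>lborel \<partial>lborel)
      = (\<integral>\<^sup>+s\<in>{0<..}. (\<integral>\<^sup>+t\<in>{0<..}. ennreal ((log_tent N s - log_tent N t)\<^sup>2 * ((s * t) powr ?p / \<bar>s - t\<bar> powr (1 + \<alpha>))) \<partial>lborel) \<partial>lborel)"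
      by (rule nn_integral_cong, rule nn_integral_multc) measurable
    also have "ennreal (4 powr ?p) * \<dots> \<le> ennreal (4 powr ?p) * ennreal (2 * Q / N)"
      by (intro mult_left_mono log_tent_remainder_le[OF a N Q tau]) simp
    finally show ?thesis .
  qed
  have RX: "ennreal (4 powr ?p) * ennreal (2 * Q / N) \<le> 2 * (ennreal \<delta> * X)"
  proof -
    have "32 * 4 powr ?p * Q \<le> N * \<delta>" using NQ \<delta> by (simp add: pos_divide_le_eq)
    also have "\<dots> \<le> N * \<delta> * N" using N1 N \<delta> by simp
    finally have "4 powr ?p * (2 * Q / N) \<le> 2 * (\<delta> * (N / 32))" using N by (simp add: field_simps)
    then have "ennreal (4 powr ?p * (2 * Q / N)) \<le> ennreal (2 * (\<delta> * (N / 32)))" by (rule ennreal_leI)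
    also have "\<dots> = 2 * (ennreal \<delta> * ennreal (N / 32))"
      using \<delta> by (simp only: ennreal_mult'[OF zero_le_numeral] ennreal_mult'[OF less_imp_le] ennreal_numeral)
    also have "\<dots> \<le> 2 * (ennreal \<delta> * X)" by (intro mult_left_mono Xlow) simp_all
    finally show ?thesis by (simp only: ennreal_mult'[OF powr_ge_zero])
  qed
  define \<eta>\<^sub>0 where "\<eta>\<^sub>0 = min (1 / 2) ((\<delta> / 6) powr (1 / (2 - \<alpha>)))"
  have eta0: "0 < \<eta>\<^sub>0" "\<eta>\<^sub>0 < 1" using \<delta> by (auto simp: \<eta>\<^sub>0_def)
  have "(\<integral>\<^sup>+s\<in>{-1<..<1}. (\<integral>\<^sup>+t\<in>{-1<..<1}. ennreal ((\<psi> s - \<psi> t)\<^sup>2 / \<bar>s - t\<bar> powr (1 + \<alpha>)) \<partial>lborel) \<partial>lborel)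
     \<le> 2 * (ennreal (kappa 1 \<alpha> + 2 * \<delta>) * X) + 2 * (ennreal \<delta> * X)"
  proof (rule interval_energy_le[OF meas eta0])
    fix \<eta> assume e: "0 < \<eta>" "\<eta> \<le> \<eta>\<^sub>0"
    have "\<eta> powr (2 - \<alpha>) \<le> ((\<delta> / 6) powr (1 / (2 - \<alpha>))) powr (2 - \<alpha>)"
      using e a by (intro powr_mono2) (auto simp: \<eta>\<^sub>0_def)
    also have "\<dots> = \<delta> / 6" using a \<delta> by (simp add: powr_powr)
    finally have small: "6 * \<eta> powr (2 - \<alpha>) \<le> \<delta>" by simp
    have "(\<integral>\<^sup>+s. \<integral>\<^sup>+t. ennreal ((\<psi> s - \<psi> t)\<^sup>2 * interval_kernel \<alpha> \<eta> s t) \<partial>lborel \<partial>lborel)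
      \<le> 2 * (ennreal (kappa 1 \<alpha> + 2 * \<delta>) * X) + ?R \<eta>"
    proof (rule interval_truncated_energy_le[OF a meas _ _ e(1) _ small X_def Xfin])
      fix s assume "\<psi> s \<noteq> 0"
      note s0 = supp0[OF this] and s1 = supp[OF this]
      have "0 < 1 + s" by (rule less_trans[OF exp_gt_zero conjunct1[OF s0]])
      then have "-1 < s" by simp
      then show "-1 < s \<and> s \<le> 0 \<and> (Beta ((1 + \<alpha>) / 2) ((2 - \<alpha>) / 2) * (1 - s) powr (- \<alpha>) - 1) / \<alpha> \<le> kappa 1 \<alpha> + \<delta>"
        using s0 s1 eN by (intro conjI near) auto
    qed (use \<delta> e eta0 in auto)
    also have "\<dots> \<le> 2 * (ennreal (kappa 1 \<alpha> + 2 * \<delta>) * X) + 2 * (ennreal \<delta> * X)"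
      by (intro add_left_mono order_trans[OF R RX])
    finally show "(\<integral>\<^sup>+s. \<integral>\<^sup>+t. ennreal ((\<psi> s - \<psi> t)\<^sup>2 * interval_kernel \<alpha> \<eta> s t) \<partial>lborel \<partial>lborel)
      \<le> 2 * (ennreal (kappa 1 \<alpha> + 2 * \<delta>) * X) + 2 * (ennreal \<delta> * X)" .
  qed
  also have "\<dots> = 2 * ((ennreal (kappa 1 \<alpha> + 2 * \<delta>) + ennreal \<delta>) * X)" by (simp only: distrib_left distrib_right)
  also have "ennreal (kappa 1 \<alpha> + 2 * \<delta>) + ennreal \<delta> = ennreal (kappa 1 \<alpha> + d)"
    using kappa_1_nonneg[OF a] \<delta> by (subst ennreal_plus[symmetric]) (auto simp: \<delta>_def)
  finally have E: "(\<integral>\<^sup>+s\<in>{-1<..<1}. (\<integral>\<^sup>+t\<in>{-1<..<1}. ennreal ((\<psi> s - \<psi> t)\<^sup>2 / \<bar>s - t\<bar> powr (1 + \<alpha>)) \<partial>lborel) \<partial>lborel)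
     \<le> 2 * (ennreal (kappa 1 \<alpha> + d) * X)" .
  have Xpos: "0 < X" using Xlow N by (auto intro: less_le_trans[rotated])
  have r: "0 < exp (- 2 * N)" "exp (- 2 * N) < 1" using N by auto
  show ?thesis
    by (rule that[OF r meas cont bd supp E[unfolded X_def] Xpos[unfolded X_def] Xfin[unfolded X_def]])
qed

section \<open>Functions constant along a direction\<close>

definition perp_norm :: "'a::euclidean_space \<Rightarrow> 'a \<Rightarrow> real" where
  "perp_norm e x = norm (x - (x \<bullet> e) *\<^sub>R e)"

lemma perp_norm_measurable[measurable]: "perp_norm e \<in> borel_measurable borel"
  unfolding perp_norm_def by measurable

lemma perp_norm_nonneg: "0 \<le> perp_norm e x"
  by (simp add: perp_norm_def)

lemma perp_norm_shift: "norm e = 1 \<Longrightarrow> perp_norm e (x + s *\<^sub>R e) = perp_norm e x"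
  by (simp add: perp_norm_def inner_add_left dot_square_norm scaleR_add_left algebra_simps)

lemma perp_norm_scale: "perp_norm e (c *\<^sub>R x) = \<bar>c\<bar> * perp_norm e x"
proof -
  have "c *\<^sub>R x - (c *\<^sub>R x \<bullet> e) *\<^sub>R e = c *\<^sub>R (x - (x \<bullet> e) *\<^sub>R e)" by (simp add: scaleR_diff_right)
  then show ?thesis by (simp add: perp_norm_def)
qed

lemma perp_norm_le: "norm e = 1 \<Longrightarrow> perp_norm e x \<le> norm x"
proof -
  assume e: "norm e = 1"
  have "(perp_norm e x)\<^sup>2 = (norm x)\<^sup>2 - (x \<bullet> e)\<^sup>2"
  proof -
    have ee: "e \<bullet> e = 1" using e by (simp add: dot_square_norm)
    show ?thesis unfolding perp_norm_def power2_norm_eq_inner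
      by (simp add: inner_diff_left inner_diff_right ee power2_eq_square inner_commute)
  qed
  also have "\<dots> \<le> (norm x)\<^sup>2" by simp
  finally show ?thesis by (rule power2_le_imp_le) simp
qed

lemma norm_le_perp_norm: "norm e = 1 \<Longrightarrow> norm x \<le> perp_norm e x + \<bar>x \<bullet> e\<bar>"
proof -
  assume e: "norm e = 1"
  have "norm x = norm ((x - (x \<bullet> e) *\<^sub>R e) + (x \<bullet> e) *\<^sub>R e)" by simp
  also have "\<dots> \<le> perp_norm e x + norm ((x \<bullet> e) *\<^sub>R e)" unfolding perp_norm_def by (rule norm_triangle_ineq)
  finally show ?thesis using e by simp
qed

lemma perp_norm_lipschitz:
  assumes "norm e = 1"
  shows "\<bar>perp_norm e x - perp_norm e y\<bar> \<le> norm (x - y)"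
proof -
  have "\<bar>perp_norm e x - perp_norm e y\<bar> \<le> norm ((x - (x \<bullet> e) *\<^sub>R e) - (y - (y \<bullet> e) *\<^sub>R e))"
    unfolding perp_norm_def by (rule norm_triangle_ineq3)
  also have "(x - (x \<bullet> e) *\<^sub>R e) - (y - (y \<bullet> e) *\<^sub>R e) = (x - y) - ((x - y) \<bullet> e) *\<^sub>R e"
    by (simp add: inner_diff_left scaleR_diff_left)
  also have "norm \<dots> \<le> norm (x - y)" using perp_norm_le[OF assms, of "x - y"] by (simp add: perp_norm_def)
  finally show ?thesis .
qed

text \<open>A function that is constant in the direction \<open>e\<close>, times a function of \<open>x \<bullet> e\<close>. Integrating the first
  factor over the strip \<open>0 \<le> x \<bullet> e < 1\<close> stands for its integral over the orthogonal hyperplane, so that no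
  measure on hyperplanes is required.\<close>

lemma nn_integral_product_lines:
  fixes e :: "'a::euclidean_space" and g :: "real \<Rightarrow> ennreal"
  assumes e: "norm e = 1" and T[measurable]: "\<Theta> \<in> borel_measurable borel" and g[measurable]: "g \<in> borel_measurable borel"
    and inv: "\<And>x s. \<Theta> (x + s *\<^sub>R e) = \<Theta> x"
  shows "(\<integral>\<^sup>+x. \<Theta> x * g (x \<bullet> e) \<partial>lborel)
    = (\<integral>\<^sup>+x. \<Theta> x * indicator {x. 0 \<le> x \<bullet> e \<and> x \<bullet> e < 1} x \<partial>lborel) * (\<integral>\<^sup>+s. g s \<partial>lborel)"
proof -
  let ?q = "\<lambda>x. indicator {x. 0 \<le> x \<bullet> e \<and> x \<bullet> e < 1} x :: ennreal"
  have "(\<integral>\<^sup>+x. \<Theta> x * g (x \<bullet> e) \<partial>lborel)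
    = (\<integral>\<^sup>+x. (\<integral>\<^sup>+s. \<Theta> (x + s *\<^sub>R e) * g ((x + s *\<^sub>R e) \<bullet> e) \<partial>lborel) * ?q x \<partial>lborel)"
    by (rule nn_integral_lines[OF _ e]) measurable
  also have "\<dots> = (\<integral>\<^sup>+x. \<Theta> x * ?q x * (\<integral>\<^sup>+s. g s \<partial>lborel) \<partial>lborel)"
  proof (rule nn_integral_cong)
    fix x :: 'a
    have "(\<integral>\<^sup>+s. \<Theta> (x + s *\<^sub>R e) * g ((x + s *\<^sub>R e) \<bullet> e) \<partial>lborel) = (\<integral>\<^sup>+s. \<Theta> x * g (x \<bullet> e + s) \<partial>lborel)"
      by (rule nn_integral_cong) (simp add: inv inner_add_left dot_square_norm e)
    also have "\<dots> = \<Theta> x * (\<integral>\<^sup>+s. g (x \<bullet> e + s) \<partial>lborel)" by (rule nn_integral_cmult) measurable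
    also have "(\<integral>\<^sup>+s. g (x \<bullet> e + s) \<partial>lborel) = (\<integral>\<^sup>+s. g s \<partial>lborel)" by (rule nn_integral_lborel_translate) measurable
    finally show "(\<integral>\<^sup>+s. \<Theta> (x + s *\<^sub>R e) * g ((x + s *\<^sub>R e) \<bullet> e) \<partial>lborel) * ?q x = \<Theta> x * ?q x * (\<integral>\<^sup>+s. g s \<partial>lborel)"
      by (simp only: mult_ac)
  qed
  also have "\<dots> = (\<integral>\<^sup>+x. \<Theta> x * ?q x \<partial>lborel) * (\<integral>\<^sup>+s. g s \<partial>lborel)" by (rule nn_integral_multc) measurable
  finally show ?thesis .
qed

text \<open>A hyperplane has dimension one less than the space, which is why a factor \<open>L\<close> appears on the left.\<close>

lemma nn_integral_cross_section_scale:
  fixes e :: "'a::euclidean_space"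
  assumes e: "norm e = 1" and [measurable]: "\<Theta> \<in> borel_measurable borel" and inv: "\<And>x s. \<Theta> (x + s *\<^sub>R e) = \<Theta> x" and L: "0 < L"
  shows "(\<integral>\<^sup>+x. \<Theta> ((1 / L) *\<^sub>R x) * indicator {x. 0 \<le> x \<bullet> e \<and> x \<bullet> e < 1} x \<partial>lborel) * ennreal L
    = ennreal (L ^ DIM('a)) * (\<integral>\<^sup>+x. \<Theta> x * indicator {x. 0 \<le> x \<bullet> e \<and> x \<bullet> e < 1} x \<partial>lborel)"
proof -
  have inv': "\<Theta> ((1 / L) *\<^sub>R (x + s *\<^sub>R e)) = \<Theta> ((1 / L) *\<^sub>R x)" for x s
    using inv[of "(1 / L) *\<^sub>R x" "s / L"] by (simp add: scaleR_add_right)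
  have "(\<integral>\<^sup>+x. \<Theta> ((1 / L) *\<^sub>R x) * indicator {x. 0 \<le> x \<bullet> e \<and> x \<bullet> e < 1} x \<partial>lborel) * ennreal L
    = (\<integral>\<^sup>+x. \<Theta> ((1 / L) *\<^sub>R x) * indicator {x. 0 \<le> x \<bullet> e \<and> x \<bullet> e < 1} x \<partial>lborel) * (\<integral>\<^sup>+s. indicator {0..<L} s \<partial>lborel)"
    using L by simp
  also have "\<dots> = (\<integral>\<^sup>+x. \<Theta> ((1 / L) *\<^sub>R x) * indicator {0..<L} (x \<bullet> e) \<partial>lborel)"
    by (rule nn_integral_product_lines[OF e _ _ inv', symmetric]) measurable
  also have "\<dots> = ennreal (\<bar>L\<bar> ^ DIM('a)) * (\<integral>\<^sup>+x. \<Theta> ((1 / L) *\<^sub>R (L *\<^sub>R x)) * indicator {0..<L} ((L *\<^sub>R x) \<bullet> e) \<partial>lborel)"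
    by (rule nn_integral_lborel_scale) (use L in auto)
  also have "(\<lambda>x. \<Theta> ((1 / L) *\<^sub>R (L *\<^sub>R x)) * indicator {0..<L} ((L *\<^sub>R x) \<bullet> e)) = (\<lambda>x. \<Theta> x * indicator {x. 0 \<le> x \<bullet> e \<and> x \<bullet> e < 1} x)"
    using L by (auto simp: fun_eq_iff indicator_def zero_le_mult_iff)
  finally show ?thesis using L by simp
qed

text \<open>Integrating the kernel over hyperplanes orthogonal to \<open>e\<close> gives the one-dimensional kernel, with the
  moment of the sphere as the factor. In polar coordinates around \<open>x\<close> the direction \<open>w\<close> contributes
  \<open>|w \<bullet> e|\<^sup>\<alpha>\<close> after rescaling the radius by \<open>w \<bullet> e\<close>.\<close>

lemma slab_kernel_integral:
  fixes e x :: "'a::euclidean_space" and h :: "real \<Rightarrow> real"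
  assumes e: "norm e = 1" and [measurable]: "h \<in> borel_measurable borel" and h0: "\<And>t. 0 \<le> h t" and hx: "h (x \<bullet> e) = 0" and a: "0 < \<alpha>"
  shows "2 * (\<integral>\<^sup>+y. ennreal (h (y \<bullet> e) / norm (x - y) powr (real DIM('a) + \<alpha>)) \<partial>lborel)
    = ennreal (sphere_moment DIM('a) \<alpha>) * (\<integral>\<^sup>+t. ennreal (h t / \<bar>x \<bullet> e - t\<bar> powr (1 + \<alpha>)) \<partial>lborel)"
proof -
  let ?J = "\<integral>\<^sup>+t. ennreal (h t / \<bar>x \<bullet> e - t\<bar> powr (1 + \<alpha>)) \<partial>lborel"
  have "2 * (\<integral>\<^sup>+y. ennreal (h (y \<bullet> e) / norm (x - y) powr (real DIM('a) + \<alpha>)) \<partial>lborel)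
    = (\<integral>\<^sup>+w. (\<integral>\<^sup>+r. ennreal (h ((x + r *\<^sub>R w) \<bullet> e) / norm (x - (x + r *\<^sub>R w)) powr (real DIM('a) + \<alpha>)) * ennreal (\<bar>r\<bar> ^ (DIM('a) - 1)) \<partial>lborel) \<partial>sphere_measure)"
    by (rule nn_integral_polar_around) measurable
  also have "\<dots> = (\<integral>\<^sup>+w. ennreal (\<bar>w \<bullet> e\<bar> powr \<alpha>) * ?J \<partial>sphere_measure)"
  proof (rule nn_integral_cong)
    fix w :: 'a assume "w \<in> space sphere_measure"
    then have w: "norm w = 1" by (simp add: space_sphere_measure)
    define c where "c = w \<bullet> e"
    have "(\<integral>\<^sup>+r. ennreal (h ((x + r *\<^sub>R w) \<bullet> e) / norm (x - (x + r *\<^sub>R w)) powr (real DIM('a) + \<alpha>)) * ennreal (\<bar>r\<bar> ^ (DIM('a) - 1)) \<partial>lborel)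
      = (\<integral>\<^sup>+r. ennreal (h (x \<bullet> e + c * r) / \<bar>r\<bar> powr (1 + \<alpha>)) \<partial>lborel)"
    proof (rule nn_integral_cong)
      fix r :: real
      have i: "(x + r *\<^sub>R w) \<bullet> e = x \<bullet> e + c * r" by (simp add: inner_add_left c_def)
      have "ennreal (h (x \<bullet> e + c * r) / norm (x - (x + r *\<^sub>R w)) powr (real DIM('a) + \<alpha>)) * ennreal (\<bar>r\<bar> ^ (DIM('a) - 1))
        = ennreal (h (x \<bullet> e + c * r) / norm (x - (x + r *\<^sub>R w)) powr (real DIM('a) + \<alpha>) * \<bar>r\<bar> ^ (DIM('a) - 1))"
        by (rule ennreal_mult'[symmetric]) (simp add: h0)
      also have "h (x \<bullet> e + c * r) / norm (x - (x + r *\<^sub>R w)) powr (real DIM('a) + \<alpha>) * \<bar>r\<bar> ^ (DIM('a) - 1) = h (x \<bullet> e + c * r) / \<bar>r\<bar> powr (1 + \<alpha>)"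
        by (rule polar_kernel[OF w])
      finally show "ennreal (h ((x + r *\<^sub>R w) \<bullet> e) / norm (x - (x + r *\<^sub>R w)) powr (real DIM('a) + \<alpha>)) * ennreal (\<bar>r\<bar> ^ (DIM('a) - 1))
        = ennreal (h (x \<bullet> e + c * r) / \<bar>r\<bar> powr (1 + \<alpha>))" unfolding i .
    qed
    also have "\<dots> = ennreal (\<bar>c\<bar> powr \<alpha>) * ?J"
    proof (cases "c = 0")
      case True
      then show ?thesis by (simp add: hx)
    next
      case False
      have "?J = ennreal \<bar>c\<bar> * (\<integral>\<^sup>+r. ennreal (h (x \<bullet> e + c * r) / \<bar>x \<bullet> e - (x \<bullet> e + c * r)\<bar> powr (1 + \<alpha>)) \<partial>lborel)"
        by (rule nn_integral_real_affine) (use False in auto)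
      also have "(\<lambda>r. ennreal (h (x \<bullet> e + c * r) / \<bar>x \<bullet> e - (x \<bullet> e + c * r)\<bar> powr (1 + \<alpha>)))
        = (\<lambda>r. ennreal (1 / \<bar>c\<bar> powr (1 + \<alpha>)) * ennreal (h (x \<bullet> e + c * r) / \<bar>r\<bar> powr (1 + \<alpha>)))"
      proof
        fix r :: real
        have "\<bar>x \<bullet> e - (x \<bullet> e + c * r)\<bar> powr (1 + \<alpha>) = \<bar>c\<bar> powr (1 + \<alpha>) * \<bar>r\<bar> powr (1 + \<alpha>)"
          by (simp add: abs_mult powr_mult)
        then have "h (x \<bullet> e + c * r) / \<bar>x \<bullet> e - (x \<bullet> e + c * r)\<bar> powr (1 + \<alpha>) = 1 / \<bar>c\<bar> powr (1 + \<alpha>) * (h (x \<bullet> e + c * r) / \<bar>r\<bar> powr (1 + \<alpha>))"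
          by simp
        then show "ennreal (h (x \<bullet> e + c * r) / \<bar>x \<bullet> e - (x \<bullet> e + c * r)\<bar> powr (1 + \<alpha>))
          = ennreal (1 / \<bar>c\<bar> powr (1 + \<alpha>)) * ennreal (h (x \<bullet> e + c * r) / \<bar>r\<bar> powr (1 + \<alpha>))"
          by (simp only: ennreal_mult' zero_le_divide_1_iff powr_ge_zero)
      qed
      also have "(\<integral>\<^sup>+r. ennreal (1 / \<bar>c\<bar> powr (1 + \<alpha>)) * ennreal (h (x \<bullet> e + c * r) / \<bar>r\<bar> powr (1 + \<alpha>)) \<partial>lborel)
        = ennreal (1 / \<bar>c\<bar> powr (1 + \<alpha>)) * (\<integral>\<^sup>+r. ennreal (h (x \<bullet> e + c * r) / \<bar>r\<bar> powr (1 + \<alpha>)) \<partial>lborel)" (is "_ = _ * ?H")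
        by (rule nn_integral_cmult) measurable
      finally have J: "?J = ennreal \<bar>c\<bar> * (ennreal (1 / \<bar>c\<bar> powr (1 + \<alpha>)) * ?H)" .
      have "\<bar>c\<bar> powr \<alpha> * \<bar>c\<bar> * (1 / \<bar>c\<bar> powr (1 + \<alpha>)) = 1" using False by (simp add: powr_add)
      then have "ennreal (\<bar>c\<bar> powr \<alpha>) * ennreal \<bar>c\<bar> * ennreal (1 / \<bar>c\<bar> powr (1 + \<alpha>)) = 1"
        by (simp only: ennreal_mult'[symmetric] powr_ge_zero mult_nonneg_nonneg abs_ge_zero ennreal_1)
      then have "ennreal (\<bar>c\<bar> powr \<alpha>) * ?J = ?H" unfolding J by (simp only: mult.assoc[symmetric] mult_1_left)
      then show ?thesis by simp
    qed
    finally show "(\<integral>\<^sup>+r. ennreal (h ((x + r *\<^sub>R w) \<bullet> e) / norm (x - (x + r *\<^sub>R w)) powr (real DIM('a) + \<alpha>)) * ennreal (\<bar>r\<bar> ^ (DIM('a) - 1)) \<partial>lborel)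
      = ennreal (\<bar>w \<bullet> e\<bar> powr \<alpha>) * ?J" unfolding c_def .
  qed
  also have "\<dots> = (\<integral>\<^sup>+w. ennreal (\<bar>w \<bullet> e\<bar> powr \<alpha>) \<partial>sphere_measure) * ?J"
  proof (rule nn_integral_multc)
    show "(\<lambda>w. ennreal (\<bar>w \<bullet> e\<bar> powr \<alpha>)) \<in> borel_measurable sphere_measure"
      by (rule measurable_compose[OF sphere_measure_id_measurable]) measurable
  qed
  also have "(\<integral>\<^sup>+w. ennreal (\<bar>w \<bullet> e\<bar> powr \<alpha>) \<partial>sphere_measure) = ennreal (sphere_moment DIM('a) \<alpha>)"
    using a by (intro sphere_moment_integral[OF e]) auto
  finally show ?thesis .
qed

text \<open>A bound for \<open>(\<theta>(x) - \<theta>(x + h))\<^sup>2 / norm h powr (n + \<alpha>)\<close> when \<open>\<theta>\<close> takes values in \<open>[0, 1]\<close> and is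
  Lipschitz with constant \<open>1 / L\<close>.\<close>

definition cutoff_kernel :: "real \<Rightarrow> real \<Rightarrow> 'a::euclidean_space \<Rightarrow> real" where
  "cutoff_kernel \<alpha> L h = min 1 ((norm h / L)\<^sup>2) / norm h powr (real DIM('a) + \<alpha>)"

lemma cutoff_kernel_measurable[measurable]: "cutoff_kernel \<alpha> L \<in> borel_measurable borel"
  unfolding cutoff_kernel_def by measurable

lemma cutoff_kernel_scale:
  assumes L: "0 < L"
  shows "(\<integral>\<^sup>+h. ennreal (cutoff_kernel \<alpha> L (h::'a::euclidean_space)) \<partial>lborel)
    = ennreal (L powr (- \<alpha>)) * (\<integral>\<^sup>+h. ennreal (cutoff_kernel \<alpha> 1 (h::'a)) \<partial>lborel)"
proof -
  have "(\<integral>\<^sup>+h. ennreal (cutoff_kernel \<alpha> L (h::'a)) \<partial>lborel) = ennreal (\<bar>L\<bar> ^ DIM('a)) * (\<integral>\<^sup>+h. ennreal (cutoff_kernel \<alpha> L (L *\<^sub>R (h::'a))) \<partial>lborel)"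
    by (rule nn_integral_lborel_scale) (use L in auto)
  also have "(\<lambda>h::'a. ennreal (cutoff_kernel \<alpha> L (L *\<^sub>R h))) = (\<lambda>h. ennreal (L powr (- real DIM('a) - \<alpha>)) * ennreal (cutoff_kernel \<alpha> 1 h))"
  proof
    fix h :: 'a
    have "- real DIM('a) - \<alpha> = - (real DIM('a) + \<alpha>)" by simp
    then have "L powr (- real DIM('a) - \<alpha>) = 1 / L powr (real DIM('a) + \<alpha>)" by (simp only: powr_minus_divide)
    then have "cutoff_kernel \<alpha> L (L *\<^sub>R h) = L powr (- real DIM('a) - \<alpha>) * cutoff_kernel \<alpha> 1 h"
      using L by (simp add: cutoff_kernel_def powr_mult)
    then show "ennreal (cutoff_kernel \<alpha> L (L *\<^sub>R h)) = ennreal (L powr (- real DIM('a) - \<alpha>)) * ennreal (cutoff_kernel \<alpha> 1 h)"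
      by (simp only: ennreal_mult'[OF powr_ge_zero])
  qed
  also have "(\<integral>\<^sup>+h. ennreal (L powr (- real DIM('a) - \<alpha>)) * ennreal (cutoff_kernel \<alpha> 1 (h::'a)) \<partial>lborel)
    = ennreal (L powr (- real DIM('a) - \<alpha>)) * (\<integral>\<^sup>+h. ennreal (cutoff_kernel \<alpha> 1 (h::'a)) \<partial>lborel)"
    by (rule nn_integral_cmult) measurable
  also have "ennreal (\<bar>L\<bar> ^ DIM('a)) * \<dots> = ennreal (L powr (- \<alpha>)) * (\<integral>\<^sup>+h. ennreal (cutoff_kernel \<alpha> 1 (h::'a)) \<partial>lborel)"
  proof -
    have "\<bar>L\<bar> ^ DIM('a) * L powr (- real DIM('a) - \<alpha>) = L powr (real DIM('a)) * L powr (- real DIM('a) - \<alpha>)"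
      using L by (simp add: powr_realpow)
    also have "\<dots> = L powr (- \<alpha>)" by (simp add: powr_add[symmetric])
    finally have "ennreal (\<bar>L\<bar> ^ DIM('a)) * ennreal (L powr (- real DIM('a) - \<alpha>)) = ennreal (L powr (- \<alpha>))"
      by (simp only: ennreal_mult'[symmetric] zero_le_power abs_ge_zero)
    then show ?thesis by (simp only: mult.assoc[symmetric])
  qed
  finally show ?thesis .
qed

text \<open>The numerator is quadratic at the origin and bounded at infinity, which is integrable
  because \<open>\<alpha>\<close> lies between \<open>0\<close> and \<open>2\<close>.\<close>

lemma cutoff_kernel_finite:
  assumes a: "1 < \<alpha>" "\<alpha> < 2"
  shows "(\<integral>\<^sup>+h. ennreal (cutoff_kernel \<alpha> 1 (h::'a::euclidean_space)) \<partial>lborel) < \<infinity>"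
proof -
  let ?f = "\<lambda>r::real. ennreal (min 1 (r\<^sup>2) / \<bar>r\<bar> powr (1 + \<alpha>))"
  have rad: "(\<integral>\<^sup>+r. ?f r \<partial>lborel) < \<infinity>"
  proof -
    have "(\<integral>\<^sup>+r. ?f r \<partial>lborel) = 2 * (\<integral>\<^sup>+r\<in>{0<..}. ?f r \<partial>lborel)" by (rule nn_integral_even) simp_all
    also have "(\<integral>\<^sup>+r\<in>{0<..}. ?f r \<partial>lborel) \<le> (\<integral>\<^sup>+r. ennreal (r powr (1 - \<alpha>)) * indicator {0<..<1} r + ennreal (r powr (- \<alpha> - 1)) * indicator {1..} r \<partial>lborel)"
    proof (rule nn_integral_mono)
      fix r :: real
      show "?f r * indicator {0<..} r \<le> ennreal (r powr (1 - \<alpha>)) * indicator {0<..<1} r + ennreal (r powr (- \<alpha> - 1)) * indicator {1..} r"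
      proof (cases "0 < r")
        case r: True
        show ?thesis
        proof (cases "r < 1")
          case True
          have "min 1 (r\<^sup>2) / r powr (1 + \<alpha>) \<le> r powr 2 / r powr (1 + \<alpha>)" using r by (intro divide_right_mono) auto
          then have "min 1 (r\<^sup>2) / \<bar>r\<bar> powr (1 + \<alpha>) \<le> r powr 2 / r powr (1 + \<alpha>)" using r by (simp only: abs_of_pos)
          also have "\<dots> = r powr (1 - \<alpha>)" by (simp add: powr_diff[symmetric] del: powr_numeral)
          finally show ?thesis using r True by (simp add: ennreal_leI)
        next
          case False
          have "min 1 (r\<^sup>2) / r powr (1 + \<alpha>) \<le> 1 / r powr (1 + \<alpha>)" by (intro divide_right_mono) auto
          then have "min 1 (r\<^sup>2) / \<bar>r\<bar> powr (1 + \<alpha>) \<le> 1 / r powr (1 + \<alpha>)" using r by (simp only: abs_of_pos)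
          then show ?thesis using r False by (simp add: ennreal_leI powr_neg_minus_one)
        qed
      qed simp
    qed
    also have "\<dots> = (\<integral>\<^sup>+r\<in>{0<..<1}. ennreal (r powr (1 - \<alpha>)) \<partial>lborel) + (\<integral>\<^sup>+r\<in>{1..}. ennreal (r powr (- \<alpha> - 1)) \<partial>lborel)"
      by (rule nn_integral_add) measurable
    also have "(\<integral>\<^sup>+r\<in>{0<..<1}. ennreal (r powr (1 - \<alpha>)) \<partial>lborel) = ennreal (1 powr (2 - \<alpha>) / (2 - \<alpha>) - 0 powr (2 - \<alpha>) / (2 - \<alpha>))"
    proof (rule nn_integral_FTC_interior)
      show "continuous_on {0..1} (\<lambda>t::real. t powr (2 - \<alpha>) / (2 - \<alpha>))"
        using a by (intro continuous_intros continuous_on_powr') auto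
      show "((\<lambda>t. t powr (2 - \<alpha>) / (2 - \<alpha>)) has_real_derivative t powr (1 - \<alpha>)) (at t)"
        if "t \<in> {0<..<1}" for t
        using that a by (auto intro!: derivative_eq_intros)
    qed auto
    also have "(\<integral>\<^sup>+r\<in>{1..}. ennreal (r powr (- \<alpha> - 1)) \<partial>lborel) = ennreal (0 - (- (1 / \<alpha>) * 1 powr (- \<alpha>)))"
    proof (rule nn_integral_FTC_atLeast[where F = "\<lambda>t. - (1 / \<alpha>) * t powr (- \<alpha>)" and T = 0])
      show "((\<lambda>t. - (1 / \<alpha>) * t powr (- \<alpha>)) has_real_derivative t powr (- \<alpha> - 1)) (at t)" if "1 \<le> t" for t
        using that a by (auto intro!: derivative_eq_intros)
      have "((\<lambda>t. t powr (- \<alpha>)) \<longlongrightarrow> 0) at_top" using a by (intro tendsto_neg_powr filterlim_ident) auto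
      then have "((\<lambda>t. - (1 / \<alpha>) * t powr (- \<alpha>)) \<longlongrightarrow> - (1 / \<alpha>) * 0) at_top" by (intro tendsto_intros)
      then show "((\<lambda>t. - (1 / \<alpha>) * t powr (- \<alpha>)) \<longlongrightarrow> 0) at_top" by simp
    qed auto
    finally have "(\<integral>\<^sup>+r. ?f r \<partial>lborel) \<le> 2 * (ennreal (1 powr (2 - \<alpha>) / (2 - \<alpha>) - 0 powr (2 - \<alpha>) / (2 - \<alpha>)) + ennreal (0 - (- (1 / \<alpha>) * 1 powr (- \<alpha>))))"
      by this (rule mult_left_mono; simp)
    also have "\<dots> < \<infinity>" by (simp add: ennreal_mult_less_top)
    finally show ?thesis .
  qed
  have "2 * (\<integral>\<^sup>+h. ennreal (cutoff_kernel \<alpha> 1 (h::'a)) \<partial>lborel)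
    = (\<integral>\<^sup>+w. (\<integral>\<^sup>+r. ennreal (cutoff_kernel \<alpha> 1 (r *\<^sub>R w)) * ennreal (\<bar>r\<bar> ^ (DIM('a) - 1)) \<partial>lborel) \<partial>(sphere_measure :: 'a measure))"
    by (rule nn_integral_polar) measurable
  also have "\<dots> = (\<integral>\<^sup>+w. (\<integral>\<^sup>+r. ?f r \<partial>lborel) \<partial>(sphere_measure :: 'a measure))"
  proof (rule nn_integral_cong, rule nn_integral_cong)
    fix w :: 'a and r :: real assume "w \<in> space sphere_measure"
    then have w: "norm w = 1" by (simp add: space_sphere_measure)
    have "ennreal (cutoff_kernel \<alpha> 1 (r *\<^sub>R w)) * ennreal (\<bar>r\<bar> ^ (DIM('a) - 1)) = ennreal (cutoff_kernel \<alpha> 1 (r *\<^sub>R w) * \<bar>r\<bar> ^ (DIM('a) - 1))"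
      by (rule ennreal_mult'[symmetric]) (simp add: cutoff_kernel_def)
    also have "cutoff_kernel \<alpha> 1 (r *\<^sub>R w) * \<bar>r\<bar> ^ (DIM('a) - 1) = min 1 (r\<^sup>2) / \<bar>r\<bar> powr (1 + \<alpha>)"
      using polar_kernel[OF w, of "min 1 (r\<^sup>2)" 0 r \<alpha>] by (simp add: cutoff_kernel_def w)
    finally show "ennreal (cutoff_kernel \<alpha> 1 (r *\<^sub>R w)) * ennreal (\<bar>r\<bar> ^ (DIM('a) - 1)) = ?f r" .
  qed
  also have "\<dots> < \<infinity>" using rad by (simp add: ennreal_mult_eq_top_iff less_top[symmetric] sphere_measure.emeasure_finite)
  finally show ?thesis by (auto simp: ennreal_mult_less_top)
qed

section \<open>The energy of a test function on a slab\<close>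

definition slab_cutoff :: "'a::euclidean_space \<Rightarrow> real \<Rightarrow> 'a \<Rightarrow> real" where
  "slab_cutoff e L x = max 0 (1 - perp_norm e x / L)"

lemma slab_cutoff_measurable[measurable]: "slab_cutoff e L \<in> borel_measurable borel"
  unfolding slab_cutoff_def by measurable

lemma slab_cutoff_bounds: "0 < L \<Longrightarrow> 0 \<le> slab_cutoff e L x" "0 < L \<Longrightarrow> slab_cutoff e L x \<le> 1"
  by (auto simp: slab_cutoff_def perp_norm_nonneg)

lemma slab_cutoff_support: "0 < L \<Longrightarrow> slab_cutoff e L x \<noteq> 0 \<Longrightarrow> perp_norm e x \<le> L"
  by (auto simp: slab_cutoff_def max_def divide_less_eq split: if_splits)

lemma slab_cutoff_shift: "norm e = 1 \<Longrightarrow> slab_cutoff e L (x + s *\<^sub>R e) = slab_cutoff e L x"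
  by (simp add: slab_cutoff_def perp_norm_shift)

lemma slab_cutoff_rescale: "0 < L \<Longrightarrow> slab_cutoff e L x = slab_cutoff e 1 ((1 / L) *\<^sub>R x)"
  by (simp add: slab_cutoff_def perp_norm_scale)

lemma slab_cutoff_diff_sq:
  assumes e: "norm e = 1" and L: "0 < L"
  shows "(slab_cutoff e L x - slab_cutoff e L y)\<^sup>2 \<le> min 1 ((norm (x - y) / L)\<^sup>2)"
proof -
  have "\<bar>slab_cutoff e L x - slab_cutoff e L y\<bar> \<le> 1"
    using slab_cutoff_bounds[OF L, of e x] slab_cutoff_bounds[OF L, of e y] by (simp add: abs_le_iff)
  then have 1: "(slab_cutoff e L x - slab_cutoff e L y)\<^sup>2 \<le> 1" by (simp add: abs_square_le_1)
  have "\<bar>max 0 (1 - p) - max 0 (1 - q)\<bar> \<le> \<bar>p - q\<bar>" for p q :: real by (smt (verit))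
  then have "\<bar>slab_cutoff e L x - slab_cutoff e L y\<bar> \<le> \<bar>perp_norm e x / L - perp_norm e y / L\<bar>"
    unfolding slab_cutoff_def .
  also have "\<dots> = \<bar>perp_norm e x - perp_norm e y\<bar> / L" using L by (simp add: diff_divide_distrib[symmetric])
  also have "\<dots> \<le> norm (x - y) / L" using L by (intro divide_right_mono perp_norm_lipschitz e) auto
  finally have "\<bar>slab_cutoff e L x - slab_cutoff e L y\<bar>\<^sup>2 \<le> (norm (x - y) / L)\<^sup>2" by (intro power_mono) auto
  then show ?thesis using 1 by simp
qed

lemma weighted_square_sum:
  fixes a b \<epsilon> :: real
  assumes "0 < \<epsilon>"
  shows "(a + b)\<^sup>2 \<le> (1 + \<epsilon>) * a\<^sup>2 + (1 + 1 / \<epsilon>) * b\<^sup>2"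
proof -
  have "0 \<le> (\<epsilon> * a - b)\<^sup>2 / \<epsilon>" using assms by simp
  also have "(\<epsilon> * a - b)\<^sup>2 / \<epsilon> = (1 + \<epsilon>) * a\<^sup>2 + (1 + 1 / \<epsilon>) * b\<^sup>2 - (a + b)\<^sup>2"
    using assms by (simp add: power2_eq_square field_simps)
  finally show ?thesis by simp
qed

text \<open>The difference of the product splits as \<open>\<theta>(x) (\<psi>(x \<bullet> e) - \<psi>(y \<bullet> e)) + (\<theta>(x) - \<theta>(y)) \<psi>(y \<bullet> e)\<close>. The first
  part integrates to the one-dimensional energy times the mass of the cross section. The second is
  bounded by \<open>cutoff_kernel\<close>, where \<open>x\<close> or \<open>y\<close> lies within distance \<open>L\<close> of the axis; these are the terms
  \<open>T3\<close> and \<open>T2\<close> of the proof. The weight \<open>\<epsilon>\<close> keeps the factor of the main part close to \<open>1\<close>.\<close>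

lemma slab_energy_upper:
  fixes \<Omega> :: "(real ^ 'n::finite) set" and \<psi> :: "real \<Rightarrow> real" and e :: "real ^ 'n"
  assumes a: "1 < \<alpha>" and e: "norm e = 1" and L: "0 < L" and eps: "0 < \<epsilon>"
    and psi[measurable]: "\<psi> \<in> borel_measurable borel"
    and psi_supp: "\<And>s. \<psi> s \<noteq> 0 \<Longrightarrow> s \<in> {-1..0}" and psi_bd: "\<And>s. \<bar>\<psi> s\<bar> \<le> 1"
    and slab: "\<And>x. x \<in> \<Omega> \<Longrightarrow> \<bar>x \<bullet> e\<bar> < 1"
  defines "q \<equiv> \<lambda>x. indicator {x. 0 \<le> x \<bullet> e \<and> x \<bullet> e < 1} x :: ennreal"
  shows "2 * frac_energy \<alpha> \<Omega> (\<lambda>x. slab_cutoff e L x * \<psi> (x \<bullet> e))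
    \<le> ennreal (1 + \<epsilon>) * (ennreal (sphere_moment CARD('n) \<alpha>) * ((\<integral>\<^sup>+x. ennreal ((slab_cutoff e L x)\<^sup>2) * q x \<partial>lborel) *
        (\<integral>\<^sup>+s\<in>{-1<..<1}. (\<integral>\<^sup>+t\<in>{-1<..<1}. ennreal ((\<psi> s - \<psi> t)\<^sup>2 / \<bar>s - t\<bar> powr (1 + \<alpha>)) \<partial>lborel) \<partial>lborel)))
      + 4 * (ennreal (1 + 1 / \<epsilon>) * ((\<integral>\<^sup>+h. ennreal (cutoff_kernel \<alpha> L (h :: real ^ 'n)) \<partial>lborel) *
        (\<integral>\<^sup>+x. indicator {x. perp_norm e x \<le> L} x * q x \<partial>lborel)))"
proof -
  let ?n = "real CARD('n)"
  let ?\<theta> = "slab_cutoff e L"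
  let ?I = "{-1<..<1::real}"
  let ?S = "{x. \<bar>x \<bullet> e\<bar> < 1}"
  let ?P = "{x. perp_norm e x \<le> L}"
  let ?k = "cutoff_kernel \<alpha> L :: real ^ 'n \<Rightarrow> real"
  let ?G = "\<lambda>s. \<integral>\<^sup>+t\<in>?I. ennreal ((\<psi> s - \<psi> t)\<^sup>2 / \<bar>s - t\<bar> powr (1 + \<alpha>)) \<partial>lborel"
  let ?u = "\<lambda>x. ?\<theta> x * \<psi> (x \<bullet> e)"
  let ?T1 = "\<lambda>x y. ennreal ((?\<theta> x)\<^sup>2 * ((\<psi> (x \<bullet> e) - \<psi> (y \<bullet> e))\<^sup>2 / norm (x - y) powr (?n + \<alpha>))) * indicator ?I (y \<bullet> e) * indicator ?I (x \<bullet> e)"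
  let ?T2 = "\<lambda>x y. ennreal (?k (x - y)) * ennreal ((\<psi> (y \<bullet> e))\<^sup>2) * indicator ?P y"
  let ?T3 = "\<lambda>x y. ennreal (?k (x - y)) * ennreal ((\<psi> (y \<bullet> e))\<^sup>2) * indicator ?P x"
  let ?I2 = "\<lambda>f. \<integral>\<^sup>+x. \<integral>\<^sup>+y. f x y \<partial>lborel \<partial>lborel"
  have kneg: "?k (- h) = ?k h" for h by (simp add: cutoff_kernel_def)
  define A where "A = (\<integral>\<^sup>+x. indicator ?P x * q x \<partial>lborel)"
  define K where "K = (\<integral>\<^sup>+h. ennreal (?k h) \<partial>lborel)"
  have pw: "ennreal ((?u x - ?u y)\<^sup>2 / norm (x - y) powr (?n + \<alpha>)) * indicator (\<Omega> \<times> \<Omega>) (x, y)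
     \<le> ennreal (1 + \<epsilon>) * ?T1 x y + ennreal (1 + 1 / \<epsilon>) * (?T2 x y + ?T3 x y)" for x y
  proof (cases "x \<in> \<Omega> \<and> y \<in> \<Omega>")
    case True
    let ?D = "norm (x - y) powr (?n + \<alpha>)"
    have I: "x \<bullet> e \<in> ?I" "y \<bullet> e \<in> ?I" using slab True by (auto simp: abs_less_iff)
    have "?u x - ?u y = ?\<theta> x * (\<psi> (x \<bullet> e) - \<psi> (y \<bullet> e)) + (?\<theta> x - ?\<theta> y) * \<psi> (y \<bullet> e)"
      by (simp add: algebra_simps)
    then have "(?u x - ?u y)\<^sup>2 \<le> (1 + \<epsilon>) * (?\<theta> x * (\<psi> (x \<bullet> e) - \<psi> (y \<bullet> e)))\<^sup>2 + (1 + 1 / \<epsilon>) * ((?\<theta> x - ?\<theta> y) * \<psi> (y \<bullet> e))\<^sup>2"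
      using weighted_square_sum[OF eps] by simp
    then have "(?u x - ?u y)\<^sup>2 / ?D \<le> ((1 + \<epsilon>) * (?\<theta> x * (\<psi> (x \<bullet> e) - \<psi> (y \<bullet> e)))\<^sup>2 + (1 + 1 / \<epsilon>) * ((?\<theta> x - ?\<theta> y) * \<psi> (y \<bullet> e))\<^sup>2) / ?D"
      by (rule divide_right_mono) simp
    also have "\<dots> = (1 + \<epsilon>) * ((?\<theta> x)\<^sup>2 * ((\<psi> (x \<bullet> e) - \<psi> (y \<bullet> e))\<^sup>2 / ?D)) + (1 + 1 / \<epsilon>) * ((?\<theta> x - ?\<theta> y)\<^sup>2 / ?D * (\<psi> (y \<bullet> e))\<^sup>2)"
      by (simp add: power_mult_distrib add_divide_distrib mult_ac)
    finally have "ennreal ((?u x - ?u y)\<^sup>2 / ?D)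
      \<le> ennreal ((1 + \<epsilon>) * ((?\<theta> x)\<^sup>2 * ((\<psi> (x \<bullet> e) - \<psi> (y \<bullet> e))\<^sup>2 / ?D)) + (1 + 1 / \<epsilon>) * ((?\<theta> x - ?\<theta> y)\<^sup>2 / ?D * (\<psi> (y \<bullet> e))\<^sup>2))"
      by (rule ennreal_leI)
    also have "\<dots> = ennreal (1 + \<epsilon>) * ennreal ((?\<theta> x)\<^sup>2 * ((\<psi> (x \<bullet> e) - \<psi> (y \<bullet> e))\<^sup>2 / ?D)) + ennreal (1 + 1 / \<epsilon>) * ennreal ((?\<theta> x - ?\<theta> y)\<^sup>2 / ?D * (\<psi> (y \<bullet> e))\<^sup>2)"
    proof -
      have "0 \<le> 1 + \<epsilon>" "0 \<le> 1 + 1 / \<epsilon>" using eps by simp_all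
      moreover have "0 \<le> (?\<theta> x)\<^sup>2 * ((\<psi> (x \<bullet> e) - \<psi> (y \<bullet> e))\<^sup>2 / ?D)" "0 \<le> (?\<theta> x - ?\<theta> y)\<^sup>2 / ?D * (\<psi> (y \<bullet> e))\<^sup>2" by simp_all
      ultimately show ?thesis by (simp only: ennreal_plus mult_nonneg_nonneg ennreal_mult')
    qed
    also have "ennreal ((?\<theta> x - ?\<theta> y)\<^sup>2 / ?D * (\<psi> (y \<bullet> e))\<^sup>2) \<le> ?T2 x y + ?T3 x y"
    proof (cases "?\<theta> x = ?\<theta> y")
      case False
      then have or: "perp_norm e x \<le> L \<or> perp_norm e y \<le> L"
        using slab_cutoff_support[OF L, of e x] slab_cutoff_support[OF L, of e y] by metis
      have "(?\<theta> x - ?\<theta> y)\<^sup>2 / ?D \<le> ?k (x - y)"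
        unfolding cutoff_kernel_def using slab_cutoff_diff_sq[OF e L, of x y] by (simp add: divide_right_mono)
      then have "ennreal ((?\<theta> x - ?\<theta> y)\<^sup>2 / ?D * (\<psi> (y \<bullet> e))\<^sup>2) \<le> ennreal (?k (x - y) * (\<psi> (y \<bullet> e))\<^sup>2)"
        by (intro ennreal_leI mult_right_mono) auto
      also have "\<dots> = ennreal (?k (x - y)) * ennreal ((\<psi> (y \<bullet> e))\<^sup>2)"
        by (rule ennreal_mult') (simp add: cutoff_kernel_def)
      finally have le: "ennreal ((?\<theta> x - ?\<theta> y)\<^sup>2 / ?D * (\<psi> (y \<bullet> e))\<^sup>2) \<le> ennreal (?k (x - y)) * ennreal ((\<psi> (y \<bullet> e))\<^sup>2)" .
      from or show ?thesis
      proof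
        assume "perp_norm e x \<le> L"
        then have "?T3 x y = ennreal (?k (x - y)) * ennreal ((\<psi> (y \<bullet> e))\<^sup>2)" by simp
        then show ?thesis using le by (simp only: add_increasing zero_le)
      next
        assume "perp_norm e y \<le> L"
        then have "?T2 x y = ennreal (?k (x - y)) * ennreal ((\<psi> (y \<bullet> e))\<^sup>2)" by simp
        then show ?thesis using le by (simp only: add_increasing2 zero_le)
      qed
    qed simp
    finally have "ennreal ((?u x - ?u y)\<^sup>2 / ?D) \<le> ennreal (1 + \<epsilon>) * ennreal ((?\<theta> x)\<^sup>2 * ((\<psi> (x \<bullet> e) - \<psi> (y \<bullet> e))\<^sup>2 / ?D)) + ennreal (1 + 1 / \<epsilon>) * (?T2 x y + ?T3 x y)"
      by (simp add: add_left_mono mult_left_mono)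
    then show ?thesis using True I by (simp only: indicator_simps mult_1_right mem_Times_iff fst_conv snd_conv simp_thms)
  qed simp
  have "frac_energy \<alpha> \<Omega> ?u = (\<integral>\<^sup>+z. ennreal ((?u (fst z) - ?u (snd z))\<^sup>2 / norm (fst z - snd z) powr (?n + \<alpha>)) * indicator (\<Omega> \<times> \<Omega>) (fst z, snd z) \<partial>lborel)"
    unfolding frac_energy_def by simp
  also have "\<dots> \<le> (\<integral>\<^sup>+z. (ennreal (1 + \<epsilon>) * ?T1 (fst z) (snd z) + ennreal (1 + 1 / \<epsilon>) * (?T2 (fst z) (snd z) + ?T3 (fst z) (snd z))) \<partial>lborel)"
    by (intro nn_integral_mono pw)
  also have "\<dots> = (\<integral>\<^sup>+z. (\<lambda>(x, y). ennreal (1 + \<epsilon>) * ?T1 x y + ennreal (1 + 1 / \<epsilon>) * (?T2 x y + ?T3 x y)) z \<partial>(lborel \<Otimes>\<^sub>M lborel))"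
    by (simp add: lborel_prod case_prod_beta)
  also have "\<dots> = ?I2 (\<lambda>x y. ennreal (1 + \<epsilon>) * ?T1 x y + ennreal (1 + 1 / \<epsilon>) * (?T2 x y + ?T3 x y))"
  proof -
    have "(\<lambda>(x, y). ennreal (1 + \<epsilon>) * ?T1 x y + ennreal (1 + 1 / \<epsilon>) * (?T2 x y + ?T3 x y)) \<in> borel_measurable (lborel \<Otimes>\<^sub>M lborel)" by measurable
    from lborel.nn_integral_fst[OF this] show ?thesis by simp
  qed
  also have "\<dots> = ennreal (1 + \<epsilon>) * ?I2 ?T1 + ennreal (1 + 1 / \<epsilon>) * (?I2 ?T2 + ?I2 ?T3)"
    by (simp add: nn_integral_add nn_integral_cmult)
  finally have main: "frac_energy \<alpha> \<Omega> ?u \<le> ennreal (1 + \<epsilon>) * ?I2 ?T1 + ennreal (1 + 1 / \<epsilon>) * (?I2 ?T2 + ?I2 ?T3)" .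
  have X0: "(\<integral>\<^sup>+s. ennreal ((\<psi> s)\<^sup>2) \<partial>lborel) \<le> 1"
  proof -
    have "(\<integral>\<^sup>+s. ennreal ((\<psi> s)\<^sup>2) \<partial>lborel) \<le> (\<integral>\<^sup>+s. indicator {-1..0::real} s \<partial>lborel)"
    proof (rule nn_integral_mono)
      fix s :: real
      have "(\<psi> s)\<^sup>2 \<le> 1" using psi_bd[of s] by (simp add: abs_square_le_1)
      then have "ennreal ((\<psi> s)\<^sup>2) \<le> 1" using ennreal_leI by fastforce
      then show "ennreal ((\<psi> s)\<^sup>2) \<le> indicator {-1..0} s" using psi_supp[of s] by (cases "\<psi> s = 0") auto
    qed
    also have "\<dots> = 1" by simp
    finally show ?thesis .
  qed
  have inv: "indicator ?P (x + s *\<^sub>R e) = (indicator ?P x :: ennreal)" for x s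
    using e by (simp add: indicator_def perp_norm_shift)
  have T2: "?I2 ?T2 \<le> K * A"
  proof -
    have "?I2 ?T2 = (\<integral>\<^sup>+y. \<integral>\<^sup>+x. ?T2 x y \<partial>lborel \<partial>lborel)" by (rule lborel_pair.Fubini') measurable
    also have "\<dots> = (\<integral>\<^sup>+y. K * (indicator ?P y * ennreal ((\<psi> (y \<bullet> e))\<^sup>2)) \<partial>lborel)"
    proof (rule nn_integral_cong)
      fix y :: "real ^ 'n"
      have "(\<integral>\<^sup>+x. ?T2 x y \<partial>lborel) = (\<integral>\<^sup>+x. (ennreal ((\<psi> (y \<bullet> e))\<^sup>2) * indicator ?P y) * ennreal (?k (- y + x)) \<partial>lborel)"
        by (rule nn_integral_cong) (simp add: mult_ac)
      also have "\<dots> = (ennreal ((\<psi> (y \<bullet> e))\<^sup>2) * indicator ?P y) * (\<integral>\<^sup>+x. ennreal (?k (- y + x)) \<partial>lborel)"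
        by (rule nn_integral_cmult) measurable
      also have "(\<integral>\<^sup>+x. ennreal (?k (- y + x)) \<partial>lborel) = K" unfolding K_def by (rule nn_integral_lborel_translate) measurable
      finally show "(\<integral>\<^sup>+x. ?T2 x y \<partial>lborel) = K * (indicator ?P y * ennreal ((\<psi> (y \<bullet> e))\<^sup>2))" by (simp only: mult_ac)
    qed
    also have "\<dots> = K * (\<integral>\<^sup>+y. indicator ?P y * ennreal ((\<psi> (y \<bullet> e))\<^sup>2) \<partial>lborel)" by (rule nn_integral_cmult) measurable
    also have "(\<integral>\<^sup>+y. indicator ?P y * ennreal ((\<psi> (y \<bullet> e))\<^sup>2) \<partial>lborel) = A * (\<integral>\<^sup>+s. ennreal ((\<psi> s)\<^sup>2) \<partial>lborel)"
      unfolding A_def q_def by (rule nn_integral_product_lines[OF e _ _ inv]) measurable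
    also have "K * (A * (\<integral>\<^sup>+s. ennreal ((\<psi> s)\<^sup>2) \<partial>lborel)) \<le> K * (A * 1)" by (intro mult_left_mono X0) simp_all
    finally show ?thesis by simp
  qed
  have T3: "?I2 ?T3 \<le> K * A"
  proof -
    have "?I2 ?T3 = (\<integral>\<^sup>+x. \<integral>\<^sup>+h. ennreal (?k h) * (indicator ?P x * ennreal ((\<psi> (x \<bullet> e + h \<bullet> e))\<^sup>2)) \<partial>lborel \<partial>lborel)"
    proof (rule nn_integral_cong)
      fix x :: "real ^ 'n"
      have "(\<integral>\<^sup>+y. ?T3 x y \<partial>lborel) = (\<integral>\<^sup>+h. ?T3 x (x + h) \<partial>lborel)" by (rule nn_integral_lborel_translate[symmetric]) measurable
      also have "\<dots> = (\<integral>\<^sup>+h. ennreal (?k h) * (indicator ?P x * ennreal ((\<psi> (x \<bullet> e + h \<bullet> e))\<^sup>2)) \<partial>lborel)"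
        by (rule nn_integral_cong) (simp add: kneg inner_add_left mult_ac)
      finally show "(\<integral>\<^sup>+y. ?T3 x y \<partial>lborel) = (\<integral>\<^sup>+h. ennreal (?k h) * (indicator ?P x * ennreal ((\<psi> (x \<bullet> e + h \<bullet> e))\<^sup>2)) \<partial>lborel)" .
    qed
    also have "\<dots> = (\<integral>\<^sup>+h. \<integral>\<^sup>+x. ennreal (?k h) * (indicator ?P x * ennreal ((\<psi> (x \<bullet> e + h \<bullet> e))\<^sup>2)) \<partial>lborel \<partial>lborel)"
      by (rule lborel_pair.Fubini') measurable
    also have "\<dots> \<le> (\<integral>\<^sup>+h. ennreal (?k h) * A \<partial>lborel)"
    proof (rule nn_integral_mono)
      fix h :: "real ^ 'n"
      have "(\<integral>\<^sup>+x. ennreal (?k h) * (indicator ?P x * ennreal ((\<psi> (x \<bullet> e + h \<bullet> e))\<^sup>2)) \<partial>lborel)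
        = ennreal (?k h) * (\<integral>\<^sup>+x. indicator ?P x * ennreal ((\<psi> (x \<bullet> e + h \<bullet> e))\<^sup>2) \<partial>lborel)" by (rule nn_integral_cmult) measurable
      also have "(\<integral>\<^sup>+x. indicator ?P x * ennreal ((\<psi> (x \<bullet> e + h \<bullet> e))\<^sup>2) \<partial>lborel) = A * (\<integral>\<^sup>+s. ennreal ((\<psi> (s + h \<bullet> e))\<^sup>2) \<partial>lborel)"
        unfolding A_def q_def by (rule nn_integral_product_lines[OF e _ _ inv]) measurable
      also have "(\<integral>\<^sup>+s. ennreal ((\<psi> (s + h \<bullet> e))\<^sup>2) \<partial>lborel) = (\<integral>\<^sup>+s. ennreal ((\<psi> (h \<bullet> e + s))\<^sup>2) \<partial>lborel)" by (simp only: add.commute)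
      also have "\<dots> = (\<integral>\<^sup>+s. ennreal ((\<psi> s)\<^sup>2) \<partial>lborel)" by (rule nn_integral_lborel_translate) measurable
      also have "ennreal (?k h) * (A * (\<integral>\<^sup>+s. ennreal ((\<psi> s)\<^sup>2) \<partial>lborel)) \<le> ennreal (?k h) * (A * 1)" by (intro mult_left_mono X0) simp_all
      finally show "(\<integral>\<^sup>+x. ennreal (?k h) * (indicator ?P x * ennreal ((\<psi> (x \<bullet> e + h \<bullet> e))\<^sup>2)) \<partial>lborel) \<le> ennreal (?k h) * A" by simp
    qed
    also have "\<dots> = K * A" unfolding K_def by (rule nn_integral_multc) measurable
    finally show ?thesis .
  qed
  have T1: "2 * ?I2 ?T1 = ennreal (sphere_moment CARD('n) \<alpha>) * ((\<integral>\<^sup>+x. ennreal ((?\<theta> x)\<^sup>2) * q x \<partial>lborel) * (\<integral>\<^sup>+s\<in>?I. ?G s \<partial>lborel))"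
  proof -
    have "2 * ?I2 ?T1 = (\<integral>\<^sup>+x. 2 * (\<integral>\<^sup>+y. ?T1 x y \<partial>lborel) \<partial>lborel)" by (rule nn_integral_cmult[symmetric]) measurable
    also have "\<dots> = (\<integral>\<^sup>+x. ennreal (sphere_moment CARD('n) \<alpha>) * (ennreal ((?\<theta> x)\<^sup>2) * (?G (x \<bullet> e) * indicator ?I (x \<bullet> e))) \<partial>lborel)"
    proof (rule nn_integral_cong)
      fix x :: "real ^ 'n"
      let ?h = "\<lambda>t. (\<psi> (x \<bullet> e) - \<psi> t)\<^sup>2 * indicator ?I t"
      have "(\<integral>\<^sup>+y. ?T1 x y \<partial>lborel) = (\<integral>\<^sup>+y. (ennreal ((?\<theta> x)\<^sup>2) * indicator ?I (x \<bullet> e)) * ennreal (?h (y \<bullet> e) / norm (x - y) powr (?n + \<alpha>)) \<partial>lborel)"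
      proof (rule nn_integral_cong)
        fix y :: "real ^ 'n"
        have "ennreal ((?\<theta> x)\<^sup>2 * ((\<psi> (x \<bullet> e) - \<psi> (y \<bullet> e))\<^sup>2 / norm (x - y) powr (?n + \<alpha>)))
          = ennreal ((?\<theta> x)\<^sup>2) * ennreal ((\<psi> (x \<bullet> e) - \<psi> (y \<bullet> e))\<^sup>2 / norm (x - y) powr (?n + \<alpha>))" by (rule ennreal_mult') simp
        then show "?T1 x y = (ennreal ((?\<theta> x)\<^sup>2) * indicator ?I (x \<bullet> e)) * ennreal (?h (y \<bullet> e) / norm (x - y) powr (?n + \<alpha>))"
          by (cases "y \<bullet> e \<in> ?I") (simp_all add: mult_ac)
      qed
      also have "\<dots> = (ennreal ((?\<theta> x)\<^sup>2) * indicator ?I (x \<bullet> e)) * (\<integral>\<^sup>+y. ennreal (?h (y \<bullet> e) / norm (x - y) powr (?n + \<alpha>)) \<partial>lborel)"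
        by (rule nn_integral_cmult) measurable
      finally have 1: "(\<integral>\<^sup>+y. ?T1 x y \<partial>lborel) = (ennreal ((?\<theta> x)\<^sup>2) * indicator ?I (x \<bullet> e)) * (\<integral>\<^sup>+y. ennreal (?h (y \<bullet> e) / norm (x - y) powr (?n + \<alpha>)) \<partial>lborel)" .
      have 2: "2 * (\<integral>\<^sup>+y. ennreal (?h (y \<bullet> e) / norm (x - y) powr (?n + \<alpha>)) \<partial>lborel)
         = ennreal (sphere_moment CARD('n) \<alpha>) * (\<integral>\<^sup>+t. ennreal (?h t / \<bar>x \<bullet> e - t\<bar> powr (1 + \<alpha>)) \<partial>lborel)"
        using slab_kernel_integral[OF e, of ?h x \<alpha>] a by simp
      have 3: "(\<integral>\<^sup>+t. ennreal (?h t / \<bar>x \<bullet> e - t\<bar> powr (1 + \<alpha>)) \<partial>lborel) = ?G (x \<bullet> e)"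
        by (rule nn_integral_cong) (simp split: split_indicator)
      show "2 * (\<integral>\<^sup>+y. ?T1 x y \<partial>lborel) = ennreal (sphere_moment CARD('n) \<alpha>) * (ennreal ((?\<theta> x)\<^sup>2) * (?G (x \<bullet> e) * indicator ?I (x \<bullet> e)))"
        unfolding 1 mult.left_commute[of 2 "ennreal ((?\<theta> x)\<^sup>2) * indicator ?I (x \<bullet> e)"] 2 3 by (simp only: mult_ac)
    qed
    also have "\<dots> = ennreal (sphere_moment CARD('n) \<alpha>) * (\<integral>\<^sup>+x. ennreal ((?\<theta> x)\<^sup>2) * (?G (x \<bullet> e) * indicator ?I (x \<bullet> e)) \<partial>lborel)"
      by (rule nn_integral_cmult) measurable
    also have "(\<integral>\<^sup>+x. ennreal ((?\<theta> x)\<^sup>2) * (?G (x \<bullet> e) * indicator ?I (x \<bullet> e)) \<partial>lborel)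
      = (\<integral>\<^sup>+x. ennreal ((?\<theta> x)\<^sup>2) * q x \<partial>lborel) * (\<integral>\<^sup>+s\<in>?I. ?G s \<partial>lborel)"
      unfolding q_def by (rule nn_integral_product_lines[OF e]) (measurable, simp add: slab_cutoff_shift[OF e])
    finally show ?thesis .
  qed
  have "2 * frac_energy \<alpha> \<Omega> ?u \<le> 2 * (ennreal (1 + \<epsilon>) * ?I2 ?T1 + ennreal (1 + 1 / \<epsilon>) * (K * A + K * A))"
    by (intro mult_left_mono order_trans[OF main] add_left_mono add_mono T2 T3) simp_all
  also have "\<dots> = ennreal (1 + \<epsilon>) * (2 * ?I2 ?T1) + 4 * (ennreal (1 + 1 / \<epsilon>) * (K * A))"
  proof -
    have "K * A + K * A = 2 * (K * A)" by (simp only: mult_2)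
    moreover have "2 * (ennreal (1 + 1 / \<epsilon>) * (2 * (K * A))) = (2 * 2) * (ennreal (1 + 1 / \<epsilon>) * (K * A))" by (simp only: mult_ac)
    moreover have "(2 * 2 :: ennreal) = 4" by simp
    ultimately show ?thesis by (simp only: distrib_left mult.left_commute[of 2 "ennreal (1 + \<epsilon>)"])
  qed
  finally show ?thesis unfolding T1 K_def A_def .
qed

section \<open>Sharpness in space\<close>

text \<open>Two is more than the half-width \<open>1\<close> of the slab, so the ball contains the support of the test
  function, on which the orthogonal component has norm at most \<open>L\<close>.\<close>

definition slab_domain :: "'a::euclidean_space \<Rightarrow> real \<Rightarrow> 'a set" where
  "slab_domain e L = {x. \<bar>x \<bullet> e\<bar> < 1} \<inter> ball 0 (L + 2)"

lemma slab_domain_geometry: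
  assumes "0 < L"
  shows "bounded_domain (slab_domain e L)" "convex (slab_domain e L)"
proof -
  have *: "{x. \<bar>x \<bullet> e\<bar> < 1} = {x. e \<bullet> x < 1} \<inter> {x. e \<bullet> x > -1}" by (auto simp: inner_commute)
  show c: "convex (slab_domain e L)" unfolding slab_domain_def *
    by (intro convex_Int convex_halfspace_lt convex_halfspace_gt convex_ball)
  have "open (slab_domain e L)" unfolding slab_domain_def *
    by (intro open_Int open_halfspace_lt open_halfspace_gt open_ball)
  moreover have "0 \<in> slab_domain e L" using assms by (simp add: slab_domain_def)
  moreover have "bounded (slab_domain e L)" unfolding slab_domain_def by (simp add: bounded_Int)
  ultimately show "bounded_domain (slab_domain e L)" unfolding bounded_domain_def
    using convex_connected[OF c] by auto
qed

lemma slab_support_subset: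
  assumes e: "norm e = 1" and "0 < r"
  shows "{x. -1 + r \<le> x \<bullet> e \<and> x \<bullet> e \<le> 0 \<and> perp_norm e x \<le> L} \<subseteq> slab_domain e L"
proof
  fix x assume x: "x \<in> {x. -1 + r \<le> x \<bullet> e \<and> x \<bullet> e \<le> 0 \<and> perp_norm e x \<le> L}"
  then have "\<bar>x \<bullet> e\<bar> < 1" using assms by (simp add: abs_less_iff)
  moreover have "norm x \<le> perp_norm e x + \<bar>x \<bullet> e\<bar>" by (rule norm_le_perp_norm[OF e])
  ultimately show "x \<in> slab_domain e L" using x by (simp add: slab_domain_def)
qed

lemma slab_test_function_Cc:
  fixes e :: "'a::euclidean_space"
  assumes e: "norm e = 1" and L: "0 < L" and r: "0 < r" and cont: "continuous_on {-1<..<1} \<psi>"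
    and supp: "\<And>s. \<psi> s \<noteq> 0 \<Longrightarrow> -1 + r \<le> s \<and> s \<le> 0"
  shows "(\<lambda>x. slab_cutoff e L x * \<psi> (x \<bullet> e)) \<in> Cc (slab_domain e L)"
proof -
  let ?u = "\<lambda>x. slab_cutoff e L x * \<psi> (x \<bullet> e)" and ?\<Omega> = "slab_domain e L"
  let ?K = "{x. -1 + r \<le> x \<bullet> e \<and> x \<bullet> e \<le> 0 \<and> perp_norm e x \<le> L}"
  have "continuous_on ?\<Omega> (\<lambda>x. \<psi> (x \<bullet> e))"
    by (rule continuous_on_compose2[OF cont]) (auto intro!: continuous_intros simp: slab_domain_def abs_less_iff)
  moreover have "continuous_on ?\<Omega> (slab_cutoff e L)"
    unfolding slab_cutoff_def perp_norm_def using L by (intro continuous_intros) auto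
  ultimately have 1: "continuous_on ?\<Omega> ?u" by (intro continuous_intros)
  have "closed ?K" unfolding perp_norm_def
    by (intro closed_Collect_conj closed_Collect_le continuous_intros)
  moreover have "{x \<in> ?\<Omega>. ?u x \<noteq> 0} \<subseteq> ?K" using supp slab_cutoff_support[OF L] by auto
  ultimately have sub: "closure {x \<in> ?\<Omega>. ?u x \<noteq> 0} \<subseteq> ?\<Omega>"
    using closure_minimal slab_support_subset[OF e r, of L] by (meson order_trans)
  have "bounded {x \<in> ?\<Omega>. ?u x \<noteq> 0}"
    by (rule bounded_subset[of ?\<Omega>]) (use slab_domain_geometry(1)[OF L, of e] in \<open>auto simp: bounded_domain_def\<close>)
  then have "compact (closure {x \<in> ?\<Omega>. ?u x \<noteq> 0})" by (simp add: compact_closure)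
  with 1 sub show ?thesis by (simp add: Cc_def)
qed

text \<open>The distance to the complement is at most the distance to the face \<open>x \<bullet> e = -1\<close> of the slab, where the
  test function concentrates.\<close>

lemma slab_domain_infdist:
  fixes e :: "'a::euclidean_space"
  assumes e: "norm e = 1" and L: "0 < L" and x: "x \<in> slab_domain e L"
  shows "0 < infdist x (- slab_domain e L)" "infdist x (- slab_domain e L) \<le> 1 + x \<bullet> e"
proof -
  \<comment> \<open>The orthogonal projection of \<open>x\<close> to the face of the slab.\<close>
  let ?y = "x - (1 + x \<bullet> e) *\<^sub>R e"
  have "e \<bullet> e = 1" using e by (simp add: dot_square_norm)
  then have "?y \<bullet> e = -1" by (simp add: inner_diff_left)
  then have y: "?y \<in> - slab_domain e L" by (simp add: slab_domain_def)
  then have "infdist x (- slab_domain e L) \<le> dist x ?y" by (rule infdist_le)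
  also have "\<dots> = 1 + x \<bullet> e" using e x by (simp add: dist_norm slab_domain_def abs_less_iff)
  finally show "infdist x (- slab_domain e L) \<le> 1 + x \<bullet> e" .
  have "closed (- slab_domain e L)"
    using slab_domain_geometry(1)[OF L, of e] by (auto simp: bounded_domain_def)
  then have "infdist x (- slab_domain e L) \<noteq> 0" using in_closed_iff_infdist_zero y x by blast
  then show "0 < infdist x (- slab_domain e L)" using infdist_nonneg[of x "- slab_domain e L"] by linarith
qed

lemma slab_potential_lower:
  fixes e :: "'a::euclidean_space"
  assumes e: "norm e = 1" and L: "0 < L" and r: "0 < r" and a: "0 < \<alpha>"
    and psi[measurable]: "\<psi> \<in> borel_measurable borel"
    and supp: "\<And>s. \<psi> s \<noteq> 0 \<Longrightarrow> -1 + r \<le> s \<and> s \<le> 0"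
  shows "(\<integral>\<^sup>+x. ennreal ((slab_cutoff e L x)\<^sup>2) * indicator {x. 0 \<le> x \<bullet> e \<and> x \<bullet> e < 1} x \<partial>lborel) *
      (\<integral>\<^sup>+s\<in>{-1<..<1}. ennreal ((\<psi> s)\<^sup>2 * (1 + s) powr (- \<alpha>)) \<partial>lborel)
    \<le> (\<integral>\<^sup>+x\<in>slab_domain e L. ennreal ((slab_cutoff e L x * \<psi> (x \<bullet> e))\<^sup>2 / infdist x (- slab_domain e L) powr \<alpha>) \<partial>lborel)"
proof -
  let ?g = "\<lambda>s. ennreal ((\<psi> s)\<^sup>2 * (1 + s) powr (- \<alpha>)) * indicator {-1<..<1} s"
  have "(\<integral>\<^sup>+x. ennreal ((slab_cutoff e L x)\<^sup>2) * indicator {x. 0 \<le> x \<bullet> e \<and> x \<bullet> e < 1} x \<partial>lborel) * (\<integral>\<^sup>+s. ?g s \<partial>lborel)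
    = (\<integral>\<^sup>+x. ennreal ((slab_cutoff e L x)\<^sup>2) * ?g (x \<bullet> e) \<partial>lborel)"
    by (rule nn_integral_product_lines[OF e, symmetric]) (measurable, simp add: slab_cutoff_shift[OF e])
  also have "\<dots> \<le> (\<integral>\<^sup>+x\<in>slab_domain e L. ennreal ((slab_cutoff e L x * \<psi> (x \<bullet> e))\<^sup>2 / infdist x (- slab_domain e L) powr \<alpha>) \<partial>lborel)"
  proof (rule nn_integral_mono)
    fix x :: 'a
    let ?d = "infdist x (- slab_domain e L)"
    show "ennreal ((slab_cutoff e L x)\<^sup>2) * ?g (x \<bullet> e)
      \<le> ennreal ((slab_cutoff e L x * \<psi> (x \<bullet> e))\<^sup>2 / ?d powr \<alpha>) * indicator (slab_domain e L) x"
    proof (cases "slab_cutoff e L x = 0 \<or> \<psi> (x \<bullet> e) = 0")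
      case False
      then have "x \<in> slab_domain e L"
        using supp[of "x \<bullet> e"] slab_cutoff_support[OF L, of e x] slab_support_subset[OF e r, of L] by blast
      note x = this slab_domain_infdist[OF e L this]
      have "(1 + x \<bullet> e) powr (- \<alpha>) \<le> ?d powr (- \<alpha>)" using x a by (intro powr_mono2') auto
      then have "(slab_cutoff e L x)\<^sup>2 * ((\<psi> (x \<bullet> e))\<^sup>2 * (1 + x \<bullet> e) powr (- \<alpha>)) \<le> (slab_cutoff e L x)\<^sup>2 * ((\<psi> (x \<bullet> e))\<^sup>2 * ?d powr (- \<alpha>))"
        by (intro mult_left_mono) auto
      also have "\<dots> = (slab_cutoff e L x * \<psi> (x \<bullet> e))\<^sup>2 / ?d powr \<alpha>"
        by (simp add: power_mult_distrib powr_minus_divide)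
      finally have *: "ennreal ((slab_cutoff e L x)\<^sup>2 * ((\<psi> (x \<bullet> e))\<^sup>2 * (1 + x \<bullet> e) powr (- \<alpha>)))
         \<le> ennreal ((slab_cutoff e L x * \<psi> (x \<bullet> e))\<^sup>2 / ?d powr \<alpha>)" by (rule ennreal_leI)
      have "x \<bullet> e \<in> {-1<..<1}" using x(1) by (simp add: slab_domain_def abs_less_iff)
      then have "ennreal ((slab_cutoff e L x)\<^sup>2) * ?g (x \<bullet> e) = ennreal ((slab_cutoff e L x)\<^sup>2 * ((\<psi> (x \<bullet> e))\<^sup>2 * (1 + x \<bullet> e) powr (- \<alpha>)))"
        by (simp only: indicator_simps mult_1_right ennreal_mult'[OF zero_le_power2])
      then show ?thesis using * x(1) by (simp only: indicator_simps mult_1_right)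
    qed auto
  qed
  finally show ?thesis .
qed

lemma cross_section_pos:
  fixes e :: "'a::euclidean_space"
  assumes e: "norm e = 1"
  shows "0 < (\<integral>\<^sup>+x. ennreal ((slab_cutoff e 1 x)\<^sup>2) * indicator {x. 0 \<le> x \<bullet> e \<and> x \<bullet> e < 1} x \<partial>lborel)"
proof -
  let ?B = "ball ((1/2) *\<^sub>R e) (1/4)"
  have ee: "e \<bullet> e = 1" using e by (simp add: dot_square_norm)
  have "emeasure lborel ?B \<noteq> 0"
    using content_ball_pos[of "1/4" "(1/2) *\<^sub>R e"] by (auto simp: measure_def)
  then have "0 < ennreal (1/4) * emeasure lborel ?B" by (simp add: ennreal_zero_less_mult_iff zero_less_iff_neq_zero)
  also have "\<dots> = (\<integral>\<^sup>+x. ennreal (1/4) * indicator ?B x \<partial>lborel)" by (simp add: nn_integral_cmult_indicator)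
  also have "\<dots> \<le> (\<integral>\<^sup>+x. ennreal ((slab_cutoff e 1 x)\<^sup>2) * indicator {x. 0 \<le> x \<bullet> e \<and> x \<bullet> e < 1} x \<partial>lborel)"
  proof (rule nn_integral_mono)
    fix x :: 'a
    show "ennreal (1/4) * indicator ?B x \<le> ennreal ((slab_cutoff e 1 x)\<^sup>2) * indicator {x. 0 \<le> x \<bullet> e \<and> x \<bullet> e < 1} x"
    proof (cases "x \<in> ?B")
      case True
      let ?z = "x + (- 1/2) *\<^sub>R e"
      have z: "norm ?z < 1/4" using True by (simp add: dist_norm norm_minus_commute)
      have "\<bar>?z \<bullet> e\<bar> \<le> norm ?z * norm e" by (rule Cauchy_Schwarz_ineq2)
      then have "\<bar>x \<bullet> e - 1/2\<bar> < 1/4" using z e ee by (simp add: inner_diff_left)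
      then have 1: "0 \<le> x \<bullet> e \<and> x \<bullet> e < 1" by arith
      have "perp_norm e x = perp_norm e ?z" by (simp only: perp_norm_shift[OF e])
      also have "\<dots> \<le> norm ?z" by (rule perp_norm_le[OF e])
      finally have "1/2 \<le> slab_cutoff e 1 x" using z by (simp add: slab_cutoff_def)
      then have "(1/2)\<^sup>2 \<le> (slab_cutoff e 1 x)\<^sup>2" by (intro power_mono) auto
      then have "ennreal (1/4) \<le> ennreal ((slab_cutoff e 1 x)\<^sup>2)" by (intro ennreal_leI) (simp add: power2_eq_square)
      then show ?thesis using 1 True by (simp only: indicator_simps mult_1_right mem_Collect_eq)
    qed simp
  qed
  finally show ?thesis .
qed

lemma cross_section_finite:
  fixes e :: "'a::euclidean_space"
  assumes e: "norm e = 1"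
  shows "(\<integral>\<^sup>+x. indicator {x. perp_norm e x \<le> 1} x * indicator {x. 0 \<le> x \<bullet> e \<and> x \<bullet> e < 1} x \<partial>lborel) < \<infinity>"
    (is "?A < _")
    "(\<integral>\<^sup>+x. ennreal ((slab_cutoff e 1 x)\<^sup>2) * indicator {x. 0 \<le> x \<bullet> e \<and> x \<bullet> e < 1} x \<partial>lborel) < \<infinity>"
proof -
  have "?A \<le> (\<integral>\<^sup>+x. indicator (cball (0::'a) 2) x \<partial>lborel)"
  proof (rule nn_integral_mono)
    fix x :: 'a
    have "norm x \<le> perp_norm e x + \<bar>x \<bullet> e\<bar>" by (rule norm_le_perp_norm[OF e])
    then show "indicator {x. perp_norm e x \<le> 1} x * indicator {x. 0 \<le> x \<bullet> e \<and> x \<bullet> e < 1} x \<le> (indicator (cball (0::'a) 2) x :: ennreal)"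
      by (auto simp: indicator_def)
  qed
  also have "\<dots> < \<infinity>" using emeasure_lborel_cball_finite[of "0::'a" 2] by (simp add: less_top)
  finally show 1: "?A < \<infinity>" .
  have "(\<integral>\<^sup>+x. ennreal ((slab_cutoff e 1 x)\<^sup>2) * indicator {x. 0 \<le> x \<bullet> e \<and> x \<bullet> e < 1} x \<partial>lborel) \<le> ?A"
  proof (rule nn_integral_mono, rule mult_right_mono)
    fix x :: 'a
    have "(slab_cutoff e 1 x)\<^sup>2 \<le> 1" using slab_cutoff_bounds[of 1 e x] by (simp add: power_le_one)
    then have "ennreal ((slab_cutoff e 1 x)\<^sup>2) \<le> 1" by (simp add: ennreal_le_1)
    then show "ennreal ((slab_cutoff e 1 x)\<^sup>2) \<le> indicator {x. perp_norm e x \<le> 1} x"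
      using slab_cutoff_support[of 1 e x] by (cases "slab_cutoff e 1 x = 0") auto
  qed simp
  with 1 show "(\<integral>\<^sup>+x. ennreal ((slab_cutoff e 1 x)\<^sup>2) * indicator {x. 0 \<le> x \<bullet> e \<and> x \<bullet> e < 1} x \<partial>lborel) < \<infinity>"
    by (rule le_less_trans[rotated])
qed

text \<open>Both sides of the inequality for the test function are divided by \<open>L\<^bsup>n - 1\<^esup>\<close>, so that the width only
  remains in the factor \<open>L\<^bsup>-\<alpha>\<^esup>\<close> of the error term. The remainder term on the right of the Hardy
  inequality is discarded.\<close>

lemma slab_comparison:
  fixes e :: "real ^ 'n::finite"
  assumes a: "1 < \<alpha>" and e: "norm e = 1" and L: "0 < L" and eps: "0 < \<epsilon>" and r: "0 < r"
    and psi[measurable]: "\<psi> \<in> borel_measurable borel" and cont: "continuous_on {-1<..<1} \<psi>"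
    and psi_bd: "\<And>s. \<bar>\<psi> s\<bar> \<le> 1" and supp: "\<And>s. \<psi> s \<noteq> 0 \<Longrightarrow> -1 + r \<le> s \<and> s \<le> 0"
    and hardy: "\<And>\<Omega> (u :: real ^ 'n \<Rightarrow> real). bounded_domain \<Omega> \<Longrightarrow> convex \<Omega> \<Longrightarrow> u \<in> Cc \<Omega> \<Longrightarrow> hardy_ineq_dist \<alpha> c \<Omega> u"
  defines "q \<equiv> \<lambda>x. indicator {x. 0 \<le> x \<bullet> e \<and> x \<bullet> e < 1} x :: ennreal"
  defines "A \<equiv> \<integral>\<^sup>+x. ennreal ((slab_cutoff e 1 x)\<^sup>2) * q x \<partial>lborel"
  defines "A' \<equiv> \<integral>\<^sup>+x. indicator {x. perp_norm e x \<le> 1} x * q x \<partial>lborel"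
  defines "K \<equiv> \<integral>\<^sup>+h. ennreal (cutoff_kernel \<alpha> 1 (h :: real ^ 'n)) \<partial>lborel"
  defines "X \<equiv> \<integral>\<^sup>+s\<in>{-1<..<1}. ennreal ((\<psi> s)\<^sup>2 * (1 + s) powr (- \<alpha>)) \<partial>lborel"
  defines "E \<equiv> \<integral>\<^sup>+s\<in>{-1<..<1}. (\<integral>\<^sup>+t\<in>{-1<..<1}. ennreal ((\<psi> s - \<psi> t)\<^sup>2 / \<bar>s - t\<bar> powr (1 + \<alpha>)) \<partial>lborel) \<partial>lborel"
  shows "4 * (ennreal c * (A * X)) \<le> ennreal (1 + \<epsilon>) * (ennreal (sphere_moment CARD('n) \<alpha>) * (A * E))
     + 4 * (ennreal (1 + 1 / \<epsilon>) * (ennreal (L powr (- \<alpha>)) * K * A'))"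
proof -
  let ?\<Omega> = "slab_domain e L" and ?u = "\<lambda>x. slab_cutoff e L x * \<psi> (x \<bullet> e)"
  define AL where "AL = (\<integral>\<^sup>+x. ennreal ((slab_cutoff e L x)\<^sup>2) * q x \<partial>lborel)"
  define AL' where "AL' = (\<integral>\<^sup>+x. indicator {x. perp_norm e x \<le> L} x * q x \<partial>lborel)"
  let ?P = "ennreal (sphere_moment CARD('n) \<alpha>)" and ?l = "ennreal (L powr (- \<alpha>))"
  have "AL * X \<le> (\<integral>\<^sup>+x\<in>?\<Omega>. ennreal ((?u x)\<^sup>2 / infdist x (- ?\<Omega>) powr \<alpha>) \<partial>lborel)"
    unfolding AL_def X_def q_def by (rule slab_potential_lower[OF e L r _ psi supp]) (use a in auto)
  then have "ennreal c * (AL * X) \<le> ennreal c * (\<integral>\<^sup>+x\<in>?\<Omega>. ennreal ((?u x)\<^sup>2 / infdist x (- ?\<Omega>) powr \<alpha>) \<partial>lborel)"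
    by (rule mult_left_mono) simp
  also have "\<dots> \<le> ennreal (1/2) * frac_energy \<alpha> ?\<Omega> ?u"
    using hardy[OF slab_domain_geometry[OF L, of e] slab_test_function_Cc[OF e L r cont supp]]
    unfolding hardy_ineq_dist_def by (rule order_trans[rotated]) (assumption | rule add_increasing2[OF zero_le order_refl])+
  finally have "4 * (ennreal c * (AL * X)) \<le> 4 * (ennreal (1/2) * frac_energy \<alpha> ?\<Omega> ?u)" by (rule mult_left_mono) simp
  also have "\<dots> = 2 * frac_energy \<alpha> ?\<Omega> ?u"
  proof -
    have "(4 :: ennreal) * ennreal (1/2) = 2" using ennreal_mult'[of 4 "1/2"] by simp
    then show ?thesis by (simp only: mult.assoc[symmetric])
  qed
  also have "\<dots> \<le> ennreal (1 + \<epsilon>) * (?P * (AL * E)) + 4 * (ennreal (1 + 1 / \<epsilon>) * ((\<integral>\<^sup>+h. ennreal (cutoff_kernel \<alpha> L (h :: real ^ 'n)) \<partial>lborel) * AL'))"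
    unfolding AL_def AL'_def E_def q_def
  proof (rule slab_energy_upper[OF a e L eps psi _ psi_bd])
    show "s \<in> {-1..0}" if "\<psi> s \<noteq> 0" for s using supp[OF that] r by auto
    show "\<bar>x \<bullet> e\<bar> < 1" if "x \<in> ?\<Omega>" for x using that by (simp add: slab_domain_def)
  qed
  finally have "4 * (ennreal c * (AL * X)) * ennreal L \<le> (ennreal (1 + \<epsilon>) * (?P * (AL * E)) + 4 * (ennreal (1 + 1 / \<epsilon>) * (?l * K * AL'))) * ennreal L"
    unfolding cutoff_kernel_scale[OF L] K_def by (rule mult_right_mono) simp
  then have le: "4 * (ennreal c * ((AL * ennreal L) * X)) \<le> ennreal (1 + \<epsilon>) * (?P * ((AL * ennreal L) * E)) + 4 * (ennreal (1 + 1 / \<epsilon>) * (?l * K * (AL' * ennreal L)))"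
    by (simp only: distrib_left distrib_right mult_ac)
  have AL: "AL * ennreal L = ennreal (L ^ CARD('n)) * A"
    using nn_integral_cross_section_scale[OF e _ _ L, of "\<lambda>x. ennreal ((slab_cutoff e 1 x)\<^sup>2)"]
    unfolding AL_def A_def q_def slab_cutoff_rescale[OF L, of e, symmetric] by (simp add: slab_cutoff_shift[OF e])
  have ind: "indicator {x. perp_norm e x \<le> 1} ((1 / L) *\<^sub>R x) = (indicator {x. perp_norm e x \<le> L} x :: ennreal)" for x
    using L by (simp add: indicator_def perp_norm_scale)
  have AL': "AL' * ennreal L = ennreal (L ^ CARD('n)) * A'"
    using nn_integral_cross_section_scale[OF e _ _ L, of "indicator {x. perp_norm e x \<le> 1}"]
    unfolding AL'_def A'_def q_def ind by (simp add: indicator_def perp_norm_shift[OF e])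
  have "ennreal (L ^ CARD('n)) * (4 * (ennreal c * (A * X))) \<le> ennreal (L ^ CARD('n)) * (ennreal (1 + \<epsilon>) * (?P * (A * E))
     + 4 * (ennreal (1 + 1 / \<epsilon>) * (?l * K * A')))"
    using le unfolding AL AL' by (simp only: distrib_left distrib_right mult_ac)
  moreover have "ennreal (L ^ CARD('n)) \<noteq> 0" "ennreal (L ^ CARD('n)) \<noteq> top" using L by simp_all
  ultimately show ?thesis by (simp only: ennreal_mult_le_mult_iff not_False_eq_True simp_thms)
qed

text \<open>Letting first \<open>L\<close> tend to infinity and then \<open>\<epsilon>\<close> to \<open>0\<close> leaves
  \<open>2 c \<le> sphere_moment n \<alpha> * (kappa 1 \<alpha> + d)\<close>. Choosing \<open>d\<close> so that the right side is
  \<open>kappa n \<alpha> + c\<close> contradicts \<open>kappa n \<alpha> < c\<close>.\<close>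

lemma hardy_constant_sharp:
  assumes a: "1 < \<alpha>" "\<alpha> < 2" and c: "kappa CARD('n::finite) \<alpha> < c"
  shows "\<not> (\<forall>(\<Omega> :: (real ^ 'n) set) u. bounded_domain \<Omega> \<and> convex \<Omega> \<and> u \<in> Cc \<Omega> \<longrightarrow> hardy_ineq_dist \<alpha> c \<Omega> u)"
proof
  assume H: "\<forall>(\<Omega> :: (real ^ 'n) set) u. bounded_domain \<Omega> \<and> convex \<Omega> \<and> u \<in> Cc \<Omega> \<longrightarrow> hardy_ineq_dist \<alpha> c \<Omega> u"
  define P where "P = sphere_moment CARD('n) \<alpha>"
  have P: "0 < P" unfolding P_def using a by (intro sphere_moment_pos) auto
  have kP: "P * kappa 1 \<alpha> = 2 * kappa CARD('n) \<alpha>" unfolding P_def by (rule kappa_sphere_moment[OF a(1)])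
  have k1: "0 \<le> kappa 1 \<alpha>" by (rule kappa_1_nonneg[OF a])
  then have c0: "0 < c" using c kP P by (smt (verit) mult_nonneg_nonneg)
  \<comment> \<open>Then \<open>P * (kappa 1 \<alpha> + d)\<close> is the sum of \<open>kappa\<close> and \<open>c\<close>, which is less than \<open>2 c\<close>.\<close>
  define d where "d = (c - kappa CARD('n) \<alpha>) / P"
  have d: "0 < d" using c P by (simp add: d_def)
  have pos_finite: "\<exists>x. y = ennreal x \<and> 0 < x" if "0 < y" "y < \<infinity>" for y :: ennreal
    using that by (cases y) auto
  obtain e :: "real ^ 'n" where "e \<in> Basis" using nonempty_Basis by blast
  then have e: "norm e = 1" by (rule norm_Basis)
  obtain \<psi> :: "real \<Rightarrow> real" and r where r: "0 < r" "r < 1" and psi: "\<psi> \<in> borel_measurable borel" "continuous_on {-1<..<1} \<psi>" "\<And>s. \<bar>\<psi> s\<bar> \<le> 1"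
      "\<And>s. \<psi> s \<noteq> 0 \<Longrightarrow> -1 + r \<le> s \<and> s \<le> 0"
    and E: "(\<integral>\<^sup>+s\<in>{-1<..<1}. (\<integral>\<^sup>+t\<in>{-1<..<1}. ennreal ((\<psi> s - \<psi> t)\<^sup>2 / \<bar>s - t\<bar> powr (1 + \<alpha>)) \<partial>lborel) \<partial>lborel)
      \<le> 2 * (ennreal (kappa 1 \<alpha> + d) * (\<integral>\<^sup>+s\<in>{-1<..<1}. ennreal ((\<psi> s)\<^sup>2 * (1 + s) powr (- \<alpha>)) \<partial>lborel))"
    and X: "0 < (\<integral>\<^sup>+s\<in>{-1<..<1}. ennreal ((\<psi> s)\<^sup>2 * (1 + s) powr (- \<alpha>)) \<partial>lborel)"
      "(\<integral>\<^sup>+s\<in>{-1<..<1}. ennreal ((\<psi> s)\<^sup>2 * (1 + s) powr (- \<alpha>)) \<partial>lborel) < \<infinity>"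
    by (rule sharp_interval[OF a d]) (rule that)
  obtain x where x: "(\<integral>\<^sup>+s\<in>{-1<..<1}. ennreal ((\<psi> s)\<^sup>2 * (1 + s) powr (- \<alpha>)) \<partial>lborel) = ennreal x" "0 < x"
    using pos_finite[OF X] by blast
  obtain A where A: "(\<integral>\<^sup>+x. ennreal ((slab_cutoff e 1 x)\<^sup>2) * indicator {x. 0 \<le> x \<bullet> e \<and> x \<bullet> e < 1} x \<partial>lborel) = ennreal A" "0 < A"
    using pos_finite[OF cross_section_pos[OF e] cross_section_finite(2)[OF e]] by blast
  obtain A' where A': "(\<integral>\<^sup>+x. indicator {x. perp_norm e x \<le> 1} x * indicator {x. 0 \<le> x \<bullet> e \<and> x \<bullet> e < 1} x \<partial>lborel) = ennreal A'" "0 \<le> A'"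
    using cross_section_finite(1)[OF e] unfolding infinity_ennreal_def less_top_ennreal by blast
  obtain K where K: "(\<integral>\<^sup>+h. ennreal (cutoff_kernel \<alpha> 1 (h :: real ^ 'n)) \<partial>lborel) = ennreal K" "0 \<le> K"
    using cutoff_kernel_finite[OF a, where 'a = "real ^ 'n"] unfolding infinity_ennreal_def less_top_ennreal by blast
  let ?E = "\<integral>\<^sup>+s\<in>{-1<..<1}. (\<integral>\<^sup>+t\<in>{-1<..<1}. ennreal ((\<psi> s - \<psi> t)\<^sup>2 / \<bar>s - t\<bar> powr (1 + \<alpha>)) \<partial>lborel) \<partial>lborel"
  let ?B = "P * (A * (2 * ((kappa 1 \<alpha> + d) * x)))"
  have real_ineq: "4 * (c * (A * x)) \<le> (1 + \<epsilon>) * ?B + 4 * ((1 + 1 / \<epsilon>) * (L powr (- \<alpha>) * K * A'))"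
    if L: "0 < L" and eps: "0 < \<epsilon>" for L \<epsilon>
  proof -
    have "4 * (ennreal c * (ennreal A * ennreal x)) \<le> ennreal (1 + \<epsilon>) * (ennreal P * (ennreal A * ?E))
     + 4 * (ennreal (1 + 1 / \<epsilon>) * (ennreal (L powr (- \<alpha>)) * ennreal K * ennreal A'))"
      unfolding x(1)[symmetric] A(1)[symmetric] A'(1)[symmetric] K(1)[symmetric] P_def
      by (rule slab_comparison[OF a(1) e L eps r(1) psi]) (use H in blast)+
    also have "\<dots> \<le> ennreal (1 + \<epsilon>) * (ennreal P * (ennreal A * (2 * (ennreal (kappa 1 \<alpha> + d) * ennreal x))))
     + 4 * (ennreal (1 + 1 / \<epsilon>) * (ennreal (L powr (- \<alpha>)) * ennreal K * ennreal A'))"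
      by (intro add_right_mono mult_left_mono E[unfolded x(1)] zero_le)
    also have "4 * (ennreal c * (ennreal A * ennreal x)) = ennreal (4 * (c * (A * x)))"
      using c0 A x by (simp add: ennreal_mult)
    also have "ennreal (1 + \<epsilon>) * (ennreal P * (ennreal A * (2 * (ennreal (kappa 1 \<alpha> + d) * ennreal x)))) = ennreal ((1 + \<epsilon>) * ?B)"
      using eps P A x d k1 by (simp add: ennreal_mult)
    also have "4 * (ennreal (1 + 1 / \<epsilon>) * (ennreal (L powr (- \<alpha>)) * ennreal K * ennreal A')) = ennreal (4 * ((1 + 1 / \<epsilon>) * (L powr (- \<alpha>) * K * A')))"
      using eps K A' by (simp add: ennreal_mult)
    also have "ennreal ((1 + \<epsilon>) * ?B) + ennreal (4 * ((1 + 1 / \<epsilon>) * (L powr (- \<alpha>) * K * A'))) = ennreal ((1 + \<epsilon>) * ?B + 4 * ((1 + 1 / \<epsilon>) * (L powr (- \<alpha>) * K * A')))"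
      by (rule ennreal_plus[symmetric]) (use eps P A x d k1 K A' in simp_all)
    finally show ?thesis
      by (subst (asm) ennreal_le_iff) (use eps P A x d k1 K A' in simp_all)
  qed
  have "4 * (c * (A * x)) \<le> (1 + \<epsilon>) * ?B" if eps: "0 < \<epsilon>" for \<epsilon>
  proof (rule tendsto_lowerbound)
    have "((\<lambda>L. L powr (- \<alpha>)) \<longlongrightarrow> 0) at_top" using a by (intro tendsto_neg_powr filterlim_ident) auto
    then have "((\<lambda>L. (1 + \<epsilon>) * ?B + 4 * ((1 + 1 / \<epsilon>) * (L powr (- \<alpha>) * K * A'))) \<longlongrightarrow> (1 + \<epsilon>) * ?B + 4 * ((1 + 1 / \<epsilon>) * (0 * K * A'))) at_top"
      by (intro tendsto_intros)
    then show "((\<lambda>L. (1 + \<epsilon>) * ?B + 4 * ((1 + 1 / \<epsilon>) * (L powr (- \<alpha>) * K * A'))) \<longlongrightarrow> (1 + \<epsilon>) * ?B) at_top" by simp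
    show "\<forall>\<^sub>F L in at_top. 4 * (c * (A * x)) \<le> (1 + \<epsilon>) * ?B + 4 * ((1 + 1 / \<epsilon>) * (L powr (- \<alpha>) * K * A'))"
      using eventually_gt_at_top[of 0] by eventually_elim (rule real_ineq[OF _ eps])
  qed simp
  then have ev: "\<forall>\<^sub>F \<epsilon> in at_right 0. 4 * (c * (A * x)) \<le> (1 + \<epsilon>) * ?B"
    by (auto simp: eventually_at_filter)
  have "((\<lambda>\<epsilon>. (1 + \<epsilon>) * ?B) \<longlongrightarrow> (1 + 0) * ?B) (at_right 0)" by (intro tendsto_intros)
  then have "4 * (c * (A * x)) \<le> (1 + 0) * ?B" by (rule tendsto_lowerbound[OF _ ev]) simp
  then have "(2 * A * x) * (2 * c) \<le> (2 * A * x) * (P * (kappa 1 \<alpha> + d))" by (simp add: mult_ac)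
  then have "2 * c \<le> P * (kappa 1 \<alpha> + d)" using A x by (simp add: mult_le_cancel_left)
  also have "\<dots> = 2 * kappa CARD('n) \<alpha> + (c - kappa CARD('n) \<alpha>)" using kP P by (simp add: distrib_left d_def)
  finally show False using c by simp
qed

theorem theorem3:
  fixes k :: "'n::finite" and \<alpha> :: real
  assumes "1 < \<alpha>" and "\<alpha> < 2"
  shows
    "(\<forall>(\<Omega> :: (real ^ 'n) set) u. bounded_domain \<Omega> \<and> u \<in> Cc \<Omega> \<longrightarrow>
        hardy_ineq_M k \<alpha> (kappa CARD('n) \<alpha>) \<Omega> u) \<and>
     (\<forall>(\<Omega> :: (real ^ 'n) set) u. bounded_domain \<Omega> \<and> convex \<Omega> \<and> u \<in> Cc \<Omega> \<longrightarrow>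
        hardy_ineq_dist \<alpha> (kappa CARD('n) \<alpha>) \<Omega> u) \<and>
     (\<forall>c > kappa CARD('n) \<alpha>.
        \<not> (\<forall>(\<Omega> :: (real ^ 'n) set) u. bounded_domain \<Omega> \<and> u \<in> Cc \<Omega> \<longrightarrow>
              hardy_ineq_M k \<alpha> c \<Omega> u) \<and>
        \<not> (\<forall>(\<Omega> :: (real ^ 'n) set) u. bounded_domain \<Omega> \<and> convex \<Omega> \<and> u \<in> Cc \<Omega> \<longrightarrow>
              hardy_ineq_dist \<alpha> c \<Omega> u))"
proof (intro conjI allI impI)
  show "hardy_ineq_M k \<alpha> (kappa CARD('n) \<alpha>) \<Omega> u" if "bounded_domain \<Omega> \<and> u \<in> Cc \<Omega>" for \<Omega> :: "(real ^ 'n) set" and u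
    using that by (intro hardy_M_inequality assms) auto
  show "hardy_ineq_dist \<alpha> (kappa CARD('n) \<alpha>) \<Omega> u" if "bounded_domain \<Omega> \<and> convex \<Omega> \<and> u \<in> Cc \<Omega>" for \<Omega> :: "(real ^ 'n) set" and u
    using that by (intro hardy_dist_inequality assms) auto
next
  fix c assume c: "kappa CARD('n) \<alpha> < c"
  then show "\<not> (\<forall>(\<Omega> :: (real ^ 'n) set) u. bounded_domain \<Omega> \<and> convex \<Omega> \<and> u \<in> Cc \<Omega> \<longrightarrow> hardy_ineq_dist \<alpha> c \<Omega> u)"
    by (rule hardy_constant_sharp[OF assms])
  then show "\<not> (\<forall>(\<Omega> :: (real ^ 'n) set) u. bounded_domain \<Omega> \<and> u \<in> Cc \<Omega> \<longrightarrow> hardy_ineq_M k \<alpha> c \<Omega> u)"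
    using hardy_dist_of_hardy_M[OF assms] by blast
qed

end
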